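(* Let $d,n\ge1$ be integers and, for $j\in\{1,\dots,d\}$ and $U\in\mathbb{R}^n$, let $A_j(U)$ be a real $n\times n$ matrix whose entries are polynomial functions of $U$. Suppose there are an open set $\mathcal{U}\subset\mathbb{R}^n$ with $0\in\mathcal{U}$, a matrix-valued map $S(\cdot)$ with polynomial entries such that $S(U)$ is real, symmetric positive definite for all $U\in\mathcal{U}$, and, for each $j\in\{1,\dots,d\}$, a real symmetric constant matrix $S_j^0$ such that $$A_j(U)=S_j^0\,S(U)\qquad\text{for all }U\in\mathcal{U}.$$ Let $s>d/2+1$ and let $U^0\in H^s((2\pi\mathbb{T})^d)^n$ take values in $\mathcal{U}$. Let $U\in\mathcal{C}(I;H^s((2\pi\mathbb{T})^d)^n)$ be the maximal-in-time classical solution (with values in $\mathcal{U}$) to $$\partial_t U+\sum_{j=1}^d A_j(U)\partial_{x_j}U=0,\qquad U|_{t=0}=U^0,$$ and, for $N\in\mathbb{N}$, let $U_N\in\mathcal{C}(I_N;H^s((2\pi\mathbb{T})^d)^n)$ be the maximal-in-time classical solution to $$\partial_t U_N+\mathsf{P}_N\Big(\sum_{j=1}^d A_j(U_N)\partial_{x_j}U_N\Big)=0,\qquad U_N|_{t=0}=\mathsf{P}_N U^0.$$ For every compact subset $I^*\subset I$, there are $N_0\in\mathbb{N}$ and $C^*>0$, depending only on $s$, $|I^*|$, $M^*:=\sup_{t\in I^*}|U(t,\cdot)|_{H^s}$ and a compact set $\mathcal{K}^*\subset\mathcal{U}$ such that $U(I^*\times\mathbb{R}^d)\subset\mathcal{K}^*$,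 such that for all $N\ge N_0$ one has $I_N\supset I^*$ and, for any $0\le r\le s$, $$\sup_{t\in I^*}|(U-U_N)(t,\cdot)|_{H^r}\le C^*\,M^*\,N^{r-s}.$$
   Context: $(2\pi\mathbb{T})^d$ is the torus of period $2\pi$ in each of the $d$ variables; functions on it are real-valued and identified with $2\pi$-periodic functions on $\mathbb{R}^d$. For real $s\ge0$, $H^s((2\pi\mathbb{T})^d)^n$ is the space of $U\in L^2((2\pi\mathbb{T})^d)^n$ with $|U|_{H^s}^2=\sum_{k\in\mathbb{Z}^d}\langle k\rangle^{2s}|\widehat U_k|^2<\infty$, where $\widehat U_k$ is the $k$-th Fourier coefficient and $\langle k\rangle=(1+|k|^2)^{1/2}$. $\mathcal{C}(I;X)$ denotes continuous functions on the interval $I$ with values in the Banach space $X$. $\mathbb{N}$ denotes the positive integers. $|I^*|$ denotes the length (Lebesgue measure) of $I^*\subset\mathbb{R}$. $\mathsf{P}_N$ (sharp low-pass filter) acts componentwise as the Fourier multiplier with symbol $\mathbf{1}_{\{-N,\dots,N\}^d}$, i.e. $\widehat{(\mathsf{P}_NU)}_k=\widehat U_k$ if $\max_j|k_j|\le N$ and $0$ otherwise. A maximal-in-time classical solution in $\mathcal{C}(I;H^s)$ is a solution on an open interval $I\ni0$ which cannot be extended to a solution in the same class on a strictly larger interval; for the problems considered with $s>d/2+1$ it exists and is unique. Constants said to depend "only" on certain quantities may also depend on the fixed data $d,n,A_1,\dots,A_d,S,\mathcal{U}$, but never on $N$.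
   Formalization: The constants depend on the length, the sup of the H^s norm and the compact value set over the smallest interval containing I* and 0, not over I* itself (same if I* is an interval containing 0); for general compact I* the dependence as stated fails. M* in the final bound stays the sup over I*. *)

theory Defs
  imports "HOL-Analysis.Analysis"
begin

text \<open>Functions on the torus are \<^typ>\<open>real^'d \<Rightarrow> real^'n\<close> functions with period \<open>2 * pi\<close> in each variable.\<close>

definition torus_periodic :: "(real^'d \<Rightarrow> 'b) \<Rightarrow> bool" where
  "torus_periodic f \<longleftrightarrow> (\<forall>x j. f (x + axis j (2 * pi)) = f x)"

definition torus_cell :: "(real^'d) set" where
  "torus_cell = cbox 0 (\<chi> j. 2 * pi)"

definition phase :: "int^'d \<Rightarrow> real^'d \<Rightarrow> real" where
  "phase k x = (\<Sum>j\<in>UNIV. of_int (k $ j) * x $ j)"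

text \<open>Normalised so that the Fourier series of \<open>f\<close> is
  \<open>\<Sum>\<^sub>k fourier_coeff f k * cis (phase k x)\<close>.\<close>

definition fourier_coeff :: "(real^'d \<Rightarrow> real^'n) \<Rightarrow> int^'d \<Rightarrow> complex^'n" where
  "fourier_coeff f k =
     (\<chi> a. (LINT x:torus_cell|lebesgue. complex_of_real (f x $ a) * cis (- phase k x))
            / complex_of_real ((2 * pi) ^ CARD('d)))"

definition japanese_bracket :: "int^'d \<Rightarrow> real" where
  "japanese_bracket k = sqrt (1 + (\<Sum>j\<in>UNIV. (of_int (k $ j))\<^sup>2))"

definition sobolev_norm :: "real \<Rightarrow> (real^'d \<Rightarrow> real^'n) \<Rightarrow> real" where
  "sobolev_norm s f =
     sqrt (\<Sum>\<^sub>\<infinity>k. japanese_bracket k powr (2 * s) * (norm (fourier_coeff f k))\<^sup>2)"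

text \<open>The elements of \<open>sobolev s\<close> are functions, not classes modulo null sets. Solutions are
  below required to be continuously differentiable, so every time slice is the continuous
  representative of its class.\<close>

definition sobolev :: "real \<Rightarrow> (real^'d \<Rightarrow> real^'n) set" where
  "sobolev s = {f. torus_periodic f \<and> f \<in> borel_measurable lebesgue
      \<and> set_integrable lebesgue torus_cell (\<lambda>x. (norm (f x))\<^sup>2)
      \<and> (\<lambda>k. japanese_bracket k powr (2 * s) * (norm (fourier_coeff f k))\<^sup>2) summable_on UNIV}"

definition sobolev_continuous_on ::
  "real \<Rightarrow> real set \<Rightarrow> (real \<Rightarrow> real^'d \<Rightarrow> real^'n) \<Rightarrow> bool" where
  "sobolev_continuous_on s I U \<longleftrightarrow>
     (\<forall>t\<in>I. U t \<in> sobolev s) \<and>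
     (\<forall>t\<in>I. ((\<lambda>\<tau>. sobolev_norm s (\<lambda>x. U \<tau> x - U t x)) \<longlongrightarrow> 0) (at t within I))"

text \<open>The multiplier with symbol the indicator of the cube of frequencies. The cube is symmetric
  under \<open>k \<mapsto> - k\<close>, so for a real-valued function the sum below is real and \<open>Re\<close> only
  changes its type.\<close>

definition lowpass :: "nat \<Rightarrow> (real^'d \<Rightarrow> real^'n) \<Rightarrow> real^'d \<Rightarrow> real^'n" where
  "lowpass N f x =
     (\<chi> a. Re (\<Sum>k | \<forall>j. \<bar>k $ j\<bar> \<le> int N. fourier_coeff f k $ a * cis (phase k x)))"

definition quasilinear_term ::
  "('d \<Rightarrow> real^'n \<Rightarrow> real^'n^'n) \<Rightarrow> (real^'d \<Rightarrow> real^'n) \<Rightarrow> real^'d \<Rightarrow> real^'n" where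
  "quasilinear_term A f x =
     (\<Sum>j\<in>UNIV. A j (f x) *v frechet_derivative f (at x) (axis j 1))"

definition C1_on :: "'a::real_normed_vector set \<Rightarrow> ('a \<Rightarrow> 'b::real_normed_vector) \<Rightarrow> bool" where
  "C1_on W F \<longleftrightarrow>
     (\<exists>F'. (\<forall>z\<in>W. (F has_derivative blinfun_apply (F' z)) (at z)) \<and> continuous_on W F')"

text \<open>Solutions in \<open>C(I; H\<^sup>s)\<close>, with values in \<open>V\<close>, of
  \<open>\<partial>\<^sub>t U + P (\<Sum>\<^sub>j A\<^sub>j(U) \<partial>\<^sub>j U) = 0\<close> with initial datum \<open>u0\<close>; \<open>P\<close> acts on functions of \<open>x\<close>.\<close>

definition classical_solution ::
  "('d \<Rightarrow> real^'n \<Rightarrow> real^'n^'n) \<Rightarrow> ((real^'d \<Rightarrow> real^'n) \<Rightarrow> real^'d \<Rightarrow> real^'n) \<Rightarrow>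
   (real^'n) set \<Rightarrow> real \<Rightarrow> (real^'d \<Rightarrow> real^'n) \<Rightarrow> real set \<Rightarrow>
   (real \<Rightarrow> real^'d \<Rightarrow> real^'n) \<Rightarrow> bool" where
  "classical_solution A P V s u0 I U \<longleftrightarrow>
     open I \<and> is_interval I \<and> 0 \<in> I \<and>
     sobolev_continuous_on s I U \<and>
     C1_on (I \<times> UNIV) (\<lambda>(t, x). U t x) \<and>
     (\<forall>t\<in>I. \<forall>x. U t x \<in> V) \<and>
     (\<forall>t\<in>I. \<forall>x.
        ((\<lambda>\<tau>. U \<tau> x) has_vector_derivative - P (quasilinear_term A (U t)) x) (at t)) \<and>
     U 0 = u0"

definition maximal_classical_solution ::
  "('d \<Rightarrow> real^'n \<Rightarrow> real^'n^'n) \<Rightarrow> ((real^'d \<Rightarrow> real^'n) \<Rightarrow> real^'d \<Rightarrow> real^'n) \<Rightarrow>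
   (real^'n) set \<Rightarrow> real \<Rightarrow> (real^'d \<Rightarrow> real^'n) \<Rightarrow> real set \<Rightarrow>
   (real \<Rightarrow> real^'d \<Rightarrow> real^'n) \<Rightarrow> bool" where
  "maximal_classical_solution A P V s u0 I U \<longleftrightarrow>
     classical_solution A P V s u0 I U \<and>
     \<not> (\<exists>J W. I \<subset> J \<and> classical_solution A P V s u0 J W \<and> (\<forall>t\<in>I. W t = U t))"

definition sym_pos_def :: "real^'n^'n \<Rightarrow> bool" where
  "sym_pos_def B \<longleftrightarrow> transpose B = B \<and> (\<forall>v. v \<noteq> 0 \<longrightarrow> 0 < v \<bullet> (B *v v))"

text \<open>The smallest interval containing \<open>T\<close> and the initial time; it is \<open>T\<close> itself if \<open>T\<close> is an
  interval containing \<open>0\<close>. Error constants on \<open>T\<close> can be uniform over solutions only in terms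
  of quantities controlled on \<open>time_hull T\<close>: if \<open>T = {t}\<close> with \<open>t > 0\<close>, the measure of \<open>T\<close> and the
  solution at time \<open>t\<close> neither bound \<open>t\<close> nor the solution on \<open>[0, t]\<close>.\<close>

definition time_hull :: "real set \<Rightarrow> real set" where
  "time_hull T = convex hull (insert 0 T)"

end

theory Submission
  imports Defs
begin

text \<open>Write \<open>U\<close> for the exact solution and \<open>V\<close> for the truncated one. The delicate point is that the usual
estimates of Sobolev norms are not available for \<open>V\<close> uniformly in \<open>N\<close>: the sharp low-pass filter
does not commute well with multiplication by \<open>S\<close>. The constant symmetric factors \<open>S0 j\<close>, however,
commute with the filter, and this is enough for an estimate without derivatives: if \<open>E\<close> satisfies \<open>\<partial>\<^sub>t E = G - (\<Sum>j. S0 j P (S(U) \<partial>\<^sub>j E))\<close> with \<open>P\<close> the filter and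
\<open>E = P E\<close>, then the energy \<open>\<integral> E \<bullet> S(U) E\<close> grows at a rate that only involves \<open>E\<close>, \<open>G\<close> and the size of
\<open>U\<close> (lemma \<open>filtered_flux_energy\<close>).

The error is therefore measured against a function that has only frequencies seen by the filter.
The obvious choice \<open>P U\<close> is bad, because the commutator of \<open>S(U)\<close> with a sharp cutoff loses a
derivative. The right choice is a truncation \<open>\<chi>(D) U\<close> by a Lipschitz cutoff \<open>\<chi>\<close> at scale \<open>N\<close>: the
Lipschitz bound \<open>2 / N\<close> on \<open>\<chi>\<close> absorbs the derivative, and what remains always contains a frequency
above \<open>N / 4\<close>. Hence the commutator is of size \<open>N powr (- s)\<close> in the mean square (lemma
\<open>commutator_bound\<close>). The equation for \<open>E = \<chi>(D) U - V\<close> has a source \<open>G\<close> made of this commutator and of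
\<open>(A(V) - A(U)) \<partial> V\<close>, which is bounded by \<open>E\<close> and \<open>\<chi>(D) U - U\<close> as long as \<open>E\<close> and its gradient are
bounded. Gronwall's lemma gives \<open>E = O(N powr (- s))\<close> in the mean square; since \<open>E\<close> has frequencies at
most \<open>N\<close> and \<open>s > d / 2 + 1\<close>, Bernstein's inequality turns this into a small uniform bound of \<open>E\<close> and
its gradient, so a continuity argument closes the estimate for large \<open>N\<close> (lemma \<open>error_small\<close>). In
particular \<open>V\<close> stays bounded. A bounded solution of the truncated system can be continued, because
that system is an ordinary differential equation with a locally Lipschitz field for the sup norm;
so \<open>V\<close> lives at least as long as the time interval considered (lemma \<open>truncated_continuation\<close>).

All functions enter through two quantities: a Wiener norm with one derivative, bounded by the
Sobolev norm since \<open>s > d / 2 + 1\<close>, and the rate of decay \<open>b \<rho> powr (- 2 * s)\<close> of the squared mass of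
the frequencies above \<open>\<rho>\<close>. Products, hence polynomials, preserve both, linearly in \<open>b\<close> (lemma
\<open>tame_mult\<close>).

The estimate must contain the Sobolev norms on the given set of times only, while the error is
accumulated from time \<open>0\<close>. The equation is reversible: the same energy estimate, applied to
\<open>U\<close> between two cutoffs, bounds the tail constant \<open>b\<close> at every time by the squared Sobolev norm at
any single reference time (theorem \<open>tail_propagation\<close>). The reference time is the one at which the
error is evaluated.\<close>

section \<open>Means over the torus\<close>

text \<open>Means rather than integrals: the wave functions are then orthonormal, and a constant
is its own mean.\<close>

definition tmean :: "(real^'d \<Rightarrow> 'b::real_normed_vector) \<Rightarrow> 'b" where
  "tmean f = (1 / (2 * pi) ^ CARD('d)) *\<^sub>R integral torus_cell f"

lemma content_torus_cell:
  "Henstock_Kurzweil_Integration.content (torus_cell :: (real^'d) set) = (2 * pi) ^ CARD('d)"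
proof -
  have "(torus_cell :: (real^'d) set) \<noteq> {}"
    by (auto simp: torus_cell_def interval_ne_empty_cart)
  then show ?thesis
    unfolding torus_cell_def by (subst content_cbox_cart) auto
qed

lemma continuous_integrable_torus:
  fixes f :: "real^'d \<Rightarrow> 'b::banach"
  assumes "continuous_on UNIV f"
  shows "f integrable_on torus_cell"
  unfolding torus_cell_def
  by (rule integrable_continuous) (use assms continuous_on_subset in blast)

lemma tmean_const [simp]: "tmean (\<lambda>x::real^'d. c) = (c :: 'b::euclidean_space)"
proof -
  have "integral (torus_cell :: (real^'d) set) (\<lambda>x. c) = ((2 * pi) ^ CARD('d)) *\<^sub>R c"
    unfolding content_torus_cell[symmetric] unfolding torus_cell_def by (rule integral_const)
  then show ?thesis by (simp add: tmean_def)
qed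

lemma tmean_bounded_linear:
  fixes f :: "real^'d \<Rightarrow> 'b::banach"
  assumes "bounded_linear h" "continuous_on UNIV f"
  shows "tmean (\<lambda>x. h (f x)) = h (tmean f)"
  using integral_linear[OF continuous_integrable_torus[OF assms(2)] assms(1)]
  by (simp add: tmean_def o_def linear_scale[OF bounded_linear.linear[OF assms(1)]])

lemma tmean_add:
  fixes f :: "real^'d \<Rightarrow> 'b::banach"
  assumes "continuous_on UNIV f" "continuous_on UNIV g"
  shows "tmean (\<lambda>x. f x + g x) = tmean f + tmean g"
  unfolding tmean_def
  by (subst integral_add) (auto intro!: continuous_integrable_torus assms simp: algebra_simps)

lemma tmean_diff:
  fixes f :: "real^'d \<Rightarrow> 'b::banach"
  assumes "continuous_on UNIV f" "continuous_on UNIV g"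
  shows "tmean (\<lambda>x. f x - g x) = tmean f - tmean g"
  unfolding tmean_def
  by (subst integral_diff) (auto intro!: continuous_integrable_torus assms simp: algebra_simps)

lemma tmean_minus: "tmean (\<lambda>x. - f x) = - tmean f"
  by (simp add: tmean_def)

lemma tmean_sum:
  fixes f :: "'i \<Rightarrow> real^'d \<Rightarrow> 'b::euclidean_space"
  assumes "\<And>i. i \<in> F \<Longrightarrow> continuous_on UNIV (f i)"
  shows "tmean (\<lambda>x. \<Sum>i\<in>F. f i x) = (\<Sum>i\<in>F. tmean (f i))"
  using assms
proof (induction F rule: infinite_finite_induct)
  case (insert i F)
  then show ?case
    by (simp add: tmean_add continuous_on_sum)
qed (auto simp: tmean_def)

lemma tmean_cmult:
  fixes f :: "real^'d \<Rightarrow> 'b::{banach, real_normed_field}"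
  assumes "continuous_on UNIV f"
  shows "tmean (\<lambda>x. c * f x) = c * tmean f" "tmean (\<lambda>x. f x * c) = tmean f * c"
  using assms
  by (auto intro!: tmean_bounded_linear[where h = "\<lambda>y. c * y"]
      tmean_bounded_linear[where h = "\<lambda>y. y * c"] bounded_linear_intros)

lemma tmean_mono:
  fixes f g :: "real^'d \<Rightarrow> real"
  assumes "continuous_on UNIV f" "continuous_on UNIV g" "\<And>x. f x \<le> g x"
  shows "tmean f \<le> tmean g"
  unfolding tmean_def
  by (auto intro!: divide_right_mono integral_le continuous_integrable_torus assms simp: scaleR_conv_of_real)

lemma tmean_nonneg:
  fixes f :: "real^'d \<Rightarrow> real"
  assumes "continuous_on UNIV f" "\<And>x. f x \<ge> 0"
  shows "tmean f \<ge> 0"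
  using tmean_mono[OF continuous_on_const assms(1), of 0] assms(2) by simp

lemma tmean_of_real:
  fixes f :: "real^'d \<Rightarrow> real"
  assumes "continuous_on UNIV f"
  shows "tmean (\<lambda>x. complex_of_real (f x)) = of_real (tmean f)"
  by (rule tmean_bounded_linear[OF bounded_linear_of_real assms])

lemma tmean_Re:
  fixes f :: "real^'d \<Rightarrow> complex"
  assumes "continuous_on UNIV f"
  shows "tmean (\<lambda>x. Re (f x)) = Re (tmean f)"
  by (rule tmean_bounded_linear[OF bounded_linear_Re assms])

lemma tmean_cnj:
  fixes f :: "real^'d \<Rightarrow> complex"
  assumes "continuous_on UNIV f"
  shows "tmean (\<lambda>x. cnj (f x)) = cnj (tmean f)"
  by (rule tmean_bounded_linear[OF bounded_linear_cnj assms])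

lemma tmean_norm_le:
  fixes f :: "real^'d \<Rightarrow> 'b::euclidean_space"
  assumes "continuous_on UNIV f" "\<And>x. norm (f x) \<le> B"
  shows "norm (tmean f) \<le> B"
proof -
  have "norm (integral torus_cell f) \<le> integral torus_cell (\<lambda>x::real^'d. B)"
    by (rule Henstock_Kurzweil_Integration.integral_norm_bound_integral)
       (use assms in \<open>auto intro!: continuous_integrable_torus\<close>)
  then have "(1 / (2 * pi) ^ CARD('d)) * norm (integral torus_cell f)
      \<le> (1 / (2 * pi) ^ CARD('d)) * integral torus_cell (\<lambda>x::real^'d. B)"
    by (intro mult_left_mono) auto
  also have "\<dots> = tmean (\<lambda>x::real^'d. B)"
    by (simp only: tmean_def real_scaleR_def)
  finally show ?thesis by (simp add: tmean_def)
qed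

lemma periodic_axis_multiple:
  fixes f :: "real^'d \<Rightarrow> 'b"
  assumes "torus_periodic f"
  shows "f (x + axis j (2 * pi * real_of_int n)) = f x"
proof -
  have up: "f (y + axis j (2 * pi * real m)) = f y" for y m
  proof (induction m)
    case (Suc m)
    have "y + axis j (2 * pi * real (Suc m)) = (y + axis j (2 * pi * real m)) + axis j (2 * pi)"
      by (simp add: vec_eq_iff axis_def algebra_simps)
    moreover have "f ((y + axis j (2 * pi * real m)) + axis j (2 * pi)) = f (y + axis j (2 * pi * real m))"
      using assms unfolding torus_periodic_def by blast
    ultimately show ?case
      using Suc by metis
  qed (simp add: axis_def zero_vec_def[symmetric] cong: if_cong)
  show ?thesis
  proof (cases "n \<ge> 0")
    case True
    then show ?thesis using up[of x "nat n"] by simp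
  next
    case False
    have "(x + axis j (2 * pi * real_of_int n)) + axis j (2 * pi * real (nat (- n))) = x"
      using False by (simp add: vec_eq_iff axis_def algebra_simps)
    then show ?thesis using up[of "x + axis j (2 * pi * real_of_int n)" "nat (- n)"] by metis
  qed
qed

lemma periodic_reduce:
  fixes f :: "real^'d \<Rightarrow> 'b"
  assumes "torus_periodic f"
  shows "f (x + (\<chi> j. 2 * pi * real_of_int (m j))) = f x"
proof -
  have "f (x + (\<Sum>j\<in>J. axis j (2 * pi * real_of_int (m j)))) = f x" for J :: "'d set"
  proof (induction J rule: infinite_finite_induct)
    case (insert j J)
    then show ?case
      using periodic_axis_multiple[OF assms, of "x + (\<Sum>j\<in>J. axis j (2 * pi * real_of_int (m j)))" j "m j"]
      by (simp add: algebra_simps)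
  qed auto
  note this[of UNIV]
  moreover have "(\<Sum>j\<in>UNIV. axis j (2 * pi * real_of_int (m j))) = (\<chi> j. 2 * pi * real_of_int (m j))"
    by (simp add: vec_eq_iff axis_def if_distrib)
  ultimately show ?thesis by simp
qed

lemma periodic_representative:
  fixes x :: "real^'d"
  obtains m where "x + (\<chi> j. 2 * pi * real_of_int (m j)) \<in> torus_cell"
proof
  let ?m = "\<lambda>j. - \<lfloor>x $ j / (2 * pi)\<rfloor>"
  have "0 \<le> x $ j + 2 * pi * real_of_int (?m j) \<and> x $ j + 2 * pi * real_of_int (?m j) \<le> 2 * pi" for j
  proof -
    have "of_int \<lfloor>x $ j / (2 * pi)\<rfloor> \<le> x $ j / (2 * pi)" "x $ j / (2 * pi) \<le> of_int \<lfloor>x $ j / (2 * pi)\<rfloor> + 1"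
      by linarith+
    then have "of_int \<lfloor>x $ j / (2 * pi)\<rfloor> * (2 * pi) \<le> x $ j" 
        "x $ j \<le> (of_int \<lfloor>x $ j / (2 * pi)\<rfloor> + 1) * (2 * pi)"
      using pos_le_divide_eq[of "2 * pi" "of_int \<lfloor>x $ j / (2 * pi)\<rfloor>" "x $ j"]
        pos_divide_le_eq[of "2 * pi" "x $ j" "of_int \<lfloor>x $ j / (2 * pi)\<rfloor> + 1"] by auto
    then show ?thesis by (simp add: algebra_simps)
  qed
  then show "x + (\<chi> j. 2 * pi * real_of_int (?m j)) \<in> torus_cell"
    by (simp add: torus_cell_def mem_box_cart)
qed

lemma tmean_zero_imp_zero:
  fixes f :: "real^'d \<Rightarrow> real"
  assumes "continuous_on UNIV f" "torus_periodic f" "\<And>x. f x \<ge> 0" "tmean f = 0"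
  shows "f x = 0"
proof -
  have "integral (cbox 0 (\<chi> j. 2 * pi)) f = 0"
    using assms(4) by (simp add: tmean_def torus_cell_def)
  moreover have "box (0::real^'d) (\<chi> j. 2 * pi) \<noteq> {}"
    by (auto simp: interval_ne_empty_cart)
  ultimately have z: "f y = 0" if "y \<in> torus_cell" for y
    using integral_cbox_eq_0_iff[of 0 "\<chi> j. 2 * pi" f] assms that
    by (auto simp: torus_cell_def intro: continuous_on_subset)
  obtain m where "x + (\<chi> j. 2 * pi * real_of_int (m j)) \<in> torus_cell"
    by (rule periodic_representative)
  then show ?thesis
    using z periodic_reduce[OF assms(2), of x m] by metis
qed

text \<open>The translated cell is cut at \<open>2 * pi\<close> in the direction \<open>j\<close>; periodicity moves the part beyond it
back to the gap that the translation leaves at \<open>0\<close>.\<close>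

lemma tmean_translate:
  fixes f :: "real^'d \<Rightarrow> 'b::banach"
  assumes "continuous_on UNIV f" "torus_periodic f" "0 \<le> c" "c \<le> 2 * pi"
  shows "tmean (\<lambda>x. f (x + axis j c)) = tmean f"
proof -
  let ?b = "(\<chi> i. 2 * pi) :: real^'d"
  have intf: "f integrable_on cbox a b" for a b
    by (rule integrable_continuous) (use assms continuous_on_subset in blast)
  have ax: "axis j (1::real) \<in> Basis"
    by (simp add: axis_in_Basis_iff)
  have split: "integral (cbox a b) f = integral (cbox a b \<inter> {x. x $ j \<le> r}) f
       + integral (cbox a b \<inter> {x. x $ j \<ge> r}) f" for a b r
    using integral_split[OF intf ax, of a b r] by (simp add: inner_axis)
  have box_le: "cbox a b \<inter> {x. x $ j \<le> r} = cbox a (\<chi> i. if i = j then min (b $ j) r else b $ i)" for a b :: "real^'d" and r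
    by (auto simp: mem_box_cart split: if_splits)
  have box_ge: "cbox a b \<inter> {x. x $ j \<ge> r} = cbox (\<chi> i. if i = j then max (a $ j) r else a $ i) b" for a b :: "real^'d" and r
    by (auto simp: mem_box_cart split: if_splits)
  have "integral (cbox 0 ?b) (\<lambda>x. f (x + axis j c)) = integral (cbox (axis j c) (?b + axis j c)) f"
    using integral_shift_cbox[of "axis j c" "axis j c" "?b + axis j c" f] by simp
  also have "\<dots> = integral (cbox (axis j c) (?b + axis j c) \<inter> {x. x $ j \<le> 2 * pi}) f
       + integral (cbox (axis j c) (?b + axis j c) \<inter> {x. x $ j \<ge> 2 * pi}) f"
    by (rule split)
  also have "cbox (axis j c) (?b + axis j c) \<inter> {x. x $ j \<le> 2 * pi} = cbox 0 ?b \<inter> {x. x $ j \<ge> c}"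
  proof -
    have *: "(axis j c $ i \<le> x $ i \<and> x $ i \<le> (?b + axis j c) $ i) \<and> x $ j \<le> 2 * pi \<longleftrightarrow>
        (0 \<le> x $ i \<and> x $ i \<le> 2 * pi) \<and> c \<le> x $ j" if "i \<noteq> j \<longrightarrow> c \<le> x $ j \<and> x $ j \<le> 2 * pi" for x :: "real^'d" and i
      using assms(3,4) that by (auto simp: axis_def)
    show ?thesis
    proof (intro set_eqI iffI)
      fix x assume "x \<in> cbox (axis j c) (?b + axis j c) \<inter> {x. x $ j \<le> 2 * pi}"
      then have x: "\<And>i. axis j c $ i \<le> x $ i \<and> x $ i \<le> (?b + axis j c) $ i" "x $ j \<le> 2 * pi"
        by (auto simp: mem_box_cart)
      moreover have "c \<le> x $ j" using x(1)[of j] by (simp add: axis_def)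
      ultimately show "x \<in> cbox 0 ?b \<inter> {x. x $ j \<ge> c}"
        using * by (auto simp: mem_box_cart)
    next
      fix x assume "x \<in> cbox 0 ?b \<inter> {x. x $ j \<ge> c}"
      then have x: "\<And>i. 0 \<le> x $ i \<and> x $ i \<le> 2 * pi" "c \<le> x $ j"
        by (auto simp: mem_box_cart)
      then show "x \<in> cbox (axis j c) (?b + axis j c) \<inter> {x. x $ j \<le> 2 * pi}"
        using * by (auto simp: mem_box_cart)
    qed
  qed
  also have "integral (cbox (axis j c) (?b + axis j c) \<inter> {x. x $ j \<ge> 2 * pi}) f
      = integral (cbox (axis j (2 * pi)) (?b + axis j c)) f"
    unfolding box_ge
    by (rule arg_cong[where f = "\<lambda>a. integral (cbox a (?b + axis j c)) f"])
       (use assms(3,4) in \<open>auto simp: vec_eq_iff axis_def\<close>)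
  also have "\<dots> = integral (cbox (axis j (2 * pi) - axis j (2 * pi)) (?b + axis j c - axis j (2 * pi)))
        (\<lambda>x. f (x + axis j (2 * pi)))"
    by (rule integral_shift_cbox[symmetric])
  also have "\<dots> = integral (cbox 0 ?b \<inter> {x. x $ j \<le> c}) f"
    unfolding box_le using assms(2)
    by (intro arg_cong2[where f = integral] arg_cong2[where f = cbox])
       (use assms(3,4) in \<open>auto simp: vec_eq_iff axis_def torus_periodic_def\<close>)
  also have "integral (cbox 0 ?b \<inter> {x. x $ j \<ge> c}) f + integral (cbox 0 ?b \<inter> {x. x $ j \<le> c}) f
      = integral (cbox 0 ?b) f"
    using split[of 0 ?b c] by simp
  finally show ?thesis
    by (simp add: tmean_def torus_cell_def)
qed

lemma tmean_has_vector_derivative: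
  fixes f :: "real \<Rightarrow> real^'d \<Rightarrow> 'b::banach"
  assumes "\<And>t x. t \<in> I \<Longrightarrow> ((\<lambda>t. f t x) has_vector_derivative f' t x) (at t within I)"
    and "\<And>t. t \<in> I \<Longrightarrow> continuous_on UNIV (f t)"
    and "continuous_on (I \<times> UNIV) (\<lambda>(t, x). f' t x)"
    and "t \<in> I" "convex I"
  shows "((\<lambda>t. tmean (f t)) has_vector_derivative tmean (f' t)) (at t within I)"
  unfolding tmean_def torus_cell_def
  by (intro bounded_linear.has_vector_derivative[OF bounded_linear_scaleR_right]
      leibniz_rule_vector_derivative integrable_continuous continuous_on_subset[OF assms(2)]
      continuous_on_subset[OF assms(3)] assms(1) assms(4,5)) auto

text \<open>Differentiating the translation invariance of the mean. This is integration by parts on the torus.\<close>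

lemma tmean_partial_derivative:
  fixes f :: "real^'d \<Rightarrow> 'b::euclidean_space"
  assumes per: "torus_periodic f" and der: "\<And>x. (f has_derivative f' x) (at x)"
    and cont: "continuous_on UNIV (\<lambda>x. f' x (axis j 1))"
  shows "tmean (\<lambda>x. f' x (axis j 1)) = 0"
proof -
  have cf: "continuous_on UNIV f"
    using der has_derivative_continuous continuous_at_imp_continuous_on by blast
  have d: "((\<lambda>c. f (x + axis j c)) has_vector_derivative f' (x + axis j c) (axis j 1)) (at c within {0..2*pi})" for x c
  proof -
    have "((\<lambda>c. x + axis j c) has_derivative (\<lambda>h. h *\<^sub>R axis j 1)) (at c within {0..2*pi})"
    proof -
      have "(\<lambda>c. x + axis j c) = (\<lambda>c. x + c *\<^sub>R axis j (1::real))"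
        by (auto simp: vec_eq_iff axis_def)
      then show ?thesis by (auto intro!: derivative_eq_intros)
    qed
    from has_derivative_compose[OF this der]
    have "((\<lambda>c. f (x + axis j c)) has_derivative (\<lambda>h. f' (x + axis j c) (h *\<^sub>R axis j 1))) (at c within {0..2*pi})" .
    moreover have "f' (x + axis j c) (h *\<^sub>R axis j 1) = h *\<^sub>R f' (x + axis j c) (axis j 1)" for h
      using der[of "x + axis j c"] by (meson has_derivative_linear linear_scale)
    ultimately show ?thesis by (simp add: has_vector_derivative_def)
  qed
  have cax: "continuous_on UNIV (\<lambda>p::real \<times> (real^'d). snd p + axis j (fst p))"
  proof -
    have "(\<lambda>p::real \<times> (real^'d). snd p + axis j (fst p)) = (\<lambda>p. snd p + fst p *\<^sub>R axis j 1)"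
      by (auto simp: vec_eq_iff axis_def)
    moreover have "continuous_on UNIV (\<lambda>p::real \<times> (real^'d). snd p + fst p *\<^sub>R axis j (1::real))"
      by (auto intro!: continuous_intros)
    ultimately show ?thesis by metis
  qed
  have "((\<lambda>c. tmean (\<lambda>x. f (x + axis j c))) has_vector_derivative
          tmean (\<lambda>x. f' (x + axis j 0) (axis j 1))) (at 0 within {0..2*pi})"
  proof (rule tmean_has_vector_derivative[where f = "\<lambda>c x. f (x + axis j c)"])
    show "continuous_on UNIV (\<lambda>x. f (x + axis j t))" for t
      by (intro continuous_on_compose2[OF cf] continuous_intros) auto
    show "continuous_on ({0..2*pi} \<times> UNIV) (\<lambda>(t, x). f' (x + axis j t) (axis j 1))"
      using continuous_on_compose2[OF cont continuous_on_subset[OF cax]] by (simp add: case_prod_unfold)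
  qed (use d in auto)
  then have "((\<lambda>c. tmean f) has_vector_derivative tmean (\<lambda>x. f' (x + axis j 0) (axis j 1))) (at 0 within {0..2*pi})"
    by (rule has_vector_derivative_transform[rotated 2])
       (use tmean_translate[OF cf per] in \<open>auto\<close>)
  moreover have "((\<lambda>c::real. tmean f) has_vector_derivative 0) (at 0 within {0..2*pi})"
    by simp
  ultimately have "tmean (\<lambda>x. f' (x + axis j 0) (axis j 1)) = 0"
    by (rule vector_derivative_unique_within[rotated])
       (auto simp: trivial_limit_within islimpt_Icc)
  moreover have "axis j (0::real) = (0::real^'d)" by (simp add: vec_eq_iff axis_def)
  ultimately show ?thesis by simp
qed

section \<open>Characters and Fourier coefficients\<close>

definition freq :: "int^'d \<Rightarrow> real^'d" where
  "freq k = (\<chi> j. of_int (k $ j))"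

definition wave :: "int^'d \<Rightarrow> real^'d \<Rightarrow> complex" where
  "wave k x = cis (phase k x)"

text \<open>The scalar version of \<open>fourier_coeff\<close>, with the Henstock-Kurzweil integral: for continuous functions it
gives the components of \<open>fourier_coeff\<close>.\<close>

definition fc :: "(real^'d \<Rightarrow> complex) \<Rightarrow> int^'d \<Rightarrow> complex" where
  "fc g k = tmean (\<lambda>x. g x * wave (- k) x)"

lemma freq_simps [simp]: "freq (k + l) = freq k + freq l" "freq (- k) = - freq k"
  "freq (k - l) = freq k - freq l" "freq 0 = 0"
  by (simp_all add: freq_def vec_eq_iff)

lemma freq_nth [simp]: "freq k $ j = of_int (k $ j)"
  by (simp add: freq_def)

lemma phase_inner: "phase k x = freq k \<bullet> x"
  by (simp add: phase_def inner_vec_def)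

lemma japanese_bracket_freq: "japanese_bracket k = sqrt (1 + (norm (freq k))\<^sup>2)"
  by (simp add: japanese_bracket_def norm_vec_def L2_set_def sum_nonneg)

lemma wave_add: "wave (k + l) x = wave k x * wave l x"
  by (simp add: wave_def phase_inner inner_add_left cis_mult)

lemma wave_minus: "wave (- k) x = cnj (wave k x)"
  by (simp add: wave_def phase_inner cis_cnj)

lemma wave_0 [simp]: "wave 0 x = 1"
  by (simp add: wave_def phase_inner)

lemma norm_wave [simp]: "norm (wave k x) = 1"
  by (simp add: wave_def)

lemma wave_has_derivative:
  "(wave k has_derivative (\<lambda>h. \<i> * of_real (freq k \<bullet> h) * wave k x)) (at x)"
proof -
  have "wave k = (\<lambda>x. exp (\<i> * of_real (freq k \<bullet> x)))"
    by (auto simp: wave_def phase_inner cis_conv_exp)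
  moreover have "((\<lambda>x. exp (\<i> * of_real (freq k \<bullet> x))) has_derivative
       (\<lambda>h. \<i> * of_real (freq k \<bullet> h) * exp (\<i> * of_real (freq k \<bullet> x)))) (at x)"
  proof -
    have "((\<lambda>x. \<i> * complex_of_real (freq k \<bullet> x)) has_derivative (\<lambda>h. \<i> * of_real (freq k \<bullet> h))) (at x)"
      by (rule bounded_linear.has_derivative[OF _ has_derivative_ident])
         (intro bounded_linear_intros bounded_linear_const_mult bounded_linear_of_real
           bounded_linear_compose[OF bounded_linear_of_real] bounded_linear_inner_right)
    from has_derivative_compose[OF this DERIV_exp[unfolded has_field_derivative_def]] show ?thesis
      by (simp add: mult_ac)
  qed
  ultimately show ?thesis by metis
qed

lemma continuous_wave [continuous_intros]:
  "continuous_on A g \<Longrightarrow> continuous_on A (\<lambda>y. wave k (g y))"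
  unfolding wave_def phase_inner by (intro continuous_intros) auto

lemma wave_periodic: "torus_periodic (wave k)"
proof -
  have "wave k (x + axis j (2 * pi)) = wave k x" for x j
  proof -
    have "wave k (x + axis j (2 * pi)) = wave k x * cis (2 * pi * real_of_int (k $ j))"
      by (simp add: wave_def phase_inner inner_add_right inner_axis cis_mult mult_ac)
    also have "cis (2 * pi * real_of_int (k $ j)) = 1"
      by (simp add: cis_multiple_2pi)
    finally show ?thesis by simp
  qed
  then show ?thesis by (simp add: torus_periodic_def)
qed

lemma tmean_wave: "tmean (wave k) = (if k = 0 then 1 else 0)"
proof (cases "k = 0")
  case True
  have "wave 0 = (\<lambda>x::real^'d. 1)" by auto
  then have "tmean (wave (0::int^'d)) = tmean (\<lambda>x::real^'d. 1)" by (rule arg_cong)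
  then show ?thesis using True by simp
next
  case False
  then obtain j where j: "k $ j \<noteq> 0" by (auto simp: vec_eq_iff)
  have "tmean (\<lambda>x. \<i> * complex_of_real (freq k \<bullet> axis j 1) * wave k x) = 0"
    by (rule tmean_partial_derivative[OF wave_periodic wave_has_derivative])
       (intro continuous_intros)
  then have "\<i> * of_int (k $ j) * tmean (wave k) = 0"
    by (subst (asm) tmean_cmult) (auto simp: inner_axis intro!: continuous_intros)
  then show ?thesis using j False by simp
qed

lemma fourier_coeff_fc:
  fixes f :: "real^'d \<Rightarrow> real^'n"
  assumes "continuous_on UNIV f"
  shows "fourier_coeff f k $ a = fc (\<lambda>x. of_real (f x $ a)) k"
proof -
  have c: "continuous_on UNIV (\<lambda>x. complex_of_real (f x $ a) * wave (- k) x)"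
    by (intro continuous_intros assms)
  have ph: "cis (- phase k x) = wave (- k) x" for x
    by (simp add: wave_def phase_inner)
  have "(\<lambda>x. complex_of_real (f x $ a) * wave (- k) x) absolutely_integrable_on torus_cell"
    unfolding torus_cell_def
    by (rule absolutely_integrable_continuous) (rule continuous_on_subset[OF c], simp)
  from set_lebesgue_integral_eq_integral(2)[OF this] show ?thesis
    by (simp add: fourier_coeff_def fc_def tmean_def ph scaleR_conv_of_real field_simps)
qed

lemma fc_add: "continuous_on UNIV f \<Longrightarrow> continuous_on UNIV g \<Longrightarrow> fc (\<lambda>x. f x + g x) k = fc f k + fc g k"
  unfolding fc_def by (subst tmean_add[symmetric]) (auto simp: algebra_simps intro!: continuous_intros)

lemma fc_diff: "continuous_on UNIV f \<Longrightarrow> continuous_on UNIV g \<Longrightarrow> fc (\<lambda>x. f x - g x) k = fc f k - fc g k"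
  unfolding fc_def by (subst tmean_diff[symmetric]) (auto simp: algebra_simps intro!: continuous_intros)

lemma fc_cmult: "continuous_on UNIV f \<Longrightarrow> fc (\<lambda>x. c * f x) k = c * fc f k"
  unfolding fc_def by (subst tmean_cmult[symmetric]) (auto simp: algebra_simps intro!: continuous_intros)

lemma fc_sum:
  "(\<And>i. i \<in> F \<Longrightarrow> continuous_on UNIV (f i)) \<Longrightarrow> fc (\<lambda>x. \<Sum>i\<in>F. f i x) k = (\<Sum>i\<in>F. fc (f i) k)"
  unfolding fc_def sum_distrib_right by (subst tmean_sum) (auto intro!: continuous_intros)

lemma fc_cnj: "continuous_on UNIV f \<Longrightarrow> fc (\<lambda>x. cnj (f x)) k = cnj (fc f (- k))"
  unfolding fc_def by (subst tmean_cnj[symmetric]) (auto simp: wave_minus intro!: continuous_intros)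

lemma fc_hermitian:
  "continuous_on UNIV f \<Longrightarrow> fc (\<lambda>x. complex_of_real (f x)) (- k) = cnj (fc (\<lambda>x. of_real (f x)) k)"
  using fc_cnj[of "\<lambda>x. complex_of_real (f x)" "-k"] by (simp add: continuous_on_of_real)

lemma fc_wave_mult: "fc (\<lambda>x. wave l x * f x) k = fc f (k - l)"
proof -
  have "- (k - l) = l + - k" by simp
  then have "wave l x * f x * wave (- k) x = f x * wave (- (k - l)) x" for x
    by (simp only: wave_add mult_ac)
  then show ?thesis by (simp only: fc_def)
qed

lemma fc_wave: "fc (wave l) k = (if k = l then 1 else 0)"
proof -
  have "fc (wave l) k = fc (\<lambda>x. wave l x * 1) k" by simp
  also have "\<dots> = fc (\<lambda>x. 1) (k - l)" by (rule fc_wave_mult)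
  also have "\<dots> = tmean (wave (l - k))" by (simp add: fc_def)
  finally show ?thesis by (auto simp: tmean_wave)
qed

lemma norm_fc_le: "continuous_on UNIV f \<Longrightarrow> (\<And>x. norm (f x) \<le> B) \<Longrightarrow> norm (fc f k) \<le> B"
  unfolding fc_def by (rule tmean_norm_le) (auto simp: norm_mult intro!: continuous_intros)

lemma fc_partial_derivative:
  assumes per: "torus_periodic g" and der: "\<And>x. (g has_derivative g' x) (at x)"
    and cont: "continuous_on UNIV (\<lambda>x. g' x (axis j 1))"
  shows "fc (\<lambda>x. g' x (axis j 1)) k = \<i> * of_int (k $ j) * fc g k"
proof -
  have cg: "continuous_on UNIV g"
    using der has_derivative_continuous continuous_at_imp_continuous_on by blast
  have "tmean (\<lambda>x. g x * (\<i> * complex_of_real (freq (- k) \<bullet> axis j 1) * wave (- k) x) + g' x (axis j 1) * wave (- k) x) = 0"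
  proof (rule tmean_partial_derivative[where f = "\<lambda>x. g x * wave (- k) x"
     and f' = "\<lambda>x h. g x * (\<i> * complex_of_real (freq (- k) \<bullet> h) * wave (- k) x) + g' x h * wave (- k) x"])
    show "torus_periodic (\<lambda>x. g x * wave (- k) x)"
      using per wave_periodic[of "-k"] by (simp add: torus_periodic_def)
    show "((\<lambda>x. g x * wave (- k) x) has_derivative
      (\<lambda>h. g x * (\<i> * complex_of_real (freq (- k) \<bullet> h) * wave (- k) x) + g' x h * wave (- k) x)) (at x)" for x
      by (rule has_derivative_mult[OF der wave_has_derivative])
  qed (intro continuous_intros cg cont)
  then have "tmean (\<lambda>x. (- \<i> * of_int (k $ j)) * (g x * wave (- k) x)) + fc (\<lambda>x. g' x (axis j 1)) k = 0"
    unfolding fc_def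
    by (subst tmean_add[symmetric])
       (auto simp: inner_axis mult_ac intro!: continuous_intros cg cont)
  then show ?thesis
    unfolding fc_def
    by (subst (asm) tmean_cmult) (auto intro!: continuous_intros cg simp: algebra_simps eq_neg_iff_add_eq_0)
qed

section \<open>Uniqueness of Fourier coefficients\<close>

text \<open>The torus as a product of unit circles. Periodic functions become functions on a compact set of a
Euclidean space, on which the polynomials are trigonometric polynomials.\<close>

definition torus_embed :: "real^'d \<Rightarrow> complex^'d" where
  "torus_embed x = (\<chi> j. cis (x $ j))"

lemma torus_embed_wave: "torus_embed x $ j = wave (axis j 1) x"
  by (simp add: torus_embed_def wave_def phase_def axis_def if_distrib if_distribR cong: if_cong)

lemma continuous_torus_embed: "continuous_on A torus_embed"
  unfolding torus_embed_def by (intro continuous_intros)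

text \<open>A coordinate of \<open>torus_embed x\<close> is a combination of waves, and a multiplication by a wave shifts the
coefficients. So the functions all of whose coefficients vanish are stable under multiplication by
polynomials in these coordinates.\<close>

lemma fc_zero_polynomial:
  fixes p :: "complex^'d \<Rightarrow> real"
  assumes "real_polynomial_function p"
  shows "continuous_on UNIV \<psi> \<Longrightarrow> (\<And>k. fc \<psi> k = 0) \<Longrightarrow> fc (\<lambda>x. of_real (p (torus_embed x)) * \<psi> x) k = 0"
  using assms
proof (induction arbitrary: \<psi> k rule: real_polynomial_function.induct)
  case (linear f)
  note \<psi> = linear.prems
  interpret bounded_linear f by fact
  let ?a = "\<lambda>j. (f (axis j 1) - \<i> * f (axis j \<i>)) / 2"
  have "complex_of_real (f (torus_embed x)) = (\<Sum>j\<in>UNIV. ?a j * wave (axis j 1) x + cnj (?a j) * wave (- axis j 1) x)" for x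
  proof -
    have ax: "axis j z = Re z *\<^sub>R axis j (1::complex) + Im z *\<^sub>R axis j \<i>" for j and z :: complex
      by (simp add: vec_eq_iff axis_def complex_eq_iff)
    have "torus_embed x = (\<Sum>j\<in>UNIV. axis j (torus_embed x $ j))"
      by (simp add: vec_eq_iff axis_def if_distrib cong: if_cong)
    then have "f (torus_embed x) = (\<Sum>j\<in>UNIV. f (axis j (torus_embed x $ j)))"
      by (metis (no_types, lifting) sum sum.cong)
    also have "\<dots> = (\<Sum>j\<in>UNIV. Re (wave (axis j 1) x) * f (axis j 1) + Im (wave (axis j 1) x) * f (axis j \<i>))"
      by (subst ax) (simp add: add scaleR torus_embed_wave)
    finally have "complex_of_real (f (torus_embed x)) = 
        (\<Sum>j\<in>UNIV. of_real (Re (wave (axis j 1) x) * f (axis j 1) + Im (wave (axis j 1) x) * f (axis j \<i>)))"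
      by simp
    also have "\<dots> = (\<Sum>j\<in>UNIV. ?a j * wave (axis j 1) x + cnj (?a j) * wave (- axis j 1) x)"
      by (intro sum.cong refl) (simp add: wave_minus complex_eq_iff field_simps)
    finally show ?thesis .
  qed
  then have "fc (\<lambda>x. of_real (f (torus_embed x)) * \<psi> x) k =
     fc (\<lambda>x. \<Sum>j\<in>UNIV. ?a j * (wave (axis j 1) x * \<psi> x) + cnj (?a j) * (wave (- axis j 1) x * \<psi> x)) k"
    by (simp only: sum_distrib_right distrib_right mult.assoc)
  moreover have "fc (\<lambda>x. \<Sum>j\<in>UNIV. a j * (wave (axis j 1) x * \<psi> x) + b j * (wave (- axis j 1) x * \<psi> x)) k = 0" for a b
    by (simp add: fc_sum fc_add fc_cmult fc_wave_mult continuous_on_add continuous_on_mult continuous_wave \<psi>)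
  ultimately show ?case by metis
next
  case (const c)
  then show ?case by (simp add: fc_cmult)
next
  case (add f g)
  have c: "continuous_on UNIV (\<lambda>x. f (torus_embed x))" "continuous_on UNIV (\<lambda>x. g (torus_embed x))"
    using add.hyps continuous_on_compose2[OF continuous_on_polymonial_function continuous_torus_embed]
    by (auto simp: real_polynomial_function_eq)
  show ?case
    unfolding of_real_add distrib_right using add c
    by (subst fc_add) (auto intro!: continuous_intros)
next
  case (mult f g)
  have c: "continuous_on UNIV (\<lambda>x. f (torus_embed x))" "continuous_on UNIV (\<lambda>x. g (torus_embed x))"
    using mult.hyps continuous_on_compose2[OF continuous_on_polymonial_function continuous_torus_embed]
    by (auto simp: real_polynomial_function_eq)
  have "fc (\<lambda>x. of_real (f (torus_embed x)) * (of_real (g (torus_embed x)) * \<psi> x)) k = 0"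
    using mult c by (intro mult.IH(1)) (auto intro!: continuous_intros)
  then show ?case by (simp add: mult.assoc)
qed

text \<open>By Stone-Weierstrass \<open>g\<close> is a uniform limit of polynomials in \<open>torus_embed x\<close>, to which \<open>g\<close> is
orthogonal; hence \<open>g\<close> is orthogonal to itself.\<close>

lemma fourier_uniqueness_real:
  fixes g :: "real^'d \<Rightarrow> real"
  assumes g: "continuous_on UNIV g" "torus_periodic g" and z: "\<And>k. fc (\<lambda>x. of_real (g x)) k = 0"
  shows "g x = 0"
proof -
  \<comment> \<open>\<open>g\<close> as a function on the embedded torus. It is continuous there although \<open>Arg2pi\<close> is not, because
    the preimages of closed sets are images of compact sets.\<close>
  let ?h = "\<lambda>z::complex^'d. g (\<chi> j. Arg2pi (z $ j))"
  have h: "?h (torus_embed x) = g x" for x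
  proof -
    have "\<exists>m. Arg2pi (cis (x $ j)) = x $ j + 2 * pi * real_of_int m" for j
    proof -
      have "cis (Arg2pi (cis (x $ j))) = cis (x $ j)"
        using Arg2pi_eq[of "cis (x $ j)"] by (simp add: cis_conv_exp)
      then have "sin (Arg2pi (cis (x $ j))) = sin (x $ j) \<and> cos (Arg2pi (cis (x $ j))) = cos (x $ j)"
        by (auto simp: complex_eq_iff)
      then obtain n where "Arg2pi (cis (x $ j)) = x $ j + 2 * pi * real_of_int n"
        using sin_cos_eq_iff by blast
      then show ?thesis by (intro exI[of _ n]) simp
    qed
    then obtain m where "\<And>j. Arg2pi (cis (x $ j)) = x $ j + 2 * pi * real_of_int (m j)" by metis
    then have "(\<chi> j. Arg2pi (torus_embed x $ j)) = x + (\<chi> j. 2 * pi * real_of_int (m j))"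
      by (simp add: vec_eq_iff torus_embed_def)
    then show ?thesis using periodic_reduce[OF g(2)] by metis
  qed
  let ?K = "torus_embed ` (torus_cell :: (real^'d) set)"
  have compact_cell: "compact (torus_cell :: (real^'d) set)"
    by (simp add: torus_cell_def)
  have cK: "compact ?K"
    by (intro compact_continuous_image continuous_torus_embed compact_cell)
  have ch: "continuous_on ?K ?h"
    unfolding continuous_on_closed_vimage[OF compact_imp_closed[OF cK]]
  proof (intro allI impI)
    fix B :: "real set" assume "closed B"
    have "?h -` B \<inter> ?K = torus_embed ` (torus_cell \<inter> g -` B)"
      using h by auto
    moreover have "closed (g -` B)"
      using g(1) \<open>closed B\<close> continuous_closed_vimage continuous_on_eq_continuous_at by blast
    then have "compact (torus_embed ` (torus_cell \<inter> g -` B))"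
      by (intro compact_continuous_image continuous_torus_embed compact_Int_closed compact_cell)
    ultimately show "closed (?h -` B \<inter> ?K)" by (simp add: compact_imp_closed)
  qed
  have g2c: "continuous_on UNIV (\<lambda>x. (g x)\<^sup>2)" by (intro continuous_intros g)
  have "bounded (g ` torus_cell)"
    by (intro compact_imp_bounded compact_continuous_image continuous_on_subset[OF g(1)] compact_cell) auto
  then obtain B where B: "\<And>x. x \<in> torus_cell \<Longrightarrow> \<bar>g x\<bar> \<le> B" "B > 0"
    unfolding bounded_pos by auto
  have B': "\<bar>g x\<bar> \<le> B" for x
    using periodic_representative[of x] periodic_reduce[OF g(2), of x] B(1) by metis
  have small: "tmean (\<lambda>x. (g x)\<^sup>2) \<le> e * B" if "e > 0" for e
  proof -
    obtain p where p: "real_polynomial_function p" "\<And>z. z \<in> ?K \<Longrightarrow> \<bar>?h z - p z\<bar> < e"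
      using Stone_Weierstrass_real_polynomial_function[OF cK ch \<open>e > 0\<close>] by metis
    have pc: "continuous_on UNIV (\<lambda>x::real^'d. p (torus_embed x))"
      using p(1) continuous_on_compose2[OF continuous_on_polymonial_function continuous_torus_embed]
      by (auto simp: real_polynomial_function_eq)
    have close: "\<bar>g x - p (torus_embed x)\<bar> \<le> e" for x
    proof -
      obtain m where m: "x + (\<chi> j. 2 * pi * real_of_int (m j)) \<in> torus_cell"
        by (rule periodic_representative)
      have "torus_periodic (torus_embed :: real^'d \<Rightarrow> _)"
      proof -
        have "torus_periodic (wave (axis i 1 :: int^'d))" for i by (rule wave_periodic)
        then show ?thesis by (simp add: torus_periodic_def vec_eq_iff torus_embed_wave)
      qed
      from periodic_reduce[OF this, of x m] have "torus_embed x \<in> ?K" using m by (metis imageI)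
      from p(2)[OF this] show ?thesis by (simp add: h)
    qed
    have "fc (\<lambda>x. of_real (p (torus_embed x)) * of_real (g x)) 0 = 0"
      by (rule fc_zero_polynomial[OF p(1)]) (use z in \<open>auto intro!: continuous_intros g\<close>)
    then have "tmean (\<lambda>x. p (torus_embed x) * g x) = 0"
      using tmean_of_real[of "\<lambda>x. p (torus_embed x) * g x"]
      by (simp add: fc_def continuous_on_mult pc g)
    then have "tmean (\<lambda>x. (g x)\<^sup>2) = tmean (\<lambda>x. (g x)\<^sup>2 - p (torus_embed x) * g x)"
      by (subst tmean_diff) (auto intro!: continuous_intros g pc)
    also have "\<dots> \<le> tmean (\<lambda>x::real^'d. e * B)"
    proof (rule tmean_mono)
      fix x
      have "(g x)\<^sup>2 - p (torus_embed x) * g x = (g x - p (torus_embed x)) * g x"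
        by (simp add: power2_eq_square algebra_simps)
      also have "\<dots> \<le> \<bar>g x - p (torus_embed x)\<bar> * \<bar>g x\<bar>"
        by (metis abs_ge_self abs_mult)
      also have "\<dots> \<le> e * B"
        by (intro mult_mono close B') (use that in auto)
      finally show "(g x)\<^sup>2 - p (torus_embed x) * g x \<le> e * B" .
    qed (auto intro!: continuous_intros g pc)
    finally show ?thesis by simp
  qed
  have "tmean (\<lambda>x. (g x)\<^sup>2) \<le> 0"
  proof (rule field_le_epsilon)
    fix e :: real assume "e > 0"
    then show "tmean (\<lambda>x. (g x)\<^sup>2) \<le> 0 + e"
      using small[of "e / B"] \<open>B > 0\<close> by simp
  qed
  then have "tmean (\<lambda>x. (g x)\<^sup>2) = 0"
    using tmean_nonneg[OF g2c] by simp
  from tmean_zero_imp_zero[OF g2c _ _ this, of x] show ?thesis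
    using g(2) by (simp add: torus_periodic_def)
qed

lemma fourier_uniqueness:
  fixes g :: "real^'d \<Rightarrow> complex"
  assumes g: "continuous_on UNIV g" "torus_periodic g" and z: "\<And>k. fc g k = 0"
  shows "g x = 0"
proof -
  have 1: "fc (\<lambda>x. of_real (Re (g x))) k = 0" for k
  proof -
    have "fc (\<lambda>x. of_real (Re (g x))) k = fc (\<lambda>x. (1/2) * (g x + cnj (g x))) k"
      by (simp add: complex_add_cnj)
    also have "\<dots> = 0"
      using g z by (simp only: fc_cmult fc_add fc_cnj continuous_on_cnj continuous_on_add) simp
    finally show ?thesis .
  qed
  have 2: "fc (\<lambda>x. of_real (Im (g x))) k = 0" for k
  proof -
    have "fc (\<lambda>x. of_real (Im (g x))) k = fc (\<lambda>x. (1 / (2 * \<i>)) * (g x - cnj (g x))) k"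
    proof -
      have "of_real (Im z) = (1 / (2 * \<i>)) * (z - cnj z)" for z by (simp add: complex_eq_iff)
      then show ?thesis by metis
    qed
    also have "\<dots> = 0"
      using g z by (simp only: fc_cmult fc_diff fc_cnj continuous_on_cnj continuous_on_diff) simp
    finally show ?thesis .
  qed
  have "Re (g x) = 0" "Im (g x) = 0"
    using g(2) by (auto intro!: fourier_uniqueness_real 1 2 continuous_intros g(1) simp: torus_periodic_def)
  then show ?thesis by (simp add: complex_eq_iff)
qed

section \<open>Absolutely convergent Fourier series\<close>

definition wave_series :: "(int^'d \<Rightarrow> complex) \<Rightarrow> real^'d \<Rightarrow> complex" where
  "wave_series c x = (\<Sum>\<^sub>\<infinity>k. c k * wave k x)"

lemma wave_series_uniform_limit:
  assumes "(\<lambda>k. norm (c k)) summable_on UNIV"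
  shows "uniform_limit UNIV (\<lambda>F x. \<Sum>k\<in>F. c k * wave k x) (wave_series c) (finite_subsets_at_top UNIV)"
  unfolding wave_series_def
  by (rule Weierstrass_m_test_general[OF _ assms]) (simp add: norm_mult)

lemma continuous_wave_series:
  assumes "(\<lambda>k. norm (c k)) summable_on UNIV"
  shows "continuous_on UNIV (wave_series c)"
  by (rule uniform_limit_theorem[OF _ wave_series_uniform_limit[OF assms]])
     (auto intro!: always_eventually continuous_intros)

lemma wave_series_periodic: "torus_periodic (wave_series (c :: int^'d \<Rightarrow> complex))"
proof -
  have "wave k (x + axis j (2 * pi)) = wave k x" for k and x :: "real^'d" and j
    using wave_periodic[of k] unfolding torus_periodic_def by blast
  then show ?thesis by (simp add: wave_series_def torus_periodic_def)
qed

text \<open>The partial sums converge uniformly, so the coefficients of the product are limits of those of the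
partial products.\<close>

lemma fc_wave_series_mult:
  fixes g :: "real^'d \<Rightarrow> complex"
  assumes c: "(\<lambda>k. norm (c k)) summable_on UNIV" and g: "continuous_on UNIV g"
  shows "((\<lambda>l. c l * fc g (k - l)) has_sum fc (\<lambda>x. wave_series c x * g x) k) UNIV"
proof -
  let ?F = "finite_subsets_at_top (UNIV :: (int^'d) set)"
  have cg: "continuous_on UNIV (\<lambda>x. g x * wave (- k) x)"
    by (intro continuous_intros g)
  have "bounded ((\<lambda>x. g x * wave (- k) x) ` torus_cell)"
    unfolding torus_cell_def
    by (intro compact_imp_bounded compact_continuous_image continuous_on_subset[OF cg]) auto
  moreover have "bounded (wave_series c ` torus_cell)"
    unfolding torus_cell_def
    by (intro compact_imp_bounded compact_continuous_image
         continuous_on_subset[OF continuous_wave_series[OF c]]) auto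
  ultimately have ul: "uniform_limit torus_cell (\<lambda>F x. (\<Sum>l\<in>F. c l * wave l x) * (g x * wave (- k) x))
      (\<lambda>x. wave_series c x * (g x * wave (- k) x)) ?F"
    by (intro bounded_bilinear.bounded_uniform_limit[OF bounded_bilinear_mult] uniform_limit_const
          uniform_limit_on_subset[OF wave_series_uniform_limit[OF c]]) auto
  obtain I J where I: "\<And>F. ((\<lambda>x. (\<Sum>l\<in>F. c l * wave l x) * (g x * wave (- k) x)) has_integral I F) torus_cell"
    and J: "((\<lambda>x. wave_series c x * (g x * wave (- k) x)) has_integral J) torus_cell"
    and lim: "(I \<longlongrightarrow> J) ?F"
    by (rule uniform_limit_integral_cbox[OF ul[unfolded torus_cell_def]])
       (auto simp: torus_cell_def intro!: continuous_intros continuous_on_subset[OF g])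
  have I': "(1 / (2 * pi) ^ CARD('d)) *\<^sub>R I F = (\<Sum>l\<in>F. c l * fc g (k - l))" for F
  proof -
    have "(1 / (2 * pi) ^ CARD('d)) *\<^sub>R I F = fc (\<lambda>x. \<Sum>l\<in>F. c l * (wave l x * g x)) k"
    proof -
      have "(\<Sum>l\<in>F. c l * wave l x) * (g x * wave (- k) x) = (\<Sum>l\<in>F. c l * (wave l x * g x)) * wave (- k) x" for x
        by (simp add: sum_distrib_right mult.assoc)
      then have "fc (\<lambda>x. \<Sum>l\<in>F. c l * (wave l x * g x)) k = (1 / (2 * pi) ^ CARD('d)) *\<^sub>R
          integral torus_cell (\<lambda>x. (\<Sum>l\<in>F. c l * wave l x) * (g x * wave (- k) x))"
        by (simp only: fc_def tmean_def)
      then show ?thesis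
        by (simp only: integral_unique[OF I[of F]])
    qed
    also have "\<dots> = (\<Sum>l\<in>F. c l * fc g (k - l))"
      by (simp add: fc_sum fc_cmult fc_wave_mult continuous_intros g)
    finally show ?thesis .
  qed
  have J': "(1 / (2 * pi) ^ CARD('d)) *\<^sub>R J = fc (\<lambda>x. wave_series c x * g x) k"
    using J by (simp add: fc_def tmean_def integral_unique mult_ac)
  show ?thesis
    using tendsto_scaleR[OF tendsto_const lim, of "1 / (2 * pi) ^ CARD('d)"]
    unfolding has_sum_def I' J' .
qed

lemma fc_wave_series:
  fixes c :: "int^'d \<Rightarrow> complex"
  assumes "(\<lambda>k. norm (c k)) summable_on UNIV"
  shows "fc (wave_series c) k = c k"
proof -
  have A: "((\<lambda>l. c l * fc (\<lambda>x. 1) (k - l)) has_sum fc (\<lambda>x. wave_series c x * 1) k) UNIV"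
    by (rule fc_wave_series_mult[OF assms]) simp
  have B: "((\<lambda>l. c l * fc (\<lambda>x. 1) (k - l)) has_sum c k) UNIV"
  proof (rule has_sum_finite_neutralI[where B = "{k}"])
    have "(\<lambda>x::real^'d. 1) = wave 0" by auto
    then have one: "fc (\<lambda>x::real^'d. 1) m = (if m = 0 then 1 else 0)" for m
      using fc_wave[of 0 m] by metis
    show "c k = (\<Sum>l\<in>{k}. c l * fc (\<lambda>x. 1) (k - l))" by (simp add: one)
    show "c l * fc (\<lambda>x. 1) (k - l) = 0" if "l \<in> UNIV - {k}" for l
      using that by (simp add: one)
  qed auto
  from has_sum_unique[OF A B] show ?thesis by simp
qed

text \<open>The Wiener algebra: continuous periodic functions with absolutely summable coefficients
  are the sums of their Fourier series, by uniqueness of coefficients.\<close>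

definition wiener :: "(real^'d \<Rightarrow> complex) set" where
  "wiener = {g. continuous_on UNIV g \<and> torus_periodic g \<and> (\<lambda>k. norm (fc g k)) summable_on UNIV}"

lemma wienerD:
  assumes "g \<in> wiener"
  shows "continuous_on UNIV g" "torus_periodic g" "(\<lambda>k. norm (fc g k)) summable_on UNIV"
  using assms by (auto simp: wiener_def)

lemma wiener_inversion:
  assumes "g \<in> wiener"
  shows "g = wave_series (fc g)"
proof
  fix x
  note w = wienerD[OF assms]
  have "g x - wave_series (fc g) x = 0"
  proof (rule fourier_uniqueness)
    show "torus_periodic (\<lambda>x. g x - wave_series (fc g) x)"
      using w(2) wave_series_periodic[of "fc g"] by (simp add: torus_periodic_def)
  qed (use w in \<open>auto intro!: continuous_intros continuous_wave_series simp: fc_diff continuous_wave_series fc_wave_series\<close>)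
  then show "g x = wave_series (fc g) x" by simp
qed

lemma wiener_norm_le:
  assumes "g \<in> wiener"
  shows "norm (g x) \<le> (\<Sum>\<^sub>\<infinity>k. norm (fc g k))"
proof -
  have "norm (wave_series (fc g) x) \<le> (\<Sum>\<^sub>\<infinity>k. norm (fc g k * wave k x))"
    unfolding wave_series_def
    by (rule norm_infsum_bound) (use wienerD[OF assms] in \<open>simp add: norm_mult\<close>)
  then show ?thesis
    using wiener_inversion[OF assms] by (metis (no_types, lifting) norm_mult norm_wave mult.right_neutral infsum_cong)
qed

text \<open>The coefficients of a product are the convolution of the coefficients; only one factor needs an
absolutely convergent series.\<close>

lemma fc_mult_has_sum:
  assumes "g \<in> wiener" "continuous_on UNIV f"
  shows "((\<lambda>l. fc g l * fc f (k - l)) has_sum fc (\<lambda>x. g x * f x) k) UNIV"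
  using fc_wave_series_mult[OF wienerD(3)[OF assms(1)] assms(2), of k] wiener_inversion[OF assms(1)]
  by metis

lemma parseval:
  assumes "g \<in> wiener"
  shows "((\<lambda>k. (norm (fc g k))\<^sup>2) has_sum tmean (\<lambda>x. (norm (g x))\<^sup>2)) UNIV"
proof -
  note w = wienerD[OF assms]
  have A: "((\<lambda>l. fc g l * fc (\<lambda>x. cnj (g x)) (0 - l)) has_sum fc (\<lambda>x. g x * cnj (g x)) 0) UNIV"
    by (rule fc_mult_has_sum[OF assms]) (intro continuous_intros w)
  have B: "fc (\<lambda>x. g x * cnj (g x)) 0 = of_real (tmean (\<lambda>x. (norm (g x))\<^sup>2))"
  proof -
    have "g x * cnj (g x) = of_real ((norm (g x))\<^sup>2)" for x
      by (simp only: complex_norm_square)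
    then have "fc (\<lambda>x. g x * cnj (g x)) 0 = tmean (\<lambda>x. of_real ((norm (g x))\<^sup>2))"
      by (simp add: fc_def)
    also have "\<dots> = of_real (tmean (\<lambda>x. (norm (g x))\<^sup>2))"
      by (intro tmean_of_real continuous_intros w)
    finally show ?thesis .
  qed
  have C: "fc g l * fc (\<lambda>x. cnj (g x)) (0 - l) = of_real ((norm (fc g l))\<^sup>2)" for l
    by (simp add: fc_cnj w complex_norm_square del: of_real_power)
  show ?thesis
    using A unfolding B C has_sum_of_real_iff .
qed

section \<open>Convolution of an absolutely summable and a square summable family\<close>

lemma weighted_sum_square_le:
  fixes a b :: "'i \<Rightarrow> real"
  assumes "\<And>i. a i \<ge> 0"
  shows "(\<Sum>i\<in>F. a i * b i)\<^sup>2 \<le> (\<Sum>i\<in>F. a i) * (\<Sum>i\<in>F. a i * (b i)\<^sup>2)"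
proof -
  have "(\<Sum>i\<in>F. sqrt (a i) * (sqrt (a i) * b i))\<^sup>2 \<le> (\<Sum>i\<in>F. (sqrt (a i))\<^sup>2) * (\<Sum>i\<in>F. (sqrt (a i) * b i)\<^sup>2)"
    by (rule Cauchy_Schwarz_ineq_sum)
  then show ?thesis
    using assms by (simp add: power_mult_distrib flip: mult.assoc)
qed

definition conv :: "(int^'d \<Rightarrow> real) \<Rightarrow> (int^'d \<Rightarrow> real) \<Rightarrow> int^'d \<Rightarrow> real" where
  "conv a b k = (\<Sum>\<^sub>\<infinity>l. a l * b (k - l))"

lemma conv_has_sum:
  fixes a b :: "int^'d \<Rightarrow> real"
  assumes "\<And>k. a k \<ge> 0" "a summable_on UNIV" "\<And>k. 0 \<le> b k" "\<And>k. b k \<le> B"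
  shows "((\<lambda>l. a l * b (k - l)) has_sum conv a b k) UNIV"
  unfolding conv_def
proof (rule has_sum_infsum, rule summable_on_comparison_test)
  show "(\<lambda>l. a l * B) summable_on UNIV"
    using assms(2) by (rule summable_on_cmult_left)
qed (use assms in \<open>auto intro!: mult_nonneg_nonneg mult_left_mono\<close>)

lemma conv_commute: "conv a b k = conv b a k"
proof -
  have "bij_betw (\<lambda>l. k - l) UNIV UNIV"
    by (rule bij_betw_byWitness[where f' = "\<lambda>l. k - l"]) auto
  from infsum_reindex_bij_betw[OF this, of "\<lambda>l. a l * b (k - l)"] show ?thesis
    by (simp add: conv_def mult.commute)
qed

lemma conv_sum_le:
  fixes a b :: "int^'d \<Rightarrow> real"
  assumes a: "\<And>k. a k \<ge> 0" "a summable_on UNIV" "infsum a UNIV \<le> \<alpha>"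
    and b: "\<And>k. b k \<ge> 0" "\<And>G. finite G \<Longrightarrow> (\<Sum>k\<in>G. b k) \<le> \<beta>"
    and F: "finite F"
  shows "(\<Sum>k\<in>F. conv a b k) \<le> \<alpha> * \<beta>"
proof -
  have \<beta>: "0 \<le> \<beta>" using b(2)[of "{}"] by simp
  have fin: "(\<Sum>k\<in>F. (\<Sum>l\<in>G. a l * b (k - l))) \<le> \<alpha> * \<beta>" if "finite G" for G
  proof -
    have aG: "(\<Sum>l\<in>G. a l) \<le> \<alpha>"
      using finite_sum_le_infsum[OF a(2) that] a by fastforce
    have "(\<Sum>k\<in>F. (\<Sum>l\<in>G. a l * b (k - l))) = (\<Sum>l\<in>G. a l * (\<Sum>k\<in>F. b (k - l)))"
      by (subst sum.swap) (simp add: sum_distrib_left)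
    also have "\<dots> \<le> (\<Sum>l\<in>G. a l * \<beta>)"
    proof (intro mult_left_mono sum_mono a)
      fix l
      have "(\<Sum>k\<in>F. b (k - l)) = (\<Sum>m\<in>(\<lambda>k. k - l) ` F. b m)"
        by (subst sum.reindex) (auto intro: inj_onI)
      also have "\<dots> \<le> \<beta>" by (rule b(2)) (use F in auto)
      finally show "(\<Sum>k\<in>F. b (k - l)) \<le> \<beta>" .
    qed
    also have "\<dots> \<le> \<alpha> * \<beta>"
      using aG \<beta> by (simp add: sum_distrib_right[symmetric] mult_right_mono)
    finally show ?thesis .
  qed
  have "b k \<le> \<beta>" for k using b(2)[of "{k}"] by simp
  then have "((\<lambda>G. \<Sum>k\<in>F. (\<Sum>l\<in>G. a l * b (k - l))) \<longlongrightarrow> (\<Sum>k\<in>F. conv a b k)) (finite_subsets_at_top UNIV)"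
    using conv_has_sum[where a = a and b = b, OF a(1,2) b(1)] by (intro tendsto_intros) (auto simp: has_sum_def)
  then show ?thesis
    by (rule tendsto_upperbound) (auto intro!: eventually_finite_subsets_at_top_weakI fin)
qed

text \<open>Young's inequality for the product of \<open>\<ell>\<^sup>1\<close> and \<open>\<ell>\<^sup>2\<close>, from Cauchy-Schwarz with the weight \<open>a\<close>.\<close>

lemma young_convolution:
  fixes a b :: "int^'d \<Rightarrow> real"
  assumes a: "\<And>k. a k \<ge> 0" "a summable_on UNIV" "infsum a UNIV \<le> \<alpha>"
    and b: "\<And>k. b k \<ge> 0" "\<And>G. finite G \<Longrightarrow> (\<Sum>k\<in>G. (b k)\<^sup>2) \<le> \<beta>"
    and F: "finite F"
  shows "(\<Sum>k\<in>F. (conv a b k)\<^sup>2) \<le> \<alpha>\<^sup>2 * \<beta>"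
proof -
  have \<beta>: "0 \<le> \<beta>" using b(2)[of "{}"] by simp
  have fin: "(\<Sum>k\<in>F. (\<Sum>l\<in>G. a l * b (k - l))\<^sup>2) \<le> \<alpha>\<^sup>2 * \<beta>" if "finite G" for G
  proof -
    have aG: "(\<Sum>l\<in>G. a l) \<le> \<alpha>"
      using finite_sum_le_infsum[OF a(2) that] a by fastforce
    have "(\<Sum>k\<in>F. (\<Sum>l\<in>G. a l * b (k - l))\<^sup>2) \<le> (\<Sum>k\<in>F. (\<Sum>l\<in>G. a l) * (\<Sum>l\<in>G. a l * (b (k - l))\<^sup>2))"
      by (intro sum_mono weighted_sum_square_le a)
    also have "\<dots> = (\<Sum>l\<in>G. a l) * (\<Sum>l\<in>G. a l * (\<Sum>k\<in>F. (b (k - l))\<^sup>2))"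
      by (subst sum_distrib_left[symmetric], subst sum.swap) (simp add: sum_distrib_left)
    also have "\<dots> \<le> (\<Sum>l\<in>G. a l) * (\<Sum>l\<in>G. a l * \<beta>)"
    proof (intro mult_left_mono sum_mono sum_nonneg a)
      fix l
      have "(\<Sum>k\<in>F. (b (k - l))\<^sup>2) = (\<Sum>m\<in>(\<lambda>k. k - l) ` F. (b m)\<^sup>2)"
        by (subst sum.reindex) (auto intro: inj_onI)
      also have "\<dots> \<le> \<beta>" by (rule b(2)) (use F in auto)
      finally show "(\<Sum>k\<in>F. (b (k - l))\<^sup>2) \<le> \<beta>" .
    qed
    also have "\<dots> = (\<Sum>l\<in>G. a l)\<^sup>2 * \<beta>"
      by (simp add: sum_distrib_right[symmetric] power2_eq_square)
    also have "\<dots> \<le> \<alpha>\<^sup>2 * \<beta>"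
      using aG a(1) \<beta> by (intro mult_right_mono power_mono sum_nonneg) auto
    finally show ?thesis .
  qed
  have "b k \<le> sqrt \<beta>" for k using b(2)[of "{k}"] by (simp add: real_le_rsqrt)
  then have "((\<lambda>G. \<Sum>k\<in>F. (\<Sum>l\<in>G. a l * b (k - l))\<^sup>2) \<longlongrightarrow> (\<Sum>k\<in>F. (conv a b k)\<^sup>2)) (finite_subsets_at_top UNIV)"
    using conv_has_sum[where a = a and b = b, OF a(1,2) b(1)] by (intro tendsto_intros) (auto simp: has_sum_def)
  then show ?thesis
    by (rule tendsto_upperbound) (auto intro!: eventually_finite_subsets_at_top_weakI fin)
qed

section \<open>Tails of Fourier series and products\<close>

text \<open>The norm of the functions whose gradient has an absolutely convergent Fourier series. It is an
algebra norm (lemma \<open>wiener_bound_mult\<close>) and controls the function and its gradient uniformly.\<close>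

definition wiener_bound :: "real \<Rightarrow> (real^'d \<Rightarrow> complex) \<Rightarrow> bool" where
  "wiener_bound \<alpha> g \<longleftrightarrow> continuous_on UNIV g \<and> torus_periodic g \<and>
     (\<forall>F. finite F \<longrightarrow> (\<Sum>k\<in>F. (1 + norm (freq k)) * norm (fc g k)) \<le> \<alpha>)"

text \<open>For functions in \<open>sobolev s\<close> the squared norm is an admissible \<open>b\<close>. In contrast to the
Sobolev norm, this quantity is compared with a single cutoff at a time, which is what an energy estimate gives.\<close>

definition tail_bound :: "real \<Rightarrow> real \<Rightarrow> (int^'d \<Rightarrow> 'b::real_normed_vector) \<Rightarrow> bool" where
  "tail_bound s b c \<longleftrightarrow>
     (\<forall>\<rho>>0. \<forall>F. finite F \<longrightarrow> (\<forall>k\<in>F. \<rho> < norm (freq k)) \<longrightarrow>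
        (\<Sum>k\<in>F. (norm (c k))\<^sup>2) \<le> b * \<rho> powr (- 2 * s))"

definition tame :: "real \<Rightarrow> real \<Rightarrow> real \<Rightarrow> (real^'d \<Rightarrow> complex) \<Rightarrow> bool" where
  "tame s \<alpha> b g \<longleftrightarrow> wiener_bound \<alpha> g \<and> tail_bound s b (fc g)"

lemma wiener_bound_nonneg: "wiener_bound \<alpha> g \<Longrightarrow> 0 \<le> \<alpha>"
  unfolding wiener_bound_def by (metis finite.emptyI sum.empty)

lemma wiener_bound_summable:
  assumes "wiener_bound \<alpha> g"
  shows "(\<lambda>k. (1 + norm (freq k)) * norm (fc g k)) summable_on UNIV"
    "(\<Sum>\<^sub>\<infinity>k. (1 + norm (freq k)) * norm (fc g k)) \<le> \<alpha>"
proof -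
  show 1: "(\<lambda>k. (1 + norm (freq k)) * norm (fc g k)) summable_on UNIV"
    using assms
    by (intro nonneg_bdd_above_summable_on) (auto simp: wiener_bound_def intro!: bdd_aboveI2)
  show "(\<Sum>\<^sub>\<infinity>k. (1 + norm (freq k)) * norm (fc g k)) \<le> \<alpha>"
    by (rule infsum_le_finite_sums[OF 1]) (use assms in \<open>auto simp: wiener_bound_def\<close>)
qed

lemma wiener_bound_coeffs:
  assumes "wiener_bound \<alpha> g"
  shows "(\<lambda>k. norm (fc g k)) summable_on UNIV" "(\<Sum>\<^sub>\<infinity>k. norm (fc g k)) \<le> \<alpha>"
    "(\<lambda>k. norm (freq k) * norm (fc g k)) summable_on UNIV" "(\<Sum>\<^sub>\<infinity>k. norm (freq k) * norm (fc g k)) \<le> \<alpha>"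
proof -
  note w = wiener_bound_summable[OF assms]
  show 1: "(\<lambda>k. norm (fc g k)) summable_on UNIV" "(\<lambda>k. norm (freq k) * norm (fc g k)) summable_on UNIV"
    by (rule summable_on_comparison_test[OF w(1)]; simp add: algebra_simps)+
  show "(\<Sum>\<^sub>\<infinity>k. norm (fc g k)) \<le> \<alpha>" "(\<Sum>\<^sub>\<infinity>k. norm (freq k) * norm (fc g k)) \<le> \<alpha>"
    by (rule order_trans[OF infsum_mono w(2)]; use 1 w in \<open>simp add: algebra_simps\<close>)+
qed

lemma wiener_bound_wiener: "wiener_bound \<alpha> g \<Longrightarrow> g \<in> wiener"
  using wiener_bound_coeffs(1) by (auto simp: wiener_def wiener_bound_def)

lemma fc_le_wiener_bound:
  assumes "wiener_bound \<alpha> g"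
  shows "norm (fc g k) \<le> \<alpha>"
proof -
  have "(\<Sum>k\<in>{k}. (1 + norm (freq k)) * norm (fc g k)) \<le> \<alpha>"
    using assms unfolding wiener_bound_def by blast
  moreover have "norm (fc g k) \<le> (1 + norm (freq k)) * norm (fc g k)" by (simp add: algebra_simps)
  ultimately show ?thesis by simp
qed

lemma fc_mult_le_conv:
  assumes "wiener_bound \<alpha> f" "wiener_bound \<beta> g"
  shows "norm (fc (\<lambda>x. f x * g x) k) \<le> conv (\<lambda>l. norm (fc f l)) (\<lambda>l. norm (fc g l)) k"
proof -
  have s: "((\<lambda>l. norm (fc f l) * norm (fc g (k - l))) has_sum conv (\<lambda>l. norm (fc f l)) (\<lambda>l. norm (fc g l)) k) UNIV"
    by (rule conv_has_sum[where B = \<beta>])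
       (use wiener_bound_coeffs(1)[OF assms(1)] fc_le_wiener_bound[OF assms(2)] in auto)
  have h: "((\<lambda>l. fc f l * fc g (k - l)) has_sum fc (\<lambda>x. f x * g x) k) UNIV"
    by (rule fc_mult_has_sum[OF wiener_bound_wiener[OF assms(1)]])
       (use assms(2) in \<open>simp add: wiener_bound_def\<close>)
  show ?thesis
    by (rule norm_has_sum_bound[OF _ h]) (use s in \<open>simp add: norm_mult\<close>)
qed

lemma conv_mono_sum:
  fixes a b :: "int^'d \<Rightarrow> real"
  assumes "((\<lambda>l. h l) has_sum x) UNIV"
    and "((\<lambda>l. a l * b (k - l)) has_sum conv a b k) UNIV" "((\<lambda>l. a' l * b' (k - l)) has_sum conv a' b' k) UNIV"
    and "\<And>l. h l \<le> a l * b (k - l) + a' l * b' (k - l)"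
  shows "x \<le> conv a b k + conv a' b' k"
  by (rule has_sum_mono[OF assms(1) has_sum_add[OF assms(2,3)]]) (use assms(4) in auto)

text \<open>The weight \<open>1 + norm (freq k)\<close> is submultiplicative in the frequencies.\<close>

lemma wiener_bound_mult:
  fixes f g :: "real^'d \<Rightarrow> complex"
  assumes f: "wiener_bound \<alpha> f" and g: "wiener_bound \<beta> g"
  shows "wiener_bound (\<alpha> * \<beta>) (\<lambda>x. f x * g x)"
proof -
  let ?a = "\<lambda>k. (1 + norm (freq k)) * norm (fc f k)" and ?b = "\<lambda>k. (1 + norm (freq k)) * norm (fc g k)"
  have b: "\<And>G. finite G \<Longrightarrow> sum ?b G \<le> \<beta>" using g by (auto simp: wiener_bound_def)
  have b1: "?b k \<le> \<beta>" for k using b[of "{k}"] by simp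
  have le: "(1 + norm (freq k)) * norm (fc (\<lambda>x. f x * g x) k) \<le> conv ?a ?b k" for k
  proof -
    have "(1 + norm (freq k)) * conv (\<lambda>l. norm (fc f l)) (\<lambda>l. norm (fc g l)) k \<le> conv ?a ?b k"
    proof (rule has_sum_mono)
      show "((\<lambda>l. (1 + norm (freq k)) * (norm (fc f l) * norm (fc g (k - l)))) has_sum
          (1 + norm (freq k)) * conv (\<lambda>l. norm (fc f l)) (\<lambda>l. norm (fc g l)) k) UNIV"
        by (intro has_sum_cmult_right conv_has_sum[where B = \<beta>])
           (use wiener_bound_coeffs(1)[OF f] fc_le_wiener_bound[OF g] in auto)
      show "((\<lambda>l. ?a l * ?b (k - l)) has_sum conv ?a ?b k) UNIV"
        by (rule conv_has_sum[where B = \<beta>, OF _ wiener_bound_summable(1)[OF f] _ b1]) auto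
      fix l
      have "1 + norm (freq k) \<le> (1 + norm (freq l)) * (1 + norm (freq (k - l)))"
      proof -
        have "freq l + freq (k - l) = freq k" by simp
        then have "norm (freq k) \<le> norm (freq l) + norm (freq (k - l))"
          by (metis norm_triangle_ineq)
        moreover have "0 \<le> norm (freq l) * norm (freq (k - l))" by simp
        ultimately show ?thesis
          unfolding distrib_left distrib_right mult_1_left mult_1_right by linarith
      qed
      then have "(1 + norm (freq k)) * (norm (fc f l) * norm (fc g (k - l)))
         \<le> ((1 + norm (freq l)) * (1 + norm (freq (k - l)))) * (norm (fc f l) * norm (fc g (k - l)))"
        by (intro mult_right_mono) auto
      then show "(1 + norm (freq k)) * (norm (fc f l) * norm (fc g (k - l))) \<le> ?a l * ?b (k - l)"
        by (simp only: mult_ac)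
    qed
    moreover have "(1 + norm (freq k)) * norm (fc (\<lambda>x. f x * g x) k) \<le> 
       (1 + norm (freq k)) * conv (\<lambda>l. norm (fc f l)) (\<lambda>l. norm (fc g l)) k"
      by (intro mult_left_mono fc_mult_le_conv[OF f g]) auto
    ultimately show ?thesis by linarith
  qed
  have "(\<Sum>k\<in>F. (1 + norm (freq k)) * norm (fc (\<lambda>x. f x * g x) k)) \<le> \<alpha> * \<beta>" if "finite F" for F
  proof -
    have "(\<Sum>k\<in>F. (1 + norm (freq k)) * norm (fc (\<lambda>x. f x * g x) k)) \<le> (\<Sum>k\<in>F. conv ?a ?b k)"
      by (intro sum_mono le)
    also have "\<dots> \<le> \<alpha> * \<beta>"
      by (rule conv_sum_le[OF _ wiener_bound_summable[OF f] _ b that]) auto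
    finally show ?thesis .
  qed
  then show ?thesis
    using f g by (auto simp: wiener_bound_def torus_periodic_def intro!: continuous_intros)
qed

lemma sum_square_le: "(x + y)\<^sup>2 \<le> 2 * x\<^sup>2 + 2 * (y::real)\<^sup>2"
  by (smt (verit) power2_diff power2_sum zero_le_power2)

lemma norm_sum_square_le: "(norm (x + y))\<^sup>2 \<le> 2 * (norm x)\<^sup>2 + 2 * (norm y)\<^sup>2"
proof -
  have "(norm (x + y))\<^sup>2 \<le> (norm x + norm y)\<^sup>2"
    by (intro power_mono norm_triangle_ineq) auto
  then show ?thesis using sum_square_le[of "norm x" "norm y"] by linarith
qed

lemma tail_boundD:
  "tail_bound s b c \<Longrightarrow> 0 < \<rho> \<Longrightarrow> finite F \<Longrightarrow> (\<And>k. k \<in> F \<Longrightarrow> \<rho> < norm (freq k)) \<Longrightarrow>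
   (\<Sum>k\<in>F. (norm (c k))\<^sup>2) \<le> b * \<rho> powr (- 2 * s)"
  by (auto simp: tail_bound_def)

lemma tail_bound_nonneg: "tail_bound s b c \<Longrightarrow> 0 \<le> b"
  using tail_boundD[of s b c 1 "{}"] by simp

lemma tail_bound_cutoff:
  assumes "tail_bound s b c" "0 < \<rho>" "finite F"
  shows "(\<Sum>k\<in>F. (if \<rho> < norm (freq k) then norm (c k) else 0)\<^sup>2) \<le> b * \<rho> powr (- 2 * s)"
proof -
  have "(\<Sum>k\<in>F. (if \<rho> < norm (freq k) then norm (c k) else 0)\<^sup>2) = (\<Sum>k\<in>{k\<in>F. \<rho> < norm (freq k)}. (norm (c k))\<^sup>2)"
    by (rule sum.mono_neutral_cong_right) (use assms in auto)
  also have "\<dots> \<le> b * \<rho> powr (- 2 * s)"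
    by (rule tail_boundD[OF assms(1,2)]) (use assms in auto)
  finally show ?thesis .
qed

lemma half_powr: "0 < \<rho> \<Longrightarrow> (\<rho> / c) powr (- 2 * s) = c powr (2 * s) * \<rho> powr (- 2 * s)" if "c > 0" for \<rho> c s :: real
  using that by (simp add: powr_divide powr_minus field_simps)

text \<open>A frequency above \<open>\<rho>\<close> of a product comes from a frequency above \<open>\<rho>/2\<close> of one factor. This is
  why the tails of a product decay like the tails of the factors, with the other factor entering
  only through its Wiener norm.\<close>

lemma tame_mult:
  fixes f g :: "real^'d \<Rightarrow> complex"
  assumes f: "tame s \<alpha> b f" and g: "tame s \<beta> b' g"
  shows "tame s (\<alpha> * \<beta>) (2 * 2 powr (2 * s) * (\<alpha>\<^sup>2 * b' + \<beta>\<^sup>2 * b)) (\<lambda>x. f x * g x)"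
proof -
  have wf: "wiener_bound \<alpha> f" and wg: "wiener_bound \<beta> g" and tf: "tail_bound s b (fc f)" and tg: "tail_bound s b' (fc g)"
    using f g by (auto simp: tame_def)
  have "(\<Sum>k\<in>F. (norm (fc (\<lambda>x. f x * g x) k))\<^sup>2) \<le> (2 * 2 powr (2 * s) * (\<alpha>\<^sup>2 * b' + \<beta>\<^sup>2 * b)) * \<rho> powr (- 2 * s)"
    if \<rho>: "0 < \<rho>" and F: "finite F" "\<forall>k\<in>F. \<rho> < norm (freq k)" for \<rho> F
  proof -
    let ?f = "\<lambda>l. norm (fc f l)" and ?g = "\<lambda>l. norm (fc g l)"
    let ?f' = "\<lambda>l. if \<rho> / 2 < norm (freq l) then norm (fc f l) else 0"
    let ?g' = "\<lambda>l. if \<rho> / 2 < norm (freq l) then norm (fc g l) else 0"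
    have r2: "\<rho> / 2 > 0" using \<rho> by simp
    have "norm (fc (\<lambda>x. f x * g x) k) \<le> conv ?f ?g' k + conv ?g ?f' k" if "k \<in> F" for k
    proof -
      have s1: "((\<lambda>l. ?f l * ?g (k - l)) has_sum conv ?f ?g k) UNIV"
        by (rule conv_has_sum[where B = \<beta>]) (use wiener_bound_coeffs(1)[OF wf] fc_le_wiener_bound[OF wg] in auto)
      have s2: "((\<lambda>l. ?f l * ?g' (k - l)) has_sum conv ?f ?g' k) UNIV"
        by (rule conv_has_sum[where B = \<beta>]) (use wiener_bound_coeffs(1)[OF wf] fc_le_wiener_bound[OF wg] wiener_bound_nonneg[OF wg] in auto)
      have s3: "((\<lambda>l. ?f' l * ?g (k - l)) has_sum conv ?f' ?g k) UNIV"
      proof (rule conv_has_sum[where B = \<beta>])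
        show "?f' summable_on UNIV"
          by (rule summable_on_comparison_test[OF wiener_bound_coeffs(1)[OF wf]]) auto
      qed (use fc_le_wiener_bound[OF wg] in auto)
      have "conv ?f ?g k \<le> conv ?f ?g' k + conv ?f' ?g k"
      proof (rule conv_mono_sum[OF s1 s2 s3])
        fix l
        have "\<rho> < norm (freq l) + norm (freq (k - l))"
          using F(2) that norm_triangle_ineq[of "freq l" "freq (k - l)"] by fastforce
        then consider "\<rho> / 2 < norm (freq l)" | "\<rho> / 2 < norm (freq (k - l))" by linarith
        then show "?f l * ?g (k - l) \<le> ?f l * ?g' (k - l) + ?f' l * ?g (k - l)"
          by cases (auto simp del: freq_simps)
      qed
      then show ?thesis using fc_mult_le_conv[OF wf wg, of k] conv_commute[of ?f' ?g k] by linarith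
    qed
    then have "(\<Sum>k\<in>F. (norm (fc (\<lambda>x. f x * g x) k))\<^sup>2) \<le> (\<Sum>k\<in>F. (conv ?f ?g' k + conv ?g ?f' k)\<^sup>2)"
      by (intro sum_mono power_mono) auto
    also have "\<dots> \<le> (\<Sum>k\<in>F. 2 * (conv ?f ?g' k)\<^sup>2 + 2 * (conv ?g ?f' k)\<^sup>2)"
      by (intro sum_mono sum_square_le)
    also have "\<dots> = 2 * (\<Sum>k\<in>F. (conv ?f ?g' k)\<^sup>2) + 2 * (\<Sum>k\<in>F. (conv ?g ?f' k)\<^sup>2)"
      by (simp add: sum.distrib sum_distrib_left)
    also have "\<dots> \<le> 2 * (\<alpha>\<^sup>2 * (b' * (\<rho> / 2) powr (- 2 * s))) + 2 * (\<beta>\<^sup>2 * (b * (\<rho> / 2) powr (- 2 * s)))"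
      by (intro add_mono mult_left_mono young_convolution wiener_bound_coeffs(1,2)[OF wf] wiener_bound_coeffs(1,2)[OF wg]
          tail_bound_cutoff[OF tf r2] tail_bound_cutoff[OF tg r2] F) auto
    also have "\<dots> = (2 * 2 powr (2 * s) * (\<alpha>\<^sup>2 * b' + \<beta>\<^sup>2 * b)) * \<rho> powr (- 2 * s)"
      using half_powr[OF _ \<rho>, of 2 s] by (simp add: algebra_simps)
    finally show ?thesis .
  qed
  then show ?thesis
    using wiener_bound_mult[OF wf wg] by (simp add: tame_def tail_bound_def)
qed

lemma tame_mono:
  assumes "tame s \<alpha> b g" "\<alpha> \<le> \<alpha>'" "b \<le> b'"
  shows "tame s \<alpha>' b' g"
  using assms unfolding tame_def wiener_bound_def tail_bound_def
  by (meson mult_right_mono order_trans powr_ge_zero)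

lemma tame_add:
  assumes f: "tame s \<alpha> b f" and g: "tame s \<alpha>' b' g"
  shows "tame s (\<alpha> + \<alpha>') (2 * b + 2 * b') (\<lambda>x. f x + g x)"
proof -
  have c: "continuous_on UNIV f" "continuous_on UNIV g" using f g by (auto simp: tame_def wiener_bound_def)
  have "(\<Sum>k\<in>F. (1 + norm (freq k)) * norm (fc (\<lambda>x. f x + g x) k)) \<le> \<alpha> + \<alpha>'" if "finite F" for F
  proof -
    have "(\<Sum>k\<in>F. (1 + norm (freq k)) * norm (fc (\<lambda>x. f x + g x) k)) \<le>
      (\<Sum>k\<in>F. (1 + norm (freq k)) * norm (fc f k) + (1 + norm (freq k)) * norm (fc g k))"
      by (intro sum_mono) (simp add: fc_add c norm_triangle_ineq mult_left_mono flip: distrib_left)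
    also have "\<dots> \<le> \<alpha> + \<alpha>'"
      using f g that unfolding sum.distrib tame_def wiener_bound_def by (intro add_mono) auto
    finally show ?thesis .
  qed
  moreover have "(\<Sum>k\<in>F. (norm (fc (\<lambda>x. f x + g x) k))\<^sup>2) \<le> (2 * b + 2 * b') * \<rho> powr (- 2 * s)"
    if "0 < \<rho>" "finite F" "\<forall>k\<in>F. \<rho> < norm (freq k)" for \<rho> F
  proof -
    have "(\<Sum>k\<in>F. (norm (fc (\<lambda>x. f x + g x) k))\<^sup>2) \<le> (\<Sum>k\<in>F. 2 * (norm (fc f k))\<^sup>2 + 2 * (norm (fc g k))\<^sup>2)"
      by (intro sum_mono) (simp only: fc_add c norm_sum_square_le)
    also have "\<dots> = 2 * (\<Sum>k\<in>F. (norm (fc f k))\<^sup>2) + 2 * (\<Sum>k\<in>F. (norm (fc g k))\<^sup>2)"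
      by (simp add: sum.distrib sum_distrib_left)
    also have "\<dots> \<le> 2 * (b * \<rho> powr (- 2 * s)) + 2 * (b' * \<rho> powr (- 2 * s))"
      using f g that unfolding tame_def by (intro add_mono mult_left_mono tail_boundD) auto
    finally show ?thesis by (simp add: algebra_simps)
  qed
  ultimately show ?thesis
    using f g by (auto simp: tame_def wiener_bound_def tail_bound_def torus_periodic_def intro!: continuous_intros)
qed

lemma tame_const: "tame s (norm c) 0 (\<lambda>x::real^'d. c)"
proof -
  have one: "fc (\<lambda>x::real^'d. c) k = (if k = 0 then c else 0)" for k
  proof -
    have "(\<lambda>x::real^'d. c) = (\<lambda>x. c * wave 0 x)" by auto
    then have "fc (\<lambda>x::real^'d. c) k = fc (\<lambda>x. c * wave 0 x) k" by (rule arg_cong)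
    also have "\<dots> = c * fc (wave 0) k" by (rule fc_cmult) (intro continuous_intros)
    finally show ?thesis by (simp add: fc_wave del: wave_0)
  qed
  have "(\<Sum>k\<in>F. (1 + norm (freq k)) * norm (fc (\<lambda>x::real^'d. c) k)) \<le> norm c" if "finite F" for F
  proof -
    have "(\<Sum>k\<in>F. (1 + norm (freq k)) * norm (fc (\<lambda>x::real^'d. c) k)) = (\<Sum>k\<in>F. if k = 0 then norm c else 0)"
      by (intro sum.cong refl) (simp add: one)
    then show ?thesis using that by simp
  qed
  moreover have "(\<Sum>k\<in>F. (norm (fc (\<lambda>x::real^'d. c) k))\<^sup>2) \<le> 0"
    if "\<rho> > 0" "\<forall>k\<in>F. \<rho> < norm (freq k)" for F \<rho>
  proof -
    have "fc (\<lambda>x::real^'d. c) k = 0" if "k \<in> F" for k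
      using that \<open>\<forall>k\<in>F. \<rho> < norm (freq k)\<close> \<open>\<rho> > 0\<close> unfolding one by fastforce
    then show ?thesis by simp
  qed
  ultimately show ?thesis
    by (auto simp: tame_def wiener_bound_def tail_bound_def torus_periodic_def)
qed

text \<open>The constant does not depend on \<open>b\<close> and \<open>b\<close> enters linearly: each product has one factor for which the
tail is used, the others are bounded by their Wiener norms.\<close>

lemma tame_polynomial:
  fixes p :: "real^'n \<Rightarrow> real"
  assumes "real_polynomial_function p" "0 \<le> \<alpha>"
  shows "\<exists>C\<ge>0. \<forall>b (u :: real^'d \<Rightarrow> real^'n). 0 \<le> b \<longrightarrow> (\<forall>a. tame s \<alpha> b (\<lambda>x. of_real (u x $ a)))
     \<longrightarrow> tame s C (C * b) (\<lambda>x. of_real (p (u x)))"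
  using assms(1)
proof (induction p rule: real_polynomial_function.induct)
  case (const c)
  show ?case
  proof (intro exI[of _ "\<bar>c\<bar>"] conjI allI impI)
    fix b :: real and u :: "real^'d \<Rightarrow> real^'n" assume "0 \<le> b"
    then show "tame s \<bar>c\<bar> (\<bar>c\<bar> * b) (\<lambda>x. complex_of_real c)"
      using tame_mono[OF tame_const[of s "complex_of_real c"], of "\<bar>c\<bar>" "\<bar>c\<bar> * b"] by simp
  qed auto
next
  case (add f g)
  then obtain C D where C: "C \<ge> 0" "\<And>b u. 0 \<le> b \<Longrightarrow> (\<And>a. tame s \<alpha> b (\<lambda>x::real^'d. of_real (u x $ a))) \<Longrightarrow> tame s C (C * b) (\<lambda>x. of_real (f (u x)))"
    and D: "D \<ge> 0" "\<And>b u. 0 \<le> b \<Longrightarrow> (\<And>a. tame s \<alpha> b (\<lambda>x::real^'d. of_real (u x $ a))) \<Longrightarrow> tame s D (D * b) (\<lambda>x. of_real (g (u x)))"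
    by metis
  show ?case
  proof (intro exI[of _ "2 * (C + D)"] conjI allI impI)
    fix b :: real and u :: "real^'d \<Rightarrow> real^'n" assume "0 \<le> b" "\<forall>a. tame s \<alpha> b (\<lambda>x. of_real (u x $ a))"
    then have t: "tame s (C + D) (2 * (C * b) + 2 * (D * b)) (\<lambda>x. of_real (f (u x)) + of_real (g (u x)))"
      by (intro tame_add C D) auto
    show "tame s (2 * (C + D)) (2 * (C + D) * b) (\<lambda>x. of_real (f (u x) + g (u x)))"
      using tame_mono[OF t, of "2 * (C + D)" "2 * (C + D) * b"] C(1) D(1) by (simp add: algebra_simps)
  qed (use C(1) D(1) in auto)
next
  case (mult f g)
  then obtain C D where C: "C \<ge> 0" "\<And>b u. 0 \<le> b \<Longrightarrow> (\<And>a. tame s \<alpha> b (\<lambda>x::real^'d. of_real (u x $ a))) \<Longrightarrow> tame s C (C * b) (\<lambda>x. of_real (f (u x)))"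
    and D: "D \<ge> 0" "\<And>b u. 0 \<le> b \<Longrightarrow> (\<And>a. tame s \<alpha> b (\<lambda>x::real^'d. of_real (u x $ a))) \<Longrightarrow> tame s D (D * b) (\<lambda>x. of_real (g (u x)))"
    by metis
  let ?B = "2 * 2 powr (2 * s) * (C\<^sup>2 * D + D\<^sup>2 * C)"
  show ?case
  proof (intro exI[of _ "C * D + ?B"] conjI allI impI)
    fix b :: real and u :: "real^'d \<Rightarrow> real^'n" assume b: "0 \<le> b" and "\<forall>a. tame s \<alpha> b (\<lambda>x. of_real (u x $ a))"
    then have t: "tame s (C * D) (2 * 2 powr (2 * s) * (C\<^sup>2 * (D * b) + D\<^sup>2 * (C * b))) (\<lambda>x. of_real (f (u x)) * of_real (g (u x)))"
      by (intro tame_mult C D) auto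
    have "C * D \<le> C * D + ?B" using C(1) D(1) by simp
    moreover have "2 * 2 powr (2 * s) * (C\<^sup>2 * (D * b) + D\<^sup>2 * (C * b)) \<le> (C * D + ?B) * b"
    proof -
      have "2 * 2 powr (2 * s) * (C\<^sup>2 * (D * b) + D\<^sup>2 * (C * b)) = ?B * b" by (simp add: algebra_simps)
      also have "\<dots> \<le> (C * D + ?B) * b" using C(1) D(1) b by (intro mult_right_mono) auto
      finally show ?thesis .
    qed
    ultimately show "tame s (C * D + ?B) ((C * D + ?B) * b) (\<lambda>x. of_real (f (u x) * g (u x)))"
      using tame_mono[OF t] by simp
  qed (use C(1) D(1) in auto)
next
  case (linear f)
  interpret bounded_linear f by (rule linear.hyps)
  have *: "\<exists>C\<ge>0. \<forall>b (u :: real^'d \<Rightarrow> real^'n). 0 \<le> b \<longrightarrow> (\<forall>a. tame s \<alpha> b (\<lambda>x. of_real (u x $ a)))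
     \<longrightarrow> tame s C (C * b) (\<lambda>x. \<Sum>a\<in>J. of_real (u x $ a) * of_real (f (axis a 1)))" for J :: "'n set"
  proof (induction J rule: infinite_finite_induct)
    case (insert a J)
    from insert.IH obtain C where C: "C \<ge> 0" "\<forall>b (u :: real^'d \<Rightarrow> real^'n). 0 \<le> b \<longrightarrow> (\<forall>a. tame s \<alpha> b (\<lambda>x. of_real (u x $ a)))
        \<longrightarrow> tame s C (C * b) (\<lambda>x. \<Sum>a\<in>J. of_real (u x $ a) * of_real (f (axis a 1)))" by blast
    define z where "z = f (axis a 1)"
    let ?D = "2 * 2 powr (2 * s) * z\<^sup>2"
    let ?C = "\<alpha> * \<bar>z\<bar> + C + 2 * ?D + 2 * C"
    show ?case
    proof (intro exI[of _ ?C] conjI allI impI)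
      fix b :: real and u :: "real^'d \<Rightarrow> real^'n" assume b: "0 \<le> b" and u: "\<forall>a. tame s \<alpha> b (\<lambda>x. of_real (u x $ a))"
      have "tame s (\<alpha> * norm (complex_of_real z)) (2 * 2 powr (2 * s) * (\<alpha>\<^sup>2 * 0 + (norm (complex_of_real z))\<^sup>2 * b)) (\<lambda>x. of_real (u x $ a) * of_real z)"
        using u by (intro tame_mult tame_const) auto
      from tame_add[OF this C(2)[rule_format, OF b, of u]] u
      have t: "tame s (\<alpha> * \<bar>z\<bar> + C) (2 * (?D * b) + 2 * (C * b)) (\<lambda>x. of_real (u x $ a) * of_real z + (\<Sum>a\<in>J. of_real (u x $ a) * of_real (f (axis a 1))))"
        by (simp add: mult.assoc)
      show "tame s ?C (?C * b) (\<lambda>x. \<Sum>a\<in>insert a J. of_real (u x $ a) * of_real (f (axis a 1)))"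
        using tame_mono[OF t, of ?C "?C * b"] insert.hyps C(1) b assms(2)
        by (simp add: z_def distrib_right)
    qed (use C(1) assms(2) in auto)
  qed (auto intro!: exI[of _ 0] tame_const[of s 0, simplified])
  have "f (u x) = (\<Sum>a\<in>UNIV. u x $ a * f (axis a 1))" for u :: "real^'d \<Rightarrow> real^'n" and x
  proof -
    have "u x = (\<Sum>a\<in>UNIV. (u x $ a) *\<^sub>R axis a 1)"
      by (simp add: vec_eq_iff axis_def if_distrib cong: if_cong)
    then have "f (u x) = (\<Sum>a\<in>UNIV. f ((u x $ a) *\<^sub>R axis a 1))"
      by (metis (no_types, lifting) sum sum.cong)
    then show ?thesis by (simp add: scaleR)
  qed
  then show ?case using *[of UNIV] by simp
qed

section \<open>Commutator with a Lipschitz frequency cutoff\<close>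

text \<open>Equal to \<open>1\<close> up to frequency \<open>\<rho> / 2\<close>, to \<open>0\<close> from frequency \<open>\<rho>\<close>, and Lipschitz with constant \<open>2 / \<rho>\<close>.\<close>

definition cutoff :: "real \<Rightarrow> int^'d \<Rightarrow> real" where
  "cutoff \<rho> k = max 0 (min 1 (2 - 2 * norm (freq k) / \<rho>))"

lemma cutoff_bounds: "0 \<le> cutoff \<rho> k" "cutoff \<rho> k \<le> 1"
  by (auto simp: cutoff_def)

lemma cutoff_minus [simp]: "cutoff \<rho> (- k) = cutoff \<rho> k"
  by (simp add: cutoff_def)

lemma cutoff_eq_1: "0 < \<rho> \<Longrightarrow> norm (freq k) \<le> \<rho> / 2 \<Longrightarrow> cutoff \<rho> k = 1"
  by (simp add: cutoff_def field_simps)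

lemma cutoff_eq_0: "0 < \<rho> \<Longrightarrow> \<rho> \<le> norm (freq k) \<Longrightarrow> cutoff \<rho> k = 0"
  by (simp add: cutoff_def field_simps)

lemma cutoff_lipschitz:
  assumes "0 < \<rho>"
  shows "\<bar>cutoff \<rho> l - cutoff \<rho> k\<bar> \<le> 2 / \<rho> * norm (freq (k - l))"
proof -
  have "\<bar>cutoff \<rho> l - cutoff \<rho> k\<bar> \<le> \<bar>2 * norm (freq l) / \<rho> - 2 * norm (freq k) / \<rho>\<bar>"
  proof -
    have "\<bar>max 0 (min 1 (2 - a)) - max 0 (min 1 (2 - b))\<bar> \<le> \<bar>a - b\<bar>" for a b :: real
      by (auto simp: max_def min_def abs_if)
    then show ?thesis by (simp only: cutoff_def)
  qed
  also have "\<dots> = 2 / \<rho> * \<bar>norm (freq l) - norm (freq k)\<bar>"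
  proof -
    have "2 * norm (freq l) / \<rho> - 2 * norm (freq k) / \<rho> = 2 / \<rho> * (norm (freq l) - norm (freq k))"
      by (simp add: right_diff_distrib)
    then show ?thesis using assms by (simp only: abs_mult) simp
  qed
  also have "\<dots> \<le> 2 / \<rho> * norm (freq (k - l))"
    using assms norm_triangle_ineq3[of "freq k" "freq l"]
    by (intro mult_left_mono) (auto simp: abs_minus_commute)
  finally show ?thesis .
qed

text \<open>The symbol of the commutator of a multiplication with the cutoff, applied to a derivative. The
  factor \<open>norm (freq l)\<close> is absorbed by the Lipschitz constant \<open>2 / \<rho>\<close> when the two frequencies are
  close, and otherwise by the frequency of the coefficient. In both cases a frequency above \<open>\<rho>/4\<close>
  is involved: this is the gain over the sharp truncation.\<close>

lemma cutoff_commutator_symbol: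
  assumes "0 < \<rho>"
  shows "\<bar>cutoff \<rho> l - cutoff \<rho> k\<bar> * norm (freq l) \<le>
     4 * norm (freq (k - l)) * of_bool (\<rho> / 4 < norm (freq l)) + norm (freq l) * of_bool (\<rho> / 4 < norm (freq (k - l)))"
proof -
  have tri: "norm (freq k) \<le> norm (freq l) + norm (freq (k - l))" "norm (freq l) \<le> norm (freq k) + norm (freq (k - l))"
    using norm_triangle_ineq[of "freq l" "freq (k - l)"] norm_triangle_ineq4[of "freq k" "freq (k - l)"]
    by simp_all
  have le1: "\<bar>cutoff \<rho> l - cutoff \<rho> k\<bar> \<le> 1"
    using cutoff_bounds[of \<rho> l] cutoff_bounds[of \<rho> k] by linarith
  consider (low) "norm (freq l) \<le> \<rho> / 4" "norm (freq (k - l)) \<le> \<rho> / 4"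
    | (far) "norm (freq l) \<le> \<rho> / 4" "\<rho> / 4 < norm (freq (k - l))"
    | (mid) "\<rho> / 4 < norm (freq l)" "norm (freq l) \<le> 2 * \<rho>"
    | (high) "2 * \<rho> < norm (freq l)"
    by linarith
  then show ?thesis
  proof cases
    case low
    have "cutoff \<rho> l = 1" "cutoff \<rho> k = 1"
      using low tri assms by (auto intro!: cutoff_eq_1)
    then show ?thesis by simp
  next
    case far
    have "\<bar>cutoff \<rho> l - cutoff \<rho> k\<bar> * norm (freq l) \<le> 1 * norm (freq l)"
      by (intro mult_right_mono le1) auto
    then show ?thesis using far by simp
  next
    case mid
    have "\<bar>cutoff \<rho> l - cutoff \<rho> k\<bar> * norm (freq l) \<le> (2 / \<rho> * norm (freq (k - l))) * (2 * \<rho>)"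
      by (intro mult_mono cutoff_lipschitz assms mid) (use assms in auto)
    also have "\<dots> = 4 * norm (freq (k - l))" using assms by (simp add: field_simps)
    finally show ?thesis using mid by (simp add: add_increasing2)
  next
    case high
    have l0: "cutoff \<rho> l = 0" using high assms by (intro cutoff_eq_0) auto
    have "\<bar>cutoff \<rho> l - cutoff \<rho> k\<bar> * norm (freq l) \<le> 4 * norm (freq (k - l))"
    proof (cases "norm (freq k) \<ge> \<rho>")
      case True
      then show ?thesis using l0 cutoff_eq_0[OF assms True] by simp
    next
      case False
      have "\<bar>cutoff \<rho> l - cutoff \<rho> k\<bar> * norm (freq l) \<le> 1 * norm (freq l)"
        by (intro mult_right_mono le1) auto
      also have "\<dots> \<le> 4 * norm (freq (k - l))" using False high tri by linarith
      finally show ?thesis .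
    qed
    then show ?thesis using high assms by (simp add: add_increasing2)
  qed
qed

lemma freq_fc_le:
  assumes "wiener_bound \<alpha> g"
  shows "norm (freq k) * norm (fc g k) \<le> \<alpha>"
proof -
  have "(\<Sum>k\<in>{k}. (1 + norm (freq k)) * norm (fc g k)) \<le> \<alpha>"
    using assms unfolding wiener_bound_def by blast
  moreover have "norm (freq k) * norm (fc g k) \<le> (1 + norm (freq k)) * norm (fc g k)"
    by (intro mult_right_mono) auto
  ultimately show ?thesis by simp
qed

text \<open>Here \<open>w'\<close> is a derivative of \<open>u\<close> and \<open>w\<close> that of its truncation. By the bound on the symbol, the
coefficient is at most \<open>4 * conv ?f ?u' + conv ?u ?f'\<close>, where the unprimed factor carries the derivative and
is summable with sum at most \<open>\<alpha>\<close>, and the primed one is restricted to the frequencies above \<open>\<rho> / 4\<close>.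
Young's inequality bounds the squares by \<open>(2 * 16 + 2) * \<alpha>\<^sup>2\<close> times a tail at \<open>\<rho> / 4\<close>.\<close>

lemma commutator_bound:
  fixes f u w w' :: "real^'d \<Rightarrow> complex"
  assumes f: "tame s \<alpha> b f" and u: "tame s \<alpha> b u" and \<rho>: "0 < \<rho>"
    and w: "w \<in> wiener" "\<And>l. fc w l = \<i> * of_int (l $ j) * (of_real (cutoff \<rho> l) * fc u l)"
    and w': "w' \<in> wiener" "\<And>l. fc w' l = \<i> * of_int (l $ j) * fc u l"
    and F: "finite F"
  shows "(\<Sum>k\<in>F. (norm (fc (\<lambda>x. w x * f x) k - of_real (cutoff \<rho> k) * fc (\<lambda>x. w' x * f x) k))\<^sup>2)
     \<le> 34 * 4 powr (2 * s) * \<alpha>\<^sup>2 * b * \<rho> powr (- 2 * s)"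
proof -
  have wf: "wiener_bound \<alpha> f" and wu: "wiener_bound \<alpha> u" and tf: "tail_bound s b (fc f)" and tu: "tail_bound s b (fc u)"
    using f u by (auto simp: tame_def)
  have cf: "continuous_on UNIV f" using wf by (simp add: wiener_bound_def)
  have r4: "\<rho> / 4 > 0" using \<rho> by simp
  let ?f = "\<lambda>l. norm (freq l) * norm (fc f l)" and ?u = "\<lambda>l. norm (freq l) * norm (fc u l)"
  let ?f' = "\<lambda>l. if \<rho> / 4 < norm (freq l) then norm (fc f l) else 0"
  let ?u' = "\<lambda>l. if \<rho> / 4 < norm (freq l) then norm (fc u l) else 0"
  have ub: "norm (fc u l) \<le> \<alpha>" "norm (fc f l) \<le> \<alpha>" for l
    using fc_le_wiener_bound[OF wu] fc_le_wiener_bound[OF wf] by auto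
  have \<alpha>: "0 \<le> \<alpha>" using wiener_bound_nonneg[OF wu] .
  let ?c = "\<lambda>k. fc (\<lambda>x. w x * f x) k - of_real (cutoff \<rho> k) * fc (\<lambda>x. w' x * f x) k"
  have le: "norm (?c k) \<le> 4 * conv ?f ?u' k + conv ?u ?f' k" for k
  proof (rule norm_infsum_le)
    show "((\<lambda>l. \<i> * of_int (l $ j) * (of_real (cutoff \<rho> l) * fc u l) * fc f (k - l)
        - of_real (cutoff \<rho> k) * (\<i> * of_int (l $ j) * fc u l * fc f (k - l))) has_sum ?c k) UNIV"
      using has_sum_add[OF fc_mult_has_sum[OF w(1) cf, of k]
          has_sum_uminusI[OF has_sum_cmult_right[OF fc_mult_has_sum[OF w'(1) cf, of k], of "of_real (cutoff \<rho> k)"]]]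
      unfolding w(2) w'(2) by (simp only: diff_conv_add_uminus)
    have s1: "((\<lambda>l. ?f l * ?u' (k - l)) has_sum conv ?f ?u' k) UNIV" for k
      by (rule conv_has_sum[where B = \<alpha>, OF _ wiener_bound_coeffs(3)[OF wf]]) (use ub \<alpha> in auto)
    have s1': "((\<lambda>l. ?u' l * ?f (k - l)) has_sum conv ?u' ?f k) UNIV"
    proof (rule conv_has_sum[where B = \<alpha>])
      show "?u' summable_on UNIV"
        by (rule summable_on_comparison_test[OF wiener_bound_coeffs(1)[OF wu]]) auto
      show "?f k \<le> \<alpha>" for k
        by (rule freq_fc_le[OF wf])
    qed auto
    have s2: "((\<lambda>l. ?u l * ?f' (k - l)) has_sum conv ?u ?f' k) UNIV"
      by (rule conv_has_sum[where B = \<alpha>, OF _ wiener_bound_coeffs(3)[OF wu]]) (use ub \<alpha> in auto)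
    have "norm (\<i> * of_int (l $ j) * (of_real (cutoff \<rho> l) * fc u l) * fc f (k - l)
        - of_real (cutoff \<rho> k) * (\<i> * of_int (l $ j) * fc u l * fc f (k - l)))
       \<le> 4 * (?u' l * ?f (k - l)) + ?u l * ?f' (k - l)" for l
    proof -
      have "norm (\<i> * of_int (l $ j) * (of_real (cutoff \<rho> l) * fc u l) * fc f (k - l)
        - of_real (cutoff \<rho> k) * (\<i> * of_int (l $ j) * fc u l * fc f (k - l)))
        = norm (of_real (cutoff \<rho> l - cutoff \<rho> k) * (\<i> * of_int (l $ j)) * (fc u l * fc f (k - l)))"
        by (rule arg_cong[where f = norm]) (simp add: algebra_simps)
      also have "\<dots> = (\<bar>cutoff \<rho> l - cutoff \<rho> k\<bar> * \<bar>freq l $ j\<bar>) * (norm (fc u l) * norm (fc f (k - l)))"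
        by (simp add: norm_mult del: of_real_diff)
      also have "\<dots> \<le> (\<bar>cutoff \<rho> l - cutoff \<rho> k\<bar> * norm (freq l)) * (norm (fc u l) * norm (fc f (k - l)))"
        by (intro mult_right_mono mult_left_mono component_le_norm_cart) auto
      also have "\<dots> \<le> (4 * norm (freq (k - l)) * of_bool (\<rho> / 4 < norm (freq l)) + norm (freq l) * of_bool (\<rho> / 4 < norm (freq (k - l))))
          * (norm (fc u l) * norm (fc f (k - l)))"
        by (intro mult_right_mono cutoff_commutator_symbol \<rho>) auto
      also have "\<dots> = 4 * (?u' l * ?f (k - l)) + ?u l * ?f' (k - l)"
        by (simp add: algebra_simps del: freq_simps)
      finally show ?thesis .
    qed
    then show "norm (\<i> * of_int (l $ j) * (of_real (cutoff \<rho> l) * fc u l) * fc f (k - l)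
        - of_real (cutoff \<rho> k) * (\<i> * of_int (l $ j) * fc u l * fc f (k - l)))
       \<le> 4 * (?u' l * ?f (k - l)) + ?u l * ?f' (k - l)" for l .
    show "((\<lambda>l. 4 * (?u' l * ?f (k - l)) + ?u l * ?f' (k - l)) has_sum (4 * conv ?f ?u' k + conv ?u ?f' k)) UNIV"
      by (subst conv_commute[of ?f ?u']) (intro has_sum_add has_sum_cmult_right s1' s2)
  qed
  have "(\<Sum>k\<in>F. (norm (?c k))\<^sup>2) \<le> (\<Sum>k\<in>F. (4 * conv ?f ?u' k + conv ?u ?f' k)\<^sup>2)"
    by (intro sum_mono power_mono le) auto
  also have "\<dots> \<le> (\<Sum>k\<in>F. 2 * (4 * conv ?f ?u' k)\<^sup>2 + 2 * (conv ?u ?f' k)\<^sup>2)"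
    by (intro sum_mono sum_square_le)
  also have "\<dots> = 32 * (\<Sum>k\<in>F. (conv ?f ?u' k)\<^sup>2) + 2 * (\<Sum>k\<in>F. (conv ?u ?f' k)\<^sup>2)"
    by (simp add: sum.distrib sum_distrib_left power_mult_distrib)
  also have "\<dots> \<le> 32 * (\<alpha>\<^sup>2 * (b * (\<rho> / 4) powr (- 2 * s))) + 2 * (\<alpha>\<^sup>2 * (b * (\<rho> / 4) powr (- 2 * s)))"
    by (intro add_mono mult_left_mono young_convolution wiener_bound_coeffs(3,4)[OF wf] wiener_bound_coeffs(3,4)[OF wu]
          tail_bound_cutoff[OF tf r4] tail_bound_cutoff[OF tu r4] F) auto
  also have "\<dots> = 34 * 4 powr (2 * s) * \<alpha>\<^sup>2 * b * \<rho> powr (- 2 * s)"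
    using half_powr[OF _ \<rho>, of 4 s] by (simp add: algebra_simps)
  finally show ?thesis .
qed

section \<open>Sobolev regularity above the critical index\<close>

lemma japanese_bracket_ge: "1 \<le> japanese_bracket k" "norm (freq k) \<le> japanese_bracket k"
  by (auto simp: japanese_bracket_freq real_le_rsqrt)

lemma sum_int_box_le:
  fixes h :: "nat \<Rightarrow> real"
  assumes "\<And>i. 0 \<le> h i" "summable h"
  shows "(\<Sum>m\<in>{- int n..int n}. h (nat \<bar>m\<bar>)) \<le> 2 * suminf h"
proof -
  have "{- int n..int n} \<subseteq> int ` {..n} \<union> (\<lambda>i. - int i) ` {..n}"
  proof
    fix m assume m: "m \<in> {- int n..int n}"
    then have "m = int (nat m) \<and> nat m \<le> n \<or> m = - int (nat (- m)) \<and> nat (- m) \<le> n"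
      by auto
    then show "m \<in> int ` {..n} \<union> (\<lambda>i. - int i) ` {..n}" by blast
  qed
  then have "(\<Sum>m\<in>{- int n..int n}. h (nat \<bar>m\<bar>)) \<le> (\<Sum>m\<in>int ` {..n} \<union> (\<lambda>i. - int i) ` {..n}. h (nat \<bar>m\<bar>))"
    by (intro sum_mono2) (use assms in auto)
  also have "\<dots> \<le> (\<Sum>m\<in>int ` {..n}. h (nat \<bar>m\<bar>)) + (\<Sum>m\<in>(\<lambda>i. - int i) ` {..n}. h (nat \<bar>m\<bar>))"
    by (subst sum_Un) (use assms in \<open>auto intro!: sum_nonneg\<close>)
  also have "\<dots> = (\<Sum>i\<le>n. h i) + (\<Sum>i\<le>n. h i)"
    by (simp add: sum.reindex inj_on_def)
  also have "(\<Sum>i\<le>n. h i) \<le> suminf h"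
    by (rule sum_le_suminf) (use assms in auto)
  finally show ?thesis by simp
qed

text \<open>Each \<open>max 1 \<bar>k $ j\<bar>\<close> is at most the Japanese bracket, so a power \<open>p > CARD('d)\<close> of the bracket
  dominates a product of one-dimensional powers larger than \<open>1\<close>.\<close>

lemma lattice_sum_bounded:
  assumes "p > real CARD('d)"
  obtains Z where "Z \<ge> 0" "\<And>F :: (int^'d) set. finite F \<Longrightarrow> (\<Sum>k\<in>F. japanese_bracket k powr (- p)) \<le> Z"
proof -
  let ?d = "real CARD('d)"
  have d: "?d > 0" by simp
  define q where "q = p / ?d"
  have q: "q > 1" using assms d by (simp add: q_def field_simps)
  define h where "h i = (max 1 (real i)) powr (- q)" for i :: nat
  have "summable (\<lambda>i. real i powr (- q))" using q by (simp add: summable_real_powr_iff)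
  then have sh: "summable h"
    by (subst summable_cong[of h "\<lambda>i. real i powr (- q)"])
       (auto simp: h_def eventually_at_top_linorder intro!: exI[of _ 1])
  have le: "japanese_bracket k powr (- p) \<le> (\<Prod>j\<in>UNIV. h (nat \<bar>k $ j\<bar>))" for k :: "int^'d"
  proof -
    have j: "max 1 (real (nat \<bar>k $ j\<bar>)) \<le> japanese_bracket k" for j
      using japanese_bracket_ge[of k] component_le_norm_cart[of "freq k" j] by auto
    have "japanese_bracket k powr (- p) = (japanese_bracket k powr (- q)) ^ CARD('d)"
      using japanese_bracket_ge[of k] d by (simp add: powr_power q_def)
    also have "\<dots> = (\<Prod>j\<in>(UNIV::'d set). japanese_bracket k powr (- q))" by simp
    also have "\<dots> \<le> (\<Prod>j\<in>UNIV. h (nat \<bar>k $ j\<bar>))"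
      unfolding h_def by (intro prod_mono conjI powr_mono2' j) (use q in auto)
    finally show ?thesis .
  qed
  have "(\<Sum>k\<in>F. japanese_bracket k powr (- p)) \<le> (2 * suminf h) ^ CARD('d)" if "finite F" for F :: "(int^'d) set"
  proof -
    define n where "n = nat (Max (insert 0 ((\<lambda>(k, j). \<bar>k $ j\<bar>) ` (F \<times> UNIV))))"
    have n: "\<bar>k $ j\<bar> \<le> int n" if "k \<in> F" for k j
    proof -
      have "\<bar>k $ j\<bar> \<le> Max (insert 0 ((\<lambda>(k, j). \<bar>k $ j\<bar>) ` (F \<times> UNIV)))"
        by (rule Max_ge) (use that \<open>finite F\<close> in \<open>auto simp: image_iff\<close>)
      then show ?thesis unfolding n_def by linarith
    qed
    let ?B = "PiE UNIV (\<lambda>_::'d. {- int n..int n})"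
    have fB: "finite ?B" by (intro finite_PiE) auto
    have sub: "vec_nth ` F \<subseteq> ?B" using n by (auto simp: abs_le_iff) (metis add.inverse_inverse neg_le_iff_le)
    have "(\<Sum>k\<in>F. japanese_bracket k powr (- p)) \<le> (\<Sum>k\<in>F. \<Prod>j\<in>UNIV. h (nat \<bar>k $ j\<bar>))"
      by (intro sum_mono le)
    also have "\<dots> = (\<Sum>g\<in>vec_nth ` F. \<Prod>j\<in>UNIV. h (nat \<bar>g j\<bar>))"
      by (subst sum.reindex) (auto simp: inj_on_def vec_nth_inject)
    also have "\<dots> \<le> (\<Sum>g\<in>?B. \<Prod>j\<in>UNIV. h (nat \<bar>g j\<bar>))"
      by (intro sum_mono2 fB sub prod_nonneg) (auto simp: h_def)
    also have "\<dots> = (\<Prod>j\<in>(UNIV::'d set). \<Sum>m\<in>{- int n..int n}. h (nat \<bar>m\<bar>))"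
      by (subst prod_sum_PiE) auto
    also have "\<dots> \<le> (\<Prod>j\<in>(UNIV::'d set). 2 * suminf h)"
      by (intro prod_mono conjI sum_int_box_le sh sum_nonneg) (auto simp: h_def)
    finally show ?thesis by simp
  qed
  moreover have "0 \<le> 2 * suminf h" using suminf_nonneg[OF sh] by (simp add: h_def)
  ultimately show ?thesis using that[of "(2 * suminf h) ^ CARD('d)"] by simp
qed

text \<open>By \<open>2 x y \<le> x\<^sup>2 + y\<^sup>2\<close> against the weight \<open>2 - 2 * s\<close>. This power of the bracket has bounded sums if
\<open>s > d / 2 + 1\<close>.\<close>

lemma sobolev_wiener_bound:
  assumes Z: "\<And>F :: (int^'d) set. finite F \<Longrightarrow> (\<Sum>k\<in>F. japanese_bracket k powr (2 - 2 * s)) \<le> Z"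
    and g: "continuous_on UNIV g" "torus_periodic g"
    and m: "\<And>F :: (int^'d) set. finite F \<Longrightarrow> (\<Sum>k\<in>F. japanese_bracket k powr (2 * s) * (norm (fc g k))\<^sup>2) \<le> m"
  shows "wiener_bound (Z + m) g"
proof -
  have "(1 + norm (freq k)) * norm (fc g k) \<le>
      japanese_bracket k powr (2 - 2 * s) + japanese_bracket k powr (2 * s) * (norm (fc g k))\<^sup>2" for k :: "int^'d"
  proof -
    let ?J = "japanese_bracket k"
    have J: "?J > 0" using japanese_bracket_ge(1)[of k] by linarith
    have "(1 + norm (freq k)) * norm (fc g k) \<le> (2 * ?J) * norm (fc g k)"
      using japanese_bracket_ge[of k] by (intro mult_right_mono) auto
    also have "\<dots> = 2 * (?J powr (1 - s)) * (?J powr s * norm (fc g k))"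
      using J by (simp add: powr_add[symmetric])
    also have "\<dots> \<le> (?J powr (1 - s))\<^sup>2 + (?J powr s * norm (fc g k))\<^sup>2"
      by (rule sum_squares_bound)
    also have "\<dots> = ?J powr (2 - 2 * s) + ?J powr (2 * s) * (norm (fc g k))\<^sup>2"
      using J by (simp add: power_mult_distrib powr_power algebra_simps)
    finally show ?thesis .
  qed
  then have "(\<Sum>k\<in>F. (1 + norm (freq k)) * norm (fc g k)) \<le> Z + m" if "finite F" for F
    using sum_mono[of F "\<lambda>k. (1 + norm (freq k)) * norm (fc g k)" "\<lambda>k. japanese_bracket k powr (2 - 2 * s) + japanese_bracket k powr (2 * s) * (norm (fc g k))\<^sup>2"]
      Z[OF that] m[OF that] by (fastforce simp: sum.distrib)
  then show ?thesis using g by (auto simp: wiener_bound_def)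
qed

lemma sobolev_tail_bound:
  assumes m: "\<And>F. finite F \<Longrightarrow> (\<Sum>k\<in>F. japanese_bracket k powr (2 * s) * (norm (c k))\<^sup>2) \<le> m" and s: "0 \<le> s"
  shows "tail_bound s m (c :: int^'a \<Rightarrow> 'b::real_normed_vector)"
  unfolding tail_bound_def
proof (intro allI impI)
  fix \<rho> :: real and F :: "(int^'a) set" assume \<rho>: "0 < \<rho>" and F: "finite F" "\<forall>k\<in>F. \<rho> < norm (freq k)"
  have "(\<Sum>k\<in>F. (norm (c k))\<^sup>2) \<le> (\<Sum>k\<in>F. \<rho> powr (- 2 * s) * (japanese_bracket k powr (2 * s) * (norm (c k))\<^sup>2))"
  proof (rule sum_mono)
    fix k assume "k \<in> F"
    then have "\<rho> \<le> japanese_bracket k" using F japanese_bracket_ge(2)[of k] by fastforce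
    then have "\<rho> powr (2 * s) \<le> japanese_bracket k powr (2 * s)"
      using \<rho> s by (intro powr_mono2) auto
    then have "1 \<le> \<rho> powr (- 2 * s) * japanese_bracket k powr (2 * s)"
      using \<rho> by (simp add: powr_minus field_simps)
    then have "1 * (norm (c k))\<^sup>2 \<le> (\<rho> powr (- 2 * s) * japanese_bracket k powr (2 * s)) * (norm (c k))\<^sup>2"
      by (intro mult_right_mono) auto
    then show "(norm (c k))\<^sup>2 \<le> \<rho> powr (- 2 * s) * (japanese_bracket k powr (2 * s) * (norm (c k))\<^sup>2)"
      by (simp add: mult.assoc)
  qed
  also have "\<dots> \<le> \<rho> powr (- 2 * s) * m"
    by (simp only: sum_distrib_left[symmetric]) (intro mult_left_mono m F, simp)
  finally show "(\<Sum>k\<in>F. (norm (c k))\<^sup>2) \<le> m * \<rho> powr (- 2 * s)" by (simp add: mult.commute)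
qed

section \<open>Continuously differentiable functions on the torus\<close>

text \<open>The partial derivative in the form in which it occurs in \<open>quasilinear_term\<close>.\<close>

definition pd :: "'d \<Rightarrow> (real^'d \<Rightarrow> 'b::real_normed_vector) \<Rightarrow> real^'d \<Rightarrow> 'b" where
  "pd j f x = frechet_derivative f (at x) (axis j 1)"

definition C1_torus :: "(real^'d \<Rightarrow> 'b::real_normed_vector) \<Rightarrow> bool" where
  "C1_torus f \<longleftrightarrow> torus_periodic f \<and> (\<forall>x. f differentiable (at x)) \<and> (\<forall>j. continuous_on UNIV (pd j f))"

lemma pd_eq: "(f has_derivative f') (at x) \<Longrightarrow> pd j f x = f' (axis j 1)"
  by (metis pd_def frechet_derivative_at)

lemma C1_torus_has_derivative:
  "C1_torus f \<Longrightarrow> (f has_derivative frechet_derivative f (at x)) (at x)"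
  by (simp add: C1_torus_def frechet_derivative_works)

lemma C1_torus_continuous: "C1_torus f \<Longrightarrow> continuous_on UNIV f"
  by (simp add: C1_torus_def continuous_at_imp_continuous_on differentiable_imp_continuous_within)

lemma C1_torus_periodic: "C1_torus f \<Longrightarrow> torus_periodic f"
  by (simp add: C1_torus_def)

lemma C1_torus_pd_continuous: "C1_torus f \<Longrightarrow> continuous_on UNIV (pd j f)"
  by (simp add: C1_torus_def)

lemma C1_torus_bilinear:
  assumes h: "bounded_bilinear h" and f: "C1_torus f" and g: "C1_torus g"
  shows "C1_torus (\<lambda>x. h (f x) (g x))"
    "pd j (\<lambda>x. h (f x) (g x)) x = h (f x) (pd j g x) + h (pd j f x) (g x)"
proof -
  have d: "((\<lambda>x. h (f x) (g x)) has_derivative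
      (\<lambda>v. h (f x) (frechet_derivative g (at x) v) + h (frechet_derivative f (at x) v) (g x))) (at x)" for x
    by (intro bounded_bilinear.FDERIV[OF h] C1_torus_has_derivative f g)
  show pd: "pd j (\<lambda>x. h (f x) (g x)) x = h (f x) (pd j g x) + h (pd j f x) (g x)" for j x
    using pd_eq[OF d] by (simp add: pd_def)
  have "continuous_on UNIV (\<lambda>x. h (f x) (pd j g x) + h (pd j f x) (g x))" for j
    by (intro continuous_on_add bounded_bilinear.continuous_on[OF h] C1_torus_continuous C1_torus_pd_continuous f g)
  then have "continuous_on UNIV (pd j (\<lambda>x. h (f x) (g x)))" for j
    using pd by (simp cong: continuous_on_cong)
  moreover have "torus_periodic (\<lambda>x. h (f x) (g x))"
    using f g by (simp add: C1_torus_def torus_periodic_def)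
  ultimately show "C1_torus (\<lambda>x. h (f x) (g x))"
    using d by (auto simp: C1_torus_def differentiable_def)
qed

lemma C1_torus_linear:
  assumes h: "bounded_linear h" and f: "C1_torus f"
  shows "C1_torus (\<lambda>x. h (f x))" "pd j (\<lambda>x. h (f x)) x = h (pd j f x)"
proof -
  have d: "((\<lambda>x. h (f x)) has_derivative (\<lambda>v. h (frechet_derivative f (at x) v))) (at x)" for x
    by (intro bounded_linear.has_derivative[OF h] C1_torus_has_derivative f)
  show pd: "pd j (\<lambda>x. h (f x)) x = h (pd j f x)" for j x
    using pd_eq[OF d] by (simp add: pd_def)
  have "continuous_on UNIV (\<lambda>x. h (pd j f x))" for j
    by (intro bounded_linear.continuous_on[OF h] C1_torus_pd_continuous f)
  then have "continuous_on UNIV (pd j (\<lambda>x. h (f x)))" for j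
    using pd by (simp cong: continuous_on_cong)
  moreover have "torus_periodic (\<lambda>x. h (f x))"
    using f by (simp add: C1_torus_def torus_periodic_def)
  ultimately show "C1_torus (\<lambda>x. h (f x))"
    using d by (auto simp: C1_torus_def differentiable_def)
qed

lemma C1_torus_diff:
  assumes f: "C1_torus f" and g: "C1_torus g"
  shows "C1_torus (\<lambda>x. f x - g x)" "pd j (\<lambda>x. f x - g x) x = pd j f x - pd j g x"
proof -
  have d: "((\<lambda>x. f x - g x) has_derivative
      (\<lambda>v. frechet_derivative f (at x) v - frechet_derivative g (at x) v)) (at x)" for x
    by (intro has_derivative_diff C1_torus_has_derivative f g)
  show pd: "pd j (\<lambda>x. f x - g x) x = pd j f x - pd j g x" for j x
    using pd_eq[OF d] by (simp add: pd_def)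
  have "continuous_on UNIV (\<lambda>x. pd j f x - pd j g x)" for j
    by (intro continuous_on_diff C1_torus_pd_continuous f g)
  then have "continuous_on UNIV (pd j (\<lambda>x. f x - g x))" for j
    using pd by (simp cong: continuous_on_cong)
  moreover have "torus_periodic (\<lambda>x. f x - g x)"
    using f g by (simp add: C1_torus_def torus_periodic_def)
  ultimately show "C1_torus (\<lambda>x. f x - g x)"
    using d by (auto simp: C1_torus_def differentiable_def)
qed

lemma tmean_pd:
  fixes f :: "real^'d \<Rightarrow> 'b::euclidean_space"
  assumes "C1_torus f"
  shows "tmean (pd j f) = 0"
  using tmean_partial_derivative[OF C1_torus_periodic[OF assms] C1_torus_has_derivative[OF assms], of j]
    C1_torus_pd_continuous[OF assms, of j] unfolding pd_def[abs_def] by simp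

lemma bounded_bilinear_matrix_vector: "bounded_bilinear ((*v) :: real^'n^'m \<Rightarrow> real^'n \<Rightarrow> real^'m)"
  unfolding bilinear_conv_bounded_bilinear[symmetric] bilinear_def
  by (auto intro!: linearI simp: matrix_vector_mult_add_rdistrib matrix_vector_right_distrib
      matrix_vector_mult_scaleR scaleR_matrix_vector_assoc)

lemma fourier_coeff_pd:
  fixes f :: "real^'d \<Rightarrow> real^'n"
  assumes "C1_torus f"
  shows "fourier_coeff (pd j f) k $ a = \<i> * of_int (k $ j) * fourier_coeff f k $ a"
proof -
  have bl: "bounded_linear (\<lambda>v::real^'n. complex_of_real (v $ a))"
    by (intro bounded_linear_compose[OF bounded_linear_of_real] bounded_linear_vec_nth)
  note c = C1_torus_linear[OF bl assms]
  have "fourier_coeff (pd j f) k $ a = fc (\<lambda>x. of_real (pd j f x $ a)) k"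
    by (intro fourier_coeff_fc C1_torus_pd_continuous assms)
  also have "(\<lambda>x. complex_of_real (pd j f x $ a)) = (\<lambda>x. frechet_derivative (\<lambda>x. complex_of_real (f x $ a)) (at x) (axis j 1))"
    using c(2)[of j] by (simp add: pd_def)
  also have "fc \<dots> k = \<i> * of_int (k $ j) * fc (\<lambda>x. of_real (f x $ a)) k"
    by (rule fc_partial_derivative[OF C1_torus_periodic[OF c(1)] C1_torus_has_derivative[OF c(1)]])
       (use C1_torus_pd_continuous[OF c(1), of j] in \<open>simp add: pd_def[abs_def]\<close>)
  finally show ?thesis by (simp add: fourier_coeff_fc C1_torus_continuous assms)
qed

section \<open>Real trigonometric polynomials and the sharp low-pass filter\<close>

definition cube :: "nat \<Rightarrow> (int^'d) set" where
  "cube N = {k. \<forall>j. \<bar>k $ j\<bar> \<le> int N}"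

text \<open>Real parts of trigonometric polynomials: no symmetry of \<open>c\<close> is needed to obtain a real-valued
function, and \<open>lowpass\<close> is of this form.\<close>

definition rtp :: "(int^'d) set \<Rightarrow> (int^'d \<Rightarrow> complex^'n) \<Rightarrow> real^'d \<Rightarrow> real^'n" where
  "rtp F c x = (\<chi> a. Re (\<Sum>k\<in>F. c k $ a * wave k x))"

definition hermitian :: "(int^'d \<Rightarrow> complex^'n) \<Rightarrow> bool" where
  "hermitian c \<longleftrightarrow> (\<forall>k a. c (- k) $ a = cnj (c k $ a))"

text \<open>The squared norm of \<open>L\<^sup>2\<close>, normalised so that Parseval's identity has no constant.\<close>

definition msq :: "(real^'d \<Rightarrow> real^'n) \<Rightarrow> real" where
  "msq f = tmean (\<lambda>x. (norm (f x))\<^sup>2)"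

lemma lowpass_rtp: "lowpass N f = rtp (cube N) (fourier_coeff f)"
  by (auto simp: lowpass_def rtp_def cube_def wave_def)

lemma finite_cube [simp]: "finite (cube N :: (int^'d) set)"
proof -
  have "(cube N :: (int^'d) set) \<subseteq> vec_lambda ` PiE UNIV (\<lambda>_. {- int N..int N})"
  proof
    fix k :: "int^'d" assume "k \<in> cube N"
    then have "vec_nth k \<in> PiE UNIV (\<lambda>_. {- int N..int N})" by (auto simp: cube_def abs_le_iff) (metis minus_le_iff)
    then show "k \<in> vec_lambda ` PiE UNIV (\<lambda>_. {- int N..int N})"
      by (metis image_eqI vec_nth_inverse)
  qed
  then show ?thesis by (rule finite_subset) (intro finite_imageI finite_PiE; auto)
qed

lemma cube_minus: "- k \<in> cube N \<longleftrightarrow> k \<in> cube N"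
  by (simp add: cube_def)

lemma in_cube: "norm (freq k) \<le> real N \<Longrightarrow> k \<in> cube N"
proof -
  assume "norm (freq k) \<le> real N"
  then have "\<bar>freq k $ j\<bar> \<le> real N" for j using component_le_norm_cart[of "freq k" j] by linarith
  then have "real_of_int \<bar>k $ j\<bar> \<le> real_of_int (int N)" for j by simp
  then show ?thesis unfolding cube_def of_int_le_iff by simp
qed

lemma rtp_nth: "rtp F c x $ a = Re (\<Sum>k\<in>F. c k $ a * wave k x)"
  by (simp add: rtp_def)

lemma rtp_diff: "rtp F (\<lambda>k. c k - d k) x = rtp F c x - rtp F d x"
  by (simp add: rtp_def vec_eq_iff left_diff_distrib sum_subtractf)

lemma rtp_cong: "(\<And>k. k \<in> F \<Longrightarrow> c k = d k) \<Longrightarrow> rtp F c x = rtp F d x"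
  by (simp add: rtp_def cong: sum.cong)

lemma has_derivative_vec_nthI:
  fixes f :: "'a::real_normed_vector \<Rightarrow> real^'n"
  assumes "\<And>a. ((\<lambda>x. f x $ a) has_derivative (\<lambda>h. f' h $ a)) (at x)"
  shows "(f has_derivative f') (at x)"
  unfolding has_derivative_componentwise_within[where f = f]
  using assms by (auto simp: Basis_vec_def inner_axis)

lemma C1_torus_rtp:
  fixes c :: "int^'d \<Rightarrow> complex^'n"
  shows "C1_torus (rtp F c)" "pd j (rtp F c) = rtp F (\<lambda>k. \<chi> a. \<i> * of_int (k $ j) * c k $ a)"
proof -
  have d: "(rtp F c has_derivative (\<lambda>h. rtp F (\<lambda>k. \<chi> a. \<i> * of_real (freq k \<bullet> h) * c k $ a) x)) (at x)" for x
  proof (rule has_derivative_vec_nthI)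
    fix a
    have "((\<lambda>x. Re (\<Sum>k\<in>F. c k $ a * wave k x)) has_derivative
       (\<lambda>h. Re (\<Sum>k\<in>F. c k $ a * (\<i> * of_real (freq k \<bullet> h) * wave k x)))) (at x)"
      by (intro bounded_linear.has_derivative[OF bounded_linear_Re] has_derivative_sum
          has_derivative_mult_right wave_has_derivative)
    then show "((\<lambda>x. rtp F c x $ a) has_derivative (\<lambda>h. rtp F (\<lambda>k. \<chi> a. \<i> * of_real (freq k \<bullet> h) * c k $ a) x $ a)) (at x)"
      by (simp add: rtp_nth mult_ac)
  qed
  show pd: "pd j (rtp F c) = rtp F (\<lambda>k. \<chi> a. \<i> * of_int (k $ j) * c k $ a)" for j
    by (rule ext) (subst pd_eq[OF d], simp add: inner_axis)
  have "continuous_on UNIV (rtp F c)" for c :: "int^'d \<Rightarrow> complex^'n"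
    unfolding rtp_def[abs_def] by (intro continuous_intros)
  moreover have "torus_periodic (rtp F c)"
  proof -
    have "wave k (x + axis j (2 * pi)) = wave k x" for k and x :: "real^'d" and j
      using wave_periodic[of k] unfolding torus_periodic_def by blast
    then show ?thesis by (simp add: torus_periodic_def rtp_def)
  qed
  ultimately show "C1_torus (rtp F c)"
    using d by (auto simp: C1_torus_def differentiable_def pd)
qed

lemma continuous_rtp: "continuous_on UNIV (rtp F c)"
  by (rule C1_torus_continuous[OF C1_torus_rtp(1)])

lemma hermitian_fourier_coeff: "continuous_on UNIV f \<Longrightarrow> hermitian (fourier_coeff f)"
  by (simp add: hermitian_def fourier_coeff_fc fc_hermitian continuous_intros)

lemma rtp_hermitian:
  assumes c: "hermitian c" and F: "\<And>k. - k \<in> F \<longleftrightarrow> k \<in> F"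
  shows "complex_of_real (rtp F c x $ a) = (\<Sum>k\<in>F. c k $ a * wave k x)"
proof -
  have "cnj (\<Sum>k\<in>F. c k $ a * wave k x) = (\<Sum>k\<in>F. c (- k) $ a * wave (- k) x)"
    using c by (simp add: hermitian_def wave_minus)
  also have "\<dots> = (\<Sum>k\<in>F. c k $ a * wave k x)"
    by (rule sum.reindex_bij_witness[where i = uminus and j = uminus]) (use F in auto)
  finally have eq: "cnj (\<Sum>k\<in>F. c k $ a * wave k x) = (\<Sum>k\<in>F. c k $ a * wave k x)" .
  have "cnj z = z \<Longrightarrow> Im z = 0" for z by (simp add: complex_eq_iff)
  from this[OF eq] have "Im (\<Sum>k\<in>F. c k $ a * wave k x) = 0" .
  then show ?thesis by (simp add: rtp_nth complex_eq_iff)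
qed

lemma fc_finite_wave_sum:
  assumes "finite F"
  shows "fc (\<lambda>x. \<Sum>k\<in>F. c k * wave k x) l = (if l \<in> F then c l else 0)"
proof -
  have "fc (\<lambda>x. \<Sum>k\<in>F. c k * wave k x) l = (\<Sum>k\<in>F. c k * fc (wave k) l)"
    by (simp add: fc_sum fc_cmult continuous_on_mult continuous_wave)
  also have "\<dots> = (\<Sum>k\<in>F. if k = l then c k else 0)"
    by (intro sum.cong refl) (auto simp: fc_wave)
  finally show ?thesis using assms by simp
qed

lemma finite_wave_sum_wiener:
  assumes "finite F"
  shows "(\<lambda>x. \<Sum>k\<in>F. c k * wave k x) \<in> wiener"
proof -
  have "(\<lambda>l. norm (fc (\<lambda>x. \<Sum>k\<in>F. c k * wave k x) l)) summable_on UNIV"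
    unfolding fc_finite_wave_sum[OF assms]
    by (rule finite_nonzero_values_imp_summable_on) (rule finite_subset[OF _ assms], auto)
  moreover have "wave k (x + axis j (2 * pi)) = wave k x" for k and x :: "real^'a" and j
    using wave_periodic[of k] unfolding torus_periodic_def by blast
  ultimately show ?thesis
    by (auto simp: wiener_def torus_periodic_def intro!: continuous_intros)
qed

lemma fourier_coeff_rtp:
  assumes "hermitian c" "\<And>k. - k \<in> F \<longleftrightarrow> k \<in> F" "finite F"
  shows "fourier_coeff (rtp F c) k = (if k \<in> F then c k else 0)"
proof (rule vec_eq_iff[THEN iffD2], rule allI)
  fix a
  show "fourier_coeff (rtp F c) k $ a = (if k \<in> F then c k else 0) $ a"
    by (simp add: fourier_coeff_fc continuous_rtp rtp_hermitian[OF assms(1,2)] fc_finite_wave_sum[OF assms(3)])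
qed

lemma parseval_finite:
  assumes "finite F"
  shows "tmean (\<lambda>x. (norm (\<Sum>k\<in>F. c k * wave k x))\<^sup>2) = (\<Sum>k\<in>F. (norm (c k))\<^sup>2)"
proof -
  have "((\<lambda>k. (norm (if k \<in> F then c k else 0))\<^sup>2) has_sum tmean (\<lambda>x. (norm (\<Sum>k\<in>F. c k * wave k x))\<^sup>2)) UNIV"
    using parseval[OF finite_wave_sum_wiener[OF assms, of c]] unfolding fc_finite_wave_sum[OF assms] .
  moreover have "((\<lambda>k. (norm (if k \<in> F then c k else 0))\<^sup>2) has_sum (\<Sum>k\<in>F. (norm (c k))\<^sup>2)) UNIV"
    by (rule has_sum_finite_neutralI[OF assms]) auto
  ultimately show ?thesis by (rule has_sum_unique)
qed

lemma norm_vec_square: "(norm (v :: ('b::real_normed_vector)^'n))\<^sup>2 = (\<Sum>a\<in>UNIV. (norm (v $ a))\<^sup>2)"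
  by (simp add: norm_vec_def L2_set_def sum_nonneg)

lemma msq_components:
  fixes f :: "real^'d \<Rightarrow> real^'n"
  assumes "continuous_on UNIV f"
  shows "msq f = (\<Sum>a\<in>UNIV. tmean (\<lambda>x. (f x $ a)\<^sup>2))"
  unfolding msq_def norm_vec_square
  by (subst tmean_sum) (auto intro!: continuous_intros assms)

lemma msq_nonneg: "continuous_on UNIV f \<Longrightarrow> 0 \<le> msq f"
  unfolding msq_def by (rule tmean_nonneg) (auto intro!: continuous_intros)

lemma msq_rtp_le:
  assumes "finite F"
  shows "msq (rtp F c) \<le> (\<Sum>k\<in>F. (norm (c k))\<^sup>2)"
proof -
  have "msq (rtp F c) = (\<Sum>a\<in>UNIV. tmean (\<lambda>x. (Re (\<Sum>k\<in>F. c k $ a * wave k x))\<^sup>2))"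
    by (simp add: msq_components continuous_rtp rtp_nth)
  also have "\<dots> \<le> (\<Sum>a\<in>UNIV. tmean (\<lambda>x. (norm (\<Sum>k\<in>F. c k $ a * wave k x))\<^sup>2))"
    by (intro sum_mono tmean_mono continuous_intros) (simp add: cmod_power2)
  also have "\<dots> = (\<Sum>k\<in>F. (norm (c k))\<^sup>2)"
    by (simp add: parseval_finite[OF assms] norm_vec_square sum.swap[of _ UNIV F])
  finally show ?thesis .
qed

lemma msq_rtp_hermitian:
  assumes "hermitian c" "\<And>k. - k \<in> F \<longleftrightarrow> k \<in> F" "finite F"
  shows "msq (rtp F c) = (\<Sum>k\<in>F. (norm (c k))\<^sup>2)"
proof -
  have "(rtp F c x $ a)\<^sup>2 = (norm (\<Sum>k\<in>F. c k $ a * wave k x))\<^sup>2" for x a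
    unfolding rtp_hermitian[OF assms(1,2), symmetric] by simp
  then have "msq (rtp F c) = (\<Sum>a\<in>UNIV. tmean (\<lambda>x. (norm (\<Sum>k\<in>F. c k $ a * wave k x))\<^sup>2))"
    by (simp add: msq_components continuous_rtp)
  also have "\<dots> = (\<Sum>k\<in>F. (norm (c k))\<^sup>2)"
    by (simp add: parseval_finite[OF assms(3)] norm_vec_square sum.swap[of _ UNIV F])
  finally show ?thesis .
qed

lemma tmean_lowpass_inner:
  fixes g h :: "real^'d \<Rightarrow> real^'n"
  assumes g: "continuous_on UNIV g" and h: "continuous_on UNIV h"
  shows "tmean (\<lambda>x. lowpass N g x \<bullet> h x) = Re (\<Sum>a\<in>UNIV. \<Sum>k\<in>cube N. fourier_coeff g k $ a * cnj (fourier_coeff h k $ a))"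
proof -
  have "tmean (\<lambda>x. (\<Sum>k\<in>cube N. fourier_coeff g k $ a * wave k x) * of_real (h x $ a))
      = (\<Sum>k\<in>cube N. fourier_coeff g k $ a * cnj (fourier_coeff h k $ a))" for a
  proof -
    have "tmean (\<lambda>x. (\<Sum>k\<in>cube N. fourier_coeff g k $ a * wave k x) * of_real (h x $ a))
       = tmean (\<lambda>x. \<Sum>k\<in>cube N. fourier_coeff g k $ a * (wave k x * of_real (h x $ a)))"
      by (simp only: sum_distrib_right mult.assoc)
    also have "\<dots> = (\<Sum>k\<in>cube N. fourier_coeff g k $ a * tmean (\<lambda>x. wave k x * of_real (h x $ a)))"
      by (simp add: tmean_sum tmean_cmult continuous_on_mult continuous_wave continuous_on_of_real continuous_on_component h)
    also have "\<dots> = (\<Sum>k\<in>cube N. fourier_coeff g k $ a * cnj (fourier_coeff h k $ a))"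
    proof (intro sum.cong refl arg_cong2[where f = "(*)"])
      fix k
      have "tmean (\<lambda>x. wave k x * of_real (h x $ a)) = fc (\<lambda>x. of_real (h x $ a)) (- k)"
        by (simp add: fc_def mult.commute)
      then show "tmean (\<lambda>x. wave k x * of_real (h x $ a)) = cnj (fourier_coeff h k $ a)"
        by (simp add: fc_hermitian fourier_coeff_fc h continuous_on_component)
    qed
    finally show ?thesis .
  qed
  note A = this
  have "tmean (\<lambda>x. lowpass N g x \<bullet> h x) = (\<Sum>a\<in>UNIV. tmean (\<lambda>x. lowpass N g x $ a * h x $ a))"
    unfolding inner_vec_def lowpass_rtp
    by (subst tmean_sum) (auto intro!: continuous_intros continuous_rtp h)
  also have "\<dots> = (\<Sum>a\<in>UNIV. Re (tmean (\<lambda>x. (\<Sum>k\<in>cube N. fourier_coeff g k $ a * wave k x) * of_real (h x $ a))))"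
    by (subst tmean_Re[symmetric]) (auto simp: lowpass_rtp rtp_nth intro!: continuous_intros h)
  finally show ?thesis unfolding A by simp
qed

lemma continuous_lowpass: "continuous_on UNIV (lowpass N f)"
  by (simp add: lowpass_rtp continuous_rtp)

lemma lowpass_selfadjoint:
  fixes g h :: "real^'d \<Rightarrow> real^'n"
  assumes g: "continuous_on UNIV g" and h: "continuous_on UNIV h"
  shows "tmean (\<lambda>x. lowpass N g x \<bullet> h x) = tmean (\<lambda>x. g x \<bullet> lowpass N h x)"
proof -
  have "tmean (\<lambda>x. g x \<bullet> lowpass N h x) = tmean (\<lambda>x. lowpass N h x \<bullet> g x)"
    by (simp add: inner_commute)
  then show ?thesis
    unfolding tmean_lowpass_inner[OF g h] tmean_lowpass_inner[OF h g] by (simp add: mult.commute)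
qed

lemma fourier_coeff_lowpass:
  "continuous_on UNIV f \<Longrightarrow> fourier_coeff (lowpass N f) k = (if k \<in> cube N then fourier_coeff f k else 0)"
  unfolding lowpass_rtp by (rule fourier_coeff_rtp) (auto simp: hermitian_fourier_coeff cube_minus)

lemma lowpass_idem:
  assumes "continuous_on UNIV f"
  shows "lowpass N (lowpass N f) = lowpass N f"
proof
  fix x
  have "lowpass N (lowpass N f) x = rtp (cube N) (fourier_coeff (lowpass N f)) x"
    by (simp only: lowpass_rtp[of N "lowpass N f"])
  also have "\<dots> = rtp (cube N) (fourier_coeff f) x"
    by (rule rtp_cong) (simp add: fourier_coeff_lowpass assms)
  finally show "lowpass N (lowpass N f) x = lowpass N f x" by (simp only: lowpass_rtp)
qed

lemma continuous_matrix_vector: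
  "continuous_on A B \<Longrightarrow> continuous_on A f \<Longrightarrow> continuous_on A (\<lambda>x. (B x :: real^'n^'m) *v f x)"
  by (rule bounded_bilinear.continuous_on[OF bounded_bilinear_matrix_vector])

lemma fourier_coeff_matrix:
  fixes f :: "real^'d \<Rightarrow> real^'n" and B :: "real^'n^'m"
  assumes "continuous_on UNIV f"
  shows "fourier_coeff (\<lambda>x. B *v f x) k $ a = (\<Sum>b\<in>UNIV. of_real (B $ a $ b) * fourier_coeff f k $ b)"
proof -
  have "fourier_coeff (\<lambda>x. B *v f x) k $ a = fc (\<lambda>x. \<Sum>b\<in>UNIV. of_real (B $ a $ b) * of_real (f x $ b)) k"
    by (subst fourier_coeff_fc) (auto intro!: continuous_matrix_vector continuous_intros assms simp: matrix_vector_mult_def)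
  also have "\<dots> = (\<Sum>b\<in>UNIV. of_real (B $ a $ b) * fourier_coeff f k $ b)"
    by (simp add: fc_sum fc_cmult fourier_coeff_fc assms continuous_on_mult continuous_on_of_real continuous_on_component)
  finally show ?thesis .
qed

lemma lowpass_matrix:
  fixes f :: "real^'d \<Rightarrow> real^'n" and B :: "real^'n^'m"
  assumes "continuous_on UNIV f"
  shows "lowpass N (\<lambda>x. B *v f x) x = B *v lowpass N f x"
proof -
  have "(\<Sum>k\<in>cube N. (\<Sum>b\<in>UNIV. of_real (B $ a $ b) * fourier_coeff f k $ b) * wave k x)
     = (\<Sum>b\<in>UNIV. of_real (B $ a $ b) * (\<Sum>k\<in>cube N. fourier_coeff f k $ b * wave k x))" for a
    unfolding sum_distrib_right sum_distrib_left by (subst sum.swap) (simp add: mult.assoc)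
  then have "lowpass N (\<lambda>x. B *v f x) x $ a = Re (\<Sum>b\<in>UNIV. of_real (B $ a $ b) * (\<Sum>k\<in>cube N. fourier_coeff f k $ b * wave k x))" for a
    by (simp only: lowpass_rtp rtp_nth fourier_coeff_matrix[OF assms])
  moreover have "(B *v lowpass N f x) $ a = (\<Sum>b\<in>UNIV. B $ a $ b * Re (\<Sum>k\<in>cube N. fourier_coeff f k $ b * wave k x))" for a
    by (simp only: lowpass_rtp rtp_nth matrix_vector_mult_def vec_lambda_beta)
  moreover have "Re (of_real r * z) = r * Re z" for r z by simp
  ultimately show ?thesis
    by (simp only: vec_eq_iff Re_sum[of _ UNIV] simp_thms)
qed

lemma fourier_coeff_diff:
  fixes f g :: "real^'d \<Rightarrow> real^'n"
  assumes "continuous_on UNIV f" "continuous_on UNIV g"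
  shows "fourier_coeff (\<lambda>x. f x - g x) k = fourier_coeff f k - fourier_coeff g k"
  by (simp add: vec_eq_iff fourier_coeff_fc assms continuous_on_diff fc_diff continuous_on_of_real continuous_on_component)

lemma lowpass_diff:
  assumes "continuous_on UNIV f" "continuous_on UNIV g"
  shows "lowpass N (\<lambda>x. f x - g x) x = lowpass N f x - lowpass N g x"
proof -
  have "fourier_coeff (\<lambda>x. f x - g x) = (\<lambda>k. fourier_coeff f k - fourier_coeff g k)"
    by (rule ext) (rule fourier_coeff_diff[OF assms])
  then show ?thesis by (simp only: lowpass_rtp rtp_diff)
qed

lemma pd_lowpass: "C1_torus f \<Longrightarrow> pd j (lowpass N f) = lowpass N (pd j f)"
  unfolding lowpass_rtp C1_torus_rtp(2)
  by (intro ext rtp_cong) (simp add: vec_eq_iff fourier_coeff_pd)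

lemma msq_lowpass_le:
  fixes g :: "real^'d \<Rightarrow> real^'n"
  assumes g: "continuous_on UNIV g"
  shows "msq (lowpass N g) \<le> msq g"
proof -
  note cl = continuous_lowpass[of N g]
  have "msq (lowpass N g) = tmean (\<lambda>x. lowpass N g x \<bullet> lowpass N g x)"
    by (simp add: msq_def power2_norm_eq_inner)
  also have "\<dots> = tmean (\<lambda>x. g x \<bullet> lowpass N g x)"
    using lowpass_selfadjoint[OF g cl, of N] by (simp add: lowpass_idem g)
  also have "\<dots> \<le> tmean (\<lambda>x. (1/2) * ((norm (g x))\<^sup>2 + (norm (lowpass N g x))\<^sup>2))"
  proof (rule tmean_mono)
    fix x
    have "g x \<bullet> lowpass N g x \<le> norm (g x) * norm (lowpass N g x)" by (rule norm_cauchy_schwarz)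
    also have "\<dots> \<le> (1/2) * ((norm (g x))\<^sup>2 + (norm (lowpass N g x))\<^sup>2)"
      using sum_squares_bound[of "norm (g x)" "norm (lowpass N g x)"] by simp
    finally show "g x \<bullet> lowpass N g x \<le> (1/2) * ((norm (g x))\<^sup>2 + (norm (lowpass N g x))\<^sup>2)" .
  qed (intro continuous_intros g cl)+
  also have "\<dots> = (1/2) * (msq g + msq (lowpass N g))"
  proof -
    have c: "continuous_on UNIV (\<lambda>x. (norm (g x))\<^sup>2)" "continuous_on UNIV (\<lambda>x. (norm (lowpass N g x))\<^sup>2)"
      by (intro continuous_intros g cl)+
    show ?thesis
      unfolding msq_def by (simp only: tmean_cmult(1)[OF continuous_on_add[OF c]] tmean_add[OF c])
  qed
  finally show ?thesis by simp
qed

section \<open>Energy estimates for symmetrised fluxes\<close>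

lemma inner_symmetric_matrix:
  fixes B :: "real^'n^'n"
  assumes "transpose B = B"
  shows "x \<bullet> (B *v y) = (B *v x) \<bullet> y"
  by (metis assms dot_lmul_matrix transpose_matrix_vector)

lemma msq_le:
  fixes f :: "real^'d \<Rightarrow> real^'n" and g :: "real^'d \<Rightarrow> real^'m"
  assumes "continuous_on UNIV f" "continuous_on UNIV g" "\<And>x. norm (f x) \<le> c * norm (g x)"
  shows "msq f \<le> c\<^sup>2 * msq g"
proof -
  have "msq f \<le> tmean (\<lambda>x. c\<^sup>2 * (norm (g x))\<^sup>2)"
    unfolding msq_def
  proof (rule tmean_mono)
    show "(norm (f x))\<^sup>2 \<le> c\<^sup>2 * (norm (g x))\<^sup>2" for x
      using power_mono[OF assms(3)[of x], of 2] by (simp add: power_mult_distrib)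
  qed (intro continuous_intros assms)+
  also have "\<dots> = c\<^sup>2 * msq g"
    unfolding msq_def by (intro tmean_cmult(1) continuous_intros assms)
  finally show ?thesis .
qed

lemma tmean_inner_le:
  fixes f :: "real^'d \<Rightarrow> real^'n" and g :: "real^'d \<Rightarrow> real^'n"
  assumes f: "continuous_on UNIV f" and g: "continuous_on UNIV g"
  shows "\<bar>tmean (\<lambda>x. f x \<bullet> g x)\<bar> \<le> (msq f + msq g) / 2"
proof -
  have c: "continuous_on UNIV (\<lambda>x. (norm (f x))\<^sup>2)" "continuous_on UNIV (\<lambda>x. (norm (g x))\<^sup>2)"
    by (intro continuous_intros f g)+
  have cfg: "continuous_on UNIV (\<lambda>x. f x \<bullet> g x)" by (intro continuous_intros f g)
  have pt: "\<bar>f x \<bullet> g x\<bar> \<le> (1/2) * ((norm (f x))\<^sup>2 + (norm (g x))\<^sup>2)" for x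
  proof -
    have "\<bar>f x \<bullet> g x\<bar> \<le> norm (f x) * norm (g x)" by (rule Cauchy_Schwarz_ineq2)
    then show ?thesis using sum_squares_bound[of "norm (f x)" "norm (g x)"] by simp
  qed
  have pt1: "f x \<bullet> g x \<le> (1/2) * ((norm (f x))\<^sup>2 + (norm (g x))\<^sup>2)"
    and pt2: "- (f x \<bullet> g x) \<le> (1/2) * ((norm (f x))\<^sup>2 + (norm (g x))\<^sup>2)" for x
    using pt[of x] by (simp_all only: abs_le_iff)
  have R: "tmean (\<lambda>x. (1/2) * ((norm (f x))\<^sup>2 + (norm (g x))\<^sup>2)) = (msq f + msq g) / 2"
    unfolding msq_def by (simp only: tmean_cmult(1)[OF continuous_on_add[OF c]] tmean_add[OF c])
  have "tmean (\<lambda>x. f x \<bullet> g x) \<le> tmean (\<lambda>x. (1/2) * ((norm (f x))\<^sup>2 + (norm (g x))\<^sup>2))"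
    by (intro tmean_mono cfg continuous_intros f g pt1)
  moreover have "tmean (\<lambda>x. - (f x \<bullet> g x)) \<le> tmean (\<lambda>x. (1/2) * ((norm (f x))\<^sup>2 + (norm (g x))\<^sup>2))"
    by (intro tmean_mono continuous_on_minus cfg continuous_intros f g pt2)
  ultimately show ?thesis unfolding R tmean_minus by (simp add: abs_le_iff)
qed

lemma tmean_symmetric_flux:
  fixes Z :: "real^'d \<Rightarrow> real^'n" and B :: "real^'n^'n"
  assumes Z: "C1_torus Z" and B: "transpose B = B"
  shows "tmean (\<lambda>x. Z x \<bullet> (B *v pd j Z x)) = 0"
proof -
  note BZ = C1_torus_linear[OF matrix_vector_mul_bounded_linear[of B] Z]
  note p = C1_torus_bilinear[OF bounded_bilinear_inner Z BZ(1)]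
  have "pd j (\<lambda>x. Z x \<bullet> (B *v Z x)) x = 2 * (Z x \<bullet> (B *v pd j Z x))" for x
    unfolding p(2) BZ(2) using inner_symmetric_matrix[OF B, of "Z x" "pd j Z x"]
    by (simp add: inner_commute inner_symmetric_matrix[OF B])
  then have "pd j (\<lambda>x. Z x \<bullet> (B *v Z x)) = (\<lambda>x. 2 * (Z x \<bullet> (B *v pd j Z x)))" by blast
  then have "tmean (\<lambda>x. 2 * (Z x \<bullet> (B *v pd j Z x))) = 0"
    using tmean_pd[OF p(1), of j] by simp
  moreover have "continuous_on UNIV (\<lambda>x. Z x \<bullet> (B *v pd j Z x))"
    by (intro continuous_intros continuous_matrix_vector C1_torus_continuous[OF Z] C1_torus_pd_continuous[OF Z])
  ultimately show ?thesis by (simp add: tmean_cmult)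
qed

text \<open>Testing the filtered flux of \<open>E\<close> with \<open>B E\<close>: the filter is a symmetric projection that commutes
  with the constant matrix \<open>S0\<close>, so both sides are filtered, and the flux of \<open>Z = lowpass N (B E)\<close> with
  the constant symmetric matrix \<open>S0\<close> integrates to zero. Only a term without derivatives of \<open>E\<close> is left.\<close>

lemma filtered_flux_energy:
  fixes E :: "real^'d \<Rightarrow> real^'n" and B :: "real^'d \<Rightarrow> real^'n^'n" and S0 :: "real^'n^'n"
  assumes E: "C1_torus E" and B: "C1_torus B" and S0: "transpose S0 = S0"
    and bB: "\<And>x v. norm (B x *v v) \<le> \<beta> * norm v" and bD: "\<And>x v. norm (pd j B x *v v) \<le> \<beta> * norm v"
    and bS: "\<And>v. norm (S0 *v v) \<le> \<sigma> * norm v"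
  shows "\<bar>tmean (\<lambda>x. (B x *v E x) \<bullet> (S0 *v lowpass N (\<lambda>x. B x *v pd j E x) x))\<bar> \<le> (1 + \<sigma>\<^sup>2) * \<beta>\<^sup>2 * msq E"
proof -
  note BE = C1_torus_bilinear[OF bounded_bilinear_matrix_vector B E]
  define Z where "Z = lowpass N (\<lambda>x. B x *v E x)"
  define D where "D = (\<lambda>x. pd j B x *v E x)"
  define X where "X = (\<lambda>x. B x *v pd j E x)"
  have cE: "continuous_on UNIV E" and cBE: "continuous_on UNIV (\<lambda>x. B x *v E x)"
    by (rule C1_torus_continuous[OF E], rule C1_torus_continuous[OF BE(1)])
  have cD: "continuous_on UNIV D" and cX: "continuous_on UNIV X"
    unfolding D_def X_def by (intro continuous_matrix_vector C1_torus_continuous C1_torus_pd_continuous E B)+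
  have Z1: "C1_torus Z" unfolding Z_def lowpass_rtp by (rule C1_torus_rtp)
  have X: "X = (\<lambda>x. pd j (\<lambda>x. B x *v E x) x - D x)"
    by (simp add: X_def D_def BE(2))
  have LX: "lowpass N X x = pd j Z x - lowpass N D x" for x
    unfolding X Z_def pd_lowpass[OF BE(1)] by (rule lowpass_diff[OF C1_torus_pd_continuous[OF BE(1)] cD])
  have cSL: "continuous_on UNIV (\<lambda>x. S0 *v lowpass N X x)"
    by (intro continuous_matrix_vector continuous_lowpass continuous_on_const)
  have "tmean (\<lambda>x. (B x *v E x) \<bullet> (S0 *v lowpass N X x)) = tmean (\<lambda>x. (B x *v E x) \<bullet> lowpass N (\<lambda>x. S0 *v lowpass N X x) x)"
    unfolding lowpass_matrix[OF continuous_lowpass] lowpass_idem[OF cX] ..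
  also have "\<dots> = tmean (\<lambda>x. Z x \<bullet> (S0 *v lowpass N X x))"
    unfolding Z_def by (rule lowpass_selfadjoint[OF cBE cSL, symmetric])
  also have "\<dots> = tmean (\<lambda>x. Z x \<bullet> (S0 *v pd j Z x) - Z x \<bullet> (S0 *v lowpass N D x))"
    unfolding LX by (simp add: matrix_vector_mult_diff_distrib inner_diff_right)
  also have "\<dots> = - tmean (\<lambda>x. Z x \<bullet> (S0 *v lowpass N D x))"
  proof -
    have "continuous_on UNIV (\<lambda>x. Z x \<bullet> (S0 *v pd j Z x))" "continuous_on UNIV (\<lambda>x. Z x \<bullet> (S0 *v lowpass N D x))"
      by (intro continuous_on_inner continuous_matrix_vector continuous_lowpass continuous_on_const
          C1_torus_continuous[OF Z1] C1_torus_pd_continuous[OF Z1])+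
    then show ?thesis by (simp add: tmean_diff tmean_symmetric_flux[OF Z1 S0])
  qed
  finally have "\<bar>tmean (\<lambda>x. (B x *v E x) \<bullet> (S0 *v lowpass N X x))\<bar> = \<bar>tmean (\<lambda>x. Z x \<bullet> (S0 *v lowpass N D x))\<bar>"
    by simp
  also have "\<dots> \<le> (msq Z + msq (\<lambda>x. S0 *v lowpass N D x)) / 2"
    by (intro tmean_inner_le C1_torus_continuous[OF Z1] continuous_matrix_vector continuous_lowpass continuous_on_const)
  also have "\<dots> \<le> (\<beta>\<^sup>2 * msq E + \<sigma>\<^sup>2 * (\<beta>\<^sup>2 * msq E)) / 2"
  proof -
    have "msq Z \<le> \<beta>\<^sup>2 * msq E"
      unfolding Z_def by (rule order_trans[OF msq_lowpass_le[OF cBE] msq_le[OF cBE cE bB]])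
    moreover have "msq (\<lambda>x. S0 *v lowpass N D x) \<le> \<sigma>\<^sup>2 * (\<beta>\<^sup>2 * msq E)"
    proof -
      have "msq (\<lambda>x. S0 *v lowpass N D x) \<le> \<sigma>\<^sup>2 * msq (lowpass N D)"
        by (rule msq_le[OF _ continuous_lowpass bS]) (intro continuous_matrix_vector continuous_lowpass continuous_on_const)
      also have "\<sigma>\<^sup>2 * msq (lowpass N D) \<le> \<sigma>\<^sup>2 * msq D"
        by (intro mult_left_mono msq_lowpass_le cD) auto
      also have "\<sigma>\<^sup>2 * msq D \<le> \<sigma>\<^sup>2 * (\<beta>\<^sup>2 * msq E)"
        by (intro mult_left_mono msq_le[OF cD cE]) (auto simp: D_def bD)
      finally show ?thesis .
    qed
    ultimately show ?thesis by (intro divide_right_mono add_mono) auto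
  qed
  also have "\<dots> \<le> (1 + \<sigma>\<^sup>2) * \<beta>\<^sup>2 * msq E"
    using msq_nonneg[OF cE] by (simp add: algebra_simps add_nonneg_nonneg)
  finally show ?thesis unfolding X_def .
qed

text \<open>The time derivative of the energy \<open>tmean (E \<bullet> B E)\<close>, where \<open>B'\<close> stands for the time derivative of \<open>B\<close>.
The flux term of each direction is bounded without derivatives of \<open>E\<close> by the preceding lemma. The
bound is on the absolute value, so that it can be used forwards and backwards in time.\<close>

lemma energy_rate_bound:
  fixes E E' G :: "real^'d \<Rightarrow> real^'n" and B B' :: "real^'d \<Rightarrow> real^'n^'n" and S0 :: "'d \<Rightarrow> real^'n^'n"
  assumes E: "C1_torus E" and B: "C1_torus B" and S0: "\<And>j. transpose (S0 j) = S0 j"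
    and bB: "\<And>x v. norm (B x *v v) \<le> \<beta> * norm v" and bD: "\<And>j x v. norm (pd j B x *v v) \<le> \<beta> * norm v"
    and bt: "\<And>x v. norm (B' x *v v) \<le> \<beta> * norm v"
    and bS: "\<And>j v. norm (S0 j *v v) \<le> \<sigma> * norm v"
    and G: "continuous_on UNIV G" and B': "continuous_on UNIV B'"
    and E': "\<And>x. E' x = G x - (\<Sum>j\<in>UNIV. S0 j *v lowpass N (\<lambda>x. B x *v pd j E x) x)"
  shows "\<bar>tmean (\<lambda>x. 2 * ((B x *v E x) \<bullet> E' x) + E x \<bullet> (B' x *v E x))\<bar>
    \<le> (2 * real CARD('d) * (1 + \<sigma>\<^sup>2) * \<beta>\<^sup>2 + 2 * \<beta>\<^sup>2 + 1) * msq E + msq G"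
proof -
  have cE: "continuous_on UNIV E" and cB: "continuous_on UNIV B"
    using E B C1_torus_continuous by auto
  let ?BE = "\<lambda>x. B x *v E x"
  let ?f = "\<lambda>j x. S0 j *v lowpass N (\<lambda>x. B x *v pd j E x) x"
  have cBE: "continuous_on UNIV ?BE" by (intro continuous_matrix_vector cE cB)
  have cBpE: "continuous_on UNIV (\<lambda>x. B' x *v E x)" by (intro continuous_matrix_vector cE B')
  have cf: "continuous_on UNIV (?f j)" for j by (intro continuous_matrix_vector continuous_lowpass continuous_on_const)
  have c1: "continuous_on UNIV (\<lambda>x. ?BE x \<bullet> G x)" "continuous_on UNIV (\<lambda>x. E x \<bullet> (B' x *v E x))"
    "\<And>j. continuous_on UNIV (\<lambda>x. ?BE x \<bullet> ?f j x)"
    by (intro continuous_on_inner cBE G cE cBpE cf)+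
  have "tmean (\<lambda>x. 2 * (?BE x \<bullet> E' x) + E x \<bullet> (B' x *v E x))
      = tmean (\<lambda>x. (2 * (?BE x \<bullet> G x) + E x \<bullet> (B' x *v E x)) - (\<Sum>j\<in>UNIV. 2 * (?BE x \<bullet> ?f j x)))"
    by (rule arg_cong[where f = tmean]) (auto simp: E' inner_diff_right inner_sum_right sum_distrib_left algebra_simps)
  also have "\<dots> = (2 * tmean (\<lambda>x. ?BE x \<bullet> G x) + tmean (\<lambda>x. E x \<bullet> (B' x *v E x))) - (\<Sum>j\<in>UNIV. 2 * tmean (\<lambda>x. ?BE x \<bullet> ?f j x))"
  proof -
    have "tmean (\<lambda>x. 2 * (?BE x \<bullet> G x) + E x \<bullet> (B' x *v E x)) = 2 * tmean (\<lambda>x. ?BE x \<bullet> G x) + tmean (\<lambda>x. E x \<bullet> (B' x *v E x))"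
      by (subst tmean_add, intro continuous_on_mult continuous_on_const c1, rule c1) (simp only: tmean_cmult(1)[OF c1(1)])
    moreover have "tmean (\<lambda>x. \<Sum>j\<in>UNIV. 2 * (?BE x \<bullet> ?f j x)) = (\<Sum>j\<in>UNIV. 2 * tmean (\<lambda>x. ?BE x \<bullet> ?f j x))"
      by (subst tmean_sum, intro continuous_on_mult continuous_on_const c1) (simp only: tmean_cmult(1)[OF c1(3)])
    ultimately show ?thesis
      by (subst tmean_diff) (auto intro!: continuous_on_add continuous_on_sum continuous_on_mult continuous_on_const c1)
  qed
  finally have eq: "tmean (\<lambda>x. 2 * (?BE x \<bullet> E' x) + E x \<bullet> (B' x *v E x)) = \<dots>" .
  have 1: "\<bar>tmean (\<lambda>x. ?BE x \<bullet> G x)\<bar> \<le> (\<beta>\<^sup>2 * msq E + msq G) / 2"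
    by (rule order_trans[OF tmean_inner_le[OF cBE G]]) (use msq_le[OF cBE cE bB] in simp)
  have 2: "\<bar>tmean (\<lambda>x. E x \<bullet> (B' x *v E x))\<bar> \<le> (msq E + \<beta>\<^sup>2 * msq E) / 2"
    by (rule order_trans[OF tmean_inner_le[OF cE cBpE]]) (use msq_le[OF cBpE cE bt] in simp)
  have 3: "\<bar>\<Sum>j\<in>UNIV. 2 * tmean (\<lambda>x. ?BE x \<bullet> ?f j x)\<bar> \<le> (\<Sum>j\<in>(UNIV::'d set). 2 * ((1 + \<sigma>\<^sup>2) * \<beta>\<^sup>2 * msq E))"
  proof (rule order_trans[OF sum_abs], rule sum_mono)
    fix j
    show "\<bar>2 * tmean (\<lambda>x. ?BE x \<bullet> ?f j x)\<bar> \<le> 2 * ((1 + \<sigma>\<^sup>2) * \<beta>\<^sup>2 * msq E)"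
      using filtered_flux_energy[OF E B S0 bB bD bS, of j N] by (simp add: abs_mult)
  qed
  have m: "0 \<le> msq E" "0 \<le> \<beta>\<^sup>2 * msq E" using msq_nonneg[OF cE] by auto
  have "\<bar>tmean (\<lambda>x. 2 * (?BE x \<bullet> E' x) + E x \<bullet> (B' x *v E x))\<bar>
     \<le> 2 * \<bar>tmean (\<lambda>x. ?BE x \<bullet> G x)\<bar> + \<bar>tmean (\<lambda>x. E x \<bullet> (B' x *v E x))\<bar> + \<bar>\<Sum>j\<in>UNIV. 2 * tmean (\<lambda>x. ?BE x \<bullet> ?f j x)\<bar>"
    unfolding eq by linarith
  also have "\<dots> \<le> (\<beta>\<^sup>2 * msq E + msq G) + (msq E + \<beta>\<^sup>2 * msq E) / 2 + real CARD('d) * (2 * ((1 + \<sigma>\<^sup>2) * \<beta>\<^sup>2 * msq E))"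
    by (intro add_mono) (use 1 2 3 in auto)
  also have "\<dots> \<le> (2 * real CARD('d) * (1 + \<sigma>\<^sup>2) * \<beta>\<^sup>2 + 2 * \<beta>\<^sup>2 + 1) * msq E + msq G"
  proof -
    have "(2 * real CARD('d) * (1 + \<sigma>\<^sup>2) * \<beta>\<^sup>2 + 2 * \<beta>\<^sup>2 + 1) * msq E
       = real CARD('d) * (2 * ((1 + \<sigma>\<^sup>2) * \<beta>\<^sup>2 * msq E)) + 2 * (\<beta>\<^sup>2 * msq E) + msq E"
      by (simp only: distrib_right mult_1_left mult.assoc mult.left_commute)
    moreover have "(\<beta>\<^sup>2 * msq E + msq G) + (msq E + \<beta>\<^sup>2 * msq E) / 2 + c \<le> c + 2 * (\<beta>\<^sup>2 * msq E) + msq E + msq G" for c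
      using m by (simp add: field_simps)
    ultimately show ?thesis by simp
  qed
  finally show ?thesis .
qed

section \<open>Functions that are continuously differentiable in time and space\<close>

lemma C1_on_slices:
  fixes u :: "real \<Rightarrow> real^'d \<Rightarrow> 'b::real_normed_vector"
  assumes "C1_on (I \<times> UNIV) (\<lambda>(t, x). u t x)"
  obtains ut where "\<And>t x. t \<in> I \<Longrightarrow> ((\<lambda>\<tau>. u \<tau> x) has_vector_derivative ut t x) (at t)"
    "continuous_on (I \<times> UNIV) (\<lambda>(t, x). u t x)" "continuous_on (I \<times> UNIV) (\<lambda>(t, x). ut t x)"
    "\<And>t x. t \<in> I \<Longrightarrow> u t differentiable (at x)"
    "\<And>j. continuous_on (I \<times> UNIV) (\<lambda>(t, x). pd j (u t) x)"
proof -
  from assms obtain F' where F: "\<And>z. z \<in> I \<times> UNIV \<Longrightarrow> ((\<lambda>(t, x). u t x) has_derivative blinfun_apply (F' z)) (at z)"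
    and cF: "continuous_on (I \<times> UNIV) F'" by (auto simp: C1_on_def)
  have t: "((\<lambda>\<tau>. u \<tau> x) has_vector_derivative F' (t, x) (1, 0)) (at t)" if "t \<in> I" for t x
  proof -
    have "((\<lambda>\<tau>. (\<tau>, x)) has_derivative (\<lambda>h. (h, 0))) (at t)"
      by (auto intro!: derivative_eq_intros)
    from has_derivative_compose[OF this F] that
    have "((\<lambda>\<tau>. u \<tau> x) has_derivative (\<lambda>h. F' (t, x) (h, 0))) (at t)" by simp
    moreover have "(\<lambda>h. F' (t, x) (h, 0)) = (\<lambda>h. h *\<^sub>R F' (t, x) (1, 0))"
      by (rule ext) (simp flip: blinfun.scaleR_right)
    ultimately show ?thesis by (simp only: has_vector_derivative_def)
  qed
  have x: "(u t has_derivative (\<lambda>h. F' (t, x) (0, h))) (at x)" if "t \<in> I" for t x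
  proof -
    have "((\<lambda>y. (t, y)) has_derivative (\<lambda>h. (0, h))) (at x)"
      by (auto intro!: derivative_eq_intros)
    from has_derivative_compose[OF this F] that show ?thesis by simp
  qed
  show ?thesis
  proof
    show "continuous_on (I \<times> UNIV) (\<lambda>(t, x). u t x)"
      by (intro continuous_at_imp_continuous_on ballI has_derivative_continuous[OF F])
    have "continuous_on (I \<times> UNIV) (\<lambda>z. F' z (1, 0))"
      by (intro continuous_intros cF)
    then show "continuous_on (I \<times> UNIV) (\<lambda>(t, x). F' (t, x) (1, 0))" by (simp add: case_prod_unfold)
    show "u t differentiable (at x)" if "t \<in> I" for t x
      using x[OF that] by (auto simp: differentiable_def)
    show "continuous_on (I \<times> UNIV) (\<lambda>(t, x). pd j (u t) x)" for j
    proof -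
      have "continuous_on (I \<times> UNIV) (\<lambda>z. F' z (0, axis j 1))"
        by (intro continuous_intros cF)
      moreover have "F' z (0, axis j 1) = (\<lambda>(t, x). pd j (u t) x) z" if "z \<in> I \<times> UNIV" for z
        using pd_eq[OF x[of "fst z" "snd z"]] that by (auto simp: case_prod_unfold)
      ultimately show ?thesis by (simp cong: continuous_on_cong)
    qed
  qed (use t in auto)
qed

lemma continuous_on_slice:
  assumes "continuous_on (I \<times> UNIV) (\<lambda>(t, x). u t x)" "t \<in> I"
  shows "continuous_on UNIV (u t)"
proof -
  have "continuous_on UNIV (\<lambda>x. case (t, x) of (t, x) \<Rightarrow> u t x)"
    by (rule continuous_on_compose2[OF assms(1)]) (use assms(2) in \<open>auto intro!: continuous_on_Pair continuous_on_const continuous_on_id\<close>)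
  then show ?thesis by simp
qed

lemma has_derivative_continuous_on_UNIV:
  assumes "\<And>u. (f has_derivative f' u) (at u)"
  shows "continuous_on UNIV f"
  by (intro continuous_at_imp_continuous_on ballI has_derivative_continuous[OF assms])

lemma real_polynomial_C1:
  fixes p :: "'a::euclidean_space \<Rightarrow> real"
  assumes "real_polynomial_function p"
  shows "\<exists>p'. (\<forall>u. (p has_derivative blinfun_apply (p' u)) (at u)) \<and> continuous_on UNIV p'"
  using assms
proof (induction p rule: real_polynomial_function.induct)
  case (linear f)
  then show ?case
    by (intro exI[of _ "\<lambda>_. Blinfun f"])
       (auto simp: bounded_linear_Blinfun_apply intro!: bounded_linear_imp_has_derivative)
next
  case (const c)
  then show ?case by (intro exI[of _ "\<lambda>_. 0"]) (auto simp: zero_blinfun.rep_eq)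
next
  case (add f g)
  then obtain f' g' where "\<And>u. (f has_derivative blinfun_apply (f' u)) (at u)" "continuous_on UNIV f'"
     "\<And>u. (g has_derivative blinfun_apply (g' u)) (at u)" "continuous_on UNIV g'" by auto
  then show ?case
    by (intro exI[of _ "\<lambda>u. f' u + g' u"])
       (auto simp: blinfun.add_left intro!: continuous_intros derivative_eq_intros)
next
  case (mult f g)
  then obtain f' g' where fg: "\<And>u. (f has_derivative blinfun_apply (f' u)) (at u)" "continuous_on UNIV f'"
     "\<And>u. (g has_derivative blinfun_apply (g' u)) (at u)" "continuous_on UNIV g'" by auto
  have "continuous_on UNIV f" "continuous_on UNIV g"
    by (rule has_derivative_continuous_on_UNIV[OF fg(1)], rule has_derivative_continuous_on_UNIV[OF fg(3)])
  moreover have "((\<lambda>u. f u * g u) has_derivative blinfun_apply (f u *\<^sub>R g' u + g u *\<^sub>R f' u)) (at u)" for u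
    by (rule has_derivative_eq_rhs[OF has_derivative_mult[OF fg(1) fg(3)]])
       (auto simp: blinfun.add_left blinfun.scaleR_left)
  ultimately show ?case
    by (intro exI[of _ "\<lambda>u. f u *\<^sub>R g' u + g u *\<^sub>R f' u"]) (auto intro!: continuous_intros fg)
qed

lemma polynomial_matrix_C1:
  fixes S :: "real^'n \<Rightarrow> real^'n^'n"
  assumes "\<And>a b. real_polynomial_function (\<lambda>u. S u $ a $ b)"
  obtains S' where "\<And>u. (S has_derivative blinfun_apply (S' u)) (at u)" "continuous_on UNIV S'"
proof -
  have "\<exists>p'. (\<forall>u. ((\<lambda>u. S u $ a $ b) has_derivative blinfun_apply (p' u)) (at u)) \<and> continuous_on UNIV p'" for a b
    by (rule real_polynomial_C1[OF assms])
  then obtain p' where p': "\<And>a b u. ((\<lambda>u. S u $ a $ b) has_derivative blinfun_apply (p' a b u)) (at u)"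
      "\<And>a b. continuous_on UNIV (p' a b)" by metis
  let ?e = "\<lambda>a b. axis a (axis b 1) :: real^'n^'n"
  have S: "S = (\<lambda>u. \<Sum>a\<in>UNIV. \<Sum>b\<in>UNIV. (S u $ a $ b) *\<^sub>R ?e a b)"
  proof
    fix u
    have "(\<Sum>b\<in>UNIV. ((S u $ a $ b) *\<^sub>R ?e a b) $ i $ j) = (if a = i then S u $ a $ j else 0)" for a i j
      by (cases "a = i") (simp_all add: axis_def if_distrib cong: if_cong)
    then show "S u = (\<Sum>a\<in>UNIV. \<Sum>b\<in>UNIV. (S u $ a $ b) *\<^sub>R ?e a b)"
      by (simp only: vec_eq_iff sum_component) simp
  qed
  let ?S' = "\<lambda>u. \<Sum>a\<in>UNIV. \<Sum>b\<in>UNIV. blinfun_scaleR_left (?e a b) o\<^sub>L p' a b u"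
  have "((\<lambda>u. \<Sum>a\<in>UNIV. \<Sum>b\<in>UNIV. (S u $ a $ b) *\<^sub>R ?e a b) has_derivative blinfun_apply (?S' u)) (at u)" for u
  proof -
    have "((\<lambda>u. \<Sum>a\<in>UNIV. \<Sum>b\<in>UNIV. (S u $ a $ b) *\<^sub>R ?e a b) has_derivative
       (\<lambda>h. \<Sum>a\<in>UNIV. \<Sum>b\<in>UNIV. p' a b u h *\<^sub>R ?e a b)) (at u)"
      by (intro has_derivative_sum has_derivative_scaleR_left p')
    moreover have "(\<lambda>h. \<Sum>a\<in>UNIV. \<Sum>b\<in>UNIV. p' a b u h *\<^sub>R ?e a b) = blinfun_apply (?S' u)"
      by (rule ext) (simp add: blinfun.sum_left)
    ultimately show ?thesis by (simp only:)
  qed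
  moreover have "continuous_on UNIV ?S'" by (intro continuous_intros p')
  ultimately show ?thesis by (intro that[of ?S']) (simp_all only: S[symmetric])
qed

section \<open>The energy in time\<close>

lemma energy_has_derivative:
  fixes E :: "real \<Rightarrow> real^'d \<Rightarrow> real^'n" and U :: "real \<Rightarrow> real^'d \<Rightarrow> real^'n" and S :: "real^'n \<Rightarrow> real^'n^'n"
  assumes I: "open I" "convex I" "t \<in> I"
    and U: "\<And>t x. t \<in> I \<Longrightarrow> ((\<lambda>\<tau>. U \<tau> x) has_vector_derivative U' t x) (at t)"
      "continuous_on (I \<times> UNIV) (\<lambda>(t, x). U t x)" "continuous_on (I \<times> UNIV) (\<lambda>(t, x). U' t x)"
    and E: "\<And>t x. t \<in> I \<Longrightarrow> ((\<lambda>\<tau>. E \<tau> x) has_vector_derivative E' t x) (at t)"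
      "continuous_on (I \<times> UNIV) (\<lambda>(t, x). E t x)" "continuous_on (I \<times> UNIV) (\<lambda>(t, x). E' t x)"
    and S: "\<And>u. (S has_derivative blinfun_apply (S' u)) (at u)" "continuous_on UNIV S'"
    and sym: "\<And>t x. t \<in> I \<Longrightarrow> transpose (S (U t x)) = S (U t x)"
  shows "((\<lambda>t. tmean (\<lambda>x. E t x \<bullet> (S (U t x) *v E t x))) has_real_derivative
     tmean (\<lambda>x. 2 * ((S (U t x) *v E t x) \<bullet> E' t x) + E t x \<bullet> (S' (U t x) (U' t x) *v E t x))) (at t)"
proof -
  have cS: "continuous_on UNIV S"
    by (rule has_derivative_continuous_on_UNIV[OF S(1)])
  have U': "continuous_on (I \<times> UNIV) (\<lambda>z. U (fst z) (snd z))" "continuous_on (I \<times> UNIV) (\<lambda>z. U' (fst z) (snd z))"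
    and E': "continuous_on (I \<times> UNIV) (\<lambda>z. E (fst z) (snd z))" "continuous_on (I \<times> UNIV) (\<lambda>z. E' (fst z) (snd z))"
    using U E by (simp_all add: case_prod_unfold)
  have cSU: "continuous_on (I \<times> UNIV) (\<lambda>z. S (U (fst z) (snd z)))" "continuous_on (I \<times> UNIV) (\<lambda>z. S' (U (fst z) (snd z)))"
    by (rule continuous_on_compose2[OF cS U'(1)], simp, rule continuous_on_compose2[OF S(2) U'(1)], simp)
  have "((\<lambda>t. tmean (\<lambda>x. E t x \<bullet> (S (U t x) *v E t x))) has_vector_derivative
     tmean (\<lambda>x. 2 * ((S (U t x) *v E t x) \<bullet> E' t x) + E t x \<bullet> (S' (U t x) (U' t x) *v E t x))) (at t within I)"
  proof (rule tmean_has_vector_derivative[where f = "\<lambda>t x. E t x \<bullet> (S (U t x) *v E t x)"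
       and f' = "\<lambda>t x. 2 * ((S (U t x) *v E t x) \<bullet> E' t x) + E t x \<bullet> (S' (U t x) (U' t x) *v E t x)"])
    show "((\<lambda>t. E t x \<bullet> (S (U t x) *v E t x)) has_vector_derivative
         2 * ((S (U t x) *v E t x) \<bullet> E' t x) + E t x \<bullet> (S' (U t x) (U' t x) *v E t x)) (at t within I)"
      if t: "t \<in> I" for t x
    proof -
      have dU: "((\<lambda>\<tau>. U \<tau> x) has_vector_derivative U' t x) (at t within I)"
        and dE: "((\<lambda>\<tau>. E \<tau> x) has_vector_derivative E' t x) (at t within I)"
        using U(1)[OF t] E(1)[OF t] has_vector_derivative_at_within by blast+
      have "((\<lambda>\<tau>. S (U \<tau> x)) has_vector_derivative S' (U t x) (U' t x)) (at t within I)"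
        using has_derivative_compose[OF dU[unfolded has_vector_derivative_def] S(1)]
        by (simp add: has_vector_derivative_def blinfun.scaleR_right)
      from bounded_bilinear.has_vector_derivative[OF bounded_bilinear_inner dE
            bounded_bilinear.has_vector_derivative[OF bounded_bilinear_matrix_vector this dE]]
      show ?thesis
      proof (rule has_vector_derivative_eq_rhs)
        show "E t x \<bullet> (S (U t x) *v E' t x + S' (U t x) (U' t x) *v E t x) + E' t x \<bullet> (S (U t x) *v E t x)
            = 2 * ((S (U t x) *v E t x) \<bullet> E' t x) + E t x \<bullet> (S' (U t x) (U' t x) *v E t x)"
          unfolding inner_add_right inner_symmetric_matrix[OF sym[OF t, of x], of "E t x" "E' t x"]
            inner_commute[of "E' t x"] by linarith
      qed
    qed
    show "continuous_on UNIV (\<lambda>x. E t x \<bullet> (S (U t x) *v E t x))" if "t \<in> I" for t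
      by (intro continuous_on_inner continuous_matrix_vector continuous_on_slice[OF E(2) that]
           continuous_on_compose2[OF cS continuous_on_slice[OF U(2) that]]) auto
    have "continuous_on (I \<times> UNIV) (\<lambda>z. 2 * ((S (U (fst z) (snd z)) *v E (fst z) (snd z)) \<bullet> E' (fst z) (snd z))
        + E (fst z) (snd z) \<bullet> (S' (U (fst z) (snd z)) (U' (fst z) (snd z)) *v E (fst z) (snd z)))"
      by (intro continuous_intros continuous_matrix_vector cSU U' E')
    then show "continuous_on (I \<times> UNIV) (\<lambda>(t, x). 2 * ((S (U t x) *v E t x) \<bullet> E' t x) + E t x \<bullet> (S' (U t x) (U' t x) *v E t x))"
      by (simp add: case_prod_unfold)
  qed (use I in auto)
  then show ?thesis
    by (simp only: has_real_derivative_iff_has_vector_derivative at_within_open[OF I(3) I(1)])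
qed

lemma gronwall_forward:
  fixes \<phi> :: "real \<Rightarrow> real"
  assumes "t0 \<le> t" and d: "\<And>\<tau>. t0 \<le> \<tau> \<Longrightarrow> \<tau> \<le> t \<Longrightarrow> (\<phi> has_real_derivative \<phi>' \<tau>) (at \<tau>)"
    and b: "\<And>\<tau>. t0 \<le> \<tau> \<Longrightarrow> \<tau> \<le> t \<Longrightarrow> \<phi>' \<tau> \<le> a * \<phi> \<tau> + b * exp (\<kappa> * (\<tau> - t0))"
    and l: "a < \<kappa>" "0 \<le> b"
  shows "\<phi> t \<le> exp (a * (t - t0)) * \<phi> t0 + b / (\<kappa> - a) * exp (\<kappa> * (t - t0))"
proof -
  define \<psi> where "\<psi> \<tau> = exp (- a * (\<tau> - t0)) * \<phi> \<tau> - b / (\<kappa> - a) * exp ((\<kappa> - a) * (\<tau> - t0))" for \<tau>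
  have "\<psi> t \<le> \<psi> t0"
  proof (rule DERIV_nonpos_imp_nonincreasing[OF assms(1)])
    fix \<tau> assume \<tau>: "t0 \<le> \<tau>" "\<tau> \<le> t"
    have "(\<psi> has_real_derivative exp (- a * (\<tau> - t0)) * (\<phi>' \<tau> - a * \<phi> \<tau> - b * exp (\<kappa> * (\<tau> - t0)))) (at \<tau>)"
    proof -
      define c where "c = b / (\<kappa> - a)"
      have c: "c * (\<kappa> - a) = b" using l by (simp add: c_def)
      have e: "exp ((\<kappa> - a) * (\<tau> - t0)) = exp (- a * (\<tau> - t0)) * exp (\<kappa> * (\<tau> - t0))"
        unfolding exp_add[symmetric] by (rule arg_cong[where f = exp]) (simp add: algebra_simps)
      have "(\<psi> has_real_derivative (exp (- a * (\<tau> - t0)) * (- a) * \<phi> \<tau> + \<phi>' \<tau> * exp (- a * (\<tau> - t0)))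
          - c * (exp ((\<kappa> - a) * (\<tau> - t0)) * (\<kappa> - a))) (at \<tau>)"
        unfolding \<psi>_def c_def[symmetric] by (auto intro!: derivative_eq_intros d[OF \<tau>])
      moreover have "c * (exp ((\<kappa> - a) * (\<tau> - t0)) * (\<kappa> - a)) = b * exp ((\<kappa> - a) * (\<tau> - t0))"
        unfolding c[symmetric] by simp
      ultimately show ?thesis
        unfolding e by (simp add: algebra_simps)
    qed
    moreover have "exp (- a * (\<tau> - t0)) * (\<phi>' \<tau> - a * \<phi> \<tau> - b * exp (\<kappa> * (\<tau> - t0))) \<le> 0"
      using b[OF \<tau>] by (intro mult_nonneg_nonpos) auto
    ultimately show "\<exists>y. (\<psi> has_real_derivative y) (at \<tau>) \<and> y \<le> 0" by blast
  qed
  also have "\<psi> t0 \<le> \<phi> t0" using l by (simp add: \<psi>_def)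
  finally have "exp (a * (t - t0)) * \<psi> t \<le> exp (a * (t - t0)) * \<phi> t0" by (intro mult_left_mono) auto
  moreover have "exp (a * (t - t0)) * \<psi> t = \<phi> t - b / (\<kappa> - a) * exp (\<kappa> * (t - t0))"
  proof -
    have 1: "exp (a * (t - t0)) * exp (- a * (t - t0)) = 1"
      and 2: "exp (a * (t - t0)) * exp ((\<kappa> - a) * (t - t0)) = exp (\<kappa> * (t - t0))"
      unfolding exp_add[symmetric] by (simp_all add: left_diff_distrib)
    have "x * (y * p - c * z) = (x * y) * p - c * (x * z)" for x y z p c :: real
      by (simp add: algebra_simps)
    then show ?thesis unfolding \<psi>_def 1 2 by (simp only: 1 2 mult_1_left)
  qed
  ultimately show ?thesis by simp
qed

text \<open>The two-sided form serves for both directions of time. The source grows faster than the homogeneous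
solutions (\<open>a < \<kappa>\<close>), so it contributes with the small factor \<open>1 / (\<kappa> - a)\<close>.\<close>

lemma gronwall:
  fixes \<phi> :: "real \<Rightarrow> real"
  assumes d: "\<And>\<tau>. \<tau> \<in> closed_segment t0 t \<Longrightarrow> (\<phi> has_real_derivative \<phi>' \<tau>) (at \<tau>)"
    and b: "\<And>\<tau>. \<tau> \<in> closed_segment t0 t \<Longrightarrow> \<bar>\<phi>' \<tau>\<bar> \<le> a * \<phi> \<tau> + b * exp (\<kappa> * \<bar>\<tau> - t0\<bar>)"
    and l: "a < \<kappa>" "0 \<le> b"
  shows "\<phi> t \<le> exp (a * \<bar>t - t0\<bar>) * \<phi> t0 + b / (\<kappa> - a) * exp (\<kappa> * \<bar>t - t0\<bar>)"
proof (cases "t0 \<le> t")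
  case True
  have "\<phi> t \<le> exp (a * (t - t0)) * \<phi> t0 + b / (\<kappa> - a) * exp (\<kappa> * (t - t0))"
  proof (rule gronwall_forward[OF True _ _ l])
    fix \<tau> assume \<tau>: "t0 \<le> \<tau>" "\<tau> \<le> t"
    then have s: "\<tau> \<in> closed_segment t0 t" by (simp add: closed_segment_eq_real_ivl)
    show "(\<phi> has_real_derivative \<phi>' \<tau>) (at \<tau>)" by (rule d[OF s])
    show "\<phi>' \<tau> \<le> a * \<phi> \<tau> + b * exp (\<kappa> * (\<tau> - t0))" using b[OF s] \<tau> by simp
  qed
  then show ?thesis using True by simp
next
  case False
  have "\<phi> (- (- t)) \<le> exp (a * (- t - (- t0))) * \<phi> (- (- t0)) + b / (\<kappa> - a) * exp (\<kappa> * (- t - (- t0)))"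
  proof (rule gronwall_forward[OF _ _ _ l, where \<phi>' = "\<lambda>\<tau>. - \<phi>' (- \<tau>)"])
    fix \<tau> assume \<tau>: "- t0 \<le> \<tau>" "\<tau> \<le> - t"
    then have s: "- \<tau> \<in> closed_segment t0 t" using False by (auto simp: closed_segment_eq_real_ivl)
    show "((\<lambda>\<tau>. \<phi> (- \<tau>)) has_real_derivative - \<phi>' (- \<tau>)) (at \<tau>)"
      using DERIV_chain2[OF d[OF s] DERIV_minus[OF DERIV_ident]] by simp
    show "- \<phi>' (- \<tau>) \<le> a * \<phi> (- \<tau>) + b * exp (\<kappa> * (\<tau> - (- t0)))" using b[OF s] \<tau> by (simp add: add.commute)
  qed (use False in auto)
  then show ?thesis using False by simp
qed

section \<open>Finite Fourier multipliers in space and time\<close>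

text \<open>The multiplier with symbol \<open>m\<close> restricted to the cube. All cutoffs that occur vanish outside a
cube, and finite sums of waves can be differentiated term by term.\<close>

definition fmult :: "(int^'d \<Rightarrow> real) \<Rightarrow> nat \<Rightarrow> (real^'d \<Rightarrow> real^'n) \<Rightarrow> real^'d \<Rightarrow> real^'n" where
  "fmult m N f = rtp (cube N) (\<lambda>k. m k *\<^sub>R fourier_coeff f k)"

lemma lowpass_fmult: "lowpass N f = fmult (\<lambda>_. 1) N f"
  by (simp add: lowpass_rtp fmult_def)

lemma C1_torus_fmult: "C1_torus (fmult m N f)"
  unfolding fmult_def by (rule C1_torus_rtp)

lemma continuous_fmult: "continuous_on UNIV (fmult m N f)"
  by (rule C1_torus_continuous[OF C1_torus_fmult])

lemma scaleR_vec_nth: "(r *\<^sub>R (v :: complex^'n)) $ a = of_real r * v $ a"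
  by (simp add: complex_eq_iff)

lemma fmult_nth: "fmult m N f x $ a = Re (\<Sum>k\<in>cube N. of_real (m k) * fourier_coeff f k $ a * wave k x)"
  by (simp only: fmult_def rtp_nth scaleR_vec_nth)

lemma fmult_matrix:
  fixes f :: "real^'d \<Rightarrow> real^'n" and B :: "real^'n^'m"
  assumes "continuous_on UNIV f"
  shows "fmult m N (\<lambda>x. B *v f x) x = B *v fmult m N f x"
proof -
  have "(\<Sum>k\<in>cube N. of_real (m k) * (\<Sum>b\<in>UNIV. of_real (B $ a $ b) * fourier_coeff f k $ b) * wave k x)
     = (\<Sum>b\<in>UNIV. of_real (B $ a $ b) * (\<Sum>k\<in>cube N. of_real (m k) * fourier_coeff f k $ b * wave k x))" for a
    unfolding sum_distrib_right sum_distrib_left by (subst sum.swap) (simp add: mult_ac)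
  then have "fmult m N (\<lambda>x. B *v f x) x $ a = Re (\<Sum>b\<in>UNIV. of_real (B $ a $ b) * (\<Sum>k\<in>cube N. of_real (m k) * fourier_coeff f k $ b * wave k x))" for a
    by (simp only: fmult_nth fourier_coeff_matrix[OF assms])
  moreover have "(B *v fmult m N f x) $ a = (\<Sum>b\<in>UNIV. B $ a $ b * Re (\<Sum>k\<in>cube N. of_real (m k) * fourier_coeff f k $ b * wave k x))" for a
    by (simp only: fmult_nth matrix_vector_mult_def vec_lambda_beta)
  moreover have "Re (of_real r * z) = r * Re z" for r z by simp
  ultimately show ?thesis
    by (simp only: vec_eq_iff Re_sum[of _ UNIV] simp_thms)
qed

lemma fourier_coeff_sum:
  fixes f :: "'i \<Rightarrow> real^'d \<Rightarrow> real^'n"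
  assumes "\<And>i. i \<in> F \<Longrightarrow> continuous_on UNIV (f i)"
  shows "fourier_coeff (\<lambda>x. \<Sum>i\<in>F. f i x) k = (\<Sum>i\<in>F. fourier_coeff (f i) k)"
proof (rule vec_eq_iff[THEN iffD2], rule allI)
  fix a
  have "fourier_coeff (\<lambda>x. \<Sum>i\<in>F. f i x) k $ a = fc (\<lambda>x. \<Sum>i\<in>F. of_real (f i x $ a)) k"
    by (subst fourier_coeff_fc) (auto intro!: continuous_on_sum assms)
  also have "\<dots> = (\<Sum>i\<in>F. fc (\<lambda>x. of_real (f i x $ a)) k)"
    by (rule fc_sum) (intro continuous_intros assms)
  also have "\<dots> = (\<Sum>i\<in>F. fourier_coeff (f i) k) $ a"
    by (simp add: fourier_coeff_fc assms)
  finally show "fourier_coeff (\<lambda>x. \<Sum>i\<in>F. f i x) k $ a = (\<Sum>i\<in>F. fourier_coeff (f i) k) $ a" .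
qed

lemma rtp_sum: "rtp F (\<lambda>k. \<Sum>i\<in>J. c i k) x = (\<Sum>i\<in>J. rtp F (c i) x)"
proof -
  have "(\<Sum>k\<in>F. (\<Sum>i\<in>J. c i k) $ a * wave k x) = (\<Sum>i\<in>J. \<Sum>k\<in>F. c i k $ a * wave k x)" for a
    unfolding sum_component sum_distrib_right by (rule sum.swap)
  then show ?thesis by (simp only: vec_eq_iff rtp_nth sum_component Re_sum[of _ J] simp_thms)
qed

lemma fmult_sum:
  assumes "\<And>i. i \<in> F \<Longrightarrow> continuous_on UNIV (f i)"
  shows "fmult m N (\<lambda>x. \<Sum>i\<in>F. f i x) x = (\<Sum>i\<in>F. fmult m N (f i) x)"
proof -
  have "(\<lambda>k. m k *\<^sub>R fourier_coeff (\<lambda>x. \<Sum>i\<in>F. f i x) k) = (\<lambda>k. \<Sum>i\<in>F. m k *\<^sub>R fourier_coeff (f i) k)"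
    by (rule ext) (simp only: fourier_coeff_sum[OF assms] scaleR_sum_right)
  then show ?thesis by (simp only: fmult_def rtp_sum)
qed

lemma fourier_coeff_fmult:
  assumes "continuous_on UNIV f" "\<And>k. m (- k) = m k"
  shows "fourier_coeff (fmult m N f) k = (if k \<in> cube N then m k *\<^sub>R fourier_coeff f k else 0)"
  unfolding fmult_def
  by (rule fourier_coeff_rtp) (use hermitian_fourier_coeff[OF assms(1)] assms(2) in \<open>auto simp: hermitian_def cube_minus\<close>)

lemma msq_fmult:
  assumes "continuous_on UNIV f" "\<And>k. m (- k) = m k"
  shows "msq (fmult m N f) = (\<Sum>k\<in>cube N. (m k)\<^sup>2 * (norm (fourier_coeff f k))\<^sup>2)"
proof -
  have "hermitian (\<lambda>k. m k *\<^sub>R fourier_coeff f k)"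
    using hermitian_fourier_coeff[OF assms(1)] assms(2) by (simp add: hermitian_def)
  then have "msq (fmult m N f) = (\<Sum>k\<in>cube N. (norm (m k *\<^sub>R fourier_coeff f k))\<^sup>2)"
    unfolding fmult_def by (rule msq_rtp_hermitian) (auto simp: cube_minus)
  then show ?thesis by (simp add: power_mult_distrib)
qed

lemma fc_continuous_in_time:
  fixes g :: "real \<Rightarrow> real^'d \<Rightarrow> complex"
  assumes "continuous_on (I \<times> UNIV) (\<lambda>(t, x). g t x)"
  shows "continuous_on I (\<lambda>t. fc (g t) k)"
proof -
  have "continuous_on (I \<times> UNIV) (\<lambda>z. g (fst z) (snd z) * wave (- k) (snd z))"
    using assms by (intro continuous_intros) (simp add: case_prod_unfold)
  then have "continuous_on (I \<times> cbox 0 (\<chi> j. 2 * pi)) (\<lambda>(t, x). g t x * wave (- k) x)"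
    by (rule continuous_on_subset[of "I \<times> UNIV", THEN continuous_on_eq]) auto
  from integral_continuous_on_param[OF this] show ?thesis
    unfolding fc_def tmean_def torus_cell_def by (intro continuous_intros)
qed

lemma fourier_coeff_continuous_in_time:
  fixes u :: "real \<Rightarrow> real^'d \<Rightarrow> real^'n"
  assumes "continuous_on (I \<times> UNIV) (\<lambda>(t, x). u t x)"
  shows "continuous_on I (\<lambda>t. fourier_coeff (u t) k $ a)"
proof -
  have "continuous_on I (\<lambda>t. fc (\<lambda>x. of_real (u t x $ a)) k)"
  proof (rule fc_continuous_in_time)
    have "continuous_on (I \<times> UNIV) (\<lambda>z. complex_of_real ((\<lambda>(t, x). u t x) z $ a))"
      by (intro continuous_intros assms)
    then show "continuous_on (I \<times> UNIV) (\<lambda>(t, x). complex_of_real (u t x $ a))"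
      by (simp add: case_prod_unfold)
  qed
  then show ?thesis
    by (rule continuous_on_eq) (simp add: fourier_coeff_fc continuous_on_slice[OF assms])
qed

lemma fmult_jointly_continuous:
  fixes u :: "real \<Rightarrow> real^'d \<Rightarrow> real^'n"
  assumes "continuous_on (I \<times> UNIV) (\<lambda>(t, x). u t x)"
  shows "continuous_on (I \<times> UNIV) (\<lambda>(t, x). fmult m N (u t) x)"
proof -
  have "continuous_on (I \<times> UNIV) (\<lambda>z. fourier_coeff (u (fst z)) k $ a)" for k :: "int^'d" and a
    by (rule continuous_on_compose2[OF fourier_coeff_continuous_in_time[OF assms]])
       (auto intro: continuous_on_fst continuous_on_id)
  then have "continuous_on (I \<times> UNIV) (\<lambda>z. \<chi> a. Re (\<Sum>k\<in>cube N. of_real (m k) * fourier_coeff (u (fst z)) k $ a * wave k (snd z)))"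
    by (intro continuous_on_vec_lambda continuous_on_Re continuous_on_sum continuous_on_mult continuous_on_const
          continuous_wave continuous_on_snd continuous_on_id)
  moreover have "fmult m N f x = (\<chi> a. Re (\<Sum>k\<in>cube N. of_real (m k) * fourier_coeff f k $ a * wave k x))" for f :: "real^'d \<Rightarrow> real^'n" and x
    by (simp only: vec_eq_iff fmult_nth vec_lambda_beta simp_thms)
  ultimately show ?thesis by (simp only: case_prod_unfold)
qed

lemma fourier_coeff_has_vector_derivative:
  fixes u u' :: "real \<Rightarrow> real^'d \<Rightarrow> real^'n"
  assumes I: "open I" "convex I" "t \<in> I"
    and d: "\<And>t x. t \<in> I \<Longrightarrow> ((\<lambda>\<tau>. u \<tau> x) has_vector_derivative u' t x) (at t)"
    and c: "continuous_on (I \<times> UNIV) (\<lambda>(t, x). u t x)" "continuous_on (I \<times> UNIV) (\<lambda>(t, x). u' t x)"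
  shows "((\<lambda>\<tau>. fourier_coeff (u \<tau>) k $ a) has_vector_derivative fourier_coeff (u' t) k $ a) (at t)"
proof -
  have bl: "bounded_linear (\<lambda>v::real^'n. complex_of_real (v $ a) * wave (- k) x)" for x :: "real^'d"
    by (intro bounded_linear_mult_const bounded_linear_compose[OF bounded_linear_of_real] bounded_linear_vec_nth)
  have "((\<lambda>\<tau>. fc (\<lambda>x. of_real (u \<tau> x $ a)) k) has_vector_derivative fc (\<lambda>x. of_real (u' t x $ a)) k) (at t within I)"
    unfolding fc_def
  proof (rule tmean_has_vector_derivative[where f = "\<lambda>t x. of_real (u t x $ a) * wave (- k) x" and f' = "\<lambda>t x. of_real (u' t x $ a) * wave (- k) x"])
    show "((\<lambda>\<tau>. complex_of_real (u \<tau> x $ a) * wave (- k) x) has_vector_derivative complex_of_real (u' t x $ a) * wave (- k) x) (at t within I)"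
      if "t \<in> I" for t x
      by (rule bounded_linear.has_vector_derivative[OF bl]) (rule has_vector_derivative_at_within[OF d[OF that]])
    show "continuous_on UNIV (\<lambda>x. complex_of_real (u t x $ a) * wave (- k) x)" if "t \<in> I" for t
      by (intro continuous_intros continuous_on_slice[OF c(1) that])
    have "continuous_on (I \<times> UNIV) (\<lambda>z. complex_of_real ((\<lambda>(t, x). u' t x) z $ a) * wave (- k) (snd z))"
      by (intro continuous_intros c)
    then show "continuous_on (I \<times> UNIV) (\<lambda>(t, x). complex_of_real (u' t x $ a) * wave (- k) x)"
      by (simp add: case_prod_unfold)
  qed (use I in auto)
  then have "((\<lambda>\<tau>. fc (\<lambda>x. of_real (u \<tau> x $ a)) k) has_vector_derivative fc (\<lambda>x. of_real (u' t x $ a)) k) (at t)"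
    by (simp only: at_within_open[OF I(3,1)])
  then have "((\<lambda>\<tau>. fourier_coeff (u \<tau>) k $ a) has_vector_derivative fc (\<lambda>x. of_real (u' t x $ a)) k) (at t)"
    by (rule has_vector_derivative_transform_within_open[OF _ I(1,3)])
       (simp add: fourier_coeff_fc continuous_on_slice[OF c(1)])
  then show ?thesis by (simp add: fourier_coeff_fc continuous_on_slice[OF c(2) I(3)])
qed

lemma has_vector_derivative_vec_nthI:
  fixes f :: "real \<Rightarrow> real^'n"
  assumes "\<And>a. ((\<lambda>x. f x $ a) has_vector_derivative (f' $ a)) (at x)"
  shows "(f has_vector_derivative f') (at x)"
  using assms unfolding has_vector_derivative_def by (intro has_derivative_vec_nthI) simp

lemma fmult_has_vector_derivative:
  fixes u u' :: "real \<Rightarrow> real^'d \<Rightarrow> real^'n"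
  assumes I: "open I" "convex I" "t \<in> I"
    and d: "\<And>t x. t \<in> I \<Longrightarrow> ((\<lambda>\<tau>. u \<tau> x) has_vector_derivative u' t x) (at t)"
    and c: "continuous_on (I \<times> UNIV) (\<lambda>(t, x). u t x)" "continuous_on (I \<times> UNIV) (\<lambda>(t, x). u' t x)"
  shows "((\<lambda>\<tau>. fmult m N (u \<tau>) x) has_vector_derivative fmult m N (u' t) x) (at t)"
proof (rule has_vector_derivative_vec_nthI)
  fix a
  have "((\<lambda>\<tau>. Re (\<Sum>k\<in>cube N. of_real (m k) * fourier_coeff (u \<tau>) k $ a * wave k x)) has_vector_derivative
      Re (\<Sum>k\<in>cube N. of_real (m k) * fourier_coeff (u' t) k $ a * wave k x)) (at t)"
    by (intro bounded_linear.has_vector_derivative[OF bounded_linear_Re] has_vector_derivative_sum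
        has_vector_derivative_mult_left has_vector_derivative_mult_right fourier_coeff_has_vector_derivative[OF I d c])
  then show "((\<lambda>\<tau>. fmult m N (u \<tau>) x $ a) has_vector_derivative fmult m N (u' t) x $ a) (at t)"
    by (simp only: fmult_nth)
qed

section \<open>The commutator of the cutoff with a matrix flux\<close>

lemma tame_partial_derivative_wiener:
  fixes u :: "real^'d \<Rightarrow> real^'n"
  assumes u: "C1_torus u" "wiener_bound \<alpha> (\<lambda>x. of_real (u x $ a))"
  shows "(\<lambda>x. of_real (pd j u x $ a)) \<in> wiener"
    "fc (\<lambda>x. of_real (pd j u x $ a)) l = \<i> * of_int (l $ j) * fc (\<lambda>x. of_real (u x $ a)) l"
    "\<bar>pd j u x $ a\<bar> \<le> \<alpha>"
proof -
  have cu: "continuous_on UNIV u" "continuous_on UNIV (pd j u)"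
    using C1_torus_continuous[OF u(1)] C1_torus_pd_continuous[OF u(1)] by auto
  show f: "fc (\<lambda>x. of_real (pd j u x $ a)) l = \<i> * of_int (l $ j) * fc (\<lambda>x. of_real (u x $ a)) l" for l
    using fourier_coeff_pd[OF u(1), of j l a] by (simp add: fourier_coeff_fc cu)
  have le: "norm (fc (\<lambda>x. of_real (pd j u x $ a)) l) \<le> norm (freq l) * norm (fc (\<lambda>x. of_real (u x $ a)) l)" for l
  proof -
    have "\<bar>of_int (l $ j)\<bar> \<le> norm (freq l)" using component_le_norm_cart[of "freq l" j] by simp
    then show ?thesis unfolding f by (simp add: norm_mult mult_right_mono)
  qed
  note w = wiener_bound_coeffs[OF u(2)]
  have sm: "(\<lambda>k. norm (fc (\<lambda>x. complex_of_real (pd j u x $ a)) k)) summable_on UNIV"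
    by (rule summable_on_comparison_test[OF w(3)]) (use le in auto)
  have per: "torus_periodic (pd j u)"
  proof -
    have "frechet_derivative u (at (x + axis i (2 * pi))) = frechet_derivative u (at x)" for x i
    proof -
      have "(u has_derivative frechet_derivative u (at (x + axis i (2 * pi)))) (at (x + axis i (2 * pi)))"
        by (rule C1_torus_has_derivative[OF u(1)])
      then have "((\<lambda>y. u (y + axis i (2 * pi))) has_derivative (\<lambda>h. frechet_derivative u (at (x + axis i (2 * pi))) h)) (at x)"
        by (rule has_derivative_compose[rotated]) (auto intro!: derivative_eq_intros)
      moreover have "(\<lambda>y. u (y + axis i (2 * pi))) = u"
        using C1_torus_periodic[OF u(1)] by (simp add: torus_periodic_def fun_eq_iff)
      ultimately have "(u has_derivative frechet_derivative u (at (x + axis i (2 * pi)))) (at x)" by simp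
      then show ?thesis by (metis frechet_derivative_at)
    qed
    then show ?thesis by (simp add: torus_periodic_def pd_def)
  qed
  show W: "(\<lambda>x. of_real (pd j u x $ a)) \<in> wiener"
    using sm per by (auto simp: wiener_def torus_periodic_def intro!: continuous_intros cu)
  have "norm (complex_of_real (pd j u x $ a)) \<le> (\<Sum>\<^sub>\<infinity>k. norm (fc (\<lambda>x. complex_of_real (pd j u x $ a)) k))"
    by (rule wiener_norm_le[OF W])
  also have "\<dots> \<le> (\<Sum>\<^sub>\<infinity>k. norm (freq k) * norm (fc (\<lambda>x. of_real (u x $ a)) k))"
    by (rule infsum_mono[OF sm w(3) le])
  finally show "\<bar>pd j u x $ a\<bar> \<le> \<alpha>" using w(4) by simp
qed

lemma norm_sum_square_le_card:
  fixes z :: "'i \<Rightarrow> 'b::real_normed_vector"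
  shows "(norm (\<Sum>i\<in>F. z i))\<^sup>2 \<le> real (card F) * (\<Sum>i\<in>F. (norm (z i))\<^sup>2)"
proof -
  have "(norm (\<Sum>i\<in>F. z i))\<^sup>2 \<le> (\<Sum>i\<in>F. norm (z i))\<^sup>2"
    by (intro power_mono norm_sum) auto
  also have "\<dots> \<le> real (card F) * (\<Sum>i\<in>F. (norm (z i))\<^sup>2)"
    using weighted_sum_square_le[of "\<lambda>_. 1" "\<lambda>i. norm (z i)" F] by simp
  finally show ?thesis .
qed

lemma fourier_coeff_matrix_product:
  fixes f :: "real^'d \<Rightarrow> real^'n" and B :: "real^'d \<Rightarrow> real^'n^'m"
  assumes "continuous_on UNIV f" "continuous_on UNIV B"
  shows "fourier_coeff (\<lambda>x. B x *v f x) k $ a = (\<Sum>b\<in>UNIV. fc (\<lambda>x. of_real (f x $ b) * of_real (B x $ a $ b)) k)"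
proof -
  have "fourier_coeff (\<lambda>x. B x *v f x) k $ a = fc (\<lambda>x. \<Sum>b\<in>UNIV. of_real (f x $ b) * of_real (B x $ a $ b)) k"
    unfolding fourier_coeff_fc[OF continuous_matrix_vector[OF assms(2,1)]]
    by (simp add: matrix_vector_mult_def mult.commute)
  also have "\<dots> = (\<Sum>b\<in>UNIV. fc (\<lambda>x. of_real (f x $ b) * of_real (B x $ a $ b)) k)"
    by (rule fc_sum) (intro continuous_intros assms)
  finally show ?thesis .
qed

text \<open>The scalar commutator bound, summed over the entries of the matrix. The sharp filter is harmless:
it only removes frequencies of the commutator outside the cube.\<close>

lemma cutoff_flux_commutator:
  fixes u :: "real^'d \<Rightarrow> real^'n" and B :: "real^'d \<Rightarrow> real^'n^'n"
  assumes u: "C1_torus u" and B: "continuous_on UNIV B" and \<rho>: "0 < \<rho>" "\<rho> \<le> real N"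
    and tu: "\<And>a. tame s \<alpha> b (\<lambda>x. of_real (u x $ a))" and tB: "\<And>a c. tame s \<alpha> b (\<lambda>x. of_real (B x $ a $ c))"
  shows "msq (\<lambda>x. lowpass N (\<lambda>x. B x *v pd j (fmult (cutoff \<rho>) N u) x) x - fmult (cutoff \<rho>) N (\<lambda>x. B x *v pd j u x) x)
     \<le> real CARD('n) ^ 3 * (34 * 4 powr (2 * s) * \<alpha>\<^sup>2 * b * \<rho> powr (- 2 * s))"
proof -
  let ?V = "fmult (cutoff \<rho>) N u"
  let ?D = "34 * 4 powr (2 * s) * \<alpha>\<^sup>2 * b * \<rho> powr (- 2 * s)"
  let ?c = "\<lambda>k. fourier_coeff (\<lambda>x. B x *v pd j ?V x) k - cutoff \<rho> k *\<^sub>R fourier_coeff (\<lambda>x. B x *v pd j u x) k"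
  have cu: "continuous_on UNIV u" "continuous_on UNIV (pd j u)"
    using C1_torus_continuous[OF u] C1_torus_pd_continuous[OF u] by auto
  have cV: "continuous_on UNIV (pd j ?V)" by (rule C1_torus_pd_continuous[OF C1_torus_fmult])
  have out: "cutoff \<rho> l = 0" if "l \<notin> cube N" for l :: "int^'d"
  proof (rule cutoff_eq_0[OF \<rho>(1)])
    show "\<rho> \<le> norm (freq l)" using in_cube[of l N] that \<rho>(2) by linarith
  qed
  have fV: "fc (\<lambda>x. of_real (pd j ?V x $ a)) l = \<i> * of_int (l $ j) * (of_real (cutoff \<rho> l) * fc (\<lambda>x. of_real (u x $ a)) l)" for l a
  proof -
    have "fc (\<lambda>x. of_real (pd j ?V x $ a)) l = \<i> * of_int (l $ j) * fourier_coeff ?V l $ a"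
      using fourier_coeff_pd[OF C1_torus_fmult[of "cutoff \<rho>" N u], of j l a] by (simp add: fourier_coeff_fc cV)
    moreover have "fourier_coeff ?V l = cutoff \<rho> l *\<^sub>R fourier_coeff u l"
      by (auto simp: fourier_coeff_fmult[OF cu(1)] out)
    ultimately show ?thesis by (simp only: fourier_coeff_fc[OF cu(1)] scaleR_vec_nth)
  qed
  have wV: "(\<lambda>x. of_real (pd j ?V x $ a)) \<in> wiener" for a
  proof -
    have "(\<lambda>k. norm (fc (\<lambda>x. complex_of_real (pd j ?V x $ a)) k)) summable_on UNIV"
      unfolding fV
    proof (rule finite_nonzero_values_imp_summable_on, rule finite_subset[OF _ finite_cube[of N]])
      show "{x \<in> UNIV. cmod (\<i> * of_int (x $ j) * (of_real (cutoff \<rho> x) * fc (\<lambda>x. of_real (u x $ a)) x)) \<noteq> 0} \<subseteq> cube N"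
        using out by fastforce
    qed
    moreover have "torus_periodic (pd j ?V)"
      unfolding fmult_def C1_torus_rtp(2) by (rule C1_torus_periodic[OF C1_torus_rtp(1)])
    ultimately show ?thesis by (auto simp: wiener_def torus_periodic_def intro!: continuous_intros cV)
  qed
  have pu: "wiener_bound \<alpha> (\<lambda>x. of_real (u x $ a))" for a using tu by (simp add: tame_def)
  have sc: "(\<Sum>k\<in>cube N. (norm (fc (\<lambda>x. of_real (pd j ?V x $ c) * of_real (B x $ a $ c)) k
      - of_real (cutoff \<rho> k) * fc (\<lambda>x. of_real (pd j u x $ c) * of_real (B x $ a $ c)) k))\<^sup>2) \<le> ?D" for a c
    by (rule commutator_bound[OF tB tu \<rho>(1) wV fV tame_partial_derivative_wiener(1,2)[OF u pu]]) auto
  have "msq (\<lambda>x. lowpass N (\<lambda>x. B x *v pd j ?V x) x - fmult (cutoff \<rho>) N (\<lambda>x. B x *v pd j u x) x) = msq (rtp (cube N) ?c)"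
    by (rule arg_cong[where f = msq]) (simp add: fun_eq_iff lowpass_rtp fmult_def rtp_diff)
  also have "\<dots> \<le> (\<Sum>k\<in>cube N. (norm (?c k))\<^sup>2)" by (rule msq_rtp_le) simp
  also have "\<dots> \<le> (\<Sum>k\<in>cube N. \<Sum>a\<in>UNIV. real CARD('n) * (\<Sum>c\<in>UNIV. (norm (fc (\<lambda>x. of_real (pd j ?V x $ c) * of_real (B x $ a $ c)) k
      - of_real (cutoff \<rho> k) * fc (\<lambda>x. of_real (pd j u x $ c) * of_real (B x $ a $ c)) k))\<^sup>2))"
  proof (rule sum_mono)
    fix k
    have "?c k $ a = (\<Sum>c\<in>UNIV. fc (\<lambda>x. of_real (pd j ?V x $ c) * of_real (B x $ a $ c)) k
      - of_real (cutoff \<rho> k) * fc (\<lambda>x. of_real (pd j u x $ c) * of_real (B x $ a $ c)) k)" for a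
      by (simp add: fourier_coeff_matrix_product[OF cV B] fourier_coeff_matrix_product[OF cu(2) B]
          sum_subtractf sum_distrib_left scaleR_vec_nth del: vector_scaleR_component)
    then show "(norm (?c k))\<^sup>2 \<le> (\<Sum>a\<in>UNIV. real CARD('n) * (\<Sum>c\<in>UNIV. (norm (fc (\<lambda>x. of_real (pd j ?V x $ c) * of_real (B x $ a $ c)) k
      - of_real (cutoff \<rho> k) * fc (\<lambda>x. of_real (pd j u x $ c) * of_real (B x $ a $ c)) k))\<^sup>2))"
      unfolding norm_vec_square by (intro sum_mono) (simp only: norm_sum_square_le_card)
  qed
  also have "\<dots> = (\<Sum>a\<in>UNIV. real CARD('n) * (\<Sum>c\<in>UNIV. \<Sum>k\<in>cube N. (norm (fc (\<lambda>x. of_real (pd j ?V x $ c) * of_real (B x $ a $ c)) k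
      - of_real (cutoff \<rho> k) * fc (\<lambda>x. of_real (pd j u x $ c) * of_real (B x $ a $ c)) k))\<^sup>2))"
    by (subst sum.swap, intro sum.cong refl) (simp add: sum_distrib_left[symmetric] sum.swap[of _ "cube N"])
  also have "\<dots> \<le> (\<Sum>a\<in>(UNIV::'n set). real CARD('n) * (\<Sum>c\<in>(UNIV::'n set). ?D))"
    by (intro sum_mono mult_left_mono sc) auto
  also have "\<dots> = real CARD('n) ^ 3 * ?D"
    by (simp add: power3_eq_cube)
  finally show ?thesis .
qed

section \<open>Sobolev norms\<close>

lemma sobolev_finite_sum:
  assumes "f \<in> sobolev s" "finite F"
  shows "(\<Sum>k\<in>F. japanese_bracket k powr (2 * s) * (norm (fourier_coeff f k))\<^sup>2) \<le> (sobolev_norm s f)\<^sup>2"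
proof -
  let ?g = "\<lambda>k. japanese_bracket k powr (2 * s) * (norm (fourier_coeff f k))\<^sup>2"
  have "?g summable_on UNIV" using assms(1) by (simp add: sobolev_def)
  then have "sum ?g F \<le> infsum ?g UNIV"
    by (rule finite_sum_le_infsum) (use assms(2) in auto)
  moreover have "(sobolev_norm s f)\<^sup>2 = infsum ?g UNIV"
    by (simp add: sobolev_norm_def infsum_nonneg)
  ultimately show ?thesis by simp
qed

lemma sobolev_norm_nonneg: "0 \<le> sobolev_norm s f"
  by (simp add: sobolev_norm_def infsum_nonneg)

lemma sobolev_norm_leI:
  assumes "\<And>F. finite F \<Longrightarrow> (\<Sum>k\<in>F. japanese_bracket k powr (2 * s) * (norm (fourier_coeff f k))\<^sup>2) \<le> c\<^sup>2" "0 \<le> c"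
  shows "sobolev_norm s f \<le> c"
proof -
  let ?g = "\<lambda>k. japanese_bracket k powr (2 * s) * (norm (fourier_coeff f k))\<^sup>2"
  have "?g summable_on UNIV"
    by (rule nonneg_bdd_above_summable_on) (use assms(1) in \<open>auto intro!: bdd_aboveI2\<close>)
  then have "infsum ?g UNIV \<le> c\<^sup>2"
    by (rule infsum_le_finite_sums) (use assms(1) in auto)
  then show ?thesis
    using assms(2) by (simp add: sobolev_norm_def real_le_lsqrt infsum_nonneg)
qed

lemma norm_fourier_coeff_nth_le: "norm (fourier_coeff f k $ a) \<le> norm (fourier_coeff f k)"
  by (rule Finite_Cartesian_Product.norm_nth_le)

lemma sobolev_component_sum:
  assumes "f \<in> sobolev s" "continuous_on UNIV f" "finite F"
  shows "(\<Sum>k\<in>F. japanese_bracket k powr (2 * s) * (norm (fc (\<lambda>x. of_real (f x $ a)) k))\<^sup>2) \<le> (sobolev_norm s f)\<^sup>2"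
proof -
  have "(\<Sum>k\<in>F. japanese_bracket k powr (2 * s) * (norm (fc (\<lambda>x. of_real (f x $ a)) k))\<^sup>2)
     \<le> (\<Sum>k\<in>F. japanese_bracket k powr (2 * s) * (norm (fourier_coeff f k))\<^sup>2)"
    unfolding fourier_coeff_fc[OF assms(2), symmetric]
    by (intro sum_mono mult_left_mono power_mono norm_fourier_coeff_nth_le) auto
  then show ?thesis using sobolev_finite_sum[OF assms(1,3)] by linarith
qed

lemma tail_bound_component:
  assumes "tail_bound s b (fourier_coeff f)" "continuous_on UNIV f"
  shows "tail_bound s b (fc (\<lambda>x. of_real (f x $ a)))"
  unfolding tail_bound_def
proof (intro allI impI)
  fix \<rho> :: real and F :: "(int^'a) set" assume "0 < \<rho>" "finite F" "\<forall>k\<in>F. \<rho> < norm (freq k)"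
  then have "(\<Sum>k\<in>F. (norm (fourier_coeff f k))\<^sup>2) \<le> b * \<rho> powr (- 2 * s)"
    by (intro tail_boundD[OF assms(1)]) auto
  moreover have "(\<Sum>k\<in>F. (norm (fc (\<lambda>x. of_real (f x $ a)) k))\<^sup>2) \<le> (\<Sum>k\<in>F. (norm (fourier_coeff f k))\<^sup>2)"
    unfolding fourier_coeff_fc[OF assms(2), symmetric]
    by (intro sum_mono power_mono norm_fourier_coeff_nth_le) auto
  ultimately show "(\<Sum>k\<in>F. (norm (fc (\<lambda>x. of_real (f x $ a)) k))\<^sup>2) \<le> b * \<rho> powr (- 2 * s)" by linarith
qed

lemma norm_le_card_components:
  fixes v :: "real^'m"
  assumes "\<And>a. \<bar>v $ a\<bar> \<le> r"
  shows "norm v \<le> real CARD('m) * r"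
proof -
  have "norm v \<le> (\<Sum>a\<in>UNIV. \<bar>v $ a\<bar>)" by (rule norm_le_l1_cart)
  also have "\<dots> \<le> (\<Sum>a\<in>(UNIV::'m set). r)" by (intro sum_mono assms)
  finally show ?thesis by simp
qed

lemma msq_sum_le:
  fixes f :: "'i \<Rightarrow> real^'d \<Rightarrow> real^'n"
  assumes "\<And>i. i \<in> F \<Longrightarrow> continuous_on UNIV (f i)"
  shows "msq (\<lambda>x. \<Sum>i\<in>F. f i x) \<le> real (card F) * (\<Sum>i\<in>F. msq (f i))"
proof -
  have c: "continuous_on UNIV (\<lambda>x. (norm (f i x))\<^sup>2)" if "i \<in> F" for i
    by (intro continuous_intros assms that)
  have "msq (\<lambda>x. \<Sum>i\<in>F. f i x) \<le> tmean (\<lambda>x. real (card F) * (\<Sum>i\<in>F. (norm (f i x))\<^sup>2))"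
    unfolding msq_def by (intro tmean_mono continuous_intros assms norm_sum_square_le_card)
  also have "\<dots> = real (card F) * (\<Sum>i\<in>F. msq (f i))"
    unfolding msq_def by (simp add: tmean_cmult tmean_sum continuous_on_sum c)
  finally show ?thesis .
qed

lemma msq_diff_le:
  fixes f g :: "real^'d \<Rightarrow> real^'n"
  assumes f: "continuous_on UNIV f" and g: "continuous_on UNIV g"
  shows "msq (\<lambda>x. f x - g x) \<le> 2 * msq f + 2 * msq g"
proof -
  have c: "continuous_on UNIV (\<lambda>x. 2 * (norm (f x))\<^sup>2)" "continuous_on UNIV (\<lambda>x. 2 * (norm (g x))\<^sup>2)"
    by (intro continuous_intros f g)+
  have "msq (\<lambda>x. f x - g x) \<le> tmean (\<lambda>x. 2 * (norm (f x))\<^sup>2 + 2 * (norm (g x))\<^sup>2)"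
    unfolding msq_def
  proof (rule tmean_mono)
    show "(norm (f x - g x))\<^sup>2 \<le> 2 * (norm (f x))\<^sup>2 + 2 * (norm (g x))\<^sup>2" for x
      using norm_sum_square_le[of "f x" "- g x"] by simp
  qed (intro continuous_intros f g)+
  also have "\<dots> = 2 * msq f + 2 * msq g"
    unfolding msq_def tmean_add[OF c] by (simp add: tmean_cmult continuous_on_power continuous_on_norm f g)
  finally show ?thesis .
qed

lemma msq_add_le:
  fixes f g :: "real^'d \<Rightarrow> real^'n"
  assumes f: "continuous_on UNIV f" and g: "continuous_on UNIV g"
  shows "msq (\<lambda>x. f x + g x) \<le> 2 * msq f + 2 * msq g"
proof -
  have "msq (\<lambda>x. - g x) = msq g" by (simp add: msq_def)
  then show ?thesis using msq_diff_le[OF f continuous_on_minus[OF g]] by simp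
qed

section \<open>Symmetrisable systems in a bounded regime\<close>

locale symmetrizable =
  fixes A :: "'d::finite \<Rightarrow> real^'n::finite \<Rightarrow> real^'n^'n"
    and S :: "real^'n \<Rightarrow> real^'n^'n"
    and S0 :: "'d \<Rightarrow> real^'n^'n"
    and \<U> :: "(real^'n) set"
    and s :: real
  assumes A_poly: "\<And>j a b. real_polynomial_function (\<lambda>u. A j u $ a $ b)"
    and S_poly: "\<And>a b. real_polynomial_function (\<lambda>u. S u $ a $ b)"
    and S_pos: "\<And>u. u \<in> \<U> \<Longrightarrow> sym_pos_def (S u)"
    and S0_sym: "\<And>j. transpose (S0 j) = S0 j"
    and A_eq: "\<And>j u. u \<in> \<U> \<Longrightarrow> A j u = S0 j ** S u"
    and s_large: "s > real CARD('d) / 2 + 1"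

text \<open>The constants of the problem on a compact set \<open>K\<close> of states and for functions with Wiener norms
  at most \<open>\<alpha>\<close>.\<close>

locale bounded_regime = symmetrizable A S S0 \<U> s
  for A :: "'d::finite \<Rightarrow> real^'n::finite \<Rightarrow> real^'n^'n" and S S0 \<U> s +
  fixes K :: "(real^'n) set" and S' :: "real^'n \<Rightarrow> ((real^'n) \<Rightarrow>\<^sub>L (real^'n^'n))"
    and \<alpha> c0 \<beta> \<gamma> \<sigma> CS \<Lambda>A :: real
  assumes K_sub: "K \<subseteq> \<U>"
    and S'_der: "\<And>u. (S has_derivative blinfun_apply (S' u)) (at u)" and S'_cont: "continuous_on UNIV S'"
    and pos: "0 < c0" "0 \<le> \<beta>" "0 \<le> \<gamma>" "0 \<le> \<sigma>" "0 \<le> CS" "0 \<le> \<alpha>" "0 \<le> \<Lambda>A"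
    and S0_bound: "\<And>j v. norm (S0 j *v v) \<le> \<sigma> * norm v"
    and S_coercive: "\<And>u v. u \<in> K \<Longrightarrow> c0 * (norm v)\<^sup>2 \<le> v \<bullet> (S u *v v)"
    and S_bound: "\<And>u v. u \<in> K \<Longrightarrow> norm (S u *v v) \<le> \<beta> * norm v"
    and S'_bound: "\<And>u h v. u \<in> K \<Longrightarrow> norm (S' u h *v v) \<le> \<gamma> * norm h * norm v"
    and S_tame: "\<And>b (u :: real^'d \<Rightarrow> real^'n) a c. 0 \<le> b \<Longrightarrow> (\<And>a. tame s \<alpha> b (\<lambda>x. of_real (u x $ a)))
        \<Longrightarrow> tame s CS (CS * b) (\<lambda>x. of_real (S (u x) $ a $ c))"
    and A_lipschitz: "\<And>j u w v. u \<in> K \<Longrightarrow> norm w \<le> real CARD('n) * \<alpha> + 1 \<Longrightarrow>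
        norm ((A j w - A j u) *v v) \<le> \<Lambda>A * norm (w - u) * norm v"
begin

text \<open>A common bound of \<open>S(U)\<close> and of its first derivatives in space and in time; the time derivative is
expressed by the equation.\<close>

definition "\<beta>' = \<beta> + \<gamma> * (real CARD('n) * \<alpha>) * (1 + real CARD('d) * \<sigma> * \<beta>)"
definition "rate = 2 * real CARD('d) * (1 + \<sigma>\<^sup>2) * \<beta>'\<^sup>2 + 2 * \<beta>'\<^sup>2 + 1"

definition "comm_const = real CARD('n) ^ 3 * (34 * 4 powr (2 * s) * (max \<alpha> CS)\<^sup>2 * (1 + CS))"

definition flux :: "'d \<Rightarrow> (real^'d \<Rightarrow> real^'n) \<Rightarrow> (real^'d \<Rightarrow> real^'n) \<Rightarrow> real^'d \<Rightarrow> real^'n" where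
  "flux j u v x = S (u x) *v pd j v x"

definition rhs :: "(real^'d \<Rightarrow> real^'n) \<Rightarrow> real^'d \<Rightarrow> real^'n" where
  "rhs u x = - (\<Sum>j\<in>UNIV. S0 j *v flux j u u x)"

lemma s_pos: "0 < s"
proof -
  have "0 < real CARD('d)" by simp
  then show ?thesis using s_large by linarith
qed

lemma beta'_ge: "\<beta> \<le> \<beta>'" "0 \<le> \<beta>'" "0 < rate"
proof -
  have "0 \<le> \<gamma> * (real CARD('n) * \<alpha>) * (1 + real CARD('d) * \<sigma> * \<beta>)"
    using pos by (intro mult_nonneg_nonneg add_nonneg_nonneg) auto
  then show "\<beta> \<le> \<beta>'" "0 \<le> \<beta>'" using pos by (auto simp: \<beta>'_def)
  show "0 < rate" unfolding rate_def
    by (intro add_nonneg_pos add_nonneg_nonneg mult_nonneg_nonneg) auto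
qed

lemma C1_torus_S:
  assumes "C1_torus (u :: real^'d \<Rightarrow> real^'n)"
  shows "C1_torus (\<lambda>x. S (u x))" "pd j (\<lambda>x. S (u x)) x = S' (u x) (pd j u x)"
proof -
  have d: "((\<lambda>x. S (u x)) has_derivative (\<lambda>h. S' (u x) (frechet_derivative u (at x) h))) (at x)" for x
    by (rule has_derivative_compose[OF C1_torus_has_derivative[OF assms] S'_der])
  show pd: "pd j (\<lambda>x. S (u x)) x = S' (u x) (pd j u x)" for j x
    using pd_eq[OF d] by (simp add: pd_def)
  have "continuous_on UNIV (\<lambda>x. S' (u x) (pd j u x))" for j
    by (intro continuous_intros continuous_on_compose2[OF S'_cont C1_torus_continuous[OF assms]]
       C1_torus_pd_continuous[OF assms]) auto
  then have "continuous_on UNIV (pd j (\<lambda>x. S (u x)))" for j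
    using pd by (simp cong: continuous_on_cong)
  moreover have "torus_periodic (\<lambda>x. S (u x))"
    using C1_torus_periodic[OF assms] by (simp add: torus_periodic_def)
  ultimately show "C1_torus (\<lambda>x. S (u x))"
    using d by (auto simp: C1_torus_def differentiable_def)
qed

lemma continuous_flux:
  "C1_torus u \<Longrightarrow> C1_torus v \<Longrightarrow> continuous_on UNIV (flux j u v)"
  unfolding flux_def[abs_def]
  by (intro continuous_matrix_vector C1_torus_continuous[OF C1_torus_S(1)] C1_torus_pd_continuous)

lemma continuous_rhs:
  assumes "C1_torus u"
  shows "continuous_on UNIV (rhs u)"
  unfolding rhs_def[abs_def]
  by (intro continuous_on_minus continuous_on_sum continuous_matrix_vector continuous_flux continuous_on_const assms)

lemma slice_bounds:
  assumes u: "C1_torus u" "\<And>x. u x \<in> K" "\<And>a. wiener_bound \<alpha> (\<lambda>x. of_real (u x $ a))"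
  shows "norm (pd j u x) \<le> real CARD('n) * \<alpha>"
    "norm (S (u x) *v v) \<le> \<beta>' * norm v"
    "norm (pd j (\<lambda>x. S (u x)) x *v v) \<le> \<beta>' * norm v"
    "norm (S' (u x) (rhs u x) *v v) \<le> \<beta>' * norm v"
proof -
  let ?P = "real CARD('n) * \<alpha>"
  show P: "norm (pd j u x) \<le> ?P" for j x
    by (rule norm_le_card_components) (rule tame_partial_derivative_wiener(3)[OF u(1,3)])
  have P0: "0 \<le> ?P" using pos by simp
  show "norm (S (u x) *v v) \<le> \<beta>' * norm v"
    using S_bound[OF u(2), of x v] mult_right_mono[OF beta'_ge(1), of "norm v"] by simp
  have nn: "0 \<le> real CARD('d) * \<sigma> * \<beta>" using pos by simp
  have main: "norm (S' (u x) h *v v) \<le> \<beta>' * norm v" if "norm h \<le> ?P * (1 + real CARD('d) * \<sigma> * \<beta>)" for h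
  proof -
    have "norm (S' (u x) h *v v) \<le> \<gamma> * norm h * norm v" by (rule S'_bound[OF u(2)])
    also have "\<dots> \<le> \<gamma> * (?P * (1 + real CARD('d) * \<sigma> * \<beta>)) * norm v"
      using pos by (intro mult_right_mono mult_left_mono that) auto
    also have "\<dots> \<le> \<beta>' * norm v"
      unfolding \<beta>'_def using pos by (intro mult_right_mono) (auto simp: mult.assoc)
    finally show ?thesis .
  qed
  have "?P * 1 \<le> ?P * (1 + real CARD('d) * \<sigma> * \<beta>)" by (intro mult_left_mono P0) (use nn in simp)
  then have q: "?P \<le> ?P * (1 + real CARD('d) * \<sigma> * \<beta>)" by (simp only: mult_1_right)
  show "norm (pd j (\<lambda>x. S (u x)) x *v v) \<le> \<beta>' * norm v"
    unfolding C1_torus_S(2)[OF u(1)] by (rule main[OF order_trans[OF P q]])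
  show "norm (S' (u x) (rhs u x) *v v) \<le> \<beta>' * norm v"
  proof (rule main)
    have "norm (rhs u x) \<le> (\<Sum>j\<in>(UNIV::'d set). \<sigma> * (\<beta> * ?P))"
      unfolding rhs_def norm_minus_cancel
    proof (rule order_trans[OF norm_sum sum_mono])
      fix j
      have "norm (S0 j *v flux j u u x) \<le> \<sigma> * norm (flux j u u x)" by (rule S0_bound)
      also have "\<dots> \<le> \<sigma> * (\<beta> * norm (pd j u x))"
        unfolding flux_def using pos by (intro mult_left_mono S_bound[OF u(2)]) auto
      also have "\<dots> \<le> \<sigma> * (\<beta> * ?P)" using pos by (intro mult_left_mono P) auto
      finally show "norm (S0 j *v flux j u u x) \<le> \<sigma> * (\<beta> * ?P)" .
    qed
    also have "\<dots> = ?P * (real CARD('d) * \<sigma> * \<beta>)" by simp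
    also have "\<dots> \<le> ?P * (1 + real CARD('d) * \<sigma> * \<beta>)" by (intro mult_left_mono P0) simp
    finally show "norm (rhs u x) \<le> ?P * (1 + real CARD('d) * \<sigma> * \<beta>)" .
  qed
qed

lemma commutator_msq:
  assumes u: "C1_torus u" "\<And>a. tame s \<alpha> b (\<lambda>x. of_real (u x $ a))" and \<rho>: "0 < \<rho>" "\<rho> \<le> real N"
  shows "msq (\<lambda>x. lowpass N (flux j u (fmult (cutoff \<rho>) N u)) x - fmult (cutoff \<rho>) N (flux j u u) x)
     \<le> comm_const * b * \<rho> powr (- 2 * s)"
proof -
  have b: "0 \<le> b" using u(2) tail_bound_nonneg unfolding tame_def by blast
  have le: "b \<le> (1 + CS) * b" "CS * b \<le> (1 + CS) * b"
    using b pos by (simp_all add: distrib_right)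
  have tu: "tame s (max \<alpha> CS) ((1 + CS) * b) (\<lambda>x. of_real (u x $ a))" for a
    by (rule tame_mono[OF u(2) _ le(1)]) simp
  have tS: "tame s (max \<alpha> CS) ((1 + CS) * b) (\<lambda>x. of_real (S (u x) $ a $ c))" for a c
    by (rule tame_mono[OF S_tame[OF b u(2)] _ le(2)]) simp
  show ?thesis
    using cutoff_flux_commutator[OF u(1) C1_torus_continuous[OF C1_torus_S(1)[OF u(1)]] \<rho> tu tS, of j]
    unfolding flux_def[abs_def] comm_const_def by (simp only: mult.assoc)
qed

end

lemma matrix_vector_neg: "(- B) *v v = - (B *v (v :: real^'n))"
  by (simp add: vec_eq_iff matrix_vector_mult_def sum_negf)

lemma fmult_symbol_diff: "fmult (\<lambda>k. m k - m' k) N f x = fmult m N f x - fmult m' N f x"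
  by (simp only: fmult_def rtp_diff scaleR_diff_left)

context bounded_regime
begin

lemma fmult_rhs:
  assumes "C1_torus u"
  shows "fmult m N (rhs u) x = - (\<Sum>j\<in>UNIV. S0 j *v fmult m N (flux j u u) x)"
proof -
  have "rhs u = (\<lambda>x. \<Sum>j\<in>UNIV. (- S0 j) *v flux j u u x)"
    by (simp add: fun_eq_iff rhs_def matrix_vector_neg sum_negf)
  then have "fmult m N (rhs u) x = fmult m N (\<lambda>x. \<Sum>j\<in>UNIV. (- S0 j) *v flux j u u x) x" by simp
  also have "\<dots> = (\<Sum>j\<in>UNIV. fmult m N (\<lambda>x. (- S0 j) *v flux j u u x) x)"
    by (rule fmult_sum) (intro continuous_matrix_vector continuous_on_const continuous_flux assms)
  also have "\<dots> = (\<Sum>j\<in>UNIV. (- S0 j) *v fmult m N (flux j u u) x)"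
    by (simp only: fmult_matrix[OF continuous_flux[OF assms assms]])
  finally show ?thesis by (simp add: matrix_vector_neg sum_negf)
qed

definition "G_const = 4 * (real CARD('d))\<^sup>2 * \<sigma>\<^sup>2 * comm_const"

lemma comm_const_nonneg: "0 \<le> comm_const" "0 \<le> G_const"
  using pos by (auto simp: comm_const_def G_const_def)

definition "a_rate = rate / c0"
definition "\<kappa> = a_rate + 2 * G_const / c0 + 1"
definition "C_tail = \<beta> * 2 powr (2 * s) / c0"

text \<open>The rate \<open>\<kappa>\<close> is chosen so large that the source in Gronwall's lemma contributes at most one half of
the tail constant that it comes from.\<close>

lemma kappa: "a_rate < \<kappa>" "0 \<le> a_rate" "G_const / (\<kappa> - a_rate) \<le> c0 / 2"
proof -
  have "0 \<le> 2 * G_const / c0" using comm_const_nonneg pos by simp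
  then show k: "a_rate < \<kappa>" by (simp add: \<kappa>_def)
  show "0 \<le> a_rate" using beta'_ge pos by (simp add: a_rate_def)
  have "G_const \<le> c0 / 2 * (\<kappa> - a_rate)"
    using pos comm_const_nonneg by (simp add: \<kappa>_def field_simps)
  then show "G_const / (\<kappa> - a_rate) \<le> c0 / 2"
    using k by (simp add: pos_divide_le_eq)
qed

lemma msq_matrix_sum_le:
  assumes "\<And>j. continuous_on UNIV (f j)" "\<And>j. msq (f j) \<le> B"
  shows "msq (\<lambda>x. \<Sum>j\<in>UNIV. S0 j *v f j x) \<le> (real CARD('d))\<^sup>2 * \<sigma>\<^sup>2 * B"
proof -
  have c: "continuous_on UNIV (\<lambda>x. S0 j *v f j x)" for j
    by (intro continuous_matrix_vector continuous_on_const assms)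
  have "msq (\<lambda>x. \<Sum>j\<in>UNIV. S0 j *v f j x) \<le> real CARD('d) * (\<Sum>j\<in>UNIV. msq (\<lambda>x. S0 j *v f j x))"
    by (rule msq_sum_le) (rule c)
  also have "\<dots> \<le> real CARD('d) * (\<Sum>j\<in>(UNIV::'d set). \<sigma>\<^sup>2 * B)"
  proof (intro mult_left_mono sum_mono)
    fix j
    have "msq (\<lambda>x. S0 j *v f j x) \<le> \<sigma>\<^sup>2 * msq (f j)" by (rule msq_le[OF c assms(1) S0_bound])
    also have "\<dots> \<le> \<sigma>\<^sup>2 * B" by (intro mult_left_mono assms) auto
    finally show "msq (\<lambda>x. S0 j *v f j x) \<le> \<sigma>\<^sup>2 * B" .
  qed auto
  finally show ?thesis by (simp add: power2_eq_square)
qed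

end

text \<open>A solution observed on a set \<open>J\<close> of times, of length at most \<open>L\<close>, on which it stays in \<open>K\<close>. The bound \<open>M\<close>
is where the iteration for the tails starts.\<close>

locale bounded_solution = bounded_regime A S S0 \<U> s K S' \<alpha> c0 \<beta> \<gamma> \<sigma> CS \<Lambda>A
  for A :: "'d::finite \<Rightarrow> real^'n::finite \<Rightarrow> real^'n^'n" and S S0 \<U> s K S' \<alpha> c0 \<beta> \<gamma> \<sigma> CS \<Lambda>A +
  fixes u0 :: "real^'d \<Rightarrow> real^'n" and I :: "real set" and U :: "real \<Rightarrow> real^'d \<Rightarrow> real^'n"
    and J :: "real set" and M L :: real
  assumes sol: "classical_solution A (\<lambda>f. f) \<U> s u0 I U"
    and J_sub: "J \<subseteq> I" and J_convex: "convex J" and L_nonneg: "0 \<le> L"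
    and J_length: "\<And>t t'. t \<in> J \<Longrightarrow> t' \<in> J \<Longrightarrow> \<bar>t - t'\<bar> \<le> L"
    and J_K: "\<And>t x. t \<in> J \<Longrightarrow> U t x \<in> K"
    and J_wiener: "\<And>t a. t \<in> J \<Longrightarrow> wiener_bound \<alpha> (\<lambda>x. of_real (U t x $ a))"
    and J_norm: "\<And>t. t \<in> J \<Longrightarrow> sobolev_norm s (U t) \<le> M"
begin

lemma open_I: "open I" and convex_I: "convex I" and zero_I: "0 \<in> I"
  using sol by (auto simp: classical_solution_def is_interval_convex)

lemma U_sobolev: "t \<in> I \<Longrightarrow> U t \<in> sobolev s"
  using sol by (simp add: classical_solution_def sobolev_continuous_on_def)

lemma U_in: "t \<in> I \<Longrightarrow> U t x \<in> \<U>"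
  using sol by (simp add: classical_solution_def)

lemma U_C1_on: "C1_on (I \<times> UNIV) (\<lambda>(t, x). U t x)"
  using sol by (simp add: classical_solution_def)

lemma U_C1_torus: "t \<in> I \<Longrightarrow> C1_torus (U t)"
proof -
  assume t: "t \<in> I"
  obtain ut where u: "\<And>t x. t \<in> I \<Longrightarrow> U t differentiable (at x)"
    "\<And>j. continuous_on (I \<times> UNIV) (\<lambda>(t, x). pd j (U t) x)"
    using C1_on_slices[OF U_C1_on] by metis
  have "continuous_on UNIV (pd j (U t))" for j
    by (rule continuous_on_slice[OF u(2) t])
  then show "C1_torus (U t)"
    using u(1)[OF t] U_sobolev[OF t] by (simp add: C1_torus_def sobolev_def)
qed

lemma U_jointly_continuous: "continuous_on (I \<times> UNIV) (\<lambda>(t, x). U t x)"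
  using C1_on_slices[OF U_C1_on] by metis

lemma quasilinear_rhs:
  assumes "t \<in> I"
  shows "quasilinear_term A (U t) x = - rhs (U t) x"
  unfolding quasilinear_term_def rhs_def flux_def
  by (simp add: A_eq[OF U_in[OF assms]] matrix_vector_mul_assoc pd_def)

lemma U_derivative: "t \<in> I \<Longrightarrow> ((\<lambda>\<tau>. U \<tau> x) has_vector_derivative rhs (U t) x) (at t)"
  using sol quasilinear_rhs by (simp add: classical_solution_def)

lemma rhs_jointly_continuous: "continuous_on (I \<times> UNIV) (\<lambda>(t, x). rhs (U t) x)"
proof -
  obtain ut where ut: "\<And>t x. t \<in> I \<Longrightarrow> ((\<lambda>\<tau>. U \<tau> x) has_vector_derivative ut t x) (at t)"
    "continuous_on (I \<times> UNIV) (\<lambda>(t, x). ut t x)"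
    using C1_on_slices[OF U_C1_on] by metis
  have "ut t x = rhs (U t) x" if "t \<in> I" for t x
    by (rule vector_derivative_unique_at[OF ut(1)[OF that] U_derivative[OF that]])
  then show ?thesis
    by (intro continuous_on_eq[OF ut(2)]) auto
qed

text \<open>The weight \<open>S (U t x)\<close> is the symmetriser of the linearised system at \<open>U\<close>.\<close>

definition energy :: "(real^'d \<Rightarrow> real^'n) \<Rightarrow> real \<Rightarrow> real" where
  "energy e t = tmean (\<lambda>x. e x \<bullet> (S (U t x) *v e x))"

lemma energy_equivalent:
  assumes t: "t \<in> J" and e: "continuous_on UNIV e"
  shows "c0 * msq e \<le> energy e t" "energy e t \<le> \<beta> * msq e"
proof -
  have tI: "t \<in> I" using t J_sub by blast
  have c: "continuous_on UNIV (\<lambda>x. e x \<bullet> (S (U t x) *v e x))"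
    by (intro continuous_on_inner continuous_matrix_vector e C1_torus_continuous[OF C1_torus_S(1)[OF U_C1_torus[OF tI]]])
  have "c0 * msq e = tmean (\<lambda>x. c0 * (norm (e x))\<^sup>2)" "\<beta> * msq e = tmean (\<lambda>x. \<beta> * (norm (e x))\<^sup>2)"
    unfolding msq_def by (simp_all add: tmean_cmult continuous_on_power continuous_on_norm e)
  moreover have "tmean (\<lambda>x. c0 * (norm (e x))\<^sup>2) \<le> energy e t"
    unfolding energy_def by (intro tmean_mono c continuous_intros e S_coercive J_K t)
  moreover have "energy e t \<le> tmean (\<lambda>x. \<beta> * (norm (e x))\<^sup>2)"
    unfolding energy_def
  proof (intro tmean_mono c continuous_intros e)
    fix x
    have "e x \<bullet> (S (U t x) *v e x) \<le> norm (e x) * norm (S (U t x) *v e x)" by (rule norm_cauchy_schwarz)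
    also have "\<dots> \<le> norm (e x) * (\<beta> * norm (e x))" by (intro mult_left_mono S_bound J_K t) auto
    finally show "e x \<bullet> (S (U t x) *v e x) \<le> \<beta> * (norm (e x))\<^sup>2" by (simp add: power2_eq_square mult_ac)
  qed
  ultimately show "c0 * msq e \<le> energy e t" "energy e t \<le> \<beta> * msq e" by auto
qed

lemma energy_differential_inequality:
  fixes E E' :: "real \<Rightarrow> real^'d \<Rightarrow> real^'n"
  assumes I': "open I'" "convex I'" "I' \<subseteq> I" "t \<in> I'" and t: "t \<in> J"
    and E: "\<And>t x. t \<in> I' \<Longrightarrow> ((\<lambda>\<tau>. E \<tau> x) has_vector_derivative E' t x) (at t)"
      "continuous_on (I' \<times> UNIV) (\<lambda>(t, x). E t x)" "continuous_on (I' \<times> UNIV) (\<lambda>(t, x). E' t x)"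
    and Et: "C1_torus (E t)" and G: "continuous_on UNIV G"
    and eq: "\<And>x. E' t x = G x - (\<Sum>j\<in>UNIV. S0 j *v lowpass N (flux j (U t) (E t)) x)"
  shows "\<exists>D. ((\<lambda>t. energy (E t) t) has_real_derivative D) (at t) \<and> \<bar>D\<bar> \<le> rate * msq (E t) + msq G"
proof (intro exI conjI)
  have tI: "t \<in> I" using t J_sub by blast
  note C = U_C1_torus[OF tI]
  have sub: "I' \<times> UNIV \<subseteq> I \<times> (UNIV :: (real^'d) set)" using I' by auto
  show "((\<lambda>t. energy (E t) t) has_real_derivative
     tmean (\<lambda>x. 2 * ((S (U t x) *v E t x) \<bullet> E' t x) + E t x \<bullet> (S' (U t x) (rhs (U t) x) *v E t x))) (at t)"
    unfolding energy_def
  proof (rule energy_has_derivative[OF I'(1,2,4) _ continuous_on_subset[OF U_jointly_continuous sub]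
        continuous_on_subset[OF rhs_jointly_continuous sub] E S'_der S'_cont])
    show "((\<lambda>\<tau>. U \<tau> x) has_vector_derivative rhs (U t) x) (at t)" if "t \<in> I'" for t x
      using U_derivative that I' by blast
    show "transpose (S (U t x)) = S (U t x)" if "t \<in> I'" for t x
      using S_pos[OF U_in] that I' by (auto simp: sym_pos_def_def)
  qed
  show "\<bar>tmean (\<lambda>x. 2 * ((S (U t x) *v E t x) \<bullet> E' t x) + E t x \<bullet> (S' (U t x) (rhs (U t) x) *v E t x))\<bar>
      \<le> rate * msq (E t) + msq G"
    unfolding rate_def
  proof (rule energy_rate_bound[OF Et C1_torus_S(1)[OF C] S0_sym slice_bounds(2,3,4)[OF C J_K[OF t] J_wiener[OF t]] S0_bound G])
    show "continuous_on UNIV (\<lambda>x. blinfun_apply (S' (U t x)) (rhs (U t) x))"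
      by (intro continuous_intros continuous_on_compose2[OF S'_cont C1_torus_continuous[OF C]] continuous_rhs C) auto
    show "E' t x = G x - (\<Sum>j\<in>UNIV. S0 j *v lowpass N (\<lambda>x. S (U t x) *v pd j (E t) x) x)" for x
      using eq[of x] by (simp only: flux_def[abs_def])
  qed
qed

section \<open>Propagation of the tails of the exact solution\<close>

text \<open>The energy estimate for \<open>U\<close> between the frequencies \<open>\<rho>\<close> and \<open>R\<close>, where \<open>R\<close> is beyond the finite set
\<open>F\<close>. Its source consists of two commutators, which are bounded by the assumed tails. Thus a tail
bound with constant \<open>X\<close> improves to one with half of \<open>X\<close> plus a multiple of the constant at \<open>t0\<close>.\<close>

lemma tail_step:
  assumes t0: "t0 \<in> J" and X: "0 \<le> X" and \<tau>: "\<tau> \<in> J"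
    and tb: "\<And>t. t \<in> J \<Longrightarrow> tail_bound s (X * exp (\<kappa> * \<bar>t - t0\<bar>)) (fourier_coeff (U t))"
    and m: "tail_bound s m (fourier_coeff (U t0))"
  shows "tail_bound s ((C_tail * m + X / 2) * exp (\<kappa> * \<bar>\<tau> - t0\<bar>)) (fourier_coeff (U \<tau>))"
  unfolding tail_bound_def
proof (intro allI impI)
  fix \<rho> :: real and F :: "(int^'d) set" assume \<rho>: "0 < \<rho>" and F: "finite F" "\<forall>k\<in>F. \<rho> < norm (freq k)"
  \<comment> \<open>The cutoff at \<open>R\<close> equals \<open>1\<close> on \<open>F\<close>.\<close>
  define R where "R = nat \<lceil>\<rho> + (\<Sum>k\<in>F. 2 * norm (freq k))\<rceil> + 1"
  have sF: "0 \<le> (\<Sum>k\<in>F. 2 * norm (freq k))" by (intro sum_nonneg) auto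
  have Rge: "\<rho> + (\<Sum>k\<in>F. 2 * norm (freq k)) \<le> real R" unfolding R_def by linarith
  then have R: "\<rho> \<le> real R" "0 < real R" using \<rho> sF by linarith+
  have RF: "norm (freq k) \<le> real R / 2" if "k \<in> F" for k
  proof -
    have "2 * norm (freq k) \<le> (\<Sum>k\<in>F. 2 * norm (freq k))"
      by (rule member_le_sum[OF that]) (use F in auto)
    then have "2 * norm (freq k) \<le> real R" using \<rho> Rge by linarith
    then show ?thesis by simp
  qed
  define mu :: "int^'d \<Rightarrow> real" where "mu k = cutoff (real R) k - cutoff \<rho> k" for k
  have mu_sym: "mu (- k) = mu k" for k by (simp add: mu_def)
  define E where "E t = fmult mu R (U t)" for t
  define E' where "E' t = fmult mu R (rhs (U t))" for t
  define cm where "cm \<rho>' t j x = lowpass R (flux j (U t) (fmult (cutoff \<rho>') R (U t))) x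
      - fmult (cutoff \<rho>') R (flux j (U t) (U t)) x" for \<rho>' t j x
  define G where "G t x = (\<Sum>j\<in>UNIV. S0 j *v (cm (real R) t j x - cm \<rho> t j x))" for t x
  define \<phi> where "\<phi> t = energy (E t) t" for t
  have Esplit: "E t = (\<lambda>x. fmult (cutoff (real R)) R (U t) x - fmult (cutoff \<rho>) R (U t) x)" for t
    unfolding E_def mu_def by (rule ext) (rule fmult_symbol_diff)
  have ccm: "continuous_on UNIV (cm \<rho>' t j)" for \<rho>' t j
    unfolding cm_def[abs_def] by (intro continuous_on_diff continuous_lowpass continuous_fmult)
  have cG: "continuous_on UNIV (G t)" for t
    unfolding G_def[abs_def] by (intro continuous_on_sum continuous_matrix_vector continuous_on_const continuous_on_diff ccm)
  have eq: "E' t x = G t x - (\<Sum>j\<in>UNIV. S0 j *v lowpass R (flux j (U t) (E t)) x)" if "t \<in> I" for t x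
  proof -
    note C = U_C1_torus[OF that]
    have fl: "flux j (U t) (E t) = (\<lambda>x. flux j (U t) (fmult (cutoff (real R)) R (U t)) x - flux j (U t) (fmult (cutoff \<rho>) R (U t)) x)" for j
      unfolding flux_def[abs_def] Esplit C1_torus_diff(2)[OF C1_torus_fmult C1_torus_fmult]
      by (simp add: matrix_vector_mult_diff_distrib)
    have lp: "lowpass R (flux j (U t) (E t)) x = lowpass R (flux j (U t) (fmult (cutoff (real R)) R (U t))) x
        - lowpass R (flux j (U t) (fmult (cutoff \<rho>) R (U t))) x" for j
      unfolding fl by (intro lowpass_diff continuous_flux C C1_torus_fmult)
    have fm: "fmult mu R (flux j (U t) (U t)) x = fmult (cutoff (real R)) R (flux j (U t) (U t)) x - fmult (cutoff \<rho>) R (flux j (U t) (U t)) x" for j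
      unfolding mu_def by (rule fmult_symbol_diff)
    have "G t x - (\<Sum>j\<in>UNIV. S0 j *v lowpass R (flux j (U t) (E t)) x)
       = (\<Sum>j\<in>UNIV. S0 j *v ((cm (real R) t j x - cm \<rho> t j x) - lowpass R (flux j (U t) (E t)) x))"
      by (simp only: G_def sum_subtractf[symmetric] matrix_vector_mult_diff_distrib)
    also have "\<dots> = (\<Sum>j\<in>UNIV. S0 j *v (- fmult mu R (flux j (U t) (U t)) x))"
      unfolding cm_def lp fm by (simp add: algebra_simps)
    also have "\<dots> = E' t x"
      unfolding E'_def fmult_rhs[OF C] by (simp add: vec.neg sum_negf)
    finally show ?thesis by simp
  qed
  have msqG: "msq (G t) \<le> G_const * (X * exp (\<kappa> * \<bar>t - t0\<bar>)) * \<rho> powr (- 2 * s)" if t: "t \<in> J" for t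
  proof -
    let ?b = "X * exp (\<kappa> * \<bar>t - t0\<bar>)"
    have tI: "t \<in> I" using t J_sub by blast
    note C = U_C1_torus[OF tI]
    have tm: "tame s \<alpha> ?b (\<lambda>x. of_real (U t x $ a))" for a
      unfolding tame_def using J_wiener[OF t] tail_bound_component[OF tb[OF t] C1_torus_continuous[OF C]] by blast
    have b0: "0 \<le> comm_const * ?b" using X comm_const_nonneg by simp
    have 1: "msq (cm \<rho> t j) \<le> comm_const * ?b * \<rho> powr (- 2 * s)" for j
      unfolding cm_def[abs_def] by (rule commutator_msq[OF C tm \<rho> R(1)])
    have 2: "msq (cm (real R) t j) \<le> comm_const * ?b * \<rho> powr (- 2 * s)" for j
    proof -
      have "msq (cm (real R) t j) \<le> comm_const * ?b * real R powr (- 2 * s)"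
        unfolding cm_def[abs_def] by (rule commutator_msq[OF C tm R(2)]) simp
      also have "\<dots> \<le> comm_const * ?b * \<rho> powr (- 2 * s)"
        using R \<rho> s_pos by (intro mult_left_mono b0 powr_mono2') auto
      finally show ?thesis .
    qed
    have "msq (\<lambda>x. cm (real R) t j x - cm \<rho> t j x) \<le> 4 * (comm_const * ?b * \<rho> powr (- 2 * s))" for j
      using msq_diff_le[OF ccm ccm, of "real R" t j \<rho> t j] 1[of j] 2[of j] by linarith
    then have "msq (G t) \<le> (real CARD('d))\<^sup>2 * \<sigma>\<^sup>2 * (4 * (comm_const * ?b * \<rho> powr (- 2 * s)))"
      unfolding G_def[abs_def] by (intro msq_matrix_sum_le continuous_on_diff ccm)
    then show ?thesis by (simp add: G_const_def mult_ac)
  qed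
  have cE: "continuous_on UNIV (E t)" for t unfolding E_def by (rule continuous_fmult)
  have seg: "closed_segment t0 \<tau> \<subseteq> J" using J_convex t0 \<tau> by (simp add: closed_segment_subset)
  have "\<exists>D. (\<phi> has_real_derivative D) (at t) \<and> \<bar>D\<bar> \<le> a_rate * \<phi> t + (G_const * X * \<rho> powr (- 2 * s)) * exp (\<kappa> * \<bar>t - t0\<bar>)"
    if t: "t \<in> J" for t
  proof -
    have tI: "t \<in> I" using t J_sub by blast
    have "\<exists>D. (\<phi> has_real_derivative D) (at t) \<and> \<bar>D\<bar> \<le> rate * msq (E t) + msq (G t)"
      unfolding \<phi>_def
    proof (rule energy_differential_inequality[OF open_I convex_I subset_refl tI t, where E' = E' and N = R])
      show "((\<lambda>\<tau>. E \<tau> x) has_vector_derivative E' t x) (at t)" if "t \<in> I" for t x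
        unfolding E_def E'_def
        by (rule fmult_has_vector_derivative[OF open_I convex_I that U_derivative U_jointly_continuous rhs_jointly_continuous])
      show "continuous_on (I \<times> UNIV) (\<lambda>(t, x). E t x)" "continuous_on (I \<times> UNIV) (\<lambda>(t, x). E' t x)"
        unfolding E_def E'_def by (intro fmult_jointly_continuous U_jointly_continuous rhs_jointly_continuous)+
    qed (use cG eq[OF tI] in \<open>auto simp: E_def C1_torus_fmult\<close>)
    moreover have "rate * msq (E t) \<le> a_rate * \<phi> t"
    proof -
      have "msq (E t) \<le> \<phi> t / c0"
        using energy_equivalent(1)[OF t cE[of t]] pos by (simp add: \<phi>_def field_simps)
      then have "rate * msq (E t) \<le> rate * (\<phi> t / c0)" using beta'_ge(3) by (intro mult_left_mono) auto
      then show ?thesis by (simp add: a_rate_def)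
    qed
    moreover note msqG[OF t]
    ultimately show ?thesis by (fastforce simp: mult_ac)
  qed
  then obtain \<phi>' where \<phi>': "\<And>t. t \<in> J \<Longrightarrow> (\<phi> has_real_derivative \<phi>' t) (at t)"
    "\<And>t. t \<in> J \<Longrightarrow> \<bar>\<phi>' t\<bar> \<le> a_rate * \<phi> t + (G_const * X * \<rho> powr (- 2 * s)) * exp (\<kappa> * \<bar>t - t0\<bar>)"
    by metis
  have gr: "\<phi> \<tau> \<le> exp (a_rate * \<bar>\<tau> - t0\<bar>) * \<phi> t0 + (G_const * X * \<rho> powr (- 2 * s)) / (\<kappa> - a_rate) * exp (\<kappa> * \<bar>\<tau> - t0\<bar>)"
    by (rule gronwall[where \<phi>' = \<phi>']) (use seg \<phi>' kappa comm_const_nonneg X in \<open>auto simp: subset_iff\<close>)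
  have mu_le: "(mu k)\<^sup>2 \<le> of_bool (\<rho> / 2 < norm (freq k))" for k :: "int^'d"
  proof (cases "\<rho> / 2 < norm (freq k)")
    case True
    have "\<bar>mu k\<bar> \<le> 1"
      using cutoff_bounds[of "real R" k] cutoff_bounds[of \<rho> k] unfolding mu_def by linarith
    then show ?thesis using True by (simp add: abs_square_le_1)
  next
    case False
    then have "cutoff \<rho> k = 1" "cutoff (real R) k = 1"
      using \<rho> R by (auto intro!: cutoff_eq_1)
    then show ?thesis by (simp add: mu_def)
  qed
  have m0: "0 \<le> m" by (rule tail_bound_nonneg[OF m])
  have msqE: "msq (E t) = (\<Sum>k\<in>cube R. (mu k)\<^sup>2 * (norm (fourier_coeff (U t) k))\<^sup>2)" if "t \<in> J" for t
    unfolding E_def using that J_sub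
    by (intro msq_fmult C1_torus_continuous U_C1_torus) (auto simp: mu_sym)
  have init: "\<phi> t0 \<le> \<beta> * (m * (2 powr (2 * s) * \<rho> powr (- 2 * s)))"
  proof -
    have "msq (E t0) = (\<Sum>k\<in>cube R. (mu k)\<^sup>2 * (norm (fourier_coeff (U t0) k))\<^sup>2)"
      by (rule msqE[OF t0])
    also have "\<dots> \<le> (\<Sum>k\<in>cube R. of_bool (\<rho> / 2 < norm (freq k)) * (norm (fourier_coeff (U t0) k))\<^sup>2)"
      by (intro sum_mono mult_right_mono mu_le) auto
    also have "\<dots> = (\<Sum>k\<in>{k\<in>cube R. \<rho> / 2 < norm (freq k)}. (norm (fourier_coeff (U t0) k))\<^sup>2)"
      by (rule sum.mono_neutral_cong_right) auto
    also have "\<dots> \<le> m * (\<rho> / 2) powr (- 2 * s)"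
      by (rule tail_boundD[OF m]) (use \<rho> in auto)
    finally have "msq (E t0) \<le> m * (2 powr (2 * s) * \<rho> powr (- 2 * s))"
      using half_powr[OF _ \<rho>, of 2 s] by simp
    then have "\<beta> * msq (E t0) \<le> \<beta> * (m * (2 powr (2 * s) * \<rho> powr (- 2 * s)))"
      using pos by (intro mult_left_mono)
    then show ?thesis using energy_equivalent(2)[OF t0 cE[of t0]] by (simp add: \<phi>_def)
  qed
  have "(\<Sum>k\<in>F. (norm (fourier_coeff (U \<tau>) k))\<^sup>2) \<le> msq (E \<tau>)"
  proof -
    have "(\<Sum>k\<in>F. (norm (fourier_coeff (U \<tau>) k))\<^sup>2) = (\<Sum>k\<in>F. (mu k)\<^sup>2 * (norm (fourier_coeff (U \<tau>) k))\<^sup>2)"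
    proof (rule sum.cong[OF refl])
      fix k assume k: "k \<in> F"
      have "cutoff (real R) k = 1" using R RF[OF k] by (intro cutoff_eq_1)
      moreover have "cutoff \<rho> k = 0" using \<rho> F k by (intro cutoff_eq_0) auto
      ultimately show "(norm (fourier_coeff (U \<tau>) k))\<^sup>2 = (mu k)\<^sup>2 * (norm (fourier_coeff (U \<tau>) k))\<^sup>2"
        by (simp add: mu_def)
    qed
    also have "\<dots> \<le> (\<Sum>k\<in>cube R. (mu k)\<^sup>2 * (norm (fourier_coeff (U \<tau>) k))\<^sup>2)"
    proof (rule sum_mono2)
      show "F \<subseteq> cube R"
      proof
        fix k assume "k \<in> F"
        then show "k \<in> cube R" using RF[of k] R by (intro in_cube) auto
      qed
    qed auto
    also have "\<dots> = msq (E \<tau>)"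
      by (rule msqE[OF \<tau>, symmetric])
    finally show ?thesis .
  qed
  also have "\<dots> \<le> \<phi> \<tau> / c0"
    using energy_equivalent(1)[OF \<tau> cE[of \<tau>]] pos by (simp add: \<phi>_def field_simps)
  also have "\<dots> \<le> ((C_tail * m + X / 2) * exp (\<kappa> * \<bar>\<tau> - t0\<bar>)) * \<rho> powr (- 2 * s)"
  proof -
    let ?e = "exp (\<kappa> * \<bar>\<tau> - t0\<bar>)" and ?r = "\<rho> powr (- 2 * s)"
    have e: "exp (a_rate * \<bar>\<tau> - t0\<bar>) \<le> ?e" using kappa by (simp add: mult_right_mono)
    have "exp (a_rate * \<bar>\<tau> - t0\<bar>) * \<phi> t0 \<le> exp (a_rate * \<bar>\<tau> - t0\<bar>) * (\<beta> * (m * (2 powr (2 * s) * ?r)))"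
      by (intro mult_left_mono init) auto
    also have "\<dots> \<le> ?e * (\<beta> * (m * (2 powr (2 * s) * ?r)))"
      using pos m0 by (intro mult_right_mono e) auto
    finally have 1: "exp (a_rate * \<bar>\<tau> - t0\<bar>) * \<phi> t0 \<le> ?e * (\<beta> * (m * (2 powr (2 * s) * ?r)))" .
    have "(G_const * X * ?r) / (\<kappa> - a_rate) * ?e = (G_const / (\<kappa> - a_rate)) * (X * ?r * ?e)" by simp
    also have "\<dots> \<le> c0 / 2 * (X * ?r * ?e)"
      using X by (intro mult_right_mono kappa) auto
    finally have 2: "(G_const * X * ?r) / (\<kappa> - a_rate) * ?e \<le> c0 / 2 * (X * ?r * ?e)" .
    have "\<phi> \<tau> \<le> ?e * (\<beta> * (m * (2 powr (2 * s) * ?r))) + c0 / 2 * (X * ?r * ?e)"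
      using gr 1 2 by linarith
    then have "\<phi> \<tau> / c0 \<le> (?e * (\<beta> * (m * (2 powr (2 * s) * ?r))) + c0 / 2 * (X * ?r * ?e)) / c0"
      using pos by (intro divide_right_mono) auto
    also have "\<dots> = ((C_tail * m + X / 2) * ?e) * ?r"
      using pos(1) by (simp add: C_tail_def field_simps)
    finally show ?thesis .
  qed
  finally show "(\<Sum>k\<in>F. (norm (fourier_coeff (U \<tau>) k))\<^sup>2) \<le> ((C_tail * m + X / 2) * exp (\<kappa> * \<bar>\<tau> - t0\<bar>)) * \<rho> powr (- 2 * s)" .
qed

text \<open>Iterating the improvement from the constant \<open>M\<^sup>2\<close>, the dependence on \<open>M\<close> disappears in the limit.\<close>

theorem tail_propagation:
  assumes t0: "t0 \<in> J" and \<tau>: "\<tau> \<in> J"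
  shows "tail_bound s (2 * C_tail * exp (\<kappa> * L) * (sobolev_norm s (U t0))\<^sup>2) (fourier_coeff (U \<tau>))"
proof -
  define m where "m = (sobolev_norm s (U t0))\<^sup>2"
  have tb0: "tail_bound s ((sobolev_norm s (U t))\<^sup>2) (fourier_coeff (U t))" if "t \<in> J" for t
  proof (rule sobolev_tail_bound)
    fix F :: "(int^'d) set" assume "finite F"
    then show "(\<Sum>k\<in>F. japanese_bracket k powr (2 * s) * (norm (fourier_coeff (U t) k))\<^sup>2) \<le> (sobolev_norm s (U t))\<^sup>2"
      using that J_sub by (intro sobolev_finite_sum U_sobolev) auto
  qed (use s_pos in simp)
  have mono: "tail_bound s b' c" if "tail_bound s b c" "b \<le> b'" for b b' and c :: "int^'d \<Rightarrow> complex^'n"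
    using that unfolding tail_bound_def by (meson mult_right_mono order_trans powr_ge_zero)
  have M: "0 \<le> M" using J_norm[OF t0] sobolev_norm_nonneg[of s "U t0"] by linarith
  have kap0: "0 \<le> \<kappa>" using kappa by linarith
  have Ct: "0 \<le> C_tail" using pos by (simp add: C_tail_def)
  have m0: "0 \<le> m" by (simp add: m_def)
  \<comment> \<open>The iterates of \<open>X \<mapsto> C_tail * m + X / 2\<close>, starting above \<open>M\<^sup>2\<close>.\<close>
  define X where "X n = 2 * C_tail * m + M\<^sup>2 / 2 ^ n" for n :: nat
  have X0: "0 \<le> X n" for n using Ct m0 by (simp add: X_def)
  have iter: "t \<in> J \<Longrightarrow> tail_bound s (X n * exp (\<kappa> * \<bar>t - t0\<bar>)) (fourier_coeff (U t))" for n t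
  proof (induction n arbitrary: t)
    case 0
    have "(sobolev_norm s (U t))\<^sup>2 \<le> M\<^sup>2"
      by (intro power_mono J_norm 0 sobolev_norm_nonneg)
    also have "\<dots> \<le> X 0" using Ct m0 by (simp add: X_def)
    also have "X 0 * 1 \<le> X 0 * exp (\<kappa> * \<bar>t - t0\<bar>)"
      using X0 kap0 by (intro mult_left_mono) auto
    finally show ?case using mono[OF tb0[OF 0]] by simp
  next
    case (Suc n)
    have "tail_bound s ((C_tail * m + X n / 2) * exp (\<kappa> * \<bar>t - t0\<bar>)) (fourier_coeff (U t))"
      by (rule tail_step[OF t0 X0 Suc.prems Suc.IH tb0[OF t0, folded m_def]])
    moreover have "C_tail * m + X n / 2 = X (Suc n)" by (simp add: X_def)
    ultimately show ?case by simp
  qed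
  have lim: "tail_bound s (2 * C_tail * m * exp (\<kappa> * \<bar>\<tau> - t0\<bar>)) (fourier_coeff (U \<tau>))"
    unfolding tail_bound_def
  proof (intro allI impI)
    fix \<rho> :: real and F :: "(int^'d) set" assume \<rho>: "0 < \<rho>" and F: "finite F" "\<forall>k\<in>F. \<rho> < norm (freq k)"
    have "(\<lambda>n. M\<^sup>2 * (1 / 2) ^ n) \<longlonglongrightarrow> M\<^sup>2 * 0"
      by (intro tendsto_mult tendsto_const LIMSEQ_power_zero) simp
    then have "X \<longlonglongrightarrow> 2 * C_tail * m + 0"
      unfolding X_def by (intro tendsto_add tendsto_const) (simp add: power_one_over field_simps)
    then have "(\<lambda>n. (X n * exp (\<kappa> * \<bar>\<tau> - t0\<bar>)) * \<rho> powr (- 2 * s)) \<longlonglongrightarrow> ((2 * C_tail * m + 0) * exp (\<kappa> * \<bar>\<tau> - t0\<bar>)) * \<rho> powr (- 2 * s)"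
      by (intro tendsto_mult tendsto_const)
    then show "(\<Sum>k\<in>F. (norm (fourier_coeff (U \<tau>) k))\<^sup>2) \<le> 2 * C_tail * m * exp (\<kappa> * \<bar>\<tau> - t0\<bar>) * \<rho> powr (- 2 * s)"
      using tail_boundD[OF iter[OF \<tau>] \<rho> F(1)] F(2)
      by (intro LIMSEQ_le_const[where X = "\<lambda>n. (X n * exp (\<kappa> * \<bar>\<tau> - t0\<bar>)) * \<rho> powr (- 2 * s)"]) auto
  qed
  show ?thesis
  proof (rule mono[OF lim])
    have "exp (\<kappa> * \<bar>\<tau> - t0\<bar>) \<le> exp (\<kappa> * L)" using J_length[OF \<tau> t0] kap0 by (simp add: mult_left_mono)
    then have "2 * C_tail * m * exp (\<kappa> * \<bar>\<tau> - t0\<bar>) \<le> 2 * C_tail * m * exp (\<kappa> * L)"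
      using Ct m0 by (intro mult_left_mono) auto
    then show "2 * C_tail * m * exp (\<kappa> * \<bar>\<tau> - t0\<bar>) \<le> 2 * C_tail * exp (\<kappa> * L) * (sobolev_norm s (U t0))\<^sup>2"
      by (simp add: m_def mult_ac)
  qed
qed

end

section \<open>Local existence for ordinary differential equations in a Banach space\<close>

lemma primitive_through:
  fixes g :: "real \<Rightarrow> 'x::banach"
  assumes g: "continuous_on {a..b} g" and t0: "t0 \<in> {a..b}" and t: "t \<in> {a..b}"
    and B: "\<And>t. t \<in> {a..b} \<Longrightarrow> norm (g t) \<le> B"
  shows "norm (integral {a..t} g - integral {a..t0} g) \<le> B * \<bar>t - t0\<bar>"
proof -
  have int: "g integrable_on {a..c}" if "c \<le> b" for c
    by (rule integrable_continuous_real, rule continuous_on_subset[OF g]) (use that in auto)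
  have one: "norm (integral {a..d} g - integral {a..c} g) \<le> B * (d - c)" if "a \<le> c" "c \<le> d" "d \<le> b" for c d
  proof -
    have "integral {a..c} g + integral {c..d} g = integral {a..d} g"
      by (rule Henstock_Kurzweil_Integration.integral_combine) (use that int in auto)
    then have "integral {a..d} g - integral {a..c} g = integral {c..d} g" by (simp add: algebra_simps)
    moreover have "norm (integral {c..d} g) \<le> B * (d - c)"
      by (rule integral_bound) (use that B continuous_on_subset[OF g] in auto)
    ultimately show ?thesis by simp
  qed
  show ?thesis
  proof (cases "t0 \<le> t")
    case True
    then show ?thesis using one[of t0 t] t t0 by auto
  next
    case False
    then show ?thesis using one[of t t0] t t0 by (auto simp: norm_minus_commute)
  qed
qed

text \<open>Banach's fixed point theorem in the space of bounded continuous functions on the whole line. The time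
is clamped to the interval by \<open>cl\<close>, so that no space of functions on an interval is needed.\<close>

lemma picard_lindelof:
  fixes F :: "'x::banach \<Rightarrow> 'x"
  assumes h: "0 < h" "h * B \<le> 1" "h * \<Lambda> \<le> 1 / 2" and B0: "0 \<le> B" "0 \<le> \<Lambda>"
    and B: "\<And>u. u \<in> cball y0 1 \<Longrightarrow> norm (F u) \<le> B"
    and lip: "\<And>u v. u \<in> cball y0 1 \<Longrightarrow> v \<in> cball y0 1 \<Longrightarrow> norm (F u - F v) \<le> \<Lambda> * norm (u - v)"
  obtains y where "y t0 = y0" "\<And>t. y t \<in> cball y0 1" "continuous_on UNIV y"
    "\<And>t. t \<in> {t0 - h<..<t0 + h} \<Longrightarrow> (y has_vector_derivative F (y t)) (at t)"
proof -
  let ?a = "t0 - h" and ?b = "t0 + h"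
  define cl where "cl t = max ?a (min ?b t)" for t
  have cl: "cl t \<in> {?a..?b}" for t using h by (auto simp: cl_def)
  have cl_id: "cl t = t" if "t \<in> {?a..?b}" for t using that by (auto simp: cl_def)
  have t0: "t0 \<in> {?a..?b}" using h by auto
  have ccl: "continuous_on UNIV cl" unfolding cl_def by (intro continuous_intros)
  have cF: "continuous_on (cball y0 1) F"
  proof (rule lipschitz_on_continuous_on[of \<Lambda>])
    show "\<Lambda>-lipschitz_on (cball y0 1) F" using lip B0 by (auto simp: lipschitz_on_def dist_norm)
  qed
  define T0 where "T0 Y t = y0 + (integral {?a..cl t} (\<lambda>s. F (Y s)) - integral {?a..t0} (\<lambda>s. F (Y s)))" for Y t
  define X where "X = (PiC UNIV (\<lambda>_. cball y0 1) :: (real \<Rightarrow>\<^sub>C 'x) set)"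
  have X: "Y \<in> X \<longleftrightarrow> (\<forall>t. Y t \<in> cball y0 1)" for Y by (auto simp: X_def mem_PiC_iff)
  have cont: "continuous_on A (\<lambda>s. F (apply_bcontfun Y s))" if "Y \<in> X" for Y A
    by (rule continuous_on_compose2[OF cF]) (use that X in auto)
  have inball: "T0 (apply_bcontfun Y) t \<in> cball y0 1" if "Y \<in> X" for Y t
  proof -
    have "norm (integral {?a..cl t} (\<lambda>s. F (Y s)) - integral {?a..t0} (\<lambda>s. F (Y s))) \<le> B * \<bar>cl t - t0\<bar>"
      by (rule primitive_through[OF cont[OF that] t0 cl]) (use that X B in auto)
    also have "\<dots> \<le> B * h" using cl[of t] B0 by (intro mult_left_mono) auto
    also have "\<dots> \<le> 1" using h by (simp add: mult.commute)
    finally have "norm (integral {?a..cl t} (\<lambda>s. F (Y s)) - integral {?a..t0} (\<lambda>s. F (Y s))) \<le> 1" .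
    then show ?thesis by (simp add: T0_def dist_norm norm_minus_commute)
  qed
  have T0b: "T0 (apply_bcontfun Y) \<in> bcontfun" if Y: "Y \<in> X" for Y
  proof (rule bcontfun_normI)
    have "continuous_on {?a..?b} (\<lambda>t. integral {?a..t} (\<lambda>s. F (Y s)))"
      by (rule indefinite_integral_continuous_1, rule integrable_continuous_real, rule cont[OF Y])
    from continuous_on_compose2[OF this ccl] have "continuous_on UNIV (\<lambda>t. integral {?a..cl t} (\<lambda>s. F (Y s)))"
      using cl by blast
    then show "continuous_on UNIV (T0 (apply_bcontfun Y))" unfolding T0_def by (intro continuous_intros)
    show "norm (T0 (apply_bcontfun Y) t) \<le> norm y0 + 1" for t
    proof -
      have "norm (T0 (apply_bcontfun Y) t) \<le> norm y0 + norm (T0 (apply_bcontfun Y) t - y0)"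
        by (rule norm_triangle_sub)
      moreover have "norm (T0 (apply_bcontfun Y) t - y0) \<le> 1"
        using inball[OF Y, of t] by (simp add: dist_norm norm_minus_commute)
      ultimately show ?thesis by linarith
    qed
  qed
  define T where "T Y = Bcontfun (T0 (apply_bcontfun Y))" for Y
  have T: "apply_bcontfun (T Y) = T0 (apply_bcontfun Y)" if "Y \<in> X" for Y
    unfolding T_def by (rule Bcontfun_inverse[OF T0b[OF that]])
  have contr: "dist (T Y) (T Z) \<le> 1 / 2 * dist Y Z" if Y: "Y \<in> X" and Z: "Z \<in> X" for Y Z
  proof (rule dist_bound)
    fix t
    have iY: "(\<lambda>s. F (Y s)) integrable_on {?a..c}" and iZ: "(\<lambda>s. F (Z s)) integrable_on {?a..c}" for c
      by (rule integrable_continuous_real, rule cont[OF Y], rule integrable_continuous_real, rule cont[OF Z])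
    have "norm (integral {?a..cl t} (\<lambda>s. F (Y s) - F (Z s)) - integral {?a..t0} (\<lambda>s. F (Y s) - F (Z s)))
        \<le> (\<Lambda> * dist Y Z) * \<bar>cl t - t0\<bar>"
    proof (rule primitive_through[OF _ t0 cl])
      show "continuous_on {?a..?b} (\<lambda>s. F (Y s) - F (Z s))" by (intro continuous_on_diff cont Y Z)
      show "norm (F (Y s) - F (Z s)) \<le> \<Lambda> * dist Y Z" for s
      proof -
        have "norm (F (Y s) - F (Z s)) \<le> \<Lambda> * norm (Y s - Z s)" by (rule lip) (use X Y Z in auto)
        also have "\<dots> \<le> \<Lambda> * dist Y Z" using B0 dist_bounded[of Y s Z] by (intro mult_left_mono) (auto simp: dist_norm)
        finally show ?thesis .
      qed
    qed
    also have "\<dots> \<le> (\<Lambda> * dist Y Z) * h" using cl[of t] B0 by (intro mult_left_mono) auto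
    also have "\<dots> = (h * \<Lambda>) * dist Y Z" by simp
    also have "\<dots> \<le> 1 / 2 * dist Y Z" using h by (intro mult_right_mono) auto
    finally show "dist (apply_bcontfun (T Y) t) (apply_bcontfun (T Z) t) \<le> 1 / 2 * dist Y Z"
      unfolding T[OF Y] T[OF Z] T0_def dist_norm
      by (simp add: Henstock_Kurzweil_Integration.integral_diff[OF iY iZ] algebra_simps)
  qed
  have "\<exists>!Y. Y \<in> X \<and> T Y = Y"
  proof (rule Banach_fix[of X "1/2" T])
    show "complete X" unfolding X_def by (intro closed_PiC[THEN complete_eq_closed[THEN iffD2]]) auto
    have "const_bcontfun y0 \<in> X" by (simp add: X const_bcontfun.rep_eq)
    then show "X \<noteq> {}" by blast
    show "T ` X \<subseteq> X" using inball T X by auto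
  qed (use contr in auto)
  then obtain Y where Y: "Y \<in> X" "T Y = Y" by blast
  then have fix_eq: "apply_bcontfun Y = T0 (apply_bcontfun Y)" using T[OF Y(1)] by simp
  show ?thesis
  proof (rule that[of "apply_bcontfun Y"])
    show "apply_bcontfun Y t0 = y0" by (subst fix_eq) (simp add: T0_def cl_id[OF t0])
    show "apply_bcontfun Y t \<in> cball y0 1" for t using X Y(1) by blast
    show "continuous_on UNIV (apply_bcontfun Y)" by simp
    show "(apply_bcontfun Y has_vector_derivative F (apply_bcontfun Y t)) (at t)" if t: "t \<in> {?a<..<?b}" for t
    proof -
      have "((\<lambda>u. integral {?a..u} (\<lambda>s. F (Y s))) has_vector_derivative F (Y t)) (at t within {?a..?b})"
        by (rule integral_has_vector_derivative[OF cont[OF Y(1)]]) (use t in auto)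
      then have "((\<lambda>u. integral {?a..u} (\<lambda>s. F (Y s))) has_vector_derivative F (Y t)) (at t within {?a<..<?b})"
        by (rule has_vector_derivative_within_subset) auto
      then have "((\<lambda>u. integral {?a..u} (\<lambda>s. F (Y s))) has_vector_derivative F (Y t)) (at t)"
        by (simp only: at_within_open[OF t open_greaterThanLessThan])
      then have "((\<lambda>u. y0 + (integral {?a..u} (\<lambda>s. F (Y s)) - integral {?a..t0} (\<lambda>s. F (Y s)))) has_vector_derivative F (Y t)) (at t)"
        by (auto intro!: derivative_eq_intros)
      then show ?thesis
      proof (rule has_vector_derivative_transform_within_open[OF _ open_greaterThanLessThan t])
        fix u assume u: "u \<in> {?a<..<?b}"
        then have "cl u = u" by (intro cl_id) auto
        then show "y0 + (integral {?a..u} (\<lambda>s. F (Y s)) - integral {?a..t0} (\<lambda>s. F (Y s))) = apply_bcontfun Y u"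
          by (subst (3) fix_eq) (simp add: T0_def)
      qed
    qed
  qed
qed

section \<open>The truncated vector field\<close>

lemma norm_rtp_le:
  fixes c :: "int^'d \<Rightarrow> complex^'n"
  assumes "\<And>k a. k \<in> F \<Longrightarrow> norm (c k $ a) \<le> r"
  shows "norm (rtp F c x) \<le> real CARD('n) * (real (card F) * r)"
proof (rule norm_le_card_components)
  fix a
  have "\<bar>rtp F c x $ a\<bar> \<le> norm (\<Sum>k\<in>F. c k $ a * wave k x)"
    unfolding rtp_nth by (rule abs_Re_le_cmod)
  also have "\<dots> \<le> (\<Sum>k\<in>F. norm (c k $ a * wave k x))" by (rule norm_sum)
  also have "\<dots> \<le> (\<Sum>k\<in>F. r)" by (intro sum_mono) (simp add: norm_mult assms)
  finally show "\<bar>rtp F c x $ a\<bar> \<le> real (card F) * r" by simp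
qed

lemma norm_fourier_coeff_le_sup:
  fixes u :: "real^'d \<Rightarrow> real^'n"
  assumes "continuous_on UNIV u" "\<And>x. norm (u x) \<le> m"
  shows "norm (fourier_coeff u k $ a) \<le> m"
  unfolding fourier_coeff_fc[OF assms(1)]
proof (rule norm_fc_le)
  show "norm (complex_of_real (u x $ a)) \<le> m" for x
    using component_le_norm_cart[of "u x" a] assms(2)[of x] by simp
qed (intro continuous_intros assms)

lemma norm_lowpass_le:
  fixes u :: "real^'d \<Rightarrow> real^'n"
  assumes "continuous_on UNIV u" "\<And>x. norm (u x) \<le> m"
  shows "norm (lowpass N u x) \<le> real CARD('n) * (real (card (cube N :: (int^'d) set)) * m)"
  unfolding lowpass_rtp by (rule norm_rtp_le) (rule norm_fourier_coeff_le_sup[OF assms])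

lemma norm_pd_lowpass_le:
  fixes u :: "real^'d \<Rightarrow> real^'n"
  assumes "continuous_on UNIV u" "\<And>x. norm (u x) \<le> m"
  shows "norm (pd j (lowpass N u) x) \<le> real CARD('n) * (real (card (cube N :: (int^'d) set)) * (real N * m))"
  unfolding lowpass_rtp C1_torus_rtp(2)
proof (rule norm_rtp_le)
  fix k :: "int^'d" and a assume "k \<in> cube N"
  then have "\<bar>real_of_int (k $ j)\<bar> \<le> real N" unfolding cube_def by (metis (mono_tags) mem_Collect_eq of_int_abs of_int_le_iff of_int_of_nat_eq)
  then show "norm ((\<chi> a. \<i> * of_int (k $ j) * fourier_coeff u k $ a) $ a) \<le> real N * m"
    using norm_fourier_coeff_le_sup[OF assms, of k a] by (simp add: norm_mult mult_mono)
qed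

lemma polynomial_matrix_bounds:
  fixes B :: "real^'n \<Rightarrow> real^'n^'n"
  assumes "\<And>a b. real_polynomial_function (\<lambda>u. B u $ a $ b)"
  obtains b where "0 \<le> b" "\<And>w v. norm w \<le> r \<Longrightarrow> norm (B w *v v) \<le> b * norm v"
    "\<And>w w' v. norm w \<le> r \<Longrightarrow> norm w' \<le> r \<Longrightarrow> norm ((B w - B w') *v v) \<le> b * norm (w - w') * norm v"
proof -
  obtain B' where B': "\<And>u. (B has_derivative blinfun_apply (B' u)) (at u)" "continuous_on UNIV B'"
    using polynomial_matrix_C1[where S = B, OF assms] by blast
  obtain K where K: "K > 0" "\<And>(M::real^'n^'n) v. norm (M *v v) \<le> norm M * norm v * K"
    using bounded_bilinear.pos_bounded[OF bounded_bilinear_matrix_vector] by blast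
  have "bounded (B' ` cball 0 r)" "bounded (B ` cball 0 r)"
    by (intro compact_imp_bounded compact_continuous_image continuous_on_subset[OF B'(2)] compact_cball,
        simp, intro compact_imp_bounded compact_continuous_image compact_cball
        continuous_on_subset[OF has_derivative_continuous_on_UNIV[OF B'(1)]], simp)
  then obtain b1 b2 where b1: "b1 > 0" "\<And>w. norm w \<le> r \<Longrightarrow> norm (B' w) \<le> b1"
    and b2: "b2 > 0" "\<And>w. norm w \<le> r \<Longrightarrow> norm (B w) \<le> b2"
    unfolding bounded_pos by (auto simp: dist_norm)
  have lip: "norm (B w - B w') \<le> b1 * norm (w - w')" if "norm w \<le> r" "norm w' \<le> r" for w w'
    by (rule differentiable_bound[of "cball 0 r" B "\<lambda>u. blinfun_apply (B' u)"])
       (use that b1 B' in \<open>auto simp: norm_blinfun.rep_eq[symmetric] intro: has_derivative_at_withinI\<close>)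
  show ?thesis
  proof (rule that[of "(b1 + b2) * K"])
    show "0 \<le> (b1 + b2) * K" using b1 b2 K by simp
    fix w w' v :: "real^'n"
    assume w: "norm w \<le> r"
    have "norm (B w *v v) \<le> norm (B w) * norm v * K" by (rule K)
    also have "\<dots> \<le> (b1 + b2) * norm v * K"
      using b1(1) b2(2)[OF w] K(1) by (intro mult_right_mono) auto
    finally show "norm (B w *v v) \<le> (b1 + b2) * K * norm v" by (simp add: mult_ac)
    assume w': "norm w' \<le> r"
    have "norm ((B w - B w') *v v) \<le> norm (B w - B w') * norm v * K" by (rule K)
    also have "\<dots> \<le> (b1 * norm (w - w')) * norm v * K"
      using lip[OF w w'] K(1) by (intro mult_right_mono) auto
    also have "\<dots> \<le> ((b1 + b2) * norm (w - w')) * norm v * K"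
      using b2(1) K(1) by (intro mult_right_mono) auto
    finally show "norm ((B w - B w') *v v) \<le> (b1 + b2) * K * norm (w - w') * norm v" by (simp add: mult_ac)
  qed
qed

text \<open>The argument is filtered as well. On functions that are invariant under the filter this is the
right-hand side of the truncated system, and it is defined and Lipschitz on bounded sets of
continuous functions, without any derivative of the argument.\<close>

definition trunc_field :: "('d \<Rightarrow> real^'n \<Rightarrow> real^'n^'n) \<Rightarrow> nat \<Rightarrow> (real^'d \<Rightarrow> real^'n) \<Rightarrow> real^'d \<Rightarrow> real^'n" where
  "trunc_field A N u x = - lowpass N (quasilinear_term A (lowpass N u)) x"

lemma quasilinear_pd: "quasilinear_term A p x = (\<Sum>j\<in>UNIV. A j (p x) *v pd j p x)"
  by (simp add: quasilinear_term_def pd_def)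

lemma continuous_quasilinear:
  assumes "\<And>j. continuous_on UNIV (A j)" "C1_torus p"
  shows "continuous_on UNIV (quasilinear_term A p)"
proof -
  have "continuous_on UNIV (\<lambda>x. A j (p x))" for j
    by (rule continuous_on_compose2[OF assms(1) C1_torus_continuous[OF assms(2)]]) auto
  then show ?thesis
    unfolding quasilinear_pd[abs_def]
    by (intro continuous_on_sum continuous_matrix_vector C1_torus_pd_continuous assms(2))
qed

lemma polynomial_matrix_continuous:
  fixes B :: "real^'n \<Rightarrow> real^'n^'n"
  assumes "\<And>a b. real_polynomial_function (\<lambda>u. B u $ a $ b)"
  shows "continuous_on UNIV B"
proof -
  obtain B' where "\<And>u. (B has_derivative blinfun_apply (B' u)) (at u)"
    using polynomial_matrix_C1[where S = B, OF assms] by blast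
  then show ?thesis by (rule has_derivative_continuous_on_UNIV)
qed

lemma trunc_field_lipschitz:
  fixes A :: "'d::finite \<Rightarrow> real^'n \<Rightarrow> real^'n^'n"
  assumes A: "\<And>j a b. real_polynomial_function (\<lambda>u. A j u $ a $ b)" and r: "0 \<le> r"
  shows "\<exists>B \<Lambda>. 0 \<le> B \<and> 0 \<le> \<Lambda> \<and>
    (\<forall>u x. continuous_on UNIV u \<longrightarrow> (\<forall>x. norm (u x) \<le> r) \<longrightarrow> norm (trunc_field A N u x) \<le> B) \<and>
    (\<forall>u v m x. continuous_on UNIV u \<longrightarrow> continuous_on UNIV v \<longrightarrow> (\<forall>x. norm (u x) \<le> r) \<longrightarrow> (\<forall>x. norm (v x) \<le> r)
       \<longrightarrow> (\<forall>x. norm (u x - v x) \<le> m) \<longrightarrow> norm (trunc_field A N u x - trunc_field A N v x) \<le> \<Lambda> * m)"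
proof -
  define P where "P = real CARD('n) * real (card (cube N :: (int^'d) set))"
  have P0: "0 \<le> P" by (simp add: P_def)
  have lpP: "norm (lowpass N u x) \<le> P * m" if "continuous_on UNIV u" "\<And>x. norm (u x) \<le> m" for u :: "real^'d \<Rightarrow> real^'n" and m x
    using norm_lowpass_le[OF that, of N x] by (simp add: P_def mult.assoc)
  have pdP: "norm (pd j (lowpass N u) x) \<le> P * real N * m" if "continuous_on UNIV u" "\<And>x. norm (u x) \<le> m" for u :: "real^'d \<Rightarrow> real^'n" and m j x
    using norm_pd_lowpass_le[OF that, of j N x] by (simp add: P_def mult.assoc)
  have "\<forall>j. \<exists>b\<ge>0. (\<forall>w v. norm w \<le> P * r \<longrightarrow> norm (A j w *v v) \<le> b * norm v) \<and>
    (\<forall>w w' v. norm w \<le> P * r \<longrightarrow> norm w' \<le> P * r \<longrightarrow> norm ((A j w - A j w') *v v) \<le> b * norm (w - w') * norm v)"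
    using polynomial_matrix_bounds[OF A] by metis
  then obtain bj where bj: "\<And>j. 0 \<le> bj j" "\<And>j w v. norm w \<le> P * r \<Longrightarrow> norm (A j w *v v) \<le> bj j * norm v"
    "\<And>j w w' v. norm w \<le> P * r \<Longrightarrow> norm w' \<le> P * r \<Longrightarrow> norm ((A j w - A j w') *v v) \<le> bj j * norm (w - w') * norm v"
    by metis
  define b where "b = (\<Sum>j\<in>UNIV. bj j)"
  have b0: "0 \<le> b" unfolding b_def by (intro sum_nonneg bj)
  have cA: "continuous_on UNIV (A j)" for j by (rule polynomial_matrix_continuous[OF A])
  define Q where "Q = b * (P * real N * r)"
  define Q' where "Q' = b * P * (P * real N * r) + b * (P * real N)"
  have cq: "continuous_on UNIV (quasilinear_term A (lowpass N u))" for u :: "real^'d \<Rightarrow> real^'n"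
    unfolding lowpass_rtp by (rule continuous_quasilinear[OF cA C1_torus_rtp(1)])
  have q1: "norm (quasilinear_term A (lowpass N u) x) \<le> Q"
    if u: "continuous_on UNIV u" "\<And>x. norm (u x) \<le> r" for u :: "real^'d \<Rightarrow> real^'n" and x
  proof -
    have "norm (quasilinear_term A (lowpass N u) x) \<le> (\<Sum>j\<in>UNIV. bj j * (P * real N * r))"
      unfolding quasilinear_pd
    proof (rule order_trans[OF norm_sum sum_mono])
      fix j
      have "norm (A j (lowpass N u x) *v pd j (lowpass N u) x) \<le> bj j * norm (pd j (lowpass N u) x)"
        by (rule bj(2)[OF lpP[OF u]])
      also have "\<dots> \<le> bj j * (P * real N * r)" by (intro mult_left_mono pdP[OF u] bj)
      finally show "norm (A j (lowpass N u x) *v pd j (lowpass N u) x) \<le> bj j * (P * real N * r)" .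
    qed
    then show ?thesis by (simp add: Q_def b_def sum_distrib_right)
  qed
  have q2: "norm (quasilinear_term A (lowpass N u) x - quasilinear_term A (lowpass N v) x) \<le> Q' * m"
    if u: "continuous_on UNIV u" "\<And>x. norm (u x) \<le> r" and v: "continuous_on UNIV v" "\<And>x. norm (v x) \<le> r"
      and d: "\<And>x. norm (u x - v x) \<le> m" for u v :: "real^'d \<Rightarrow> real^'n" and m x
  proof -
    let ?p = "lowpass N u" and ?q = "lowpass N v"
    have duv: "?p x - ?q x = lowpass N (\<lambda>x. u x - v x) x" for x by (rule lowpass_diff[OF u(1) v(1), symmetric])
    have dfun: "(\<lambda>x. ?p x - ?q x) = lowpass N (\<lambda>x. u x - v x)" using duv by auto
    have pdd: "pd j ?p x - pd j ?q x = pd j (lowpass N (\<lambda>x. u x - v x)) x" for j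
      using C1_torus_diff(2)[of ?p ?q j x] unfolding dfun by (simp add: lowpass_rtp C1_torus_rtp(1))
    have cd: "continuous_on UNIV (\<lambda>x. u x - v x)" by (intro continuous_on_diff u v)
    have "norm (quasilinear_term A ?p x - quasilinear_term A ?q x) \<le>
       (\<Sum>j\<in>UNIV. bj j * (P * m) * (P * real N * r) + bj j * (P * real N * m))"
      unfolding quasilinear_pd sum_subtractf[symmetric]
    proof (rule order_trans[OF norm_sum sum_mono])
      fix j
      have e: "A j (?p x) *v pd j ?p x - A j (?q x) *v pd j ?q x
          = (A j (?p x) - A j (?q x)) *v pd j ?p x + A j (?q x) *v (pd j ?p x - pd j ?q x)"
        by (simp add: matrix_vector_mult_diff_rdistrib matrix_vector_mult_diff_distrib)
      have "norm ((A j (?p x) - A j (?q x)) *v pd j ?p x) \<le> bj j * norm (?p x - ?q x) * norm (pd j ?p x)"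
        by (rule bj(3)[OF lpP[OF u] lpP[OF v]])
      also have "\<dots> \<le> bj j * (P * m) * (P * real N * r)"
        unfolding duv using P0 order_trans[OF norm_ge_zero d]
        by (intro mult_mono mult_left_mono lpP[OF cd d] pdP[OF u] bj mult_nonneg_nonneg) auto
      finally have 1: "norm ((A j (?p x) - A j (?q x)) *v pd j ?p x) \<le> bj j * (P * m) * (P * real N * r)" .
      have "norm (A j (?q x) *v (pd j ?p x - pd j ?q x)) \<le> bj j * norm (pd j ?p x - pd j ?q x)"
        by (rule bj(2)[OF lpP[OF v]])
      also have "\<dots> \<le> bj j * (P * real N * m)"
        unfolding pdd by (intro mult_left_mono pdP[OF cd d] bj)
      finally have 2: "norm (A j (?q x) *v (pd j ?p x - pd j ?q x)) \<le> bj j * (P * real N * m)" .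
      show "norm (A j (?p x) *v pd j ?p x - A j (?q x) *v pd j ?q x) \<le> bj j * (P * m) * (P * real N * r) + bj j * (P * real N * m)"
        unfolding e by (rule norm_triangle_le[OF add_mono[OF 1 2]])
    qed
    also have "\<dots> = Q' * m"
      unfolding Q'_def b_def sum.distrib sum_distrib_right distrib_right by (simp add: mult_ac)
    finally show ?thesis .
  qed
  have PQ: "0 \<le> P * Q" "0 \<le> P * Q'" using P0 b0 r by (auto simp: Q_def Q'_def)
  have t1: "norm (trunc_field A N u x) \<le> P * Q" if "continuous_on UNIV u" "\<And>x. norm (u x) \<le> r" for u x
    unfolding trunc_field_def norm_minus_cancel by (rule lpP[OF cq q1[OF that]])
  have t2: "norm (trunc_field A N u x - trunc_field A N v x) \<le> P * Q' * m"
    if u: "continuous_on UNIV u" and v: "continuous_on UNIV v" and ur: "\<And>x. norm (u x) \<le> r" and vr: "\<And>x. norm (v x) \<le> r"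
      and d: "\<And>x. norm (u x - v x) \<le> m" for u v m x
  proof -
    let ?g = "\<lambda>x. quasilinear_term A (lowpass N u) x - quasilinear_term A (lowpass N v) x"
    have "trunc_field A N u x - trunc_field A N v x = - lowpass N ?g x"
      unfolding trunc_field_def by (simp add: lowpass_diff[OF cq cq])
    moreover have "norm (lowpass N ?g x) \<le> P * (Q' * m)"
      by (rule lpP[OF continuous_on_diff[OF cq cq] q2[OF u ur v vr d]])
    ultimately show ?thesis by (simp add: mult.assoc)
  qed
  show ?thesis
  proof (rule exI[of _ "P * Q"], rule exI[of _ "P * Q'"], intro conjI allI impI PQ)
    fix u :: "real^'d \<Rightarrow> real^'n" and x assume "continuous_on UNIV u" "\<forall>x. norm (u x) \<le> r"
    then show "norm (trunc_field A N u x) \<le> P * Q" by (intro t1) auto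
  next
    fix u v :: "real^'d \<Rightarrow> real^'n" and m x
    assume "continuous_on UNIV u" "continuous_on UNIV v" "\<forall>x. norm (u x) \<le> r" "\<forall>x. norm (v x) \<le> r" "\<forall>x. norm (u x - v x) \<le> m"
    then show "norm (trunc_field A N u x - trunc_field A N v x) \<le> P * Q' * m" by (intro t2) auto
  qed
qed

section \<open>Continuation of solutions of the truncated system\<close>

lemma C1_on_trigonometric:
  fixes c c' :: "real \<Rightarrow> int^'d \<Rightarrow> complex^'n" and W :: "real \<Rightarrow> real^'d \<Rightarrow> real^'n"
  assumes J: "open J" and W: "\<And>t x. t \<in> J \<Longrightarrow> W t x = rtp (cube N) (c t) x"
    and d: "\<And>t k a. t \<in> J \<Longrightarrow> ((\<lambda>t. c t k $ a) has_vector_derivative c' t k $ a) (at t)"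
    and cont: "\<And>k a. continuous_on J (\<lambda>t. c' t k $ a)"
  shows "C1_on (J \<times> UNIV) (\<lambda>(t, x). W t x)"
proof -
  define D where "D z v = (\<chi> a. Re (\<Sum>k\<in>cube N. c (fst z) k $ a * (\<i> * of_real (freq k \<bullet> snd v) * wave k (snd z))
      + (fst v *\<^sub>R c' (fst z) k $ a) * wave k (snd z)))" for z v :: "real \<times> (real^'d)"
  have der: "((\<lambda>z. rtp (cube N) (c (fst z)) (snd z)) has_derivative D z) (at z)" if z: "fst z \<in> J" for z :: "real \<times> (real^'d)"
  proof (rule has_derivative_vec_nthI)
    fix a
    have 1: "((\<lambda>z. c (fst z) k $ a) has_derivative (\<lambda>v. fst v *\<^sub>R c' (fst z) k $ a)) (at z)" for k
      by (rule has_derivative_compose[OF has_derivative_fst[OF has_derivative_ident] d[OF z, unfolded has_vector_derivative_def]])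
    have 2: "((\<lambda>z. wave k (snd z)) has_derivative (\<lambda>v. \<i> * of_real (freq k \<bullet> snd v) * wave k (snd z))) (at z)" for k
      by (rule has_derivative_compose[OF has_derivative_snd[OF has_derivative_ident] wave_has_derivative])
    have "((\<lambda>z. Re (\<Sum>k\<in>cube N. c (fst z) k $ a * wave k (snd z))) has_derivative
       (\<lambda>v. Re (\<Sum>k\<in>cube N. c (fst z) k $ a * (\<i> * of_real (freq k \<bullet> snd v) * wave k (snd z))
      + (fst v *\<^sub>R c' (fst z) k $ a) * wave k (snd z)))) (at z)"
      by (intro bounded_linear.has_derivative[OF bounded_linear_Re] has_derivative_sum has_derivative_mult 1 2)
    then show "((\<lambda>z. rtp (cube N) (c (fst z)) (snd z) $ a) has_derivative (\<lambda>v. D z v $ a)) (at z)"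
      by (simp only: rtp_nth D_def vec_lambda_beta)
  qed
  have bl: "blinfun_apply (Blinfun (D z)) = D z" if "fst z \<in> J" for z
    by (rule bounded_linear_Blinfun_apply[OF has_derivative_bounded_linear[OF der[OF that]]])
  have cc: "continuous_on J (\<lambda>t. c t k $ a)" for k a
    by (intro continuous_at_imp_continuous_on ballI has_vector_derivative_continuous[OF d])
  show ?thesis
    unfolding C1_on_def
  proof (intro exI[of _ "\<lambda>z. Blinfun (D z)"] conjI ballI)
    fix z :: "real \<times> (real^'d)" assume "z \<in> J \<times> UNIV"
    then have z: "fst z \<in> J" by auto
    show "((\<lambda>(t, x). W t x) has_derivative blinfun_apply (Blinfun (D z))) (at z)"
      unfolding bl[OF z]
    proof (rule has_derivative_transform_within_open[OF der[OF z]])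
      show "open (J \<times> (UNIV :: (real^'d) set))" using J by (intro open_Times) auto
      show "z \<in> J \<times> UNIV" by fact
    qed (use W in auto)
  next
    show "continuous_on (J \<times> UNIV) (\<lambda>z. Blinfun (D z))"
    proof (rule continuous_on_blinfun_componentwise)
      fix i :: "real \<times> (real^'d)"
      have c1: "continuous_on (J \<times> (UNIV :: (real^'d) set)) (\<lambda>z. c (fst z) k $ a)"
        and c2: "continuous_on (J \<times> (UNIV :: (real^'d) set)) (\<lambda>z. c' (fst z) k $ a)" for k a
        by (rule continuous_on_compose2[OF cc], auto intro: continuous_on_fst continuous_on_id)
           (rule continuous_on_compose2[OF cont], auto intro: continuous_on_fst continuous_on_id)
      have "continuous_on (J \<times> UNIV) (\<lambda>z. D z i)"
        unfolding D_def
        by (intro continuous_on_vec_lambda continuous_on_Re continuous_on_sum continuous_on_add continuous_on_mult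
            continuous_on_const continuous_wave continuous_on_snd continuous_on_id c1 c2 continuous_on_scaleR)
      then show "continuous_on (J \<times> UNIV) (\<lambda>z. blinfun_apply (Blinfun (D z)) i)"
        by (rule continuous_on_eq) (use bl in auto)
    qed
  qed
qed

lemma trigonometric_in_sobolev:
  fixes f :: "real^'d \<Rightarrow> real^'n"
  assumes f: "f = lowpass N f"
  shows "f \<in> sobolev s" "(sobolev_norm s f)\<^sup>2 = (\<Sum>k\<in>cube N. japanese_bracket k powr (2 * s) * (norm (fourier_coeff f k))\<^sup>2)"
proof -
  have C: "C1_torus f" by (subst f) (simp add: lowpass_rtp C1_torus_rtp)
  note cf = C1_torus_continuous[OF C]
  have z: "fourier_coeff f k = 0" if "k \<notin> cube N" for k
    by (subst f) (simp add: fourier_coeff_lowpass[OF cf] that)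
  let ?g = "\<lambda>k. japanese_bracket k powr (2 * s) * (norm (fourier_coeff f k))\<^sup>2"
  have hs: "(?g has_sum (\<Sum>k\<in>cube N. ?g k)) UNIV"
    by (rule has_sum_finite_neutralI[of "cube N"]) (auto simp: z)
  have c2: "continuous_on UNIV (\<lambda>x. (norm (f x))\<^sup>2)" by (intro continuous_intros cf)
  have "(\<lambda>x. (norm (f x))\<^sup>2) absolutely_integrable_on torus_cell"
    unfolding torus_cell_def
    by (rule absolutely_integrable_continuous) (rule continuous_on_subset[OF c2], simp)
  moreover have "f \<in> borel_measurable lebesgue"
    using borel_measurable_continuous_onI[OF cf] by (intro measurable_completion) simp
  ultimately show "f \<in> sobolev s"
    using hs C1_torus_periodic[OF C] by (auto simp: sobolev_def summable_on_def)
  show "(sobolev_norm s f)\<^sup>2 = sum ?g (cube N)"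
    using infsumI[OF hs] by (simp add: sobolev_norm_def sum_nonneg)
qed

lemma lowpass_neg:
  fixes g :: "real^'d \<Rightarrow> real^'n"
  assumes "continuous_on UNIV g"
  shows "lowpass N (\<lambda>x. - g x) = (\<lambda>x. - lowpass N g x)"
proof
  fix x
  have 1: "(- mat 1) *v v = - v" for v :: "real^'n" by (simp add: matrix_vector_neg)
  show "lowpass N (\<lambda>x. - g x) x = - lowpass N g x"
    using lowpass_matrix[OF assms, of N "- mat 1" x] by (simp only: 1)
qed

text \<open>Solutions of the truncated system with trigonometric polynomials as values are classical solutions:
all their Sobolev norms are finite sums of continuous coefficients.\<close>

lemma truncated_solutionI:
  fixes W W' :: "real \<Rightarrow> real^'d \<Rightarrow> real^'n"
  assumes J: "open J" "convex J" "0 \<in> J"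
    and d: "\<And>t x. t \<in> J \<Longrightarrow> ((\<lambda>\<tau>. W \<tau> x) has_vector_derivative W' t x) (at t)"
    and c: "continuous_on (J \<times> UNIV) (\<lambda>(t, x). W t x)" "continuous_on (J \<times> UNIV) (\<lambda>(t, x). W' t x)"
    and W': "\<And>t x. t \<in> J \<Longrightarrow> W' t x = - lowpass N (quasilinear_term A (W t)) x"
    and inv: "\<And>t. t \<in> J \<Longrightarrow> W t = lowpass N (W t)" and init: "W 0 = v0"
  shows "classical_solution A (lowpass N) UNIV s v0 J W"
proof -
  have cW: "continuous_on UNIV (W t)" if "t \<in> J" for t by (rule continuous_on_slice[OF c(1) that])
  have C1: "C1_on (J \<times> UNIV) (\<lambda>(t, x). W t x)"
  proof (rule C1_on_trigonometric[OF J(1), where N = N and c = "\<lambda>t. fourier_coeff (W t)" and c' = "\<lambda>t. fourier_coeff (W' t)"])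
    show "W t x = rtp (cube N) (fourier_coeff (W t)) x" if "t \<in> J" for t x
      using inv[OF that] by (simp only: lowpass_rtp[symmetric])
    show "((\<lambda>t. fourier_coeff (W t) k $ a) has_vector_derivative fourier_coeff (W' t) k $ a) (at t)" if "t \<in> J" for t k a
      by (rule fourier_coeff_has_vector_derivative[OF J(1,2) that d c])
    show "continuous_on J (\<lambda>t. fourier_coeff (W' t) k $ a)" for k a
      by (rule fourier_coeff_continuous_in_time[OF c(2)])
  qed
  have lim: "((\<lambda>\<tau>. sobolev_norm s (\<lambda>x. W \<tau> x - W t x)) \<longlongrightarrow> 0) (at t within J)" if t: "t \<in> J" for t
  proof -
    have inv2: "(\<lambda>x. W \<tau> x - W t x) = lowpass N (\<lambda>x. W \<tau> x - W t x)" if "\<tau> \<in> J" for \<tau>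
    proof
      fix x
      have "lowpass N (\<lambda>x. W \<tau> x - W t x) x = lowpass N (W \<tau>) x - lowpass N (W t) x"
        by (rule lowpass_diff[OF cW[OF that] cW[OF t]])
      then show "W \<tau> x - W t x = lowpass N (\<lambda>x. W \<tau> x - W t x) x"
        using inv[OF that] inv[OF t] by simp
    qed
    let ?q = "\<lambda>\<tau>. sqrt (\<Sum>k\<in>cube N. japanese_bracket k powr (2 * s) * (norm (fourier_coeff (W \<tau>) k - fourier_coeff (W t) k))\<^sup>2)"
    have eq: "sobolev_norm s (\<lambda>x. W \<tau> x - W t x) = ?q \<tau>" if "\<tau> \<in> J" for \<tau>
      using trigonometric_in_sobolev(2)[OF inv2[OF that], of s]
      unfolding fourier_coeff_diff[OF cW[OF that] cW[OF t]]
      by (rule real_sqrt_unique[symmetric]) (rule sobolev_norm_nonneg)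
    have cf: "continuous_on J (\<lambda>\<tau>. fourier_coeff (W \<tau>) k)" for k
      using fourier_coeff_continuous_in_time[OF c(1), of k] continuous_on_vec_lambda[of J "\<lambda>a t. fourier_coeff (W t) k $ a"] by simp
    have "continuous_on J ?q" by (intro continuous_intros cf)
    then have "(?q \<longlongrightarrow> ?q t) (at t within J)" using t unfolding continuous_on_def by blast
    moreover have "?q t = 0" by simp
    ultimately have "(?q \<longlongrightarrow> 0) (at t within J)" by (simp only:)
    then show ?thesis
      by (rule Lim_transform_eventually) (auto simp: eventually_at_filter eq)
  qed
  have "W t \<in> sobolev s" if "t \<in> J" for t by (rule trigonometric_in_sobolev(1)[OF inv[OF that]])
  then show ?thesis
    using J C1 lim d W' init by (auto simp: classical_solution_def sobolev_continuous_on_def is_interval_convex_1)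
qed

lemma lowpass_invariant:
  fixes W W' :: "real \<Rightarrow> real^'d \<Rightarrow> real^'n"
  assumes J: "open J" "convex J" "t0 \<in> J" "t \<in> J"
    and d: "\<And>t x. t \<in> J \<Longrightarrow> ((\<lambda>\<tau>. W \<tau> x) has_vector_derivative W' t x) (at t)"
    and c: "continuous_on (J \<times> UNIV) (\<lambda>(t, x). W t x)" "continuous_on (J \<times> UNIV) (\<lambda>(t, x). W' t x)"
    and W': "\<And>t. t \<in> J \<Longrightarrow> lowpass N (W' t) = W' t" and init: "W t0 = lowpass N (W t0)"
  shows "W t = lowpass N (W t)"
proof
  fix x
  have "((\<lambda>\<tau>. W \<tau> x - lowpass N (W \<tau>) x) has_derivative (\<lambda>h. 0)) (at \<tau> within J)" if "\<tau> \<in> J" for \<tau>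
  proof -
    have "((\<lambda>\<tau>. W \<tau> x - lowpass N (W \<tau>) x) has_vector_derivative W' \<tau> x - lowpass N (W' \<tau>) x) (at \<tau>)"
      unfolding lowpass_fmult
      by (intro has_vector_derivative_diff d that fmult_has_vector_derivative[OF J(1,2) that d c])
    then show ?thesis
      unfolding W'[OF that] has_vector_derivative_def by (simp add: has_derivative_at_withinI)
  qed
  from has_derivative_zero_unique[OF J(2) this J(4,3)]
  have "W t x - lowpass N (W t) x = W t0 x - lowpass N (W t0) x" .
  then show "W t x = lowpass N (W t) x" using init by simp
qed

lemma trunc_field_invariant:
  assumes "\<And>j. continuous_on UNIV (A j)"
  shows "lowpass N (trunc_field A N u) = trunc_field A N u" "continuous_on UNIV (trunc_field A N u)"
proof -
  have cq: "continuous_on UNIV (quasilinear_term A (lowpass N u))"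
    unfolding lowpass_rtp by (rule continuous_quasilinear[OF assms C1_torus_rtp(1)])
  have e: "trunc_field A N u = lowpass N (\<lambda>x. - quasilinear_term A (lowpass N u) x)"
    unfolding lowpass_neg[OF cq] by (simp add: trunc_field_def fun_eq_iff)
  show "lowpass N (trunc_field A N u) = trunc_field A N u"
    unfolding e by (rule lowpass_idem) (intro continuous_on_minus cq)
  show "continuous_on UNIV (trunc_field A N u)" unfolding e by (rule continuous_lowpass)
qed

text \<open>On an interval of length at most \<open>h\<close> around \<open>t0\<close> the distance of two solutions is at most one half of
its supremum.\<close>

lemma trunc_solution_unique:
  fixes V Y :: "real \<Rightarrow> real^'d \<Rightarrow> real^'n"
  assumes T: "convex T" "t0 \<in> T" "\<And>t. t \<in> T \<Longrightarrow> \<bar>t - t0\<bar> \<le> h" and h: "h * \<Lambda> \<le> 1 / 2" "0 \<le> \<Lambda>"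
    and lip: "\<And>u v m x. continuous_on UNIV u \<Longrightarrow> continuous_on UNIV v \<Longrightarrow> (\<And>x. norm (u x) \<le> r) \<Longrightarrow> (\<And>x. norm (v x) \<le> r)
       \<Longrightarrow> (\<And>x. norm (u x - v x) \<le> m) \<Longrightarrow> norm (G u x - G v x) \<le> \<Lambda> * m"
    and V: "\<And>t. t \<in> T \<Longrightarrow> continuous_on UNIV (V t)" "\<And>t x. t \<in> T \<Longrightarrow> norm (V t x) \<le> r"
      "\<And>t x. t \<in> T \<Longrightarrow> ((\<lambda>\<tau>. V \<tau> x) has_vector_derivative G (V t) x) (at t)"
    and Y: "\<And>t. t \<in> T \<Longrightarrow> continuous_on UNIV (Y t)" "\<And>t x. t \<in> T \<Longrightarrow> norm (Y t x) \<le> r"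
      "\<And>t x. t \<in> T \<Longrightarrow> ((\<lambda>\<tau>. Y \<tau> x) has_vector_derivative G (Y t) x) (at t)"
    and init: "V t0 = Y t0" and t: "t \<in> T"
  shows "V t x = Y t x"
proof -
  define D where "D = (\<lambda>(t, x). norm (V t x - Y t x)) ` (T \<times> UNIV)"
  define m where "m = Sup D"
  have "bdd_above D"
  proof (rule bdd_aboveI)
    fix y assume "y \<in> D"
    then obtain t x where tx: "t \<in> T" "y = norm (V t x - Y t x)" by (auto simp: D_def)
    have "y \<le> norm (V t x) + norm (Y t x)" unfolding tx by (rule norm_triangle_ineq4)
    then show "y \<le> 2 * r" using V(2)[OF tx(1), of x] Y(2)[OF tx(1), of x] by linarith
  qed
  then have le: "norm (V t x - Y t x) \<le> m" if "t \<in> T" for t x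
    unfolding m_def by (intro cSup_upper) (use that in \<open>auto simp: D_def\<close>)
  have m0: "0 \<le> m" using le[OF T(2), of undefined] norm_ge_zero order_trans by blast
  have half: "norm (V t x - Y t x) \<le> m / 2" if t: "t \<in> T" for t x
  proof -
    have "norm ((V t x - Y t x) - (V t0 x - Y t0 x)) \<le> (\<Lambda> * m) * norm (t - t0)"
    proof (rule differentiable_bound[OF T(1) _ _ t T(2), where f = "\<lambda>\<tau>. V \<tau> x - Y \<tau> x" and f' = "\<lambda>\<tau> h. h *\<^sub>R (G (V \<tau>) x - G (Y \<tau>) x)"])
      fix \<tau> assume \<tau>: "\<tau> \<in> T"
      show "((\<lambda>\<tau>. V \<tau> x - Y \<tau> x) has_derivative (\<lambda>h. h *\<^sub>R (G (V \<tau>) x - G (Y \<tau>) x))) (at \<tau> within T)"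
        using has_vector_derivative_diff[OF V(3)[OF \<tau>] Y(3)[OF \<tau>], of x x]
        by (simp add: has_vector_derivative_def has_derivative_at_withinI)
      show "onorm (\<lambda>h. h *\<^sub>R (G (V \<tau>) x - G (Y \<tau>) x)) \<le> \<Lambda> * m"
      proof (rule onorm_le)
        fix h :: real
        have "norm (G (V \<tau>) x - G (Y \<tau>) x) \<le> \<Lambda> * m"
          by (rule lip[OF V(1)[OF \<tau>] Y(1)[OF \<tau>] V(2)[OF \<tau>] Y(2)[OF \<tau>] le[OF \<tau>]])
        then show "norm (h *\<^sub>R (G (V \<tau>) x - G (Y \<tau>) x)) \<le> \<Lambda> * m * norm h"
          using mult_left_mono[of _ _ "\<bar>h\<bar>"] by (simp add: mult.commute[of "\<Lambda> * m"])
      qed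
    qed
    also have "\<dots> \<le> (\<Lambda> * m) * h" using T(3)[OF t] h m0 by (intro mult_left_mono) auto
    also have "\<dots> = (h * \<Lambda>) * m" by simp
    also have "\<dots> \<le> 1 / 2 * m" by (intro mult_right_mono h m0)
    finally show ?thesis using init by simp
  qed
  have "D \<noteq> {}" using T(2) by (auto simp: D_def)
  moreover have "y \<le> m / 2" if "y \<in> D" for y using that half by (auto simp: D_def)
  ultimately have "Sup D \<le> m / 2" by (rule cSup_least)
  then have "m \<le> m / 2" by (simp only: m_def)
  then have "m = 0" using m0 by linarith
  then show ?thesis using le[OF t, of x] by simp
qed

instance bcontfun :: (metric_space, banach) banach ..

lemma bounded_linear_apply_bcontfun: "bounded_linear (\<lambda>u :: ('a::topological_space \<Rightarrow>\<^sub>C 'b::real_normed_vector). apply_bcontfun u x)"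
  by (rule bounded_linear_intro[where K = 1]) (auto simp: norm_bounded)

lemma jointly_continuous_bcontfun:
  fixes y :: "real \<Rightarrow> ((real^'d) \<Rightarrow>\<^sub>C (real^'n))"
  assumes "continuous_on UNIV y"
  shows "continuous_on (A \<times> UNIV) (\<lambda>(t, x). apply_bcontfun (y t) x)"
proof -
  have "isCont (\<lambda>z. apply_bcontfun (y (fst z)) (snd z)) z" for z
  proof -
    define t where "t = fst z"
    have "continuous_on UNIV (\<lambda>z :: real \<times> (real^'d). y (fst z))"
      by (rule continuous_on_compose2[OF assms]) (auto intro: continuous_on_fst continuous_on_id)
    then have "isCont (\<lambda>z. y (fst z)) z"
      using continuous_on_eq_continuous_at[OF open_UNIV] by blast
    then have "((\<lambda>z. y (fst z)) \<longlongrightarrow> y t) (at z)"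
      by (simp only: isCont_def t_def)
    then have 1: "((\<lambda>z. dist (y (fst z)) (y t)) \<longlongrightarrow> 0) (at z)" by (rule tendsto_dist_iff[THEN iffD1])
    have "continuous_on UNIV (\<lambda>z :: real \<times> (real^'d). apply_bcontfun (y t) (snd z))"
      by (rule continuous_on_compose2[OF continuous_on_apply_bcontfun[of UNIV]]) (auto intro: continuous_on_snd continuous_on_id)
    then have "isCont (\<lambda>z. apply_bcontfun (y t) (snd z)) z"
      using continuous_on_eq_continuous_at[OF open_UNIV] by blast
    then have "((\<lambda>z. apply_bcontfun (y t) (snd z)) \<longlongrightarrow> apply_bcontfun (y t) (snd z)) (at z)"
      by (simp only: isCont_def)
    then have 2: "((\<lambda>w. dist (apply_bcontfun (y t) (snd w)) (apply_bcontfun (y t) (snd z))) \<longlongrightarrow> 0) (at z)"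
      by (rule tendsto_dist_iff[THEN iffD1])
    have 3: "((\<lambda>w. dist (y (fst w)) (y t) + dist (apply_bcontfun (y t) (snd w)) (apply_bcontfun (y t) (snd z))) \<longlongrightarrow> 0) (at z)"
      using tendsto_add[OF 1 2] by simp
    have "((\<lambda>w. dist (apply_bcontfun (y (fst w)) (snd w)) (apply_bcontfun (y t) (snd z))) \<longlongrightarrow> 0) (at z)"
    proof (rule tendsto_sandwich[OF _ _ tendsto_const 3])
      show "\<forall>\<^sub>F w in at z. dist (apply_bcontfun (y (fst w)) (snd w)) (apply_bcontfun (y t) (snd z))
          \<le> dist (y (fst w)) (y t) + dist (apply_bcontfun (y t) (snd w)) (apply_bcontfun (y t) (snd z))"
      proof (intro always_eventually allI)
        fix w :: "real \<times> (real^'d)"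
        show "dist (apply_bcontfun (y (fst w)) (snd w)) (apply_bcontfun (y t) (snd z))
          \<le> dist (y (fst w)) (y t) + dist (apply_bcontfun (y t) (snd w)) (apply_bcontfun (y t) (snd z))"
          using dist_triangle[of "apply_bcontfun (y (fst w)) (snd w)" "apply_bcontfun (y t) (snd z)" "apply_bcontfun (y t) (snd w)"]
            dist_bounded[of "y (fst w)" "snd w" "y t"] by linarith
      qed
    qed auto
    then show ?thesis unfolding isCont_def t_def by (subst tendsto_dist_iff) simp
  qed
  then show ?thesis by (simp add: case_prod_unfold continuous_at_imp_continuous_on)
qed

text \<open>A classical solution of the truncated system with filtered initial datum stays filtered, since
its time derivative is; so it solves the equation with \<open>trunc_field\<close>.\<close>

lemma truncated_solution_facts:
  fixes A :: "'d::finite \<Rightarrow> real^'n::finite \<Rightarrow> real^'n^'n" and V :: "real \<Rightarrow> real^'d \<Rightarrow> real^'n"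
  assumes A: "\<And>j. continuous_on UNIV (A j)"
    and sol: "classical_solution A (lowpass N) UNIV s v0 I V" and v0: "v0 = lowpass N v0"
  shows "open I" "convex I" "0 \<in> I"
    "\<And>t x. t \<in> I \<Longrightarrow> ((\<lambda>\<tau>. V \<tau> x) has_vector_derivative trunc_field A N (V t) x) (at t)"
    "\<And>t. t \<in> I \<Longrightarrow> V t = lowpass N (V t)"
    "continuous_on (I \<times> UNIV) (\<lambda>(t, x). V t x)"
    "continuous_on (I \<times> UNIV) (\<lambda>(t, x). trunc_field A N (V t) x)"
proof -
  show I: "open I" "convex I" "0 \<in> I"
    using sol by (auto simp: classical_solution_def is_interval_convex_1)
  have d: "((\<lambda>\<tau>. V \<tau> x) has_vector_derivative - lowpass N (quasilinear_term A (V t)) x) (at t)" if "t \<in> I" for t x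
    using sol that by (simp add: classical_solution_def)
  obtain ut where ut: "\<And>t x. t \<in> I \<Longrightarrow> ((\<lambda>\<tau>. V \<tau> x) has_vector_derivative ut t x) (at t)"
    "continuous_on (I \<times> UNIV) (\<lambda>(t, x). V t x)" "continuous_on (I \<times> UNIV) (\<lambda>(t, x). ut t x)"
    "\<And>t x. t \<in> I \<Longrightarrow> V t differentiable (at x)" "\<And>j. continuous_on (I \<times> UNIV) (\<lambda>(t, x). pd j (V t) x)"
    using sol C1_on_slices[of I V] unfolding classical_solution_def by metis
  show cV: "continuous_on (I \<times> UNIV) (\<lambda>(t, x). V t x)" by (rule ut(2))
  have ut_eq: "ut t x = - lowpass N (quasilinear_term A (V t)) x" if "t \<in> I" for t x
    by (rule vector_derivative_unique_at[OF ut(1)[OF that] d[OF that]])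
  have C: "C1_torus (V t)" if "t \<in> I" for t
  proof -
    have "continuous_on UNIV (pd j (V t))" for j by (rule continuous_on_slice[OF ut(5) that])
    moreover have "torus_periodic (V t)"
      using sol that by (simp add: classical_solution_def sobolev_continuous_on_def sobolev_def)
    ultimately show ?thesis using ut(4)[OF that] by (simp add: C1_torus_def)
  qed
  have inv: "V t = lowpass N (V t)" if t: "t \<in> I" for t
  proof (rule lowpass_invariant[OF I(1,2,3) t ut(1) ut(2,3)])
    show "V 0 = lowpass N (V 0)" using sol v0 by (simp add: classical_solution_def)
    fix t assume t: "t \<in> I"
    have cq: "continuous_on UNIV (quasilinear_term A (V t))" by (rule continuous_quasilinear[OF A C[OF t]])
    have "ut t = lowpass N (\<lambda>x. - quasilinear_term A (V t) x)"
      unfolding lowpass_neg[OF cq] using ut_eq[OF t] by auto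
    then show "lowpass N (ut t) = ut t" by (simp add: lowpass_idem continuous_on_minus cq)
  qed
  then show "V t = lowpass N (V t)" if "t \<in> I" for t using that .
  have tf: "trunc_field A N (V t) x = - lowpass N (quasilinear_term A (V t)) x" if "t \<in> I" for t x
    using inv[OF that] by (simp add: trunc_field_def)
  show "((\<lambda>\<tau>. V \<tau> x) has_vector_derivative trunc_field A N (V t) x) (at t)" if "t \<in> I" for t x
    using d[OF that] by (simp add: tf[OF that])
  show "continuous_on (I \<times> UNIV) (\<lambda>(t, x). trunc_field A N (V t) x)"
    by (rule continuous_on_eq[OF ut(3)]) (auto simp: ut_eq tf)
qed

text \<open>An open interval that does not contain a given point of \<open>J\<close> has a boundary point \<open>T\<close> in \<open>J\<close>, which
  is approached from the side of \<open>0\<close>. The neighbourhood \<open>Q\<close> of \<open>T\<close> meets \<open>I\<close>, so \<open>I \<union> Q\<close> is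
again an interval, and it does so only between a restarting time \<open>t0\<close> and \<open>T\<close>.\<close>

lemma interval_exit:
  fixes I J :: "real set"
  assumes I: "open I" "convex I" "0 \<in> I" and J: "convex J" "0 \<in> J" "t1 \<in> J" "t1 \<notin> I" and h: "0 < h"
  obtains t0 T Q where "t0 \<in> I" "T \<notin> I" "T \<in> Q" "open Q" "convex Q" "Q \<subseteq> {t0 - h<..<t0 + h}"
    "closed_segment t0 T \<subseteq> J" "I \<inter> Q \<subseteq> closed_segment t0 T" "I \<inter> Q \<noteq> {}"
proof -
  have "closed_segment 0 t1 \<inter> frontier I \<noteq> {}"
    by (rule connected_Int_frontier) (use I J in auto)
  then obtain T where T: "T \<in> closed_segment 0 t1" "T \<in> frontier I" by blast
  have TI: "T \<notin> I" using T(2) I(1) by (simp add: frontier_def interior_open)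
  have TJ: "T \<in> J" using T(1) J closed_segment_subset by blast
  have T0: "T \<noteq> 0" using TI I(3) by auto
  have "T \<in> closure I" using T(2) by (simp add: frontier_def)
  then obtain t' where t': "t' \<in> I" "dist t' T < h" using h by (auto simp: closure_approachable)
  have conn: "x \<in> I" if "a \<in> I" "b \<in> I" "a \<le> x" "x \<le> b" for a b x
    using I(2) that unfolding is_interval_convex_1[symmetric] is_interval_1 by blast
  have connJ: "x \<in> J" if "a \<in> J" "b \<in> J" "a \<le> x" "x \<le> b" for a b x
    using J(1) that unfolding is_interval_convex_1[symmetric] is_interval_1 by blast
  show ?thesis
  proof (cases "0 < T")
    case True
    define t0 where "t0 = max 0 t'"
    have lt: "x < T" if "x \<in> I" for x using conn[OF I(3) that, of T] TI True that by linarith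
    have t0: "t0 \<in> I" "0 \<le> t0" "t0 < T" "T < t0 + h"
      using t' I(3) lt[OF t'(1)] True by (auto simp: t0_def dist_real_def max_def)
    obtain e where e: "e > 0" "ball t0 e \<subseteq> I" using I(1) t0(1) by (auto simp: open_contains_ball)
    have near: "t0 + min (e/2) (h/2) \<in> I"
      using e h by (intro subsetD[OF e(2)]) (auto simp: dist_real_def min_def)
    show ?thesis
    proof (rule that[of t0 T "{t0<..<t0 + h}"])
      show "closed_segment t0 T \<subseteq> J"
        using connJ[OF J(2) TJ] t0 by (auto simp: closed_segment_eq_real_ivl)
      show "I \<inter> {t0<..<t0 + h} \<subseteq> closed_segment t0 T"
        using less_imp_le[OF lt] t0 by (auto simp: closed_segment_eq_real_ivl)
      show "I \<inter> {t0<..<t0 + h} \<noteq> {}"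
      proof -
        have "0 < min (e/2) (h/2)" "min (e/2) (h/2) < h" using e(1) h by (auto simp: min_def)
        then have "t0 + min (e/2) (h/2) \<in> {t0<..<t0 + h}" by auto
        then show ?thesis using near by blast
      qed
    qed (use t0 TI in auto)
  next
    case False
    then have neg: "T < 0" using T0 by simp
    define t0 where "t0 = min 0 t'"
    have gt: "T < x" if "x \<in> I" for x using conn[OF that I(3), of T] TI neg that by linarith
    have t0: "t0 \<in> I" "t0 \<le> 0" "T < t0" "t0 - h < T"
      using t' I(3) gt[OF t'(1)] neg by (auto simp: t0_def dist_real_def min_def)
    obtain e where e: "e > 0" "ball t0 e \<subseteq> I" using I(1) t0(1) by (auto simp: open_contains_ball)
    have near: "t0 - min (e/2) (h/2) \<in> I"
      using e h by (intro subsetD[OF e(2)]) (auto simp: dist_real_def min_def)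
    show ?thesis
    proof (rule that[of t0 T "{t0 - h<..<t0}"])
      show "closed_segment t0 T \<subseteq> J"
        using connJ[OF TJ J(2)] t0 by (auto simp: closed_segment_eq_real_ivl)
      show "I \<inter> {t0 - h<..<t0} \<subseteq> closed_segment t0 T"
        using less_imp_le[OF gt] t0 by (auto simp: closed_segment_eq_real_ivl)
      show "I \<inter> {t0 - h<..<t0} \<noteq> {}"
      proof -
        have "0 < min (e/2) (h/2)" "min (e/2) (h/2) < h" using e(1) h by (auto simp: min_def)
        then have "t0 - min (e/2) (h/2) \<in> {t0 - h<..<t0}" by auto
        then show ?thesis using near by blast
      qed
    qed (use t0 TI in auto)
  qed
qed

text \<open>The bound \<open>r\<close> gives an existence time \<open>h\<close> that does not depend on the starting time. If \<open>I\<close> ended inside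
\<open>J\<close>, a restart closer than \<open>h\<close> to the end would give a solution past it, which coincides with \<open>V\<close> by
uniqueness; this contradicts maximality.\<close>

lemma truncated_continuation:
  fixes A :: "'d::finite \<Rightarrow> real^'n::finite \<Rightarrow> real^'n^'n" and V :: "real \<Rightarrow> real^'d \<Rightarrow> real^'n"
  assumes A: "\<And>j a b. real_polynomial_function (\<lambda>u. A j u $ a $ b)"
    and max: "maximal_classical_solution A (lowpass N) UNIV s v0 I V" and v0: "v0 = lowpass N v0"
    and J: "convex J" "0 \<in> J" and r: "0 \<le> r" and bd: "\<And>t x. t \<in> I \<Longrightarrow> t \<in> J \<Longrightarrow> norm (V t x) \<le> r"
  shows "J \<subseteq> I"
proof (rule ccontr)
  assume "\<not> J \<subseteq> I"
  then obtain t1 where t1: "t1 \<in> J" "t1 \<notin> I" by blast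
  have cA: "continuous_on UNIV (A j)" for j by (rule polynomial_matrix_continuous[OF A])
  have sol: "classical_solution A (lowpass N) UNIV s v0 I V" using max by (simp add: maximal_classical_solution_def)
  note V = truncated_solution_facts[OF cA sol v0]
  have cV: "continuous_on UNIV (V t)" if "t \<in> I" for t by (rule continuous_on_slice[OF V(6) that])
  have r1: "0 \<le> r + 1" using r by simp
  obtain B \<Lambda> where B': "0 \<le> B" "0 \<le> \<Lambda>"
    "\<forall>u x. continuous_on UNIV u \<longrightarrow> (\<forall>x. norm (u x) \<le> r + 1) \<longrightarrow> norm (trunc_field A N u x) \<le> B"
    "\<forall>u v m x. continuous_on UNIV u \<longrightarrow> continuous_on UNIV v \<longrightarrow> (\<forall>x. norm (u x) \<le> r + 1) \<longrightarrow> (\<forall>x. norm (v x) \<le> r + 1)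
       \<longrightarrow> (\<forall>x. norm (u x - v x) \<le> m) \<longrightarrow> norm (trunc_field A N u x - trunc_field A N v x) \<le> \<Lambda> * m"
    using trunc_field_lipschitz[where A = A and N = N and r = "r + 1", OF A r1] by blast
  have B: "0 \<le> B" "0 \<le> \<Lambda>"
    "\<And>u x. continuous_on UNIV u \<Longrightarrow> (\<And>x. norm (u x) \<le> r + 1) \<Longrightarrow> norm (trunc_field A N u x) \<le> B"
    "\<And>u v m x. continuous_on UNIV u \<Longrightarrow> continuous_on UNIV v \<Longrightarrow> (\<And>x. norm (u x) \<le> r + 1) \<Longrightarrow> (\<And>x. norm (v x) \<le> r + 1)
       \<Longrightarrow> (\<And>x. norm (u x - v x) \<le> m) \<Longrightarrow> norm (trunc_field A N u x - trunc_field A N v x) \<le> \<Lambda> * m"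
    subgoal by (rule B'(1))
    subgoal by (rule B'(2))
    subgoal using B'(3) by blast
    subgoal using B'(4) by blast
    done
  define h where "h = 1 / (2 * (B + \<Lambda> + 1))"
  have h: "0 < h" "h * B \<le> 1" "h * \<Lambda> \<le> 1 / 2" using B(1,2) by (auto simp: h_def field_simps)
  obtain t0 T Q where Q: "t0 \<in> I" "T \<notin> I" "T \<in> Q" "open Q" "convex Q" "Q \<subseteq> {t0 - h<..<t0 + h}"
    "closed_segment t0 T \<subseteq> J" "I \<inter> Q \<subseteq> closed_segment t0 T" "I \<inter> Q \<noteq> {}"
    by (rule interval_exit[OF V(1,2,3) J t1 h(1)])
  have t0J: "t0 \<in> J" using Q(7) by auto
  define y0 where "y0 = Bcontfun (V t0)"
  have y0: "apply_bcontfun y0 = V t0"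
    unfolding y0_def by (rule Bcontfun_inverse, rule bcontfun_normI[OF cV[OF Q(1)] bd[OF Q(1) t0J]])
  define F where "F u = Bcontfun (trunc_field A N (apply_bcontfun u))" for u :: "(real^'d) \<Rightarrow>\<^sub>C (real^'n)"
  have ball: "norm (apply_bcontfun u x) \<le> r + 1" if "u \<in> cball y0 1" for u x
  proof -
    have "dist (apply_bcontfun y0 x) (apply_bcontfun u x) \<le> 1"
      using dist_bounded[of y0 x u] that by simp
    then have "norm (apply_bcontfun u x - V t0 x) \<le> 1" by (simp add: y0 dist_norm norm_minus_commute)
    then show ?thesis using bd[OF Q(1) t0J, of x] norm_triangle_sub[of "apply_bcontfun u x" "V t0 x"] by linarith
  qed
  have F: "apply_bcontfun (F u) = trunc_field A N (apply_bcontfun u)" if "u \<in> cball y0 1" for u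
    unfolding F_def
    by (rule Bcontfun_inverse, rule bcontfun_normI[OF trunc_field_invariant(2)[OF cA] B(3)]) (use ball[OF that] in auto)
  have FB: "norm (F u) \<le> B" if "u \<in> cball y0 1" for u
    by (rule norm_bound) (unfold F[OF that], rule B(3), use ball[OF that] in auto)
  have FL: "norm (F u - F v) \<le> \<Lambda> * norm (u - v)" if u: "u \<in> cball y0 1" and v: "v \<in> cball y0 1" for u v
  proof (rule norm_bound)
    fix x
    have "norm (trunc_field A N (apply_bcontfun u) x - trunc_field A N (apply_bcontfun v) x) \<le> \<Lambda> * norm (u - v)"
    proof (rule B(4))
      show "norm (apply_bcontfun u x - apply_bcontfun v x) \<le> norm (u - v)" for x
        using norm_bounded[of "u - v" x] by simp
    qed (use ball[OF u] ball[OF v] in auto)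
    then show "norm (apply_bcontfun (F u - F v) x) \<le> \<Lambda> * norm (u - v)" by (simp add: F[OF u] F[OF v])
  qed
  obtain Y where Y: "Y t0 = y0" "\<And>t. Y t \<in> cball y0 1" "continuous_on UNIV Y"
    "\<And>t. t \<in> {t0 - h<..<t0 + h} \<Longrightarrow> (Y has_vector_derivative F (Y t)) (at t)"
    by (rule picard_lindelof[where F = F and ?y0.0 = y0 and B = B and \<Lambda> = \<Lambda> and h = h and ?t0.0 = t0, OF h B(1,2) FB FL]) blast+
  define y where "y t x = apply_bcontfun (Y t) x" for t x
  have yfun: "y t = apply_bcontfun (Y t)" for t by (rule ext) (simp add: y_def)
  have yd: "((\<lambda>\<tau>. y \<tau> x) has_vector_derivative trunc_field A N (y t) x) (at t)" if "t \<in> {t0 - h<..<t0 + h}" for t x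
    using bounded_linear.has_vector_derivative[OF bounded_linear_apply_bcontfun[of x] Y(4)[OF that]]
    by (simp add: F[OF Y(2)] yfun)
  have cy: "continuous_on UNIV (y t)" and yr: "norm (y t x) \<le> r + 1" for t x
    using ball[OF Y(2)] by (auto simp: yfun)
  have jy: "continuous_on (X \<times> UNIV) (\<lambda>(t, x). y t x)" for X
    unfolding y_def by (rule jointly_continuous_bcontfun[OF Y(3)])
  have "continuous_on (cball y0 1) F"
  proof (rule lipschitz_on_continuous_on[of \<Lambda>])
    show "\<Lambda>-lipschitz_on (cball y0 1) F" using FL B by (auto simp: lipschitz_on_def dist_norm)
  qed
  then have "continuous_on UNIV (\<lambda>t. F (Y t))" by (rule continuous_on_compose2[OF _ Y(3)]) (use Y(2) in auto)
  then have jy': "continuous_on (X \<times> UNIV) (\<lambda>(t, x). trunc_field A N (y t) x)" for X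
    using jointly_continuous_bcontfun[of "\<lambda>t. F (Y t)" X] by (simp add: F[OF Y(2)] yfun)
  have init: "V t0 = y t0" by (simp add: yfun Y(1) y0)
  have yinv: "y t = lowpass N (y t)" if "t \<in> {t0 - h<..<t0 + h}" for t
    by (rule lowpass_invariant[OF _ _ _ that yd jy jy' trunc_field_invariant(1)[OF cA], of t0])
       (use h V(5)[OF Q(1)] init in auto)
  have agree: "V t x = y t x" if t: "t \<in> I \<inter> Q" for t x
  proof (rule trunc_solution_unique[where T = "I \<inter> {t0 - h<..<t0 + h} \<inter> closed_segment t0 T" and ?t0.0 = t0 and h = h
        and \<Lambda> = \<Lambda> and r = "r + 1" and G = "trunc_field A N" and V = V and Y = y])
    let ?S = "I \<inter> {t0 - h<..<t0 + h} \<inter> closed_segment t0 T"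
    show "convex ?S" by (intro convex_Int V(2)) auto
    show "t0 \<in> ?S" using Q(1) h by auto
    show "t \<in> ?S" using t Q(6,8) by auto
    show "norm (V t x) \<le> r + 1" if "t \<in> ?S" for t x
      using bd[of t x] that Q(7) by auto
    show "norm (trunc_field A N u x - trunc_field A N v x) \<le> \<Lambda> * m"
      if "continuous_on UNIV u" "continuous_on UNIV v" "\<And>x. norm (u x) \<le> r + 1" "\<And>x. norm (v x) \<le> r + 1" "\<And>x. norm (u x - v x) \<le> m" for u v m x
      by (rule B(4)[OF that])
  qed (use h B cV V(4) cy yr yd init in auto)
  define W where "W t = (if t \<in> I then V t else y t)" for t
  define J' where "J' = I \<union> Q"
  have WQ: "W t = y t" if "t \<in> Q" for t using agree[of t] that by (auto simp: W_def)
  have WI: "W t = V t" if "t \<in> I" for t using that by (simp add: W_def)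
  have Qh: "t \<in> {t0 - h<..<t0 + h}" if "t \<in> Q" for t using Q(6) that by blast
  have dW: "((\<lambda>\<tau>. W \<tau> x) has_vector_derivative trunc_field A N (W t) x) (at t)" if "t \<in> J'" for t x
  proof (cases "t \<in> I")
    case True
    show ?thesis unfolding WI[OF True]
      by (rule has_vector_derivative_transform_within_open[OF V(4)[OF True] V(1) True]) (simp add: WI)
  next
    case False
    then have tQ: "t \<in> Q" using that by (simp add: J'_def)
    show ?thesis unfolding WQ[OF tQ]
      by (rule has_vector_derivative_transform_within_open[OF yd[OF Qh[OF tQ]] Q(4) tQ]) (simp add: WQ)
  qed
  have prod: "J' \<times> UNIV = I \<times> UNIV \<union> Q \<times> (UNIV :: (real^'d) set)" by (auto simp: J'_def)
  have jW: "continuous_on (J' \<times> UNIV) (\<lambda>(t, x). W t x)"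
    unfolding prod
  proof (rule continuous_on_open_Un)
    show "continuous_on (I \<times> UNIV) (\<lambda>(t, x). W t x)" by (rule continuous_on_eq[OF V(6)]) (auto simp: WI)
    show "continuous_on (Q \<times> UNIV) (\<lambda>(t, x). W t x)" by (rule continuous_on_eq[OF jy]) (auto simp: WQ)
  qed (use V(1) Q(4) in \<open>auto intro: open_Times\<close>)
  have jW': "continuous_on (J' \<times> UNIV) (\<lambda>(t, x). trunc_field A N (W t) x)"
    unfolding prod
  proof (rule continuous_on_open_Un)
    show "continuous_on (I \<times> UNIV) (\<lambda>(t, x). trunc_field A N (W t) x)" by (rule continuous_on_eq[OF V(7)]) (auto simp: WI)
    show "continuous_on (Q \<times> UNIV) (\<lambda>(t, x). trunc_field A N (W t) x)" by (rule continuous_on_eq[OF jy']) (auto simp: WQ)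
  qed (use V(1) Q(4) in \<open>auto intro: open_Times\<close>)
  have Winv: "W t = lowpass N (W t)" if "t \<in> J'" for t
  proof (cases "t \<in> I")
    case True
    show ?thesis unfolding WI[OF True] by (rule V(5)[OF True])
  next
    case False
    then have tQ: "t \<in> Q" using that by (simp add: J'_def)
    show ?thesis unfolding WQ[OF tQ] by (rule yinv[OF Qh[OF tQ]])
  qed
  have "classical_solution A (lowpass N) UNIV s v0 J' W"
  proof (rule truncated_solutionI[OF _ _ _ dW jW jW'])
    show "open J'" unfolding J'_def by (intro open_Un V(1) Q(4))
    have "connected J'"
      unfolding J'_def by (rule connected_Un[OF convex_connected[OF V(2)] convex_connected[OF Q(5)] Q(9)])
    then show "convex J'" by (simp only: is_interval_convex_1[symmetric] is_interval_connected_1)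
    show "0 \<in> J'" using V(3) by (simp add: J'_def)
    show "trunc_field A N (W t) x = - lowpass N (quasilinear_term A (W t)) x" if "t \<in> J'" for t x
      unfolding trunc_field_def using Winv[OF that] by simp
    show "W 0 = v0" using WI[OF V(3)] sol by (simp add: classical_solution_def)
  qed (use Winv in auto)
  moreover have "I \<subset> J'" using Q(2,3) by (auto simp: J'_def)
  ultimately show False using max WI unfolding maximal_classical_solution_def by blast
qed

section \<open>Bernstein inequalities for trigonometric polynomials\<close>

lemma card_cube_le: "real (card (cube N :: (int^'d) set)) \<le> (2 * real N + 1) ^ CARD('d)"
proof -
  have "(cube N :: (int^'d) set) \<subseteq> vec_lambda ` PiE UNIV (\<lambda>_. {- int N..int N})"
  proof
    fix k :: "int^'d" assume "k \<in> cube N"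
    then have "vec_nth k \<in> PiE UNIV (\<lambda>_. {- int N..int N})" by (auto simp: cube_def abs_le_iff) (metis minus_le_iff)
    then show "k \<in> vec_lambda ` PiE UNIV (\<lambda>_. {- int N..int N})"
      by (metis image_eqI vec_nth_inverse)
  qed
  then have "card (cube N :: (int^'d) set) \<le> card (PiE (UNIV :: 'd set) (\<lambda>_. {- int N..int N}))"
    by (rule surj_card_le[rotated]) (intro finite_PiE; auto)
  also have "\<dots> = (2 * N + 1) ^ CARD('d)"
  proof -
    have "card {- int N..int N} = 2 * N + 1" by (simp add: nat_eq_iff)
    then show ?thesis by (simp only: card_PiE[OF finite] prod_constant)
  qed
  finally have "real (card (cube N :: (int^'d) set)) \<le> real ((2 * N + 1) ^ CARD('d))" by linarith
  then show ?thesis by (simp add: add.commute)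
qed

lemma rtp_sup_square_le:
  fixes c :: "int^'d \<Rightarrow> complex^'n"
  shows "(norm (rtp F c x))\<^sup>2 \<le> real (card F) * (\<Sum>k\<in>F. (norm (c k))\<^sup>2)"
proof -
  have "(norm (rtp F c x))\<^sup>2 \<le> (\<Sum>a\<in>UNIV. real (card F) * (\<Sum>k\<in>F. (norm (c k $ a))\<^sup>2))"
    unfolding norm_vec_square
  proof (rule sum_mono)
    fix a
    have "\<bar>rtp F c x $ a\<bar> \<le> norm (\<Sum>k\<in>F. c k $ a * wave k x)"
      unfolding rtp_nth by (rule abs_Re_le_cmod)
    then have "(norm (rtp F c x $ a))\<^sup>2 \<le> (norm (\<Sum>k\<in>F. c k $ a * wave k x))\<^sup>2"
      by (intro power_mono) auto
    also have "\<dots> \<le> real (card F) * (\<Sum>k\<in>F. (norm (c k $ a * wave k x))\<^sup>2)"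
      by (rule norm_sum_square_le_card)
    finally show "(norm (rtp F c x $ a))\<^sup>2 \<le> real (card F) * (\<Sum>k\<in>F. (norm (c k $ a))\<^sup>2)"
      by (simp add: norm_mult)
  qed
  also have "\<dots> = real (card F) * (\<Sum>k\<in>F. (norm (c k))\<^sup>2)"
    unfolding norm_vec_square[of "c _"] sum_distrib_left[symmetric] by (subst sum.swap) simp
  finally show ?thesis .
qed

text \<open>Cauchy-Schwarz over the at most \<open>(3 * N) ^ d\<close> frequencies; a derivative costs a factor \<open>N\<close>.\<close>

lemma bernstein:
  fixes f :: "real^'d \<Rightarrow> real^'n"
  assumes f: "f = lowpass N f" and N: "1 \<le> N" and small: "(3 * real N) ^ CARD('d) * (real N)\<^sup>2 * msq f \<le> 1"
  shows "norm (f x) \<le> 1" "norm (pd j f x) \<le> 1"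
proof -
  have C: "C1_torus f" by (subst f) (simp add: lowpass_rtp C1_torus_rtp)
  note cf = C1_torus_continuous[OF C]
  have h: "hermitian (fourier_coeff f)" by (rule hermitian_fourier_coeff[OF cf])
  have fr: "f = rtp (cube N) (fourier_coeff f)" using f by (simp add: lowpass_rtp)
  have ms: "msq f = (\<Sum>k\<in>cube N. (norm (fourier_coeff f k))\<^sup>2)"
    using msq_rtp_hermitian[OF h, of "cube N"] fr by (simp add: cube_minus)
  have ms0: "0 \<le> msq f" by (rule msq_nonneg[OF cf])
  have card: "real (card (cube N :: (int^'d) set)) \<le> (3 * real N) ^ CARD('d)"
    by (rule order_trans[OF card_cube_le power_mono]) (use N in auto)
  have N1: "1 \<le> (real N)\<^sup>2" using N by simp
  have main: "real (card (cube N :: (int^'d) set)) * ((real N)\<^sup>2 * msq f) \<le> 1"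
  proof -
    have "real (card (cube N :: (int^'d) set)) * ((real N)\<^sup>2 * msq f) \<le> (3 * real N) ^ CARD('d) * ((real N)\<^sup>2 * msq f)"
      using ms0 by (intro mult_right_mono card) auto
    then show ?thesis using small by (simp add: mult.assoc)
  qed
  have "(norm (f x))\<^sup>2 \<le> real (card (cube N :: (int^'d) set)) * msq f"
    using rtp_sup_square_le[of "cube N" "fourier_coeff f" x] fr ms by simp
  also have "\<dots> \<le> real (card (cube N :: (int^'d) set)) * ((real N)\<^sup>2 * msq f)"
    using mult_right_mono[OF N1 ms0] by (intro mult_left_mono) auto
  finally have "(norm (f x))\<^sup>2 \<le> 1\<^sup>2" using main by simp
  then show "norm (f x) \<le> 1" by (rule power2_le_imp_le) simp
  have pd: "pd j f = rtp (cube N) (\<lambda>k. \<chi> a. \<i> * of_int (k $ j) * fourier_coeff f k $ a)"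
    by (subst fr) (rule C1_torus_rtp(2))
  have "(\<Sum>k\<in>cube N. (norm ((\<chi> a. \<i> * of_int (k $ j) * fourier_coeff f k $ a) :: complex^'n))\<^sup>2) \<le> (\<Sum>k\<in>cube N. (real N)\<^sup>2 * (norm (fourier_coeff f k))\<^sup>2)"
  proof (rule sum_mono)
    fix k :: "int^'d" assume "k \<in> cube N"
    then have "\<bar>real_of_int (k $ j)\<bar> \<le> real N" unfolding cube_def by (metis (mono_tags) mem_Collect_eq of_int_abs of_int_le_iff of_int_of_nat_eq)
    then have k: "(real_of_int (k $ j))\<^sup>2 \<le> (real N)\<^sup>2" by (simp add: abs_le_square_iff[symmetric])
    have "(norm ((\<chi> a. \<i> * of_int (k $ j) * fourier_coeff f k $ a) :: complex^'n))\<^sup>2 = (real_of_int (k $ j))\<^sup>2 * (norm (fourier_coeff f k))\<^sup>2"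
      by (simp add: norm_vec_square norm_mult power_mult_distrib sum_distrib_left)
    also have "\<dots> \<le> (real N)\<^sup>2 * (norm (fourier_coeff f k))\<^sup>2" by (intro mult_right_mono k) auto
    finally show "(norm ((\<chi> a. \<i> * of_int (k $ j) * fourier_coeff f k $ a) :: complex^'n))\<^sup>2 \<le> (real N)\<^sup>2 * (norm (fourier_coeff f k))\<^sup>2" .
  qed
  also have "\<dots> = (real N)\<^sup>2 * msq f" by (simp add: ms sum_distrib_left)
  finally have "(norm (pd j f x))\<^sup>2 \<le> real (card (cube N :: (int^'d) set)) * ((real N)\<^sup>2 * msq f)"
    unfolding pd by (intro order_trans[OF rtp_sup_square_le] mult_left_mono) auto
  then have "(norm (pd j f x))\<^sup>2 \<le> 1\<^sup>2" using main by simp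
  then show "norm (pd j f x) \<le> 1" by (rule power2_le_imp_le) simp
qed

section \<open>The smooth truncation of a function with small tails\<close>

lemma tail_bound_le:
  assumes "tail_bound s b c" "0 < \<rho>" "finite F"
    and "\<And>k. k \<in> F \<Longrightarrow> norm (d k) \<le> norm (c k)" "\<And>k. k \<in> F \<Longrightarrow> norm (freq k) \<le> \<rho> \<Longrightarrow> d k = 0"
  shows "(\<Sum>k\<in>F. (norm (d k))\<^sup>2) \<le> b * \<rho> powr (- 2 * s)"
proof -
  have "(\<Sum>k\<in>F. (norm (d k))\<^sup>2) = (\<Sum>k\<in>{k\<in>F. \<rho> < norm (freq k)}. (norm (d k))\<^sup>2)"
    by (rule sum.mono_neutral_right) (use assms in \<open>auto simp: not_less\<close>)
  also have "\<dots> \<le> (\<Sum>k\<in>{k\<in>F. \<rho> < norm (freq k)}. (norm (c k))\<^sup>2)"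
    by (intro sum_mono power_mono assms) auto
  also have "\<dots> \<le> b * \<rho> powr (- 2 * s)"
    by (rule tail_boundD[OF assms(1,2)]) (use assms in auto)
  finally show ?thesis .
qed

lemma cutoff_outside_cube:
  assumes "1 \<le> N" "k \<notin> cube N"
  shows "cutoff (real N) k = 0"
proof (rule cutoff_eq_0)
  show "real N \<le> norm (freq k)" using in_cube[of k N] assms(2) by linarith
qed (use assms in auto)

lemma fourier_coeff_smooth_truncation:
  assumes "continuous_on UNIV u" "1 \<le> N"
  shows "fourier_coeff (fmult (cutoff (real N)) N u) k = cutoff (real N) k *\<^sub>R fourier_coeff u k"
  using cutoff_outside_cube[OF assms(2)] by (auto simp: fourier_coeff_fmult[OF assms(1)])

lemma smooth_truncation_defect:
  assumes "1 \<le> N"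
  shows "norm ((cutoff (real N) k - 1) *\<^sub>R v) \<le> norm v" "norm (freq k) \<le> real N / 2 \<Longrightarrow> (cutoff (real N) k - 1) *\<^sub>R v = 0"
proof -
  have "\<bar>cutoff (real N) k - 1\<bar> \<le> 1" using cutoff_bounds[of "real N" k] by linarith
  then show "norm ((cutoff (real N) k - 1) *\<^sub>R v) \<le> norm v"
    using mult_right_mono[of "\<bar>cutoff (real N) k - 1\<bar>" 1 "norm v"] by simp
  show "norm (freq k) \<le> real N / 2 \<Longrightarrow> (cutoff (real N) k - 1) *\<^sub>R v = 0"
    using cutoff_eq_1[of "real N" k] assms by simp
qed

lemma msq_smooth_truncation_error:
  fixes u :: "real^'d \<Rightarrow> real^'n"
  assumes u: "continuous_on UNIV u" "\<And>a. wiener_bound \<alpha> (\<lambda>x. of_real (u x $ a))" and tb: "tail_bound s b (fourier_coeff u)"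
    and N: "1 \<le> N"
  shows "msq (\<lambda>x. fmult (cutoff (real N)) N u x - u x) \<le> real CARD('n) * (b * (2 powr (2 * s) * real N powr (- 2 * s)))"
proof -
  let ?e = "\<lambda>x. fmult (cutoff (real N)) N u x - u x"
  have ce: "continuous_on UNIV ?e" by (intro continuous_on_diff continuous_fmult u)
  have fe: "fourier_coeff ?e k = (cutoff (real N) k - 1) *\<^sub>R fourier_coeff u k" for k
    by (simp add: fourier_coeff_diff[OF continuous_fmult u(1)] fourier_coeff_smooth_truncation[OF u(1) N] scaleR_diff_left)
  have fce: "fc (\<lambda>x. of_real (?e x $ a)) k = (cutoff (real N) k - 1) *\<^sub>R fc (\<lambda>x. of_real (u x $ a)) k" for a k
    using arg_cong[OF fe[of k], of "\<lambda>v. v $ a"]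
    by (simp only: fourier_coeff_fc[OF ce] fourier_coeff_fc[OF u(1)] scaleR_vec_nth) (simp add: scaleR_conv_of_real)
  have per: "torus_periodic ?e"
  proof -
    have "torus_periodic u"
      using u(2) unfolding wiener_bound_def torus_periodic_def by (simp add: vec_eq_iff)
    then show ?thesis using C1_torus_periodic[OF C1_torus_fmult[of "cutoff (real N)" N u]] by (simp add: torus_periodic_def)
  qed
  have w: "(\<lambda>x. of_real (?e x $ a)) \<in> wiener" for a
  proof -
    have "(\<lambda>k. norm (fc (\<lambda>x. complex_of_real (?e x $ a)) k)) summable_on UNIV"
      by (rule summable_on_comparison_test[OF wiener_bound_coeffs(1)[OF u(2)[of a]]])
         (use smooth_truncation_defect(1)[OF N] in \<open>auto simp only: fce norm_ge_zero\<close>)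
    moreover have "continuous_on UNIV (\<lambda>x. complex_of_real (?e x $ a))" by (intro continuous_intros ce)
    moreover have "torus_periodic (\<lambda>x. complex_of_real (?e x $ a))"
      unfolding torus_periodic_def
      by (intro allI arg_cong[where f = "\<lambda>v. complex_of_real (v $ a)"] per[unfolded torus_periodic_def, rule_format])
    ultimately show ?thesis by (simp add: wiener_def)
  qed
  have comp: "tmean (\<lambda>x. (?e x $ a)\<^sup>2) \<le> b * (2 powr (2 * s) * real N powr (- 2 * s))" for a
  proof -
    have hs: "((\<lambda>k. (norm (fc (\<lambda>x. of_real (?e x $ a)) k))\<^sup>2) has_sum tmean (\<lambda>x. (?e x $ a)\<^sup>2)) UNIV"
    proof -
      have "(norm (complex_of_real r))\<^sup>2 = r\<^sup>2" for r by simp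
      then show ?thesis using parseval[OF w[of a]] by (simp only:)
    qed
    have N2: "0 < real N / 2" using N by simp
    show ?thesis
    proof (rule has_sum_le_finite_sums[OF hs])
      fix F :: "(int^'d) set" assume "finite F"
      then have "(\<Sum>k\<in>F. (norm (fc (\<lambda>x. of_real (?e x $ a)) k))\<^sup>2) \<le> b * (real N / 2) powr (- 2 * s)"
        by (intro tail_bound_le[OF tail_bound_component[OF tb u(1)] N2, of F _ a])
           (simp_all only: fce smooth_truncation_defect[OF N])
      then show "(\<Sum>k\<in>F. (norm (fc (\<lambda>x. of_real (?e x $ a)) k))\<^sup>2) \<le> b * (2 powr (2 * s) * real N powr (- 2 * s))"
        using half_powr[of 2 "real N" s] N by simp
    qed
  qed
  have "msq ?e \<le> (\<Sum>a\<in>(UNIV::'n set). b * (2 powr (2 * s) * real N powr (- 2 * s)))"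
    unfolding msq_components[OF ce] by (intro sum_mono comp)
  then show ?thesis by simp
qed

lemma smooth_truncation_sup:
  fixes u :: "real^'d \<Rightarrow> real^'n"
  assumes u: "continuous_on UNIV u" "\<And>a. wiener_bound \<alpha> (\<lambda>x. of_real (u x $ a))"
  shows "norm (fmult (cutoff \<rho>) N u x) \<le> real CARD('n) * \<alpha>" "norm (pd j (fmult (cutoff \<rho>) N u) x) \<le> real CARD('n) * \<alpha>"
proof -
  have le: "\<bar>Re (\<Sum>k\<in>cube N. z k * wave k x)\<bar> \<le> \<alpha>" if z: "\<And>k. norm (z k) \<le> (1 + norm (freq k)) * norm (fc (\<lambda>x. of_real (u x $ a)) k)" for z a
  proof -
    have "\<bar>Re (\<Sum>k\<in>cube N. z k * wave k x)\<bar> \<le> norm (\<Sum>k\<in>cube N. z k * wave k x)" by (rule abs_Re_le_cmod)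
    also have "\<dots> \<le> (\<Sum>k\<in>cube N. norm (z k * wave k x))" by (rule norm_sum)
    also have "\<dots> \<le> (\<Sum>k\<in>cube N. (1 + norm (freq k)) * norm (fc (\<lambda>x. of_real (u x $ a)) k))"
      by (intro sum_mono) (simp add: norm_mult z)
    also have "\<dots> \<le> \<alpha>" using u(2)[of a] unfolding wiener_bound_def by simp
    finally show ?thesis .
  qed
  have c: "norm (complex_of_real (cutoff \<rho> k) * fourier_coeff u k $ a) \<le> norm (fc (\<lambda>x. of_real (u x $ a)) k)" for k a
    using cutoff_bounds[of \<rho> k] mult_right_mono[of "cutoff \<rho> k" 1 "norm (fc (\<lambda>x. of_real (u x $ a)) k)"]
    by (simp add: norm_mult fourier_coeff_fc[OF u(1)])
  show "norm (fmult (cutoff \<rho>) N u x) \<le> real CARD('n) * \<alpha>"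
  proof (rule norm_le_card_components)
    fix a
    show "\<bar>fmult (cutoff \<rho>) N u x $ a\<bar> \<le> \<alpha>"
      unfolding fmult_nth
    proof (rule le)
      fix k
      show "norm (complex_of_real (cutoff \<rho> k) * fourier_coeff u k $ a) \<le> (1 + norm (freq k)) * norm (fc (\<lambda>x. of_real (u x $ a)) k)"
        using c[of k a] mult_right_mono[of 1 "1 + norm (freq k)" "norm (fc (\<lambda>x. of_real (u x $ a)) k)"] by simp
    qed
  qed
  show "norm (pd j (fmult (cutoff \<rho>) N u) x) \<le> real CARD('n) * \<alpha>"
  proof (rule norm_le_card_components)
    fix a
    have e: "pd j (fmult (cutoff \<rho>) N u) x $ a = Re (\<Sum>k\<in>cube N. (\<i> * of_int (k $ j) * (of_real (cutoff \<rho> k) * fourier_coeff u k $ a)) * wave k x)"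
      unfolding fmult_def C1_torus_rtp(2) rtp_nth by (simp only: vec_lambda_beta scaleR_vec_nth)
    show "\<bar>pd j (fmult (cutoff \<rho>) N u) x $ a\<bar> \<le> \<alpha>"
      unfolding e
    proof (rule le)
      fix k :: "int^'d"
      have "norm (\<i> * of_int (k $ j) * (complex_of_real (cutoff \<rho> k) * fourier_coeff u k $ a))
         = \<bar>freq k $ j\<bar> * norm (complex_of_real (cutoff \<rho> k) * fourier_coeff u k $ a)" by (simp add: norm_mult)
      also have "\<dots> \<le> norm (freq k) * norm (fc (\<lambda>x. of_real (u x $ a)) k)"
        by (intro mult_mono component_le_norm_cart c) auto
      also have "\<dots> \<le> (1 + norm (freq k)) * norm (fc (\<lambda>x. of_real (u x $ a)) k)" by (intro mult_right_mono) auto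
      finally show "norm (\<i> * of_int (k $ j) * (complex_of_real (cutoff \<rho> k) * fourier_coeff u k $ a))
          \<le> (1 + norm (freq k)) * norm (fc (\<lambda>x. of_real (u x $ a)) k)" .
    qed
  qed
qed

text \<open>At the first time, seen from \<open>0\<close> in the direction of \<open>t\<close>, at which \<open>f\<close> reaches \<open>\<theta>\<close>, the hypothesis forces
the value \<open>\<theta> / 2\<close>.\<close>

lemma bootstrap_from_zero:
  fixes f :: "real \<Rightarrow> real"
  assumes T: "convex T" "0 \<in> T" and c: "continuous_on T f" and \<theta>: "0 < \<theta>" "f 0 \<le> \<theta>"
    and step: "\<And>t. t \<in> T \<Longrightarrow> (\<And>\<tau>. \<tau> \<in> closed_segment 0 t \<Longrightarrow> f \<tau> \<le> \<theta>) \<Longrightarrow> f t \<le> \<theta> / 2"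
    and t: "t \<in> T"
  shows "f t \<le> \<theta>"
proof (rule ccontr)
  assume "\<not> f t \<le> \<theta>"
  define g where "g \<sigma> = f (\<sigma> * t)" for \<sigma>
  have seg: "\<sigma> * t \<in> T" if "0 \<le> \<sigma>" "\<sigma> \<le> 1" for \<sigma>
    using convexD_alt[OF T(1,2) t that] by simp
  have cg: "continuous_on {0..1} g"
    unfolding g_def by (rule continuous_on_compose2[OF c]) (use seg in \<open>auto intro!: continuous_intros\<close>)
  define B where "B = {\<sigma> \<in> {0..1}. \<theta> \<le> g \<sigma>}"
  have "closed ({0..1} \<inter> g -` {\<theta>..})"
    by (rule continuous_closed_preimage[OF cg]) auto
  then have clB: "closed B" by (simp add: B_def vimage_def Int_def)
  have neB: "1 \<in> B" using \<open>\<not> f t \<le> \<theta>\<close> by (simp add: B_def g_def)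
  have bdB: "bdd_below B" by (rule bdd_belowI[of _ 0]) (simp add: B_def)
  define \<sigma> where "\<sigma> = Inf B"
  have \<sigma>B: "\<sigma> \<in> B" unfolding \<sigma>_def using closed_contains_Inf[OF _ bdB clB] neB by blast
  have low: "\<sigma> \<le> \<tau>" if "\<tau> \<in> B" for \<tau> unfolding \<sigma>_def by (rule cInf_lower[OF that bdB])
  have s01: "0 \<le> \<sigma>" "\<sigma> \<le> 1" "\<theta> \<le> g \<sigma>" using \<sigma>B by (auto simp: B_def)
  have "\<exists>\<tau>\<ge>0. \<tau> \<le> \<sigma> \<and> g \<tau> = \<theta>"
    by (rule IVT') (use \<theta> s01 continuous_on_subset[OF cg, of "{0..\<sigma>}"] in \<open>auto simp: g_def\<close>)
  then obtain \<tau> where \<tau>: "0 \<le> \<tau>" "\<tau> \<le> \<sigma>" "g \<tau> = \<theta>" by blast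
  then have "\<tau> = \<sigma>" using low[of \<tau>] s01 by (auto simp: B_def)
  then have gs: "g \<sigma> = \<theta>" using \<tau> by simp
  have "f (\<sigma> * t) \<le> \<theta> / 2"
  proof (rule step[OF seg[OF s01(1,2)]])
    fix x assume "x \<in> closed_segment 0 (\<sigma> * t)"
    then obtain v where v: "0 \<le> v" "v \<le> 1" "x = v * (\<sigma> * t)" by (auto simp: closed_segment_def)
    have vs: "0 \<le> v * \<sigma>" "v * \<sigma> \<le> \<sigma>" using v s01 by (auto simp: mult_left_le_one_le)
    have "g (v * \<sigma>) \<le> \<theta>"
    proof (rule ccontr)
      assume "\<not> g (v * \<sigma>) \<le> \<theta>"
      then have "v * \<sigma> \<in> B" using vs s01 by (auto simp: B_def)
      then have "v * \<sigma> = \<sigma>" using low[of "v * \<sigma>"] vs by simp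
      then have "g (v * \<sigma>) = \<theta>" by (simp only: gs)
      then show False using \<open>\<not> g (v * \<sigma>) \<le> \<theta>\<close> by simp
    qed
    then show "f x \<le> \<theta>" by (simp add: g_def v(3) mult.assoc)
  qed
  then show False using gs \<theta> by (simp add: g_def)
qed

section \<open>The error estimate\<close>

context bounded_regime
begin

text \<open>The Lipschitz constant of the remainder: the coefficients are Lipschitz with constant \<open>\<Lambda>A\<close>, and the gradient
of \<open>V\<close> is that of the smooth truncation up to \<open>1\<close>.\<close>

definition "H = real CARD('d) * (\<Lambda>A * (real CARD('n) * \<alpha> + 1))"
definition "a_err = (rate + 4 * H\<^sup>2) / c0"
definition "g_err = 2 * ((real CARD('d))\<^sup>2 * \<sigma>\<^sup>2 * comm_const) + 4 * H\<^sup>2 * (real CARD('n) * 2 powr (2 * s))"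
definition C_err :: "real \<Rightarrow> real" where
  "C_err L = exp ((a_err + 1) * L) * (\<beta> * 2 powr (2 * s) + g_err) / c0"

lemma err_const_nonneg: "0 \<le> H" "0 \<le> a_err" "0 \<le> g_err" "0 \<le> C_err L"
proof -
  show "0 \<le> H" using pos by (simp add: H_def)
  show "0 \<le> a_err" using beta'_ge pos by (simp add: a_err_def)
  show g: "0 \<le> g_err" using comm_const_nonneg by (simp add: g_err_def)
  show "0 \<le> C_err L" using pos g by (simp add: C_err_def)
qed

end

text \<open>The tail constant \<open>b\<close> is a parameter, since it is later taken from the Sobolev norm at the time at
which the error is evaluated. The last assumption is the condition on \<open>N\<close> under which Bernstein's
inequality applies to the error.\<close>

locale truncated_comparison = bounded_solution A S S0 \<U> s K S' \<alpha> c0 \<beta> \<gamma> \<sigma> CS \<Lambda>A u0 I U J M L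
  for A :: "'d::finite \<Rightarrow> real^'n::finite \<Rightarrow> real^'n^'n" and S S0 \<U> s K S' \<alpha> c0 \<beta> \<gamma> \<sigma> CS \<Lambda>A
    and u0 :: "real^'d \<Rightarrow> real^'n" and I U J M L +
  fixes N :: nat and V :: "real \<Rightarrow> real^'d \<Rightarrow> real^'n" and IN :: "real set" and b :: real
  assumes zero_J: "0 \<in> J" and N: "1 \<le> N"
    and b_tail: "\<And>t. t \<in> J \<Longrightarrow> tail_bound s b (fourier_coeff (U t))"
    and solN: "maximal_classical_solution A (lowpass N) UNIV s (lowpass N u0) IN V"
    and small: "(3 * real N) ^ CARD('d) * (real N)\<^sup>2 * (2 * ((C_err L + 2 powr (2 * s)) * (b * real N powr (- 2 * s)))) \<le> 1"
begin

definition E :: "real \<Rightarrow> real^'d \<Rightarrow> real^'n" where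
  "E t x = fmult (cutoff (real N)) N (U t) x - V t x"

definition "\<epsilon> = b * real N powr (- 2 * s)"

lemma b_nonneg: "0 \<le> b" "0 \<le> \<epsilon>"
  using tail_bound_nonneg[OF b_tail[OF zero_J]] by (auto simp: \<epsilon>_def)

lemma cont_A: "continuous_on UNIV (A j)"
  by (rule polynomial_matrix_continuous[OF A_poly])

lemma U_zero: "U 0 = u0"
  using sol by (simp add: classical_solution_def)

lemma cont_u0: "continuous_on UNIV u0"
  using C1_torus_continuous[OF U_C1_torus[OF zero_I]] by (simp add: U_zero)

lemma u0_trunc: "lowpass N u0 = lowpass N (lowpass N u0)"
  by (simp add: lowpass_idem cont_u0)

lemma V_sol: "classical_solution A (lowpass N) UNIV s (lowpass N u0) IN V"
  using solN by (simp add: maximal_classical_solution_def)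

lemmas V_facts = truncated_solution_facts[OF cont_A V_sol u0_trunc]

lemma V_C1: "t \<in> IN \<Longrightarrow> C1_torus (V t)"
  using V_facts(5)[of t] C1_torus_rtp(1) by (metis lowpass_rtp)

lemma J_I: "t \<in> J \<Longrightarrow> t \<in> I"
  using J_sub by blast

lemma E_C1: "t \<in> IN \<Longrightarrow> C1_torus (E t)" and pd_E: "t \<in> IN \<Longrightarrow> pd j (E t) x = pd j (fmult (cutoff (real N)) N (U t)) x - pd j (V t) x"
  unfolding E_def[abs_def] by (intro C1_torus_diff C1_torus_fmult V_C1; assumption)+

lemma E_trunc:
  assumes "t \<in> IN" "t \<in> I"
  shows "E t = lowpass N (E t)"
proof -
  have "lowpass N (fmult (cutoff (real N)) N (U t)) x = fmult (cutoff (real N)) N (U t) x" for x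
    unfolding lowpass_rtp fmult_def[of _ N "U t"]
    by (rule rtp_cong)
       (simp add: fourier_coeff_smooth_truncation[OF C1_torus_continuous[OF U_C1_torus[OF assms(2)]] N] flip: fmult_def)
  then show ?thesis
    unfolding E_def[abs_def]
    using lowpass_diff[OF continuous_fmult C1_torus_continuous[OF V_C1[OF assms(1)]], of N "cutoff (real N)" N "U t"] V_facts(5)[OF assms(1)]
    by (simp add: fun_eq_iff)
qed

lemma V_split: "V t x = fmult (cutoff (real N)) N (U t) x - E t x"
  by (simp add: E_def)

text \<open>The difference between freezing the coefficients at \<open>V\<close> and at \<open>U\<close>.\<close>

definition remainder :: "real \<Rightarrow> real^'d \<Rightarrow> real^'n" where
  "remainder t x = (\<Sum>j\<in>UNIV. (A j (V t x) - A j (U t x)) *v pd j (V t) x)"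

definition source :: "real \<Rightarrow> real^'d \<Rightarrow> real^'n" where
  "source t x = (\<Sum>j\<in>UNIV. S0 j *v (lowpass N (flux j (U t) (fmult (cutoff (real N)) N (U t))) x
      - fmult (cutoff (real N)) N (flux j (U t) (U t)) x)) + lowpass N (remainder t) x"

definition E' :: "real \<Rightarrow> real^'d \<Rightarrow> real^'n" where
  "E' t x = fmult (cutoff (real N)) N (rhs (U t)) x - trunc_field A N (V t) x"

lemma continuous_remainder:
  assumes "t \<in> IN" "t \<in> I"
  shows "continuous_on UNIV (remainder t)"
proof -
  have "continuous_on UNIV (\<lambda>x. A j (V t x))" "continuous_on UNIV (\<lambda>x. A j (U t x))" for j
    by (rule continuous_on_compose2[OF cont_A C1_torus_continuous[OF V_C1[OF assms(1)]]], simp)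
       (rule continuous_on_compose2[OF cont_A C1_torus_continuous[OF U_C1_torus[OF assms(2)]]], simp)
  then show ?thesis
    unfolding remainder_def[abs_def]
    by (intro continuous_on_sum continuous_matrix_vector continuous_on_diff C1_torus_pd_continuous V_C1 assms)
qed

text \<open>Both systems are written with the flux at \<open>U\<close>: there \<open>A j\<close> factors as \<open>S0 j ** S\<close>, which need not hold at
\<open>V\<close>. The constant matrices \<open>S0 j\<close> pass through the filter.\<close>

lemma E_equation:
  assumes t: "t \<in> IN" "t \<in> I"
  shows "E' t x = source t x - (\<Sum>j\<in>UNIV. S0 j *v lowpass N (flux j (U t) (E t)) x)"
proof -
  note CU = U_C1_torus[OF t(2)] and CV = V_C1[OF t(1)] and CE = E_C1[OF t(1)]
  let ?W = "fmult (cutoff (real N)) N (U t)"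
  have cfV: "continuous_on UNIV (flux j (U t) (V t))" for j by (rule continuous_flux[OF CU CV])
  have q: "quasilinear_term A (lowpass N (V t)) = (\<lambda>x. \<Sum>j\<in>UNIV. S0 j *v flux j (U t) (V t) x - (A j (U t x) - A j (V t x)) *v pd j (V t) x)"
  proof
    fix x
    have "A j (V t x) *v pd j (V t) x = S0 j *v flux j (U t) (V t) x - (A j (U t x) - A j (V t x)) *v pd j (V t) x" for j
      unfolding flux_def by (simp add: matrix_vector_mul_assoc A_eq[OF U_in[OF t(2)]] matrix_vector_mult_diff_rdistrib)
    then show "quasilinear_term A (lowpass N (V t)) x = (\<Sum>j\<in>UNIV. S0 j *v flux j (U t) (V t) x - (A j (U t x) - A j (V t x)) *v pd j (V t) x)"
      unfolding V_facts(5)[OF t(1), symmetric] quasilinear_pd by (intro sum.cong refl)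
  qed
  have q2: "quasilinear_term A (lowpass N (V t)) = (\<lambda>x. (\<Sum>j\<in>UNIV. S0 j *v flux j (U t) (V t) x) - (- remainder t x))"
    unfolding q remainder_def
    by (rule ext) (simp add: sum_subtractf matrix_vector_mult_diff_rdistrib sum_negf)
  have c1: "continuous_on UNIV (\<lambda>x. S0 j *v flux j (U t) (V t) x)" for j
    by (intro continuous_matrix_vector continuous_on_const cfV)
  have lp: "lowpass N (quasilinear_term A (lowpass N (V t))) x = (\<Sum>j\<in>UNIV. S0 j *v lowpass N (flux j (U t) (V t)) x) + lowpass N (remainder t) x"
  proof -
    have "lowpass N (quasilinear_term A (lowpass N (V t))) x
       = lowpass N (\<lambda>x. \<Sum>j\<in>UNIV. S0 j *v flux j (U t) (V t) x) x - lowpass N (\<lambda>x. - remainder t x) x"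
      unfolding q2 by (intro lowpass_diff continuous_on_sum c1 continuous_on_minus continuous_remainder t)
    moreover have "lowpass N (\<lambda>x. \<Sum>j\<in>UNIV. S0 j *v flux j (U t) (V t) x) x = (\<Sum>j\<in>UNIV. S0 j *v lowpass N (flux j (U t) (V t)) x)"
      unfolding lowpass_fmult by (simp add: fmult_sum[OF c1] fmult_matrix[OF cfV])
    ultimately show ?thesis by (simp add: lowpass_neg[OF continuous_remainder[OF t]])
  qed
  have fl: "lowpass N (flux j (U t) (V t)) x = lowpass N (flux j (U t) ?W) x - lowpass N (flux j (U t) (E t)) x" for j
  proof -
    have "flux j (U t) (V t) = (\<lambda>x. flux j (U t) ?W x - flux j (U t) (E t) x)"
      by (rule ext) (simp add: flux_def pd_E[OF t(1)] matrix_vector_mult_diff_distrib)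
    then show ?thesis by (simp add: lowpass_diff[OF continuous_flux[OF CU C1_torus_fmult] continuous_flux[OF CU CE]])
  qed
  have "E' t x = - (\<Sum>j\<in>UNIV. S0 j *v fmult (cutoff (real N)) N (flux j (U t) (U t)) x)
      + ((\<Sum>j\<in>UNIV. S0 j *v lowpass N (flux j (U t) (V t)) x) + lowpass N (remainder t) x)"
    unfolding E'_def fmult_rhs[OF CU] trunc_field_def lp by simp
  also have "\<dots> = source t x - (\<Sum>j\<in>UNIV. S0 j *v lowpass N (flux j (U t) (E t)) x)"
    unfolding source_def fl matrix_vector_mult_diff_distrib sum_subtractf by (simp add: algebra_simps)
  finally show ?thesis .
qed

lemma truncation_error: "t \<in> J \<Longrightarrow> msq (\<lambda>x. fmult (cutoff (real N)) N (U t) x - U t x) \<le> real CARD('n) * (2 powr (2 * s) * \<epsilon>)"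
  using msq_smooth_truncation_error[OF C1_torus_continuous[OF U_C1_torus[OF J_I]] J_wiener b_tail N, of t]
  by (simp add: \<epsilon>_def mult_ac)

lemma msq_source_le:
  assumes t: "t \<in> IN" "t \<in> J" and bd: "\<And>x. norm (E t x) \<le> 1" "\<And>j x. norm (pd j (E t) x) \<le> 1"
  shows "msq (source t) \<le> g_err * \<epsilon> + 4 * H\<^sup>2 * msq (E t)"
proof -
  note tI = J_I[OF t(2)]
  note CU = U_C1_torus[OF tI] and CV = V_C1[OF t(1)] and CE = E_C1[OF t(1)]
  let ?W = "fmult (cutoff (real N)) N (U t)"
  let ?P = "real CARD('n) * \<alpha> + 1"
  note cU = C1_torus_continuous[OF CU]
  note sup = smooth_truncation_sup[OF cU J_wiener[OF t(2)], where \<rho> = "real N" and N = N]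
  have V1: "norm (V t x) \<le> ?P" for x
    using norm_triangle_ineq4[of "?W x" "E t x"] sup(1)[of x] bd(1)[of x] unfolding V_split[symmetric] by linarith
  have V2: "norm (pd j (V t) x) \<le> ?P" for j x
  proof -
    have "pd j (V t) x = pd j ?W x - pd j (E t) x" using pd_E[OF t(1), of j x] by simp
    then show ?thesis using norm_triangle_ineq4[of "pd j ?W x" "pd j (E t) x"] sup(2)[of j x] bd(2)[of j x] by simp
  qed
  define comm where "comm x = (\<Sum>j\<in>UNIV. S0 j *v (lowpass N (flux j (U t) ?W) x - fmult (cutoff (real N)) N (flux j (U t) (U t)) x))" for x
  have cc: "continuous_on UNIV (\<lambda>x. lowpass N (flux j (U t) ?W) x - fmult (cutoff (real N)) N (flux j (U t) (U t)) x)" for j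
    by (intro continuous_on_diff continuous_lowpass continuous_fmult)
  have ccomm: "continuous_on UNIV comm"
    unfolding comm_def[abs_def] by (intro continuous_on_sum continuous_matrix_vector continuous_on_const cc)
  have tm: "tame s \<alpha> b (\<lambda>x. of_real (U t x $ a))" for a
    unfolding tame_def using J_wiener[OF t(2)] tail_bound_component[OF b_tail[OF t(2)] cU] by blast
  have 1: "msq comm \<le> (real CARD('d))\<^sup>2 * \<sigma>\<^sup>2 * (comm_const * \<epsilon>)"
    unfolding comm_def[abs_def]
  proof (rule msq_matrix_sum_le[OF cc])
    fix j
    show "msq (\<lambda>x. lowpass N (flux j (U t) ?W) x - fmult (cutoff (real N)) N (flux j (U t) (U t)) x) \<le> comm_const * \<epsilon>"
      using commutator_msq[OF CU tm, of "real N" N j] N by (simp add: \<epsilon>_def mult.assoc)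
  qed
  have crem: "continuous_on UNIV (remainder t)" by (rule continuous_remainder[OF t(1) tI])
  have cVU: "continuous_on UNIV (\<lambda>x. V t x - U t x)" by (intro continuous_on_diff cU C1_torus_continuous[OF CV])
  have rem: "norm (remainder t x) \<le> H * norm (V t x - U t x)" for x
  proof -
    have "norm (remainder t x) \<le> (\<Sum>j\<in>(UNIV::'d set). \<Lambda>A * ?P * norm (V t x - U t x))"
      unfolding remainder_def
    proof (rule order_trans[OF norm_sum sum_mono])
      fix j
      have "norm ((A j (V t x) - A j (U t x)) *v pd j (V t) x) \<le> \<Lambda>A * norm (V t x - U t x) * norm (pd j (V t) x)"
        by (rule A_lipschitz[OF J_K[OF t(2)] V1])
      also have "\<dots> \<le> \<Lambda>A * norm (V t x - U t x) * ?P"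
        using pos by (intro mult_left_mono V2) auto
      finally show "norm ((A j (V t x) - A j (U t x)) *v pd j (V t) x) \<le> \<Lambda>A * ?P * norm (V t x - U t x)" by (simp only: mult_ac)
    qed
    then show ?thesis by (simp add: H_def mult_ac)
  qed
  have VU: "msq (\<lambda>x. V t x - U t x) \<le> 2 * (real CARD('n) * (2 powr (2 * s) * \<epsilon>)) + 2 * msq (E t)"
  proof -
    have "(\<lambda>x. V t x - U t x) = (\<lambda>x. (?W x - U t x) - E t x)" by (simp add: V_split fun_eq_iff)
    then have "msq (\<lambda>x. V t x - U t x) \<le> 2 * msq (\<lambda>x. ?W x - U t x) + 2 * msq (E t)"
      by (simp only:) (intro msq_diff_le continuous_on_diff continuous_fmult cU C1_torus_continuous[OF CE])
    then show ?thesis using truncation_error[OF t(2)] by linarith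
  qed
  have "msq (source t) \<le> 2 * msq comm + 2 * msq (lowpass N (remainder t))"
    unfolding source_def[abs_def] comm_def[symmetric]
    by (intro msq_add_le ccomm[unfolded comm_def[abs_def], folded comm_def] continuous_lowpass)
  moreover have "msq (lowpass N (remainder t)) \<le> H\<^sup>2 * (2 * (real CARD('n) * (2 powr (2 * s) * \<epsilon>)) + 2 * msq (E t))"
    using msq_lowpass_le[OF crem, of N] msq_le[OF crem cVU rem] mult_left_mono[OF VU, of "H\<^sup>2"] by simp
  ultimately have "msq (source t) \<le> 2 * ((real CARD('d))\<^sup>2 * \<sigma>\<^sup>2 * (comm_const * \<epsilon>)) + 2 * (H\<^sup>2 * (2 * (real CARD('n) * (2 powr (2 * s) * \<epsilon>)) + 2 * msq (E t)))"
    using 1 by linarith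
  also have "\<dots> = g_err * \<epsilon> + 4 * H\<^sup>2 * msq (E t)"
    by (simp add: g_err_def algebra_simps)
  finally show ?thesis .
qed

lemma continuous_source: "continuous_on UNIV (source t)"
  unfolding source_def[abs_def]
  by (intro continuous_on_add continuous_on_sum continuous_matrix_vector continuous_on_const continuous_on_diff continuous_lowpass continuous_fmult)

text \<open>At time \<open>0\<close> the truncated solution is the sharp truncation of the same datum, so the difference lives on the
frequencies above \<open>N / 2\<close>.\<close>

lemma E_initial: "msq (E 0) \<le> 2 powr (2 * s) * \<epsilon>"
proof -
  have cu: "continuous_on UNIV (U 0)" by (rule C1_torus_continuous[OF U_C1_torus[OF zero_I]])
  have "V 0 = lowpass N (U 0)" using V_sol by (simp add: classical_solution_def U_zero)
  then have "E 0 = fmult (\<lambda>k. cutoff (real N) k - 1) N (U 0)"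
    by (simp add: E_def fun_eq_iff fmult_symbol_diff lowpass_fmult)
  then have "msq (E 0) \<le> (\<Sum>k\<in>cube N. (norm ((cutoff (real N) k - 1) *\<^sub>R fourier_coeff (U 0) k))\<^sup>2)"
    unfolding fmult_def by (simp only: msq_rtp_le finite_cube)
  also have "\<dots> \<le> b * (real N / 2) powr (- 2 * s)"
    by (rule tail_bound_le[OF b_tail[OF zero_J]]) (use N smooth_truncation_defect[OF N] in auto)
  also have "\<dots> = 2 powr (2 * s) * \<epsilon>"
    using half_powr[of 2 "real N" s] N by (simp add: \<epsilon>_def)
  finally show ?thesis .
qed

text \<open>Gronwall's lemma for the energy of the error. The bounds by \<open>1\<close> keep the values and the gradient of \<open>V\<close> in
the range in which \<open>remainder\<close> is Lipschitz.\<close>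

lemma error_estimate_conditional:
  assumes t: "t \<in> J \<inter> IN"
    and bd: "\<And>\<tau> x. \<tau> \<in> closed_segment 0 t \<Longrightarrow> norm (E \<tau> x) \<le> 1" "\<And>\<tau> j x. \<tau> \<in> closed_segment 0 t \<Longrightarrow> norm (pd j (E \<tau>) x) \<le> 1"
  shows "msq (E t) \<le> C_err L * \<epsilon>"
proof -
  define I' where "I' = I \<inter> IN"
  have I': "open I'" "convex I'" "I' \<subseteq> I" using open_I convex_I V_facts(1,2) by (auto simp: I'_def open_Int convex_Int)
  define \<phi> where "\<phi> \<tau> = energy (E \<tau>) \<tau>" for \<tau>
  have seg: "closed_segment 0 t \<subseteq> J \<inter> IN"
    using t zero_J V_facts(3) by (intro closed_segment_subset convex_Int J_convex V_facts(2)) auto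
  have sub: "I' \<times> UNIV \<subseteq> I \<times> (UNIV :: (real^'d) set)" "I' \<times> UNIV \<subseteq> IN \<times> (UNIV :: (real^'d) set)" by (auto simp: I'_def)
  have "\<exists>D. (\<phi> has_real_derivative D) (at \<tau>) \<and> \<bar>D\<bar> \<le> a_err * \<phi> \<tau> + (g_err * \<epsilon>) * exp ((a_err + 1) * \<bar>\<tau> - 0\<bar>)"
    if \<tau>: "\<tau> \<in> closed_segment 0 t" for \<tau>
  proof -
    have \<tau>J: "\<tau> \<in> J" "\<tau> \<in> IN" using \<tau> seg by auto
    have \<tau>I': "\<tau> \<in> I'" using \<tau>J J_I by (auto simp: I'_def)
    have "\<exists>D. (\<phi> has_real_derivative D) (at \<tau>) \<and> \<bar>D\<bar> \<le> rate * msq (E \<tau>) + msq (source \<tau>)"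
      unfolding \<phi>_def
    proof (rule energy_differential_inequality[OF I' \<tau>I' \<tau>J(1), where E = E and E' = E' and N = N])
      show "((\<lambda>\<tau>. E \<tau> x) has_vector_derivative E' t x) (at t)" if "t \<in> I'" for t x
        unfolding E_def E'_def using that
        by (intro has_vector_derivative_diff fmult_has_vector_derivative[OF open_I convex_I _ U_derivative U_jointly_continuous rhs_jointly_continuous] V_facts(4))
           (auto simp: I'_def)
      have "continuous_on (I' \<times> UNIV) (\<lambda>z. (case z of (t, x) \<Rightarrow> fmult (cutoff (real N)) N (U t) x) - (case z of (t, x) \<Rightarrow> V t x))"
        by (intro continuous_on_diff continuous_on_subset[OF fmult_jointly_continuous[OF U_jointly_continuous] sub(1)] continuous_on_subset[OF V_facts(6) sub(2)])
      then show "continuous_on (I' \<times> UNIV) (\<lambda>(t, x). E t x)" by (simp add: E_def case_prod_unfold)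
      have "continuous_on (I' \<times> UNIV) (\<lambda>z. (case z of (t, x) \<Rightarrow> fmult (cutoff (real N)) N (rhs (U t)) x) - (case z of (t, x) \<Rightarrow> trunc_field A N (V t) x))"
        by (intro continuous_on_diff continuous_on_subset[OF fmult_jointly_continuous[OF rhs_jointly_continuous] sub(1)] continuous_on_subset[OF V_facts(7) sub(2)])
      then show "continuous_on (I' \<times> UNIV) (\<lambda>(t, x). E' t x)" by (simp add: E'_def case_prod_unfold)
      show "C1_torus (E \<tau>)" by (rule E_C1[OF \<tau>J(2)])
      show "continuous_on UNIV (source \<tau>)" by (rule continuous_source)
      show "E' \<tau> x = source \<tau> x - (\<Sum>j\<in>UNIV. S0 j *v lowpass N (flux j (U \<tau>) (E \<tau>)) x)" for x
        by (rule E_equation[OF \<tau>J(2) J_I[OF \<tau>J(1)]])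
    qed
    moreover have "rate * msq (E \<tau>) + msq (source \<tau>) \<le> a_err * \<phi> \<tau> + (g_err * \<epsilon>) * exp ((a_err + 1) * \<bar>\<tau> - 0\<bar>)"
    proof -
      have "msq (source \<tau>) \<le> g_err * \<epsilon> + 4 * H\<^sup>2 * msq (E \<tau>)"
        by (rule msq_source_le[OF \<tau>J(2,1) bd(1)[OF \<tau>] bd(2)[OF \<tau>]])
      moreover have "(rate + 4 * H\<^sup>2) * msq (E \<tau>) \<le> a_err * \<phi> \<tau>"
      proof -
        have "msq (E \<tau>) \<le> \<phi> \<tau> / c0"
          using energy_equivalent(1)[OF \<tau>J(1) C1_torus_continuous[OF E_C1[OF \<tau>J(2)]]] pos by (simp add: \<phi>_def field_simps)
        then have "(rate + 4 * H\<^sup>2) * msq (E \<tau>) \<le> (rate + 4 * H\<^sup>2) * (\<phi> \<tau> / c0)" using beta'_ge(3) by (intro mult_left_mono) auto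
        then show ?thesis by (simp add: a_err_def)
      qed
      moreover have "g_err * \<epsilon> * 1 \<le> (g_err * \<epsilon>) * exp ((a_err + 1) * \<bar>\<tau> - 0\<bar>)"
        using err_const_nonneg b_nonneg by (intro mult_left_mono) auto
      ultimately show ?thesis by (simp add: distrib_right)
    qed
    ultimately show ?thesis by (meson order_trans)
  qed
  then obtain \<phi>' where \<phi>': "\<And>\<tau>. \<tau> \<in> closed_segment 0 t \<Longrightarrow> (\<phi> has_real_derivative \<phi>' \<tau>) (at \<tau>)"
    "\<And>\<tau>. \<tau> \<in> closed_segment 0 t \<Longrightarrow> \<bar>\<phi>' \<tau>\<bar> \<le> a_err * \<phi> \<tau> + (g_err * \<epsilon>) * exp ((a_err + 1) * \<bar>\<tau> - 0\<bar>)"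
    by metis
  have gr: "\<phi> t \<le> exp (a_err * \<bar>t - 0\<bar>) * \<phi> 0 + (g_err * \<epsilon>) / (a_err + 1 - a_err) * exp ((a_err + 1) * \<bar>t - 0\<bar>)"
    by (rule gronwall[where \<phi>' = \<phi>']) (use \<phi>' err_const_nonneg b_nonneg in auto)
  let ?e = "exp ((a_err + 1) * L)"
  have tL: "\<bar>t - 0\<bar> \<le> L" using J_length[of t 0] t zero_J by simp
  have e1: "exp (a_err * \<bar>t - 0\<bar>) \<le> ?e"
    using tL err_const_nonneg(2) L_nonneg by (auto intro!: mult_mono)
  have e2: "exp ((a_err + 1) * \<bar>t - 0\<bar>) \<le> ?e"
    using tL err_const_nonneg(2) by (auto intro!: mult_left_mono)
  have cE: "continuous_on UNIV (E t)" if "t \<in> IN" for t by (rule C1_torus_continuous[OF E_C1[OF that]])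
  have p0: "\<phi> 0 \<le> \<beta> * (2 powr (2 * s) * \<epsilon>)"
  proof -
    have "\<phi> 0 \<le> \<beta> * msq (E 0)" unfolding \<phi>_def by (rule energy_equivalent(2)[OF zero_J cE[OF V_facts(3)]])
    also have "\<dots> \<le> \<beta> * (2 powr (2 * s) * \<epsilon>)" using pos by (intro mult_left_mono E_initial) auto
    finally show ?thesis .
  qed
  have "exp (a_err * \<bar>t - 0\<bar>) * \<phi> 0 \<le> exp (a_err * \<bar>t - 0\<bar>) * (\<beta> * (2 powr (2 * s) * \<epsilon>))" by (intro mult_left_mono p0) auto
  also have "\<dots> \<le> ?e * (\<beta> * (2 powr (2 * s) * \<epsilon>))" using pos b_nonneg by (intro mult_right_mono e1) auto
  finally have 1: "exp (a_err * \<bar>t - 0\<bar>) * \<phi> 0 \<le> ?e * (\<beta> * (2 powr (2 * s) * \<epsilon>))" .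
  have 2: "(g_err * \<epsilon>) / (a_err + 1 - a_err) * exp ((a_err + 1) * \<bar>t - 0\<bar>) \<le> g_err * \<epsilon> * ?e"
    using mult_left_mono[OF e2, of "g_err * \<epsilon>"] err_const_nonneg b_nonneg by simp
  have "c0 * msq (E t) \<le> \<phi> t" unfolding \<phi>_def by (rule energy_equivalent(1)) (use t cE in auto)
  also have "\<dots> \<le> ?e * (\<beta> * (2 powr (2 * s) * \<epsilon>)) + g_err * \<epsilon> * ?e" using gr 1 2 by linarith
  also have "\<dots> = c0 * (C_err L * \<epsilon>)" using pos(1) by (simp add: C_err_def field_simps)
  finally show ?thesis using pos(1) by simp
qed

lemma E_small_bounds:
  assumes t: "t \<in> J \<inter> IN" and m: "(3 * real N) ^ CARD('d) * (real N)\<^sup>2 * msq (E t) \<le> 1"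
  shows "norm (E t x) \<le> 1" "norm (pd j (E t) x) \<le> 1"
  using bernstein[OF E_trunc N, of t] t J_I m by auto

text \<open>Continuity in time and the smallness of \<open>N powr (- 2 * s)\<close> remove the condition: the
  bound that the energy estimate gives is half of what the Bernstein inequality requires.\<close>

lemma error_small:
  assumes t: "t \<in> J \<inter> IN"
  shows "(3 * real N) ^ CARD('d) * (real N)\<^sup>2 * msq (E t) \<le> 1"
proof -
  \<comment> \<open>The threshold \<open>1 / D\<close> is what Bernstein's inequality requires. It is positive also if \<open>\<epsilon> = 0\<close>.\<close>
  define D where "D = (3 * real N) ^ CARD('d) * (real N)\<^sup>2"
  have D: "0 < D" using N by (simp add: D_def)
  define \<theta> where "\<theta> = 1 / D"
  have \<theta>: "0 < \<theta>" and D\<theta>: "D * x \<le> 1 \<longleftrightarrow> x \<le> \<theta>" for x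
    using D by (simp_all add: \<theta>_def field_simps)
  have "2 * ((C_err L + 2 powr (2 * s)) * \<epsilon>) \<le> \<theta>"
    using small by (simp only: D_def[symmetric] \<epsilon>_def[symmetric] D\<theta>)
  moreover have "0 \<le> C_err L * \<epsilon>" "0 \<le> 2 powr (2 * s) * \<epsilon>"
    using err_const_nonneg(4)[of L] b_nonneg by simp_all
  ultimately have le: "C_err L * \<epsilon> \<le> \<theta> / 2" "2 powr (2 * s) * \<epsilon> \<le> \<theta>"
    by (simp_all add: distrib_right)
  have "msq (E t) \<le> \<theta>"
  proof (rule bootstrap_from_zero[where T = "J \<inter> IN" and f = "\<lambda>t. msq (E t)"])
    show "convex (J \<inter> IN)" by (intro convex_Int J_convex V_facts(2))
    show "0 \<in> J \<inter> IN" using zero_J V_facts(3) by blast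
    show "msq (E 0) \<le> \<theta>" by (rule order_trans[OF E_initial le(2)])
    have "continuous_on ((J \<inter> IN) \<times> UNIV) (\<lambda>z. (case z of (t, x) \<Rightarrow> fmult (cutoff (real N)) N (U t) x) - (case z of (t, x) \<Rightarrow> V t x))"
      by (intro continuous_on_diff continuous_on_subset[OF fmult_jointly_continuous[OF U_jointly_continuous]] continuous_on_subset[OF V_facts(6)])
         (use J_I in auto)
    then have "continuous_on ((J \<inter> IN) \<times> UNIV) (\<lambda>(t, x). (norm (E t x))\<^sup>2)"
      unfolding case_prod_unfold E_def by (intro continuous_on_power continuous_on_norm)
    then have "continuous_on ((J \<inter> IN) \<times> cbox 0 (\<chi> j. 2 * pi)) (\<lambda>(t, x). (norm (E t x))\<^sup>2)"
      by (rule continuous_on_subset) auto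
    from integral_continuous_on_param[OF this]
    show "continuous_on (J \<inter> IN) (\<lambda>t. msq (E t))"
      unfolding msq_def tmean_def torus_cell_def by (intro continuous_intros)
    show "msq (E t) \<le> \<theta> / 2" if t: "t \<in> J \<inter> IN" and small: "\<And>\<tau>. \<tau> \<in> closed_segment 0 t \<Longrightarrow> msq (E \<tau>) \<le> \<theta>" for t
    proof -
      have seg: "closed_segment 0 t \<subseteq> J \<inter> IN"
        using t zero_J V_facts(3) by (intro closed_segment_subset convex_Int J_convex V_facts(2)) auto
      have "msq (E t) \<le> C_err L * \<epsilon>"
      proof (rule error_estimate_conditional[OF t])
        fix \<tau> x j assume \<tau>: "\<tau> \<in> closed_segment 0 t"
        then have T: "\<tau> \<in> J \<inter> IN" using seg by blast
        have m: "D * msq (E \<tau>) \<le> 1" using small[OF \<tau>] by (simp only: D\<theta>)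
        show "norm (E \<tau> x) \<le> 1" "norm (pd j (E \<tau>) x) \<le> 1"
          by (rule E_small_bounds[OF T m[unfolded D_def]])+
      qed
      then show ?thesis by (rule order_trans[OF _ le(1)])
    qed
  qed (use \<theta> t in auto)
  then have "D * msq (E t) \<le> 1" by (simp only: D\<theta>)
  then show ?thesis by (simp only: D_def)
qed

lemma error_bounds:
  assumes t: "t \<in> J \<inter> IN"
  shows "norm (E t x) \<le> 1" "norm (pd j (E t) x) \<le> 1" "msq (E t) \<le> C_err L * \<epsilon>"
proof -
  show "norm (E t x) \<le> 1" "norm (pd j (E t) x) \<le> 1" for x j
    by (rule E_small_bounds[OF t error_small[OF t]])+
  have seg: "closed_segment 0 t \<subseteq> J \<inter> IN"
    using t zero_J V_facts(3) by (intro closed_segment_subset convex_Int J_convex V_facts(2)) auto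
  show "msq (E t) \<le> C_err L * \<epsilon>"
  proof (rule error_estimate_conditional[OF t])
    fix \<tau> x j assume "\<tau> \<in> closed_segment 0 t"
    then have \<tau>: "\<tau> \<in> J \<inter> IN" using seg by blast
    show "norm (E \<tau> x) \<le> 1" "norm (pd j (E \<tau>) x) \<le> 1"
      by (rule E_small_bounds[OF \<tau> error_small[OF \<tau>]])+
  qed
qed

text \<open>\<open>V\<close> is within distance \<open>1\<close> of the smooth truncation of \<open>U\<close>, which is bounded by the Wiener norm.\<close>

lemma truncated_solution_exists: "J \<subseteq> IN"
proof (rule truncated_continuation[OF A_poly solN u0_trunc J_convex zero_J])
  show "0 \<le> real CARD('n) * \<alpha> + 1" using pos by simp
  fix t x assume t: "t \<in> IN" "t \<in> J"
  have tJ: "t \<in> J \<inter> IN" by (rule IntI[OF t(2,1)])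
  have "norm (V t x) \<le> norm (fmult (cutoff (real N)) N (U t) x) + norm (E t x)"
    by (rule ord_eq_le_trans[OF arg_cong[where f = norm, OF V_split] norm_triangle_ineq4])
  also have "\<dots> \<le> real CARD('n) * \<alpha> + 1"
    by (rule add_mono[OF smooth_truncation_sup(1)[OF C1_torus_continuous[OF U_C1_torus[OF J_I[OF t(2)]]] J_wiener[OF t(2)]]
       error_bounds(1)[OF tJ]])
  finally show "norm (V t x) \<le> real CARD('n) * \<alpha> + 1" .
qed

lemma error_estimate: "t \<in> J \<Longrightarrow> msq (E t) \<le> C_err L * \<epsilon>"
proof (rule error_bounds(3))
  show "t \<in> J \<Longrightarrow> t \<in> J \<inter> IN" using truncated_solution_exists by blast
qed

end

section \<open>The error in Sobolev norms\<close>

lemma norm_diff_square_le: "(norm (x - y))\<^sup>2 \<le> 2 * (norm x)\<^sup>2 + 2 * (norm y)\<^sup>2"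
  using norm_sum_square_le[of x "- y"] by simp

lemma bracket_cube_le:
  fixes k :: "int^'d"
  assumes k: "k \<in> cube N" and N: "1 \<le> N" and r: "0 \<le> r" "r \<le> s"
  shows "japanese_bracket k powr (2 * r) \<le> (1 + real CARD('d)) powr s * real N powr (2 * r)"
proof -
  have "(\<Sum>j\<in>UNIV. (real_of_int (k $ j))\<^sup>2) \<le> (\<Sum>j\<in>(UNIV :: 'd set). (real N)\<^sup>2)"
  proof (rule sum_mono)
    fix j
    have "\<bar>k $ j\<bar> \<le> int N" using k by (simp add: cube_def)
    then have "\<bar>real_of_int (k $ j)\<bar> \<le> \<bar>real N\<bar>" by linarith
    then show "(real_of_int (k $ j))\<^sup>2 \<le> (real N)\<^sup>2" by (simp only: abs_le_square_iff)
  qed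
  moreover have "1 \<le> (real N)\<^sup>2" using N by simp
  ultimately have j2: "(japanese_bracket k)\<^sup>2 \<le> (1 + real CARD('d)) * (real N)\<^sup>2"
    by (simp add: japanese_bracket_def sum_nonneg distrib_right)
  have jb: "0 < japanese_bracket k" using japanese_bracket_ge(1)[of k] by linarith
  have "japanese_bracket k powr (2 * r) = (japanese_bracket k)\<^sup>2 powr r"
    using jb by (simp add: powr_powr flip: powr_numeral)
  also have "\<dots> \<le> ((1 + real CARD('d)) * (real N)\<^sup>2) powr r"
    using r by (intro powr_mono2 j2) auto
  also have "\<dots> = (1 + real CARD('d)) powr r * real N powr (2 * r)"
    using N by (simp add: powr_mult powr_powr flip: powr_numeral)
  also have "\<dots> \<le> (1 + real CARD('d)) powr s * real N powr (2 * r)"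
    using r by (intro mult_right_mono powr_mono) auto
  finally show ?thesis .
qed

lemma bracket_high_le:
  assumes k: "\<rho> / 2 < norm (freq k)" and \<rho>: "0 < \<rho>" and r: "0 \<le> r" "r \<le> s"
  shows "japanese_bracket k powr (2 * r) \<le> 2 powr (2 * s) * (\<rho> powr (r - s))\<^sup>2 * japanese_bracket k powr (2 * s)"
proof -
  have jb: "1 \<le> japanese_bracket k" "\<rho> / 2 \<le> japanese_bracket k"
    using japanese_bracket_ge[of k] k by auto
  have "japanese_bracket k powr (2 * r) = japanese_bracket k powr (2 * (r - s)) * japanese_bracket k powr (2 * s)"
    using jb by (simp add: algebra_simps flip: powr_add)
  also have "\<dots> \<le> (\<rho> / 2) powr (2 * (r - s)) * japanese_bracket k powr (2 * s)"
    using jb \<rho> r by (intro mult_right_mono powr_mono2') auto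
  also have "(\<rho> / 2) powr (2 * (r - s)) = 2 powr (2 * (s - r)) * (\<rho> powr (r - s))\<^sup>2"
    using half_powr[of 2 \<rho> "s - r"] \<rho> by (simp add: powr_powr algebra_simps flip: powr_numeral)
  also have "\<dots> \<le> 2 powr (2 * s) * (\<rho> powr (r - s))\<^sup>2"
    using r by (intro mult_right_mono powr_mono) auto
  finally show ?thesis by (simp add: mult_right_mono)
qed

lemma msq_trigonometric:
  assumes "f = lowpass N f"
  shows "msq f = (\<Sum>k\<in>cube N. (norm (fourier_coeff f k))\<^sup>2)"
proof -
  have "continuous_on UNIV f" using continuous_lowpass[of N f] assms by simp
  from msq_rtp_hermitian[OF hermitian_fourier_coeff[OF this], of "cube N"] show ?thesis
    using assms by (simp add: cube_minus flip: lowpass_rtp)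
qed

context truncated_comparison
begin

text \<open>The low frequencies of the error are those of \<open>E\<close> and cost a factor \<open>N powr (2 * r)\<close>. The
  high frequencies are those of the exact solution and are small by its regularity.\<close>

lemma sobolev_error:
  assumes t: "t \<in> J" and r: "0 \<le> r" "r \<le> s"
    and b: "b = Cb * (sobolev_norm s (U t))\<^sup>2" and Cb: "0 \<le> Cb"
  shows "sobolev_norm r (\<lambda>x. U t x - V t x)
    \<le> sqrt (2 * ((1 + real CARD('d)) powr s * C_err L * Cb) + 2 * 2 powr (2 * s)) * sobolev_norm s (U t) * real N powr (r - s)"
proof (rule sobolev_norm_leI)
  have tI: "t \<in> I" and tIN: "t \<in> IN" using t J_I truncated_solution_exists by auto
  have cU: "continuous_on UNIV (U t)" by (rule C1_torus_continuous[OF U_C1_torus[OF tI]])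
  have cV: "continuous_on UNIV (V t)" by (rule C1_torus_continuous[OF V_C1[OF tIN]])
  have cE: "continuous_on UNIV (E t)" by (rule C1_torus_continuous[OF E_C1[OF tIN]])
  let ?d = "(1 + real CARD('d)) powr s"
  let ?m = "(sobolev_norm s (U t))\<^sup>2" and ?q = "(real N powr (r - s))\<^sup>2"
  let ?e = "fourier_coeff (E t)" and ?u = "fourier_coeff (U t)"
  let ?h = "\<lambda>k. (cutoff (real N) k - 1) *\<^sub>R ?u k"
  have C0: "0 \<le> 2 * (?d * C_err L * Cb) + 2 * 2 powr (2 * s)"
    using Cb err_const_nonneg(4)[of L] by (intro add_nonneg_nonneg mult_nonneg_nonneg) auto
  show "0 \<le> sqrt (2 * (?d * C_err L * Cb) + 2 * 2 powr (2 * s)) * sobolev_norm s (U t) * real N powr (r - s)"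
    using C0 by (intro mult_nonneg_nonneg sobolev_norm_nonneg) auto
  have co: "fourier_coeff (\<lambda>x. U t x - V t x) k = ?e k - ?h k" for k
  proof -
    have "?e k = cutoff (real N) k *\<^sub>R ?u k - fourier_coeff (V t) k"
      unfolding E_def[abs_def] fourier_coeff_diff[OF continuous_fmult cV] fourier_coeff_smooth_truncation[OF cU N] ..
    then show ?thesis by (simp add: fourier_coeff_diff[OF cU cV] scaleR_diff_left)
  qed
  have N2: "real N powr (2 * r) * real N powr (- 2 * s) = ?q"
    using N by (simp add: power2_eq_square algebra_simps flip: powr_add)
  fix F :: "(int^'d) set" assume F: "finite F"
  have low: "(\<Sum>k\<in>F. japanese_bracket k powr (2 * r) * (norm (?e k))\<^sup>2) \<le> ?d * C_err L * Cb * ?m * ?q"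
  proof -
    have "?e k = 0" if "k \<notin> cube N" for k
      using that fourier_coeff_lowpass[OF cE, of N k] E_trunc[OF tIN tI] by simp
    then have "(\<Sum>k\<in>F. japanese_bracket k powr (2 * r) * (norm (?e k))\<^sup>2) = (\<Sum>k\<in>F \<inter> cube N. japanese_bracket k powr (2 * r) * (norm (?e k))\<^sup>2)"
      by (intro sum.mono_neutral_right F) auto
    also have "\<dots> \<le> (\<Sum>k\<in>F \<inter> cube N. (?d * real N powr (2 * r)) * (norm (?e k))\<^sup>2)"
      by (intro sum_mono mult_right_mono bracket_cube_le r N) auto
    also have "\<dots> \<le> (\<Sum>k\<in>cube N. (?d * real N powr (2 * r)) * (norm (?e k))\<^sup>2)"
      by (intro sum_mono2 finite_cube) auto
    also have "\<dots> = ?d * real N powr (2 * r) * msq (E t)"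
      by (simp only: msq_trigonometric[OF E_trunc[OF tIN tI]] sum_distrib_left)
    also have "\<dots> \<le> ?d * real N powr (2 * r) * (C_err L * \<epsilon>)"
      by (intro mult_left_mono error_estimate t) auto
    also have "\<dots> = ?d * C_err L * Cb * ?m * (real N powr (2 * r) * real N powr (- 2 * s))"
      unfolding \<epsilon>_def by (simp only: b mult_ac)
    finally show ?thesis by (simp only: N2)
  qed
  have high: "(\<Sum>k\<in>F. japanese_bracket k powr (2 * r) * (norm (?h k))\<^sup>2) \<le> 2 powr (2 * s) * ?q * ?m"
  proof -
    have "(\<Sum>k\<in>F. japanese_bracket k powr (2 * r) * (norm (?h k))\<^sup>2)
        \<le> (\<Sum>k\<in>F. 2 powr (2 * s) * ?q * (japanese_bracket k powr (2 * s) * (norm (?u k))\<^sup>2))"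
    proof (rule sum_mono)
      fix k
      show "japanese_bracket k powr (2 * r) * (norm (?h k))\<^sup>2 \<le> 2 powr (2 * s) * ?q * (japanese_bracket k powr (2 * s) * (norm (?u k))\<^sup>2)"
      proof (cases "norm (freq k) \<le> real N / 2")
        case True
        then show ?thesis by (simp only: smooth_truncation_defect(2)[OF N]) simp
      next
        case False
        have "japanese_bracket k powr (2 * r) * (norm (?h k))\<^sup>2
            \<le> (2 powr (2 * s) * ?q * japanese_bracket k powr (2 * s)) * (norm (?u k))\<^sup>2"
          using False N r by (intro mult_mono bracket_high_le power_mono smooth_truncation_defect(1)) auto
        then show ?thesis by (simp only: mult_ac)
      qed
    qed
    also have "\<dots> \<le> 2 powr (2 * s) * ?q * ?m"
      unfolding sum_distrib_left[symmetric]
      by (intro mult_left_mono sobolev_finite_sum U_sobolev tI F) auto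
    finally show ?thesis .
  qed
  have "(\<Sum>k\<in>F. japanese_bracket k powr (2 * r) * (norm (fourier_coeff (\<lambda>x. U t x - V t x) k))\<^sup>2)
     \<le> (\<Sum>k\<in>F. japanese_bracket k powr (2 * r) * (2 * (norm (?e k))\<^sup>2 + 2 * (norm (?h k))\<^sup>2))"
    unfolding co by (intro sum_mono mult_left_mono norm_diff_square_le) auto
  also have "\<dots> = 2 * (\<Sum>k\<in>F. japanese_bracket k powr (2 * r) * (norm (?e k))\<^sup>2) + 2 * (\<Sum>k\<in>F. japanese_bracket k powr (2 * r) * (norm (?h k))\<^sup>2)"
    by (simp only: distrib_left sum.distrib sum_distrib_left mult.left_commute[of _ 2])
  also have "\<dots> \<le> 2 * (?d * C_err L * Cb * ?m * ?q) + 2 * (2 powr (2 * s) * ?q * ?m)"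
    by (intro add_mono mult_left_mono low high) auto
  also have "\<dots> = (2 * (?d * C_err L * Cb) + 2 * 2 powr (2 * s)) * ?m * ?q"
    by (simp only: distrib_right distrib_left mult_ac)
  also have "\<dots> = (sqrt (2 * (?d * C_err L * Cb) + 2 * 2 powr (2 * s)) * sobolev_norm s (U t) * real N powr (r - s))\<^sup>2"
    using C0 by (simp only: power_mult_distrib real_sqrt_pow2)
  finally show "(\<Sum>k\<in>F. japanese_bracket k powr (2 * r) * (norm (fourier_coeff (\<lambda>x. U t x - V t x) k))\<^sup>2)
     \<le> (sqrt (2 * (?d * C_err L * Cb) + 2 * 2 powr (2 * s)) * sobolev_norm s (U t) * real N powr (r - s))\<^sup>2" .
qed

end

section \<open>Uniform constants\<close>

text \<open>The power of \<open>N\<close> is \<open>d + 2 - 2 * s\<close>, which is negative exactly for the Sobolev exponents considered.\<close>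

lemma frequency_threshold:
  fixes s X :: real
  assumes "s > real d / 2 + 1"
  obtains N0 :: nat where "1 \<le> N0" "\<And>N. N0 \<le> N \<Longrightarrow> (3 * real N) ^ d * (real N)\<^sup>2 * (X * real N powr (- 2 * s)) \<le> 1"
proof -
  have "(\<lambda>N. real N powr (real d + 2 - 2 * s)) \<longlonglongrightarrow> 0"
    by (rule tendsto_neg_powr[OF _ filterlim_real_sequentially]) (use assms in simp)
  then have "(\<lambda>N. 3 ^ d * X * real N powr (real d + 2 - 2 * s)) \<longlonglongrightarrow> 3 ^ d * X * 0"
    by (intro tendsto_mult tendsto_const)
  then have "\<forall>\<^sub>F N in sequentially. 3 ^ d * X * real N powr (real d + 2 - 2 * s) < 1"
    by (rule order_tendstoD) simp
  then obtain n where n: "\<And>N. n \<le> N \<Longrightarrow> 3 ^ d * X * real N powr (real d + 2 - 2 * s) < 1"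
    unfolding eventually_sequentially by blast
  show ?thesis
  proof (rule that[of "max 1 n"])
    fix N assume N: "max 1 n \<le> N"
    then have N0: "0 < real N" by simp
    have "(3 * real N) ^ d * (real N)\<^sup>2 * (X * real N powr (- 2 * s))
        = 3 ^ d * X * (real N powr real d * real N powr 2 * real N powr (- 2 * s))"
      using N0 by (simp add: powr_realpow power_mult_distrib)
    also have "real N powr real d * real N powr 2 * real N powr (- 2 * s) = real N powr (real d + 2 - 2 * s)"
    proof -
      have "real d + 2 - 2 * s = real d + 2 + - 2 * s" by simp
      then show ?thesis by (simp only: powr_add)
    qed
    also have "3 ^ d * X * real N powr (real d + 2 - 2 * s) \<le> 1"
      using n[of N] N by simp
    finally show "(3 * real N) ^ d * (real N)\<^sup>2 * (X * real N powr (- 2 * s)) \<le> 1" .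
  qed simp
qed

text \<open>For each time \<open>t\<close> the comparison is made with the tail constant taken from the Sobolev norm at \<open>t\<close>. The
threshold on \<open>N\<close> uses \<open>M\<close> instead, so that it serves for all \<open>t\<close>.\<close>

lemma (in bounded_regime) uniform_error_estimate:
  obtains N0 :: nat and C :: real where "1 \<le> N0" "0 < C"
    "\<And>u0 I U J N V IN. bounded_solution A S S0 \<U> s K S' \<alpha> c0 \<beta> \<gamma> \<sigma> CS \<Lambda>A u0 I U J M L \<Longrightarrow> 0 \<in> J \<Longrightarrow> N0 \<le> N \<Longrightarrow>
      maximal_classical_solution A (lowpass N) UNIV s (lowpass N u0) IN V \<Longrightarrow>
      J \<subseteq> IN \<and> (\<forall>r t. 0 \<le> r \<longrightarrow> r \<le> s \<longrightarrow> t \<in> J \<longrightarrow>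
        sobolev_norm r (\<lambda>x. U t x - V t x) \<le> C * sobolev_norm s (U t) * real N powr (r - s))"
proof -
  define Cb where "Cb = 2 * C_tail * exp (\<kappa> * L)"
  have Cb: "0 \<le> Cb" using pos by (simp add: Cb_def C_tail_def)
  define X where "X = 2 * ((C_err L + 2 powr (2 * s)) * (Cb * M\<^sup>2))"
  obtain N0 where N0: "1 \<le> N0" "\<And>N. N0 \<le> N \<Longrightarrow> (3 * real N) ^ CARD('d) * (real N)\<^sup>2 * (X * real N powr (- 2 * s)) \<le> 1"
    using frequency_threshold[OF s_large] by blast
  define C where "C = sqrt (2 * ((1 + real CARD('d)) powr s * C_err L * Cb) + 2 * 2 powr (2 * s))"
  have C: "0 < C"
    using Cb err_const_nonneg(4)[of L] unfolding C_def
    by (intro real_sqrt_gt_zero add_nonneg_pos mult_nonneg_nonneg) auto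
  show ?thesis
  proof (rule that[OF N0(1) C])
    fix u0 I U J N V IN
    assume bs: "bounded_solution A S S0 \<U> s K S' \<alpha> c0 \<beta> \<gamma> \<sigma> CS \<Lambda>A u0 I U J M L" and J0: "0 \<in> J" and N: "N0 \<le> N"
      and V: "maximal_classical_solution A (lowpass N) UNIV s (lowpass N u0) IN V"
    interpret bounded_solution A S S0 \<U> s K S' \<alpha> c0 \<beta> \<gamma> \<sigma> CS \<Lambda>A u0 I U J M L by (rule bs)
    have cmp: "truncated_comparison A S S0 \<U> s K S' \<alpha> c0 \<beta> \<gamma> \<sigma> CS \<Lambda>A u0 I U J M L N V IN (Cb * (sobolev_norm s (U t))\<^sup>2)"
      if t: "t \<in> J" for t
    proof unfold_locales
      have "(sobolev_norm s (U t))\<^sup>2 \<le> M\<^sup>2" by (intro power_mono J_norm t sobolev_norm_nonneg)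
      then have "2 * ((C_err L + 2 powr (2 * s)) * (Cb * (sobolev_norm s (U t))\<^sup>2 * real N powr (- 2 * s)))
         \<le> 2 * ((C_err L + 2 powr (2 * s)) * (Cb * M\<^sup>2 * real N powr (- 2 * s)))"
        using Cb err_const_nonneg(4)[of L] by (intro mult_left_mono mult_right_mono) auto
      also have "\<dots> = X * real N powr (- 2 * s)" by (simp add: X_def mult_ac)
      finally have "(3 * real N) ^ CARD('d) * (real N)\<^sup>2 * (2 * ((C_err L + 2 powr (2 * s)) * (Cb * (sobolev_norm s (U t))\<^sup>2 * real N powr (- 2 * s))))
         \<le> (3 * real N) ^ CARD('d) * (real N)\<^sup>2 * (X * real N powr (- 2 * s))"
        by (intro mult_left_mono) auto
      also have "\<dots> \<le> 1" by (rule N0(2)[OF N])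
      finally show "(3 * real N) ^ CARD('d) * (real N)\<^sup>2 * (2 * ((C_err L + 2 powr (2 * s)) * (Cb * (sobolev_norm s (U t))\<^sup>2 * real N powr (- 2 * s)))) \<le> 1" .
      show "tail_bound s (Cb * (sobolev_norm s (U t))\<^sup>2) (fourier_coeff (U \<tau>))" if "\<tau> \<in> J" for \<tau>
        unfolding Cb_def by (rule tail_propagation[OF t that])
    qed (use J0 N N0(1) V in auto)
    have "J \<subseteq> IN" by (rule truncated_comparison.truncated_solution_exists[OF cmp[OF J0]])
    moreover have "sobolev_norm r (\<lambda>x. U t x - V t x) \<le> C * sobolev_norm s (U t) * real N powr (r - s)"
      if "0 \<le> r" "r \<le> s" "t \<in> J" for r t
      unfolding C_def by (rule truncated_comparison.sobolev_error[OF cmp[OF that(3)] that(3,1,2) refl Cb])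
    ultimately show "J \<subseteq> IN \<and> (\<forall>r t. 0 \<le> r \<longrightarrow> r \<le> s \<longrightarrow> t \<in> J \<longrightarrow>
        sobolev_norm r (\<lambda>x. U t x - V t x) \<le> C * sobolev_norm s (U t) * real N powr (r - s))" by blast
  qed
qed

lemma (in symmetrizable) coercive_on_compact:
  assumes K: "compact K" "K \<subseteq> \<U>"
  obtains c where "0 < c" "\<And>u v. u \<in> K \<Longrightarrow> c * (norm v)\<^sup>2 \<le> v \<bullet> (S u *v v)"
proof (cases "K = {}")
  case True
  then show ?thesis using that[of 1] by auto
next
  case False
  let ?f = "\<lambda>z. snd z \<bullet> (S (fst z) *v snd z)"
  obtain v0 :: "real^'n" where v0: "norm v0 = 1" using vector_choose_size[of 1] by auto
  then have "sphere (0 :: real^'n) 1 \<noteq> {}" by (metis empty_iff mem_sphere_0)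
  with False have ne: "K \<times> sphere (0 :: real^'n) 1 \<noteq> {}" by (simp only: Times_empty simp_thms)
  have "continuous_on (K \<times> sphere 0 1) (\<lambda>z. S (fst z))"
    by (rule continuous_on_compose2[OF polynomial_matrix_continuous[OF S_poly]]) (auto intro!: continuous_intros)
  then have "continuous_on (K \<times> sphere 0 1) ?f"
    by (intro continuous_on_inner continuous_matrix_vector continuous_on_snd continuous_on_id)
  from continuous_attains_inf[OF compact_Times[OF K(1) compact_sphere] ne this]
  obtain z where z: "z \<in> K \<times> sphere 0 1" "\<And>y. y \<in> K \<times> sphere 0 1 \<Longrightarrow> ?f z \<le> ?f y" by blast
  show ?thesis
  proof (rule that[of "?f z"])
    have "fst z \<in> \<U>" "snd z \<noteq> 0" using z(1) K(2) by (auto simp: mem_Times_iff)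
    then show "0 < ?f z" using S_pos by (simp add: sym_pos_def_def)
    fix u v assume u: "u \<in> K"
    show "?f z * (norm v)\<^sup>2 \<le> v \<bullet> (S u *v v)"
    proof (cases "v = 0")
      case False
      let ?w = "(1 / norm v) *\<^sub>R v"
      have "?f z \<le> ?w \<bullet> (S u *v ?w)" using z(2)[of "(u, ?w)"] u False by (simp add: mem_Times_iff)
      also have "\<dots> = (v \<bullet> (S u *v v)) / (norm v)\<^sup>2"
        by (simp add: matrix_vector_mult_scaleR power2_eq_square)
      finally show ?thesis using False by (simp add: pos_le_divide_eq)
    qed simp
  qed
qed

lemma (in symmetrizable) bounded_regime_exists:
  assumes K: "compact K" "K \<subseteq> \<U>" and \<alpha>: "0 \<le> \<alpha>"
  shows "\<exists>S' c0 \<beta> \<gamma> \<sigma> CS \<Lambda>A. bounded_regime A S S0 \<U> s K S' \<alpha> c0 \<beta> \<gamma> \<sigma> CS \<Lambda>A"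
proof -
  obtain S' where S': "\<And>u. (S has_derivative blinfun_apply (S' u)) (at u)" "continuous_on UNIV S'"
    using polynomial_matrix_C1[where S = S, OF S_poly] by blast
  obtain c0 where c0: "0 < c0" "\<And>u v. u \<in> K \<Longrightarrow> c0 * (norm v)\<^sup>2 \<le> v \<bullet> (S u *v v)"
    using coercive_on_compact[OF K] by blast
  obtain rK where rK: "\<And>u. u \<in> K \<Longrightarrow> norm u \<le> rK"
    using compact_imp_bounded[OF K(1)] unfolding bounded_iff by blast
  obtain \<beta> where \<beta>: "0 \<le> \<beta>" "\<And>w v. norm w \<le> rK \<Longrightarrow> norm (S w *v v) \<le> \<beta> * norm v"
    by (rule polynomial_matrix_bounds[where B = S and r = rK, OF S_poly]) blast
  obtain m where m: "m > 0" "\<And>(B::real^'n^'n) v. norm (B *v v) \<le> norm B * norm v * m"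
    using bounded_bilinear.pos_bounded[OF bounded_bilinear_matrix_vector] by blast
  have "bounded (S' ` K)"
    by (rule compact_imp_bounded[OF compact_continuous_image[OF continuous_on_subset[OF S'(2)] K(1)]]) simp
  then obtain g where g: "0 < g" "\<And>u. u \<in> K \<Longrightarrow> norm (S' u) \<le> g" unfolding bounded_pos by blast
  define \<sigma> where "\<sigma> = (\<Sum>j\<in>UNIV. norm (S0 j)) * m"
  obtain C where C: "\<And>a c. 0 \<le> C a c" "\<And>a c b (u :: real^'d \<Rightarrow> real^'n). 0 \<le> b \<Longrightarrow> (\<forall>a. tame s \<alpha> b (\<lambda>x. of_real (u x $ a)))
     \<Longrightarrow> tame s (C a c) (C a c * b) (\<lambda>x. of_real (S (u x) $ a $ c))"
  proof -
    have "\<forall>a c. \<exists>C\<ge>0. \<forall>b (u :: real^'d \<Rightarrow> real^'n). 0 \<le> b \<longrightarrow> (\<forall>a. tame s \<alpha> b (\<lambda>x. of_real (u x $ a)))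
     \<longrightarrow> tame s C (C * b) (\<lambda>x. of_real (S (u x) $ a $ c))"
      by (intro allI tame_polynomial S_poly \<alpha>)
    then show ?thesis using that by metis
  qed
  define CS where "CS = (\<Sum>a\<in>UNIV. \<Sum>c\<in>UNIV. C a c)"
  have CS: "C a c \<le> CS" for a c
  proof -
    have "C a c \<le> (\<Sum>c\<in>UNIV. C a c)" by (intro member_le_sum C(1)) auto
    also have "\<dots> \<le> CS" unfolding CS_def by (intro member_le_sum[of _ _ "\<lambda>a. \<Sum>c\<in>UNIV. C a c"] sum_nonneg C(1)) auto
    finally show ?thesis .
  qed
  define r where "r = max rK (real CARD('n) * \<alpha> + 1)"
  have "\<exists>b\<ge>0. \<forall>w w' v. norm w \<le> r \<longrightarrow> norm w' \<le> r \<longrightarrow> norm ((A j w - A j w') *v v) \<le> b * norm (w - w') * norm v" for j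
    by (rule polynomial_matrix_bounds[where B = "A j" and r = r, OF A_poly]) blast
  then obtain \<Lambda> where \<Lambda>: "\<And>j. 0 \<le> \<Lambda> j" "\<And>j w w' v. norm w \<le> r \<Longrightarrow> norm w' \<le> r \<Longrightarrow> norm ((A j w - A j w') *v v) \<le> \<Lambda> j * norm (w - w') * norm v"
    by metis
  have "bounded_regime A S S0 \<U> s K S' \<alpha> c0 \<beta> (g * m) \<sigma> CS (\<Sum>j\<in>UNIV. \<Lambda> j)"
  proof unfold_locales
    show "0 \<le> g * m" "0 \<le> \<sigma>" "0 \<le> CS" "0 \<le> (\<Sum>j\<in>UNIV. \<Lambda> j)"
      using g m C(1) \<Lambda>(1) by (auto simp: \<sigma>_def CS_def intro!: sum_nonneg mult_nonneg_nonneg)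
    show "norm (S0 j *v v) \<le> \<sigma> * norm v" for j v
    proof -
      have "norm (S0 j) \<le> (\<Sum>j\<in>UNIV. norm (S0 j))" by (intro member_le_sum[of _ _ "\<lambda>j. norm (S0 j)"]) auto
      then have "norm (S0 j) * (norm v * m) \<le> (\<Sum>j\<in>UNIV. norm (S0 j)) * (norm v * m)"
        using m(1) by (intro mult_right_mono) auto
      then show ?thesis using m(2)[of "S0 j" v] by (simp add: \<sigma>_def mult_ac)
    qed
    show "norm (S u *v v) \<le> \<beta> * norm v" if "u \<in> K" for u v by (rule \<beta>(2)[OF rK[OF that]])
    show "norm (S' u h *v v) \<le> g * m * norm h * norm v" if "u \<in> K" for u h v
    proof -
      have "norm (S' u h) \<le> g * norm h"
        by (rule order_trans[OF norm_blinfun mult_right_mono[OF g(2)[OF that]]]) simp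
      then have "norm (S' u h) * (norm v * m) \<le> g * norm h * (norm v * m)"
        using m(1) by (intro mult_right_mono) auto
      then show ?thesis using m(2)[of "S' u h" v] by (simp add: mult_ac)
    qed
    show "tame s CS (CS * b) (\<lambda>x. of_real (S (u x) $ a $ c))"
      if "0 \<le> b" "\<And>a. tame s \<alpha> b (\<lambda>x. of_real (u x $ a))" for b a c and u :: "real^'d \<Rightarrow> real^'n"
      using tame_mono[OF C(2)[of b u a c] CS mult_right_mono[OF CS]] that by blast
    show "norm ((A j w - A j u) *v v) \<le> (\<Sum>j\<in>UNIV. \<Lambda> j) * norm (w - u) * norm v"
      if "u \<in> K" "norm w \<le> real CARD('n) * \<alpha> + 1" for j u w v
    proof -
      have "\<Lambda> j \<le> (\<Sum>j\<in>UNIV. \<Lambda> j)" by (intro member_le_sum \<Lambda>(1)) auto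
      then have "\<Lambda> j * (norm (w - u) * norm v) \<le> (\<Sum>j\<in>UNIV. \<Lambda> j) * (norm (w - u) * norm v)"
        by (intro mult_right_mono) auto
      moreover have "norm ((A j w - A j u) *v v) \<le> \<Lambda> j * norm (w - u) * norm v"
        using that rK[OF that(1)] by (intro \<Lambda>(2)) (auto simp: r_def)
      ultimately show ?thesis by (simp add: mult.assoc)
    qed
  qed (use K(2) S' \<alpha> c0 \<beta>(1) in auto)
  then show ?thesis by blast
qed

section \<open>The approximation theorem\<close>

lemma sobolev_norm_square_le:
  fixes f g :: "real^'d \<Rightarrow> real^'n"
  assumes f: "f \<in> sobolev s" "continuous_on UNIV f" and g: "g \<in> sobolev s" "continuous_on UNIV g"
  shows "(sobolev_norm s f)\<^sup>2 \<le> 2 * (sobolev_norm s (\<lambda>x. f x - g x))\<^sup>2 + 2 * (sobolev_norm s g)\<^sup>2"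
proof -
  let ?w = "\<lambda>h k. japanese_bracket k powr (2 * s) * (norm (fourier_coeff h k))\<^sup>2"
  let ?D = "\<lambda>x. f x - g x"
  have co: "fourier_coeff ?D k = fourier_coeff f k - fourier_coeff g k" for k
    by (rule fourier_coeff_diff[OF f(2) g(2)])
  have split: "sum (?w h) F \<le> 2 * sum (?w h1) F + 2 * sum (?w h2) F"
    if "\<And>k. (norm (fourier_coeff h k))\<^sup>2 \<le> 2 * (norm (fourier_coeff h1 k))\<^sup>2 + 2 * (norm (fourier_coeff h2 k))\<^sup>2"
    for h h1 h2 :: "real^'d \<Rightarrow> real^'n" and F
  proof -
    have "sum (?w h) F \<le> (\<Sum>k\<in>F. japanese_bracket k powr (2 * s) * (2 * (norm (fourier_coeff h1 k))\<^sup>2 + 2 * (norm (fourier_coeff h2 k))\<^sup>2))"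
      by (intro sum_mono mult_left_mono that) auto
    also have "\<dots> = 2 * sum (?w h1) F + 2 * sum (?w h2) F"
      by (simp only: distrib_left sum.distrib sum_distrib_left mult.left_commute[of _ 2])
    finally show ?thesis .
  qed
  have "(norm (fourier_coeff ?D k))\<^sup>2 \<le> 2 * (norm (fourier_coeff f k))\<^sup>2 + 2 * (norm (fourier_coeff g k))\<^sup>2" for k
    unfolding co by (rule norm_diff_square_le)
  then have "sum (?w ?D) F \<le> 2 * sum (?w f) F + 2 * sum (?w g) F" for F by (rule split)
  then have "sum (?w ?D) F \<le> 2 * (sobolev_norm s f)\<^sup>2 + 2 * (sobolev_norm s g)\<^sup>2" if "finite F" for F
    by (rule order_trans) (intro add_mono mult_left_mono sobolev_finite_sum[OF f(1) that] sobolev_finite_sum[OF g(1) that]; simp)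
  then have summ: "?w ?D summable_on UNIV"
    by (intro nonneg_bdd_above_summable_on) (auto intro!: bdd_aboveI2)
  have D: "sum (?w ?D) F \<le> (sobolev_norm s ?D)\<^sup>2" if "finite F" for F
  proof -
    have "sum (?w ?D) F \<le> infsum (?w ?D) UNIV" by (rule finite_sum_le_infsum[OF summ that]) auto
    also have "\<dots> = (sobolev_norm s ?D)\<^sup>2" by (simp add: sobolev_norm_def infsum_nonneg)
    finally show ?thesis .
  qed
  have fk: "(norm (fourier_coeff f k))\<^sup>2 \<le> 2 * (norm (fourier_coeff ?D k))\<^sup>2 + 2 * (norm (fourier_coeff g k))\<^sup>2" for k
    using norm_diff_square_le[of "fourier_coeff ?D k" "- fourier_coeff g k"] by (simp add: co)
  let ?c = "2 * (sobolev_norm s ?D)\<^sup>2 + 2 * (sobolev_norm s g)\<^sup>2"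
  have "sobolev_norm s f \<le> sqrt ?c"
  proof (rule sobolev_norm_leI)
    fix F :: "(int^'d) set" assume F: "finite F"
    have "sum (?w f) F \<le> 2 * sum (?w ?D) F + 2 * sum (?w g) F" by (rule split[OF fk])
    also have "\<dots> \<le> ?c"
      by (intro add_mono mult_left_mono D[OF F] sobolev_finite_sum[OF g(1) F]; simp)
    finally have "sum (?w f) F \<le> ?c" .
    then show "sum (?w f) F \<le> (sqrt ?c)\<^sup>2" by simp
  qed simp
  then have "(sobolev_norm s f)\<^sup>2 \<le> (sqrt ?c)\<^sup>2"
    by (intro power_mono sobolev_norm_nonneg)
  then show ?thesis by simp
qed

lemma locally_bdd_above_compact:
  fixes f :: "'a::topological_space \<Rightarrow> real"
  assumes J: "compact J" and loc: "\<And>t. t \<in> J \<Longrightarrow> \<exists>B. \<forall>\<^sub>F \<tau> in at t within J. f \<tau> \<le> B"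
  shows "bdd_above (f ` J)"
proof -
  have "\<exists>T B. open T \<and> t \<in> T \<and> (\<forall>\<tau>\<in>T \<inter> J. f \<tau> \<le> B)" if t: "t \<in> J" for t
  proof -
    obtain B where "\<forall>\<^sub>F \<tau> in at t within J. f \<tau> \<le> B" using loc[OF t] by blast
    then obtain T where T: "open T" "t \<in> T" "\<And>\<tau>. \<tau> \<in> T \<Longrightarrow> \<tau> \<noteq> t \<Longrightarrow> \<tau> \<in> J \<Longrightarrow> f \<tau> \<le> B"
      unfolding eventually_at_topological by blast
    have "f \<tau> \<le> max B (f t)" if "\<tau> \<in> T \<inter> J" for \<tau>
      using T(3)[of \<tau>] that by (cases "\<tau> = t") auto
    then show ?thesis using T by blast
  qed
  then obtain T B where T: "\<And>t. t \<in> J \<Longrightarrow> open (T t)" "\<And>t. t \<in> J \<Longrightarrow> t \<in> T t"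
    "\<And>t \<tau>. t \<in> J \<Longrightarrow> \<tau> \<in> T t \<inter> J \<Longrightarrow> f \<tau> \<le> B t" by metis
  have "J \<subseteq> (\<Union>t\<in>J. T t)" using T(2) by blast
  then obtain C where C: "C \<subseteq> J" "finite C" "J \<subseteq> (\<Union>t\<in>C. T t)"
    using compactE_image[OF J, of J T] T(1) by blast
  show ?thesis
  proof (rule bdd_aboveI2)
    fix \<tau> assume \<tau>: "\<tau> \<in> J"
    then obtain t where t: "t \<in> C" "\<tau> \<in> T t" using C(3) by blast
    have "f \<tau> \<le> B t" using T(3)[of t \<tau>] t C(1) \<tau> by blast
    also have "\<dots> \<le> (\<Sum>t\<in>C. \<bar>B t\<bar>)" using member_le_sum[OF t(1), of "\<lambda>t. \<bar>B t\<bar>"] C(2) by auto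
    finally show "f \<tau> \<le> (\<Sum>t\<in>C. \<bar>B t\<bar>)" .
  qed
qed

text \<open>The supremum of the Sobolev norms over the times is only meaningful if they are bounded; otherwise
it would be an arbitrary real number.\<close>

lemma sobolev_continuous_bounded:
  assumes U: "sobolev_continuous_on s I U" "\<And>t. t \<in> I \<Longrightarrow> continuous_on UNIV (U t)"
    and J: "compact J" "J \<subseteq> I"
  shows "bdd_above ((\<lambda>t. sobolev_norm s (U t)) ` J)"
proof (rule locally_bdd_above_compact[OF J(1)])
  fix t assume t: "t \<in> J"
  then have tI: "t \<in> I" using J(2) by blast
  have "((\<lambda>\<tau>. sobolev_norm s (\<lambda>x. U \<tau> x - U t x)) \<longlongrightarrow> 0) (at t within J)"
    using U(1) tI J(2) unfolding sobolev_continuous_on_def by (blast intro: tendsto_within_subset)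
  then have "\<forall>\<^sub>F \<tau> in at t within J. sobolev_norm s (\<lambda>x. U \<tau> x - U t x) < 1"
    by (rule order_tendstoD) simp
  then have "\<forall>\<^sub>F \<tau> in at t within J. sobolev_norm s (U \<tau>) \<le> sqrt (2 + 2 * (sobolev_norm s (U t))\<^sup>2)"
    unfolding eventually_at_filter
  proof eventually_elim
    case (elim \<tau>)
    show ?case
    proof (intro impI real_le_rsqrt)
      assume "\<tau> \<noteq> t" "\<tau> \<in> J"
      then have \<tau>: "\<tau> \<in> I" "sobolev_norm s (\<lambda>x. U \<tau> x - U t x) \<le> 1" using elim J(2) by auto
      have "(sobolev_norm s (U \<tau>))\<^sup>2 \<le> 2 * (sobolev_norm s (\<lambda>x. U \<tau> x - U t x))\<^sup>2 + 2 * (sobolev_norm s (U t))\<^sup>2"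
        by (intro sobolev_norm_square_le U(2) \<tau>(1) tI) (use U(1) \<tau>(1) tI in \<open>auto simp: sobolev_continuous_on_def\<close>)
      moreover have "(sobolev_norm s (\<lambda>x. U \<tau> x - U t x))\<^sup>2 \<le> 1"
        using \<tau>(2) sobolev_norm_nonneg[of s "\<lambda>x. U \<tau> x - U t x"] by (simp add: abs_square_le_1)
      ultimately show "(sobolev_norm s (U \<tau>))\<^sup>2 \<le> 2 + 2 * (sobolev_norm s (U t))\<^sup>2" by linarith
    qed
  qed
  then show "\<exists>B. \<forall>\<^sub>F \<tau> in at t within J. sobolev_norm s (U \<tau>) \<le> B" by blast
qed

lemma time_hull_props:
  assumes "compact T"
  shows "compact (time_hull T)" "convex (time_hull T)" "0 \<in> time_hull T" "T \<subseteq> time_hull T"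
    "t \<in> time_hull T \<Longrightarrow> t' \<in> time_hull T \<Longrightarrow> \<bar>t - t'\<bar> \<le> measure lborel (time_hull T)"
proof -
  show c: "compact (time_hull T)" "convex (time_hull T)" "0 \<in> time_hull T" "T \<subseteq> time_hull T"
    using assms hull_subset[of "insert 0 T" convex] by (auto simp: time_hull_def intro!: compact_convex_hull)
  obtain a b where ab: "time_hull T = {a..b}"
    using c(1,2) is_interval_compact[of "time_hull T"] by (auto simp: is_interval_convex_1 cbox_interval)
  then show "t \<in> time_hull T \<Longrightarrow> t' \<in> time_hull T \<Longrightarrow> \<bar>t - t'\<bar> \<le> measure lborel (time_hull T)"
    using c(3) by (auto simp: abs_le_iff)
qed

theorem proposition3p10:
  fixes A :: "'d::finite \<Rightarrow> real^'n::finite \<Rightarrow> real^'n^'n"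
    and S :: "real^'n \<Rightarrow> real^'n^'n"
    and S0 :: "'d \<Rightarrow> real^'n^'n"
    and \<U> :: "(real^'n) set"
    and s :: real
  assumes "\<And>j a b. real_polynomial_function (\<lambda>u. A j u $ a $ b)"
    and "open \<U>" and "0 \<in> \<U>"
    and "\<And>a b. real_polynomial_function (\<lambda>u. S u $ a $ b)"
    and "\<And>u. u \<in> \<U> \<Longrightarrow> sym_pos_def (S u)"
    and "\<And>j. transpose (S0 j) = S0 j"
    and "\<And>j u. u \<in> \<U> \<Longrightarrow> A j u = S0 j ** S u"
    and "s > real CARD('d) / 2 + 1"
  shows "\<forall>L M :: real. \<forall>K. compact K \<and> K \<subseteq> \<U> \<longrightarrow>
    (\<exists>N0 :: nat. \<exists>C :: real. N0 \<ge> 1 \<and> C > 0 \<and>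
      (\<forall>(U0 :: real^'d \<Rightarrow> real^'n) I U I\<^sub>N U\<^sub>N Istar.
         U0 \<in> sobolev s \<and> (\<forall>x. U0 x \<in> \<U>) \<and>
         maximal_classical_solution A (\<lambda>f. f) \<U> s U0 I U \<and>
         (\<forall>N\<ge>1. maximal_classical_solution A (lowpass N) UNIV s (lowpass N U0) (I\<^sub>N N) (U\<^sub>N N)) \<and>
         compact Istar \<and> Istar \<subseteq> I \<and>
         measure lborel (time_hull Istar) = L \<and>
         (SUP t\<in>time_hull Istar. sobolev_norm s (U t)) = M \<and>
         (\<forall>t\<in>time_hull Istar. \<forall>x. U t x \<in> K)
         \<longrightarrow>
         (\<forall>N\<ge>N0. Istar \<subseteq> I\<^sub>N N \<and>
            (\<forall>r. 0 \<le> r \<and> r \<le> s \<longrightarrow>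
               (\<forall>t\<in>Istar. sobolev_norm r (\<lambda>x. U t x - U\<^sub>N N t x)
                  \<le> C * (SUP \<tau>\<in>Istar. sobolev_norm s (U \<tau>)) * real N powr (r - s))))))"
proof (intro allI impI, elim conjE)
  fix L M :: real and K :: "(real^'n) set" assume K: "compact K" "K \<subseteq> \<U>"
  interpret symmetrizable A S S0 \<U> s by unfold_locales (fact assms)+
  obtain Z where Z: "0 \<le> Z" "\<And>F :: (int^'d) set. finite F \<Longrightarrow> (\<Sum>k\<in>F. japanese_bracket k powr (- (2 * s - 2))) \<le> Z"
    by (rule lattice_sum_bounded[where p = "2 * s - 2"]) (use s_large in auto)
  define \<alpha> where "\<alpha> = Z + M\<^sup>2"
  have "0 \<le> \<alpha>" using Z(1) by (simp add: \<alpha>_def)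
  then obtain S' c0 \<beta> \<gamma> \<sigma> CS \<Lambda>A where regime: "bounded_regime A S S0 \<U> s K S' \<alpha> c0 \<beta> \<gamma> \<sigma> CS \<Lambda>A"
    using bounded_regime_exists[OF K] by blast
  interpret bounded_regime A S S0 \<U> s K S' \<alpha> c0 \<beta> \<gamma> \<sigma> CS \<Lambda>A by (rule regime)
  obtain N0 C where N0: "1 \<le> N0" and C: "0 < C" and est:
    "\<And>u0 I U J N V IN. bounded_solution A S S0 \<U> s K S' \<alpha> c0 \<beta> \<gamma> \<sigma> CS \<Lambda>A u0 I U J M L \<Longrightarrow> 0 \<in> J \<Longrightarrow> N0 \<le> N \<Longrightarrow>
      maximal_classical_solution A (lowpass N) UNIV s (lowpass N u0) IN V \<Longrightarrow>
      J \<subseteq> IN \<and> (\<forall>r t. 0 \<le> r \<longrightarrow> r \<le> s \<longrightarrow> t \<in> J \<longrightarrow>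
        sobolev_norm r (\<lambda>x. U t x - V t x) \<le> C * sobolev_norm s (U t) * real N powr (r - s))"
    by (rule uniform_error_estimate[where M = M and L = L]) blast
  have main: "T \<subseteq> IN \<and> (\<forall>r. 0 \<le> r \<and> r \<le> s \<longrightarrow>
               (\<forall>t\<in>T. sobolev_norm r (\<lambda>x. U t x - V t x)
                  \<le> C * (SUP \<tau>\<in>T. sobolev_norm s (U \<tau>)) * real N powr (r - s)))"
    if sol: "classical_solution A (\<lambda>f. f) \<U> s U0 I U"
      and V: "maximal_classical_solution A (lowpass N) UNIV s (lowpass N U0) IN V"
      and T: "compact T" "T \<subseteq> I" and L: "measure lborel (time_hull T) = L"
      and M: "(SUP t\<in>time_hull T. sobolev_norm s (U t)) = M"
      and UK: "\<And>t x. t \<in> time_hull T \<Longrightarrow> U t x \<in> K" and N: "N0 \<le> N"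
    for U0 :: "real^'d \<Rightarrow> real^'n" and I U IN V T N
  proof -
    let ?J = "time_hull T"
    note J = time_hull_props[OF T(1)]
    have L0: "0 \<le> L" using L by (metis measure_nonneg)
    have JI: "?J \<subseteq> I"
      unfolding time_hull_def using sol T(2)
      by (intro hull_minimal) (auto simp: classical_solution_def is_interval_convex)
    \<comment> \<open>With an empty set of times, only the regularity of \<open>U\<close> at single times is available; it is what
      boundedness of the Sobolev norms on the hull requires.\<close>
    interpret no_time: bounded_solution A S S0 \<U> s K S' \<alpha> c0 \<beta> \<gamma> \<sigma> CS \<Lambda>A U0 I U "{}" M L
      by unfold_locales (use sol L0 in auto)
    note CU = no_time.U_C1_torus
    have bdd: "bdd_above ((\<lambda>t. sobolev_norm s (U t)) ` ?J)"
      by (rule sobolev_continuous_bounded[OF _ C1_torus_continuous[OF CU] J(1) JI])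
         (use sol in \<open>simp_all add: classical_solution_def\<close>)
    have norm: "sobolev_norm s (U t) \<le> M" if "t \<in> ?J" for t
      using cSUP_upper[OF that bdd] M by simp
    have wb: "wiener_bound \<alpha> (\<lambda>x. of_real (U t x $ a))" if t: "t \<in> ?J" for t a
      unfolding \<alpha>_def
    proof (rule sobolev_wiener_bound)
      have tI: "t \<in> I" using t JI by blast
      note cU = C1_torus_continuous[OF CU[OF tI]]
      show "(\<Sum>k\<in>F. japanese_bracket k powr (2 - 2 * s)) \<le> Z" if "finite F" for F :: "(int^'d) set"
        using Z(2)[OF that] by simp
      show "continuous_on UNIV (\<lambda>x. complex_of_real (U t x $ a))" by (intro continuous_intros cU)
      show "torus_periodic (\<lambda>x. complex_of_real (U t x $ a))"
        using C1_torus_periodic[OF CU[OF tI]] by (simp add: torus_periodic_def)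
      fix F :: "(int^'d) set" assume "finite F"
      from sobolev_component_sum[OF no_time.U_sobolev[OF tI] cU this, of a]
        power_mono[OF norm[OF t] sobolev_norm_nonneg, of 2]
      show "(\<Sum>k\<in>F. japanese_bracket k powr (2 * s) * (norm (fc (\<lambda>x. complex_of_real (U t x $ a)) k))\<^sup>2) \<le> M\<^sup>2"
        by (rule order_trans)
    qed
    have bs: "bounded_solution A S S0 \<U> s K S' \<alpha> c0 \<beta> \<gamma> \<sigma> CS \<Lambda>A U0 I U ?J M L"
    proof unfold_locales
      show "\<bar>t - t'\<bar> \<le> L" if "t \<in> ?J" "t' \<in> ?J" for t t' using J(5)[OF that] L by simp
    qed (use sol L0 JI J(2) UK wb norm in auto)
    have JN: "?J \<subseteq> IN" and err: "0 \<le> r \<Longrightarrow> r \<le> s \<Longrightarrow> t \<in> ?J \<Longrightarrow>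
        sobolev_norm r (\<lambda>x. U t x - V t x) \<le> C * sobolev_norm s (U t) * real N powr (r - s)" for r t
      using est[OF bs J(3) N V] by auto
    have "sobolev_norm r (\<lambda>x. U t x - V t x) \<le> C * (SUP \<tau>\<in>T. sobolev_norm s (U \<tau>)) * real N powr (r - s)"
      if r: "0 \<le> r" "r \<le> s" and t: "t \<in> T" for r t
    proof -
      have "sobolev_norm s (U t) \<le> (SUP \<tau>\<in>T. sobolev_norm s (U \<tau>))"
        by (rule cSUP_upper[OF t bdd_above_mono[OF bdd image_mono[OF J(4)]]])
      then have "C * sobolev_norm s (U t) * real N powr (r - s) \<le> C * (SUP \<tau>\<in>T. sobolev_norm s (U \<tau>)) * real N powr (r - s)"
        using C by (intro mult_right_mono mult_left_mono) auto
      then show ?thesis using err[OF r, of t] t J(4) by (meson order_trans subsetD)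
    qed
    then show ?thesis using J(4) JN by blast
  qed
  show "\<exists>N0 :: nat. \<exists>C :: real. N0 \<ge> 1 \<and> C > 0 \<and>
      (\<forall>(U0 :: real^'d \<Rightarrow> real^'n) I U I\<^sub>N U\<^sub>N Istar.
         U0 \<in> sobolev s \<and> (\<forall>x. U0 x \<in> \<U>) \<and>
         maximal_classical_solution A (\<lambda>f. f) \<U> s U0 I U \<and>
         (\<forall>N\<ge>1. maximal_classical_solution A (lowpass N) UNIV s (lowpass N U0) (I\<^sub>N N) (U\<^sub>N N)) \<and>
         compact Istar \<and> Istar \<subseteq> I \<and>
         measure lborel (time_hull Istar) = L \<and>
         (SUP t\<in>time_hull Istar. sobolev_norm s (U t)) = M \<and>
         (\<forall>t\<in>time_hull Istar. \<forall>x. U t x \<in> K)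
         \<longrightarrow>
         (\<forall>N\<ge>N0. Istar \<subseteq> I\<^sub>N N \<and>
            (\<forall>r. 0 \<le> r \<and> r \<le> s \<longrightarrow>
               (\<forall>t\<in>Istar. sobolev_norm r (\<lambda>x. U t x - U\<^sub>N N t x)
                  \<le> C * (SUP \<tau>\<in>Istar. sobolev_norm s (U \<tau>)) * real N powr (r - s)))))"
  proof (rule exI[of _ N0], rule exI[of _ C], intro conjI[OF N0 conjI[OF C]] allI impI, elim conjE)
    fix U0 :: "real^'d \<Rightarrow> real^'n" and I U and I\<^sub>N :: "nat \<Rightarrow> real set" and U\<^sub>N and T N
    assume U: "maximal_classical_solution A (\<lambda>f. f) \<U> s U0 I U"
      and V: "\<forall>N\<ge>1. maximal_classical_solution A (lowpass N) UNIV s (lowpass N U0) (I\<^sub>N N) (U\<^sub>N N)"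
      and T: "compact T" "T \<subseteq> I" "measure lborel (time_hull T) = L"
        "(SUP t\<in>time_hull T. sobolev_norm s (U t)) = M" "\<forall>t\<in>time_hull T. \<forall>x. U t x \<in> K" and N: "N0 \<le> N"
    have sol: "classical_solution A (\<lambda>f. f) \<U> s U0 I U" using U by (simp add: maximal_classical_solution_def)
    have VN: "maximal_classical_solution A (lowpass N) UNIV s (lowpass N U0) (I\<^sub>N N) (U\<^sub>N N)"
      using V N N0 by simp
    show "T \<subseteq> I\<^sub>N N \<and>
            (\<forall>r. 0 \<le> r \<and> r \<le> s \<longrightarrow>
               (\<forall>t\<in>T. sobolev_norm r (\<lambda>x. U t x - U\<^sub>N N t x)
                  \<le> C * (SUP \<tau>\<in>T. sobolev_norm s (U \<tau>)) * real N powr (r - s)))"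
      by (rule main[OF sol VN T(1-4) _ N]) (use T(5) in blast)
  qed
qed

end
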